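(* Let $M$ be a semifinite von Neumann algebra with separable predual and let $\tau$ be a faithful normal semifinite trace on $M$. Let $1\le p\le 2$, and let $G$ be a closed subgroup of $\mathcal{U}_p(M,\tau)$ with property (FH). Then there exists a $\tau$-finite projection $e$ in $M$ such that $e$ reduces all elements in $G$, $u=1$ on $\mathrm{ran}(e)^{\perp}$ for all $u\in G$, and the map $$G\to\mathcal{U}(M_e),\qquad u\mapsto u|_{\mathrm{ran}(e)}$$ defines an isomorphism (of topological groups) from $G$ onto a closed subgroup of $\mathcal{U}(M_e)$. In particular, $G$ is a Polish group of finite type.
   Context: $L^p(M,\tau)$ is the noncommutative $L^p$-space with norm $\|x\|_p=\tau(|x|^p)^{1/p}$. The $p$-unitary group $\mathcal{U}_p(M,\tau)$ is the group of all unitaries $u\in M$ with $u-1\in L^p(M,\tau)$, with the topology of the bi-invariant metric $d(u,v)=\|u-v\|_p$. A topological group has property (FH) if every continuous affine isometric action of it on a real Hilbert space has a fixed point. A projection $e\in M$ is $\tau$-finite if $\tau(e)<\infty$. A projection $e$ reduces an operator $u$ if $u$ leaves $\mathrm{ran}(e)$ and $\mathrm{ran}(e)^\perp$ invariant, i.e. $ue=eu$. For a projection $e\in M$, $M_e=\{ex|_{\mathrm{ran}(e)}\mid x\in M\}$, a von Neumann algebra acting on $\mathrm{ran}(e)$; its unitary group $\mathcal{U}(M_e)$ carries the strong operator topology. A Hausdorff topological group is of finite type if it is isomorphic as a topological group to a closed subgroup of $\mathcal{U}(N)$, with the strong operator topology, for some finite von Neumann algebra $N$. *)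

theory Defs
  imports
    "HOL-Analysis.Analysis"
    "HOL-Algebra.Module"
begin

section \<open>Complex Hilbert spaces\<close>

text \<open>
  The inner product is linear in the first argument.  Norm, metric and topology are those of the
  underlying real Hilbert space, whose inner product is the real part of the complex one.
\<close>

class complex_hilbert = real_inner + complete_space +
  fixes scaleC :: "complex \<Rightarrow> 'a \<Rightarrow> 'a"  (infixr \<open>*\<^sub>C\<close> 75)
    and cinner :: "'a \<Rightarrow> 'a \<Rightarrow> complex"
  assumes scaleC_add_right: "c *\<^sub>C (x + y) = c *\<^sub>C x + c *\<^sub>C y"
    and scaleC_add_left: "(c + d) *\<^sub>C x = c *\<^sub>C x + d *\<^sub>C x"
    and scaleC_scaleC: "c *\<^sub>C (d *\<^sub>C x) = (c * d) *\<^sub>C x"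
    and scaleC_of_real: "complex_of_real r *\<^sub>C x = r *\<^sub>R x"
    and cinner_commute: "cinner x y = cnj (cinner y x)"
    and cinner_add_left: "cinner (x + y) z = cinner x z + cinner y z"
    and cinner_scaleC_left: "cinner (c *\<^sub>C x) y = c * cinner x y"
    and inner_eq_Re_cinner: "inner x y = Re (cinner x y)"

instantiation complex :: complex_hilbert
begin

definition scaleC_complex :: "complex \<Rightarrow> complex \<Rightarrow> complex"
  where "scaleC_complex c x = c * x"

definition cinner_complex :: "complex \<Rightarrow> complex \<Rightarrow> complex"
  where "cinner_complex x y = x * cnj y"

instance
  by standard
    (simp_all add: scaleC_complex_def cinner_complex_def algebra_simps scaleR_conv_of_real
      inner_complex_def)

end

definition closed_csubspace :: "'h::complex_hilbert set \<Rightarrow> bool"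
  where "closed_csubspace H \<longleftrightarrow>
    closed H \<and> 0 \<in> H \<and> (\<forall>\<xi>\<in>H. \<forall>\<eta>\<in>H. \<xi> + \<eta> \<in> H) \<and> (\<forall>c. \<forall>\<xi>\<in>H. c *\<^sub>C \<xi> \<in> H)"


section \<open>Bounded operators on a closed subspace\<close>

text \<open>
  A Hilbert space is a closed subspace \<open>H\<close> of an ambient one (possibly \<open>UNIV\<close>), so that
  \<open>ran e\<close> is again a Hilbert space.  Operators on \<open>H\<close> are functions that are \<open>undefined\<close> outside
  \<open>H\<close>, so that equality of operators is equality of functions; their product is
  \<^const>\<open>compose\<close> \<open>H\<close>.
\<close>

definition bounded_ops :: "'h::complex_hilbert set \<Rightarrow> ('h \<Rightarrow> 'h) set"
  where "bounded_ops H = {x \<in> H \<rightarrow>\<^sub>E H.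
    (\<forall>\<xi>\<in>H. \<forall>\<eta>\<in>H. x (\<xi> + \<eta>) = x \<xi> + x \<eta>) \<and>
    (\<forall>c. \<forall>\<xi>\<in>H. x (c *\<^sub>C \<xi>) = c *\<^sub>C x \<xi>) \<and>
    (\<exists>B. \<forall>\<xi>\<in>H. norm (x \<xi>) \<le> B * norm \<xi>)}"

definition op_one :: "'h set \<Rightarrow> 'h \<Rightarrow> 'h"
  where "op_one H = (\<lambda>\<xi>\<in>H. \<xi>)"

definition op_zero :: "'h::complex_hilbert set \<Rightarrow> 'h \<Rightarrow> 'h"
  where "op_zero H = (\<lambda>\<xi>\<in>H. 0)"

definition op_add :: "'h::complex_hilbert set \<Rightarrow> ('h \<Rightarrow> 'h) \<Rightarrow> ('h \<Rightarrow> 'h) \<Rightarrow> 'h \<Rightarrow> 'h"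
  where "op_add H x y = (\<lambda>\<xi>\<in>H. x \<xi> + y \<xi>)"

definition op_diff :: "'h::complex_hilbert set \<Rightarrow> ('h \<Rightarrow> 'h) \<Rightarrow> ('h \<Rightarrow> 'h) \<Rightarrow> 'h \<Rightarrow> 'h"
  where "op_diff H x y = (\<lambda>\<xi>\<in>H. x \<xi> - y \<xi>)"

definition op_scale :: "'h::complex_hilbert set \<Rightarrow> complex \<Rightarrow> ('h \<Rightarrow> 'h) \<Rightarrow> 'h \<Rightarrow> 'h"
  where "op_scale H c x = (\<lambda>\<xi>\<in>H. c *\<^sub>C x \<xi>)"

definition op_norm :: "'h::complex_hilbert set \<Rightarrow> ('h \<Rightarrow> 'h) \<Rightarrow> real"
  where "op_norm H x = (SUP \<xi>\<in>{\<xi>\<in>H. norm \<xi> \<le> 1}. norm (x \<xi>))"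

definition op_adj :: "'h::complex_hilbert set \<Rightarrow> ('h \<Rightarrow> 'h) \<Rightarrow> 'h \<Rightarrow> 'h"
  where "op_adj H x =
    (THE y. y \<in> bounded_ops H \<and> (\<forall>\<xi>\<in>H. \<forall>\<eta>\<in>H. cinner (x \<xi>) \<eta> = cinner \<xi> (y \<eta>)))"

definition op_pos :: "'h::complex_hilbert set \<Rightarrow> ('h \<Rightarrow> 'h) \<Rightarrow> bool"
  where "op_pos H x \<longleftrightarrow> x \<in> bounded_ops H \<and> (\<forall>\<xi>\<in>H. cinner (x \<xi>) \<xi> \<in> \<real>\<^sub>\<ge>\<^sub>0)"

definition op_le :: "'h::complex_hilbert set \<Rightarrow> ('h \<Rightarrow> 'h) \<Rightarrow> ('h \<Rightarrow> 'h) \<Rightarrow> bool"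
  where "op_le H x y \<longleftrightarrow> op_pos H (op_diff H y x)"

definition is_projection :: "'h::complex_hilbert set \<Rightarrow> ('h \<Rightarrow> 'h) \<Rightarrow> bool"
  where "is_projection H e \<longleftrightarrow> e \<in> bounded_ops H \<and> compose H e e = e \<and> op_adj H e = e"

definition ortho_compl :: "'h::complex_hilbert set \<Rightarrow> 'h set \<Rightarrow> 'h set"
  where "ortho_compl H S = {\<xi>\<in>H. \<forall>\<eta>\<in>S. cinner \<xi> \<eta> = 0}"

definition reduces :: "'h::complex_hilbert set \<Rightarrow> ('h \<Rightarrow> 'h) \<Rightarrow> ('h \<Rightarrow> 'h) \<Rightarrow> bool"
  where "reduces H e u \<longleftrightarrow>
    u ` (e ` H) \<subseteq> e ` H \<and> u ` ortho_compl H (e ` H) \<subseteq> ortho_compl H (e ` H)"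

definition op_abs :: "'h::complex_hilbert set \<Rightarrow> ('h \<Rightarrow> 'h) \<Rightarrow> 'h \<Rightarrow> 'h"
  where "op_abs H x = (THE a. op_pos H a \<and> compose H a a = compose H (op_adj H x) x)"

definition op_poly :: "'h::complex_hilbert set \<Rightarrow> real poly \<Rightarrow> ('h \<Rightarrow> 'h) \<Rightarrow> 'h \<Rightarrow> 'h"
  where "op_poly H q a = (\<lambda>\<xi>\<in>H. \<Sum>i\<le>degree q. coeff q i *\<^sub>R (a ^^ i) \<xi>)"

text \<open>
  Continuous functional calculus for a positive operator \<open>a\<close> and a function \<open>f\<close> continuous on
  \<open>[0, \<parallel>a\<parallel>]\<close> (an interval that contains the spectrum of \<open>a\<close>): \<open>f(a)\<close> is the norm limit of
  \<open>q\<^sub>n(a)\<close> for polynomials \<open>q\<^sub>n\<close> converging to \<open>f\<close> uniformly on that interval.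
\<close>

definition op_fun :: "'h::complex_hilbert set \<Rightarrow> (real \<Rightarrow> real) \<Rightarrow> ('h \<Rightarrow> 'h) \<Rightarrow> 'h \<Rightarrow> 'h"
  where "op_fun H f a = (THE b. b \<in> bounded_ops H \<and>
    (\<forall>q :: nat \<Rightarrow> real poly.
      uniform_limit {0..op_norm H a} (\<lambda>n. poly (q n)) f sequentially \<longrightarrow>
      (\<lambda>n. op_norm H (op_diff H (op_poly H (q n) a) b)) \<longlonglongrightarrow> 0))"


section \<open>Von Neumann algebras\<close>

definition commutant :: "'h::complex_hilbert set \<Rightarrow> ('h \<Rightarrow> 'h) set \<Rightarrow> ('h \<Rightarrow> 'h) set"
  where "commutant H S = {x \<in> bounded_ops H. \<forall>y\<in>S. compose H x y = compose H y x}"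

definition von_neumann_algebra :: "'h::complex_hilbert set \<Rightarrow> ('h \<Rightarrow> 'h) set \<Rightarrow> bool"
  where "von_neumann_algebra H M \<longleftrightarrow> closed_csubspace H \<and> M \<subseteq> bounded_ops H \<and>
    (\<forall>x\<in>M. op_adj H x \<in> M) \<and> commutant H (commutant H M) = M"

definition finite_projection ::
    "'h::complex_hilbert set \<Rightarrow> ('h \<Rightarrow> 'h) set \<Rightarrow> ('h \<Rightarrow> 'h) \<Rightarrow> bool"
  where "finite_projection H M e \<longleftrightarrow> is_projection H e \<and> e \<in> M \<and>
    (\<forall>v\<in>M. compose H (op_adj H v) v = e \<and> op_le H (compose H v (op_adj H v)) e \<longrightarrow>
      compose H v (op_adj H v) = e)"

definition finite_vna :: "'h::complex_hilbert set \<Rightarrow> ('h \<Rightarrow> 'h) set \<Rightarrow> bool"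
  where "finite_vna H M \<longleftrightarrow> von_neumann_algebra H M \<and> finite_projection H M (op_one H)"

definition semifinite_vna :: "'h::complex_hilbert set \<Rightarrow> ('h \<Rightarrow> 'h) set \<Rightarrow> bool"
  where "semifinite_vna H M \<longleftrightarrow> von_neumann_algebra H M \<and>
    (\<forall>z \<in> M \<inter> commutant H M. is_projection H z \<and> z \<noteq> op_zero H \<longrightarrow>
      (\<exists>e. finite_projection H M e \<and> e \<noteq> op_zero H \<and> op_le H e z))"

text \<open>The predual as the space of normal (\<open>\<sigma>\<close>-weakly continuous) linear functionals on \<open>M\<close>.\<close>

definition predual :: "'h::complex_hilbert set \<Rightarrow> ('h \<Rightarrow> 'h) set \<Rightarrow> (('h \<Rightarrow> 'h) \<Rightarrow> complex) set"
  where "predual H M = {(\<lambda>x\<in>M. \<Sum>n. cinner (x (\<xi> n)) (\<eta> n)) | \<xi> \<eta> :: nat \<Rightarrow> 'h.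
    range \<xi> \<subseteq> H \<and> range \<eta> \<subseteq> H \<and>
    summable (\<lambda>n. (norm (\<xi> n))\<^sup>2) \<and> summable (\<lambda>n. (norm (\<eta> n))\<^sup>2)}"

definition separable_predual :: "'h::complex_hilbert set \<Rightarrow> ('h \<Rightarrow> 'h) set \<Rightarrow> bool"
  where "separable_predual H M \<longleftrightarrow> (\<exists>D. countable D \<and> D \<subseteq> predual H M \<and>
    (\<forall>\<phi> \<in> predual H M. \<forall>\<epsilon>>0. \<exists>\<psi>\<in>D.
      (SUP x\<in>{x\<in>M. op_norm H x \<le> 1}. norm (\<phi> x - \<psi> x)) < \<epsilon>))"

definition corner :: "'h set \<Rightarrow> ('h \<Rightarrow> 'h) set \<Rightarrow> ('h \<Rightarrow> 'h) \<Rightarrow> ('h \<Rightarrow> 'h) set"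
  where "corner H M e = (\<lambda>x. restrict (compose H e x) (e ` H)) ` M"

definition unitary_group :: "'h::complex_hilbert set \<Rightarrow> ('h \<Rightarrow> 'h) set \<Rightarrow> ('h \<Rightarrow> 'h) monoid"
  where "unitary_group H M =
    \<lparr>carrier = {u\<in>M. compose H (op_adj H u) u = op_one H \<and> compose H u (op_adj H u) = op_one H},
     monoid.mult = compose H, one = op_one H\<rparr>"

text \<open>
  The strong operator topology is the topology of pointwise norm convergence on \<open>H\<close>.  The
  underlying set of the product topology is the set of all functions that are \<open>undefined\<close>
  outside \<open>H\<close>.
\<close>

definition strong_topology ::
    "'h::complex_hilbert set \<Rightarrow> ('h \<Rightarrow> 'h) set \<Rightarrow> ('h \<Rightarrow> 'h) topology"
  where "strong_topology H S = subtopology (product_topology (\<lambda>_. euclidean) H) S"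


section \<open>Traces and the \<open>p\<close>-unitary group\<close>

definition pos_cone :: "'h::complex_hilbert set \<Rightarrow> ('h \<Rightarrow> 'h) set \<Rightarrow> ('h \<Rightarrow> 'h) set"
  where "pos_cone H M = {x\<in>M. op_pos H x}"

definition is_lub :: "'h::complex_hilbert set \<Rightarrow> ('h \<Rightarrow> 'h) set \<Rightarrow> ('h \<Rightarrow> 'h) set \<Rightarrow> ('h \<Rightarrow> 'h) \<Rightarrow> bool"
  where "is_lub H M D x \<longleftrightarrow> x \<in> pos_cone H M \<and> (\<forall>y\<in>D. op_le H y x) \<and>
    (\<forall>z\<in>pos_cone H M. (\<forall>y\<in>D. op_le H y z) \<longrightarrow> op_le H x z)"

text \<open>
  A trace is given on the positive cone; the values of \<open>\<tau>\<close> elsewhere are never used.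
  The clauses after \<^const>\<open>von_neumann_algebra\<close> are, in order: additivity, homogeneity, traciality, faithfulness,
  normality, semifiniteness.
\<close>

definition fns_trace ::
    "'h::complex_hilbert set \<Rightarrow> ('h \<Rightarrow> 'h) set \<Rightarrow> (('h \<Rightarrow> 'h) \<Rightarrow> ennreal) \<Rightarrow> bool"
  where "fns_trace H M \<tau> \<longleftrightarrow> von_neumann_algebra H M \<and>
    (\<forall>x\<in>pos_cone H M. \<forall>y\<in>pos_cone H M. \<tau> (op_add H x y) = \<tau> x + \<tau> y) \<and>
    (\<forall>x\<in>pos_cone H M. \<forall>c\<ge>0. \<tau> (op_scale H (complex_of_real c) x) = ennreal c * \<tau> x) \<and>
    (\<forall>x\<in>M. \<tau> (compose H (op_adj H x) x) = \<tau> (compose H x (op_adj H x))) \<and>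
    (\<forall>x\<in>pos_cone H M. \<tau> x = 0 \<longrightarrow> x = op_zero H) \<and>
    (\<forall>D x. D \<subseteq> pos_cone H M \<and> D \<noteq> {} \<and>
      (\<forall>y\<in>D. \<forall>z\<in>D. \<exists>w\<in>D. op_le H y w \<and> op_le H z w) \<and> is_lub H M D x \<longrightarrow>
      \<tau> x = (SUP y\<in>D. \<tau> y)) \<and>
    (\<forall>x\<in>pos_cone H M. x \<noteq> op_zero H \<longrightarrow>
      (\<exists>y\<in>pos_cone H M. y \<noteq> op_zero H \<and> op_le H y x \<and> \<tau> y < \<infinity>))"

definition trace_abs_powr ::
    "'h::complex_hilbert set \<Rightarrow> (('h \<Rightarrow> 'h) \<Rightarrow> ennreal) \<Rightarrow> real \<Rightarrow> ('h \<Rightarrow> 'h) \<Rightarrow> ennreal"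
  where "trace_abs_powr H \<tau> p x = \<tau> (op_fun H (\<lambda>t. t powr p) (op_abs H x))"

text \<open>
  Only bounded elements of \<open>L\<^sup>p(M,\<tau>)\<close> occur, since \<open>u - 1\<close> and \<open>u - v\<close> lie in \<open>M\<close>:
  the following set is \<open>M \<inter> L\<^sup>p(M,\<tau>)\<close>.
\<close>

definition Lp_bounded ::
    "'h::complex_hilbert set \<Rightarrow> ('h \<Rightarrow> 'h) set \<Rightarrow> (('h \<Rightarrow> 'h) \<Rightarrow> ennreal) \<Rightarrow> real \<Rightarrow> ('h \<Rightarrow> 'h) set"
  where "Lp_bounded H M \<tau> p = {x\<in>M. trace_abs_powr H \<tau> p x < \<infinity>}"

definition Lp_norm ::
    "'h::complex_hilbert set \<Rightarrow> (('h \<Rightarrow> 'h) \<Rightarrow> ennreal) \<Rightarrow> real \<Rightarrow> ('h \<Rightarrow> 'h) \<Rightarrow> real"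
  where "Lp_norm H \<tau> p x = enn2real (trace_abs_powr H \<tau> p x) powr (1 / p)"

definition p_unitary_group ::
    "'h::complex_hilbert set \<Rightarrow> ('h \<Rightarrow> 'h) set \<Rightarrow> (('h \<Rightarrow> 'h) \<Rightarrow> ennreal) \<Rightarrow> real \<Rightarrow>
     ('h \<Rightarrow> 'h) monoid"
  where "p_unitary_group H M \<tau> p = (unitary_group H M)
    \<lparr>carrier := {u \<in> carrier (unitary_group H M). op_diff H u (op_one H) \<in> Lp_bounded H M \<tau> p}\<rparr>"

text \<open>
  The locale \<^locale>\<open>Metric_space\<close> asks for symmetry and nonnegativity also outside the carrier,
  so metrics are set to \<open>0\<close> there.
\<close>

definition p_unitary_dist ::
    "'h::complex_hilbert set \<Rightarrow> ('h \<Rightarrow> 'h) set \<Rightarrow> (('h \<Rightarrow> 'h) \<Rightarrow> ennreal) \<Rightarrow> real \<Rightarrow>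
     ('h \<Rightarrow> 'h) \<Rightarrow> ('h \<Rightarrow> 'h) \<Rightarrow> real"
  where "p_unitary_dist H M \<tau> p u v =
    (if u \<in> carrier (p_unitary_group H M \<tau> p) \<and> v \<in> carrier (p_unitary_group H M \<tau> p)
     then Lp_norm H \<tau> p (op_diff H u v) else 0)"

definition p_unitary_topology ::
    "'h::complex_hilbert set \<Rightarrow> ('h \<Rightarrow> 'h) set \<Rightarrow> (('h \<Rightarrow> 'h) \<Rightarrow> ennreal) \<Rightarrow> real \<Rightarrow>
     ('h \<Rightarrow> 'h) topology"
  where "p_unitary_topology H M \<tau> p =
    Metric_space.mtopology (carrier (p_unitary_group H M \<tau> p)) (p_unitary_dist H M \<tau> p)"


section \<open>Topological groups\<close>

definition topological_group :: "('g, 'm) monoid_scheme \<Rightarrow> 'g topology \<Rightarrow> bool"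
  where "topological_group G T \<longleftrightarrow> group G \<and> topspace T = carrier G \<and>
    continuous_map (prod_topology T T) T (\<lambda>(g, h). g \<otimes>\<^bsub>G\<^esub> h) \<and>
    continuous_map T T (\<lambda>g. inv\<^bsub>G\<^esub> g)"

definition closed_subgroup :: "'g set \<Rightarrow> ('g, 'm) monoid_scheme \<Rightarrow> 'g topology \<Rightarrow> bool"
  where "closed_subgroup L G T \<longleftrightarrow> subgroup L G \<and> closedin T L"

definition topological_group_iso ::
    "('g \<Rightarrow> 'k) \<Rightarrow> ('g, 'm) monoid_scheme \<Rightarrow> 'g topology \<Rightarrow>
     ('k, 'n) monoid_scheme \<Rightarrow> 'k topology \<Rightarrow> bool"
  where "topological_group_iso f G T K S \<longleftrightarrow> f \<in> iso G K \<and> homeomorphic_map T S f"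

definition iso_onto_closed_subgroup ::
    "('g \<Rightarrow> 'k) \<Rightarrow> ('g, 'm) monoid_scheme \<Rightarrow> 'g topology \<Rightarrow>
     ('k, 'n) monoid_scheme \<Rightarrow> 'k topology \<Rightarrow> bool"
  where "iso_onto_closed_subgroup f G T K S \<longleftrightarrow>
    closed_subgroup (f ` carrier G) K S \<and>
    topological_group_iso f G T
      (K\<lparr>carrier := f ` carrier G\<rparr>) (subtopology S (f ` carrier G))"

definition polish_group :: "('g, 'm) monoid_scheme \<Rightarrow> 'g topology \<Rightarrow> bool"
  where "polish_group G T \<longleftrightarrow>
    topological_group G T \<and> completely_metrizable_space T \<and> separable_space T"

text \<open>
  The type argument only says where the Hilbert space of the witnessing finite von Neumann
  algebra is taken from (a closed subspace of \<open>'k\<close>).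
\<close>

definition finite_type_group ::
    "'k::complex_hilbert itself \<Rightarrow> ('g, 'm) monoid_scheme \<Rightarrow> 'g topology \<Rightarrow> bool"
  where "finite_type_group (_ :: 'k itself) G T \<longleftrightarrow>
    topological_group G T \<and> Hausdorff_space T \<and>
    (\<exists>(K :: 'k set) N f. finite_vna K N \<and>
      iso_onto_closed_subgroup f G T (unitary_group K N)
        (strong_topology K (carrier (unitary_group K N))))"


section \<open>Property (FH)\<close>

definition real_field :: "real ring"
  where "real_field =
    \<lparr>carrier = UNIV, monoid.mult = (*), one = 1, ring.zero = 0, add = (+)\<rparr>"

record 'v inner_module = "(real, 'v) module" +
  ip :: "'v \<Rightarrow> 'v \<Rightarrow> real"

definition ip_dist :: "('v, 'm) inner_module_scheme \<Rightarrow> 'v \<Rightarrow> 'v \<Rightarrow> real"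
  where "ip_dist V v w =
    (if v \<in> carrier V \<and> w \<in> carrier V then sqrt (ip V (v \<ominus>\<^bsub>V\<^esub> w) (v \<ominus>\<^bsub>V\<^esub> w)) else 0)"

definition real_hilbert :: "('v, 'm) inner_module_scheme \<Rightarrow> bool"
  where "real_hilbert V \<longleftrightarrow> Module.module real_field V \<and>
    (\<forall>v\<in>carrier V. \<forall>w\<in>carrier V. ip V v w = ip V w v) \<and>
    (\<forall>u\<in>carrier V. \<forall>v\<in>carrier V. \<forall>w\<in>carrier V.
      ip V (u \<oplus>\<^bsub>V\<^esub> v) w = ip V u w + ip V v w) \<and>
    (\<forall>r. \<forall>v\<in>carrier V. \<forall>w\<in>carrier V. ip V (r \<odot>\<^bsub>V\<^esub> v) w = r * ip V v w) \<and>
    (\<forall>v\<in>carrier V. v \<noteq> \<zero>\<^bsub>V\<^esub> \<longrightarrow> ip V v v > 0) \<and>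
    Metric_space.mcomplete (carrier V) (ip_dist V)"

definition hilbert_topology :: "('v, 'm) inner_module_scheme \<Rightarrow> 'v topology"
  where "hilbert_topology V = Metric_space.mtopology (carrier V) (ip_dist V)"

definition affine_isometric_action ::
    "('g, 'm) monoid_scheme \<Rightarrow> ('v, 'n) inner_module_scheme \<Rightarrow> ('g \<Rightarrow> 'v \<Rightarrow> 'v) \<Rightarrow> bool"
  where "affine_isometric_action G V \<alpha> \<longleftrightarrow>
    (\<forall>g\<in>carrier G. \<forall>v\<in>carrier V. \<alpha> g v \<in> carrier V) \<and>
    (\<forall>v\<in>carrier V. \<alpha> \<one>\<^bsub>G\<^esub> v = v) \<and>
    (\<forall>g\<in>carrier G. \<forall>h\<in>carrier G. \<forall>v\<in>carrier V. \<alpha> (g \<otimes>\<^bsub>G\<^esub> h) v = \<alpha> g (\<alpha> h v)) \<and>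
    (\<forall>g\<in>carrier G. \<forall>v\<in>carrier V. \<forall>w\<in>carrier V. \<forall>t.
      \<alpha> g (t \<odot>\<^bsub>V\<^esub> v \<oplus>\<^bsub>V\<^esub> (1 - t) \<odot>\<^bsub>V\<^esub> w) = t \<odot>\<^bsub>V\<^esub> \<alpha> g v \<oplus>\<^bsub>V\<^esub> (1 - t) \<odot>\<^bsub>V\<^esub> \<alpha> g w) \<and>
    (\<forall>g\<in>carrier G. \<forall>v\<in>carrier V. \<forall>w\<in>carrier V. ip_dist V (\<alpha> g v) (\<alpha> g w) = ip_dist V v w)"

text \<open>
  A HOL formula cannot quantify over all types, so the Hilbert spaces range over all those
  whose underlying set consists of functions \<open>'g \<Rightarrow> real\<close>.  This is no restriction, as the lemma
  \<open>property_FH_fixed_point\<close> below shows: the closed linear span \<open>W\<close> of the orbit of \<open>0\<close> is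
  invariant, and \<open>v \<mapsto> (\<lambda>g. \<langle>v, g \<cdot> 0\<rangle>)\<close> is injective on \<open>W\<close>.
\<close>

definition property_FH :: "('g, 'm) monoid_scheme \<Rightarrow> 'g topology \<Rightarrow> bool"
  where "property_FH G T \<longleftrightarrow>
    (\<forall>(V :: ('g \<Rightarrow> real) inner_module) \<alpha>.
      real_hilbert V \<and> affine_isometric_action G V \<alpha> \<and>
      continuous_map (prod_topology T (hilbert_topology V)) (hilbert_topology V)
        (\<lambda>(g, v). \<alpha> g v) \<longrightarrow>
      (\<exists>v\<in>carrier V. \<forall>g\<in>carrier G. \<alpha> g v = v))"

text \<open>
  Adequacy of \<^const>\<open>property_FH\<close>: it yields fixed points on real Hilbert spaces of every type.
\<close>

definition transported_hilbert ::
    "('v::real_inner \<Rightarrow> 'w) \<Rightarrow> 'v set \<Rightarrow> 'w inner_module"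
  where "transported_hilbert \<phi> W =
    \<lparr>carrier = \<phi> ` W, monoid.mult = (\<lambda>x y. x), one = \<phi> 0, ring.zero = \<phi> 0,
     add = (\<lambda>x y. \<phi> (inv_into W \<phi> x + inv_into W \<phi> y)),
     smult = (\<lambda>r x. \<phi> (r *\<^sub>R inv_into W \<phi> x)),
     ip = (\<lambda>x y. inner (inv_into W \<phi> x) (inv_into W \<phi> y))\<rparr>"

lemma
  fixes W :: "'v::{real_inner, complete_space} set" and \<phi> :: "'v \<Rightarrow> 'w"
  assumes sub: "subspace W" and cl: "closed W" and inj: "inj_on \<phi> W"
  shows real_hilbert_transported: "real_hilbert (transported_hilbert \<phi> W)"
    and hilbert_topology_transported:
      "homeomorphic_map (top_of_set W) (hilbert_topology (transported_hilbert \<phi> W)) \<phi>"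
    and ip_dist_transported:
      "v \<in> W \<Longrightarrow> w \<in> W \<Longrightarrow> ip_dist (transported_hilbert \<phi> W) (\<phi> v) (\<phi> w) = dist v w"
proof -
  let ?V = "transported_hilbert \<phi> W"
  note inv = inv_into_f_f[OF inj]
  note W = subspace_0[OF sub] subspace_add[OF sub] subspace_scale[OF sub] subspace_neg[OF sub]
    subspace_diff[OF sub]
  have carr: "carrier ?V = \<phi> ` W" and zero: "\<zero>\<^bsub>?V\<^esub> = \<phi> 0"
    by (simp_all add: transported_hilbert_def)
  have add: "\<phi> v \<oplus>\<^bsub>?V\<^esub> \<phi> w = \<phi> (v + w)" if "v \<in> W" "w \<in> W" for v w
    using that by (simp add: transported_hilbert_def inv)
  have smult: "r \<odot>\<^bsub>?V\<^esub> \<phi> v = \<phi> (r *\<^sub>R v)" if "v \<in> W" for r v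
    using that by (simp add: transported_hilbert_def inv)
  have ip: "ip ?V (\<phi> v) (\<phi> w) = inner v w" if "v \<in> W" "w \<in> W" for v w
    using that by (simp add: transported_hilbert_def inv)
  have ag: "abelian_group ?V"
  proof (rule abelian_groupI)
    fix x assume "x \<in> carrier ?V"
    then obtain v where "v \<in> W" "x = \<phi> v" by (auto simp: carr)
    then show "\<exists>y\<in>carrier ?V. y \<oplus>\<^bsub>?V\<^esub> x = \<zero>\<^bsub>?V\<^esub>"
      by (intro bexI[of _ "\<phi> (- v)"]) (auto simp: carr zero add W)
  qed (auto simp: carr zero add W ac_simps)
  have "abelian_group real_field"
    by (rule abelian_groupI) (auto simp: real_field_def intro: exI[of _ "- x" for x])
  moreover have "Group.comm_monoid real_field"
    by (rule comm_monoidI) (auto simp: real_field_def)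
  ultimately have "cring real_field"
    by (rule cringI) (simp add: real_field_def algebra_simps)
  then have mod: "Module.module real_field ?V"
    by (rule moduleI[OF _ ag])
      (auto simp: real_field_def carr add smult W algebra_simps)
  have minus: "\<phi> v \<ominus>\<^bsub>?V\<^esub> \<phi> w = \<phi> (v - w)" if "v \<in> W" "w \<in> W" for v w
  proof -
    have "\<ominus>\<^bsub>?V\<^esub> (\<phi> w) = \<phi> (- w)"
      using that by (intro abelian_group.minus_equality[OF ag]) (auto simp: carr zero add W)
    then show ?thesis
      using that by (simp add: a_minus_def add W)
  qed
  show dist: "ip_dist ?V (\<phi> v) (\<phi> w) = dist v w" if "v \<in> W" "w \<in> W" for v w
    using that by (simp add: ip_dist_def carr minus ip W dist_norm norm_eq_sqrt_inner)
  have inW: "x \<in> \<phi> ` W \<Longrightarrow> inv_into W \<phi> x \<in> W" for x by (rule inv_into_into)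
  have ms: "Metric_space (carrier ?V) (ip_dist ?V)"
  proof
    fix x y
    show "0 \<le> ip_dist ?V x y"
      by (cases "x \<in> carrier ?V \<and> y \<in> carrier ?V") (auto simp: carr dist, auto simp: ip_dist_def carr)
    show "ip_dist ?V x y = ip_dist ?V y x"
      by (cases "x \<in> carrier ?V \<and> y \<in> carrier ?V")
        (auto simp: carr dist dist_commute, auto simp: ip_dist_def carr)
  next
    fix x y z assume "x \<in> carrier ?V" "y \<in> carrier ?V"
    then show "ip_dist ?V x y = 0 \<longleftrightarrow> x = y"
      using inj by (auto simp: carr dist inj_on_eq_iff)
    assume "z \<in> carrier ?V"
    with \<open>x \<in> carrier ?V\<close> \<open>y \<in> carrier ?V\<close>
    show "ip_dist ?V x z \<le> ip_dist ?V x y + ip_dist ?V y z"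
      by (auto simp: carr dist dist_triangle)
  qed
  interpret A: Metric_space W "dist :: 'v \<Rightarrow> 'v \<Rightarrow> real"
    using Met_TC.subspace by blast
  interpret B: Metric_space "carrier ?V" "ip_dist ?V" by (rule ms)
  interpret AB: Metric_space12 W dist "carrier ?V" "ip_dist ?V" ..
  have topA: "A.mtopology = top_of_set W"
    using Submetric.mtopology_submetric[of UNIV dist W] Met_TC.Metric_space_axioms
    by (simp add: Submetric_def Submetric_axioms_def)
  show hom: "homeomorphic_map (top_of_set W) (hilbert_topology ?V) \<phi>"
    unfolding hilbert_topology_def topA[symmetric]
    by (rule AB.isometry_imp_homeomorphic_map) (auto simp: carr dist)
  have "B.mcomplete"
    unfolding B.mcomplete_def
  proof (intro allI impI)
    fix \<sigma> assume \<sigma>: "B.MCauchy \<sigma>"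
    define s where "s n = inv_into W \<phi> (\<sigma> n)" for n
    have "range \<sigma> \<subseteq> carrier ?V"
      using \<sigma> unfolding B.MCauchy_def by blast
    then have \<sigma>W: "\<sigma> n \<in> \<phi> ` W" for n
      by (auto simp: carr)
    then have sW: "s n \<in> W" and \<phi>s: "\<sigma> n = \<phi> (s n)" for n
      by (auto simp: s_def inW f_inv_into_f)
    have "Cauchy s"
      using \<sigma> sW unfolding B.MCauchy_def Cauchy_def by (simp add: \<phi>s dist)
    then obtain l where l: "s \<longlonglongrightarrow> l"
      using Cauchy_convergent convergent_def by blast
    then have lW: "l \<in> W"
      using cl sW closed_sequentially by blast
    have "limitin B.mtopology \<sigma> (\<phi> l) sequentially"
      unfolding B.limitin_metric using l lW sW
      by (auto simp: \<phi>s dist carr tendsto_iff)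
    then show "\<exists>x. limitin B.mtopology \<sigma> x sequentially" ..
  qed
  with mod show "real_hilbert ?V"
    by (auto simp: real_hilbert_def carr ip add smult zero W inner_add_left intro: inner_commute)
qed

lemma property_FH_fixed_point:
  fixes \<alpha> :: "'g \<Rightarrow> 'v::{real_inner, complete_space} \<Rightarrow> 'v"
  assumes FH: "property_FH G T" and G: "topological_group G T"
    and one: "\<And>v. \<alpha> \<one>\<^bsub>G\<^esub> v = v"
    and mult: "\<And>g h v. g \<in> carrier G \<Longrightarrow> h \<in> carrier G \<Longrightarrow> \<alpha> (g \<otimes>\<^bsub>G\<^esub> h) v = \<alpha> g (\<alpha> h v)"
    and affine: "\<And>g v w t. g \<in> carrier G \<Longrightarrow>
      \<alpha> g (t *\<^sub>R v + (1 - t) *\<^sub>R w) = t *\<^sub>R \<alpha> g v + (1 - t) *\<^sub>R \<alpha> g w"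
    and isom: "\<And>g v w. g \<in> carrier G \<Longrightarrow> dist (\<alpha> g v) (\<alpha> g w) = dist v w"
    and cont: "continuous_map (prod_topology T euclidean) euclidean (\<lambda>(g, v). \<alpha> g v)"
  shows "\<exists>v. \<forall>g\<in>carrier G. \<alpha> g v = v"
proof -
  interpret group G using G by (simp add: topological_group_def)
  define S where "S = (\<lambda>g. \<alpha> g 0) ` carrier G"
  define W where "W = closure (span S)"
  define \<phi> where "\<phi> v = (\<lambda>g. inner v (\<alpha> g 0))" for v
  let ?V = "transported_hilbert \<phi> W"
  have sub: "subspace W" 
    unfolding subspace_def W_def
  proof (intro conjI ballI allI)
    show "0 \<in> closure (span S)"
      by (simp add: closure_subset[THEN subsetD] span_zero)
    fix x assume "x \<in> closure (span S)"
    then obtain f where f: "\<And>n. f n \<in> span S" "f \<longlonglongrightarrow> x"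
      unfolding closure_sequential by blast
    show "c *\<^sub>R x \<in> closure (span S)" for c
      unfolding closure_sequential
      using f by (intro exI[of _ "\<lambda>n. c *\<^sub>R f n"]) (simp add: span_scale tendsto_scaleR)
    fix y assume "y \<in> closure (span S)"
    then obtain g where "\<And>n. g n \<in> span S" "g \<longlonglongrightarrow> y"
      unfolding closure_sequential by blast
    with f show "x + y \<in> closure (span S)"
      unfolding closure_sequential
      by (intro exI[of _ "\<lambda>n. f n + g n"]) (simp add: span_add tendsto_add)
  qed
  have cl: "closed W" by (simp add: W_def)
  note W = subspace_0[OF sub] subspace_add[OF sub] subspace_scale[OF sub] subspace_diff[OF sub]
  have SW: "S \<subseteq> span S" "span S \<subseteq> W"
    by (auto simp: W_def span_base closure_subset[THEN subsetD])
  have inj: "inj_on \<phi> W"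
  proof (rule inj_onI)
    fix v w assume vw: "v \<in> W" "w \<in> W" "\<phi> v = \<phi> w"
    have "inner (v - w) s = 0" if "s \<in> S" for s
      using that vw(3) by (auto simp: S_def \<phi>_def inner_diff_left dest: fun_cong)
    then have "S \<subseteq> {s. inner (v - w) s = 0}" by auto
    moreover have "subspace {s. inner (v - w) s = 0}"
      by (auto simp: subspace_def inner_add_right)
    ultimately have "span S \<subseteq> {s. inner (v - w) s = 0}"
      by (rule span_minimal)
    moreover have "closed {s. inner (v - w) s = 0}"
      by (intro closed_Collect_eq continuous_intros)
    ultimately have "W \<subseteq> {s. inner (v - w) s = 0}"
      unfolding W_def by (rule closure_minimal)
    then have "inner (v - w) (v - w) = 0" using W(4)[OF vw(1,2)] by blast
    then show "v = w" by simp
  qed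
  have lin: "\<alpha> g (v + w) = \<alpha> g v + \<alpha> g w - \<alpha> g 0"
    and scale: "\<alpha> g (r *\<^sub>R v) = r *\<^sub>R \<alpha> g v + (1 - r) *\<^sub>R \<alpha> g 0" if "g \<in> carrier G" for g v w r
  proof -
    show *: "\<alpha> g (r *\<^sub>R v) = r *\<^sub>R \<alpha> g v + (1 - r) *\<^sub>R \<alpha> g 0" for r v
      using affine[OF that, of r v 0] by simp
    have "\<alpha> g (v + w) = \<alpha> g ((1/2) *\<^sub>R (2 *\<^sub>R v) + (1 - 1/2) *\<^sub>R (2 *\<^sub>R w))" by simp
    also have "\<dots> = (1/2) *\<^sub>R \<alpha> g (2 *\<^sub>R v) + (1/2) *\<^sub>R \<alpha> g (2 *\<^sub>R w)"
      by (subst affine[OF that]) simp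
    also have "\<dots> = \<alpha> g v + \<alpha> g w - \<alpha> g 0"
    proof -
      have h: "(1/2) *\<^sub>R c + (1/2) *\<^sub>R c = c" for c :: 'v
        by (simp flip: scaleR_add_left)
      show ?thesis
        by (simp add: *[of 2] scaleR_diff_right) (metis h diff_add_eq_diff_diff_swap diff_0)
    qed
    finally show "\<alpha> g (v + w) = \<alpha> g v + \<alpha> g w - \<alpha> g 0" .
  qed
  have S: "\<alpha> g 0 \<in> S" if "g \<in> carrier G" for g using that by (auto simp: S_def)
  have inv: "\<alpha> g v \<in> W" if g: "g \<in> carrier G" and v: "v \<in> W" for g v
  proof -
    have "\<alpha> g v - \<alpha> g 0 \<in> span S" if "v \<in> span S" for v
      using that
    proof (induction rule: span_induct_alt)
      case base then show ?case by (simp add: span_zero)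
    next
      case (step c x y)
      then obtain h where h: "h \<in> carrier G" "x = \<alpha> h 0" by (auto simp: S_def)
      then have "\<alpha> g x = \<alpha> (g \<otimes>\<^bsub>G\<^esub> h) 0" using mult g by simp
      then have gx: "\<alpha> g x \<in> S" using S g h by simp
      have eq: "\<alpha> g (c *\<^sub>R x + y) - \<alpha> g 0 = c *\<^sub>R (\<alpha> g x - \<alpha> g 0) + (\<alpha> g y - \<alpha> g 0)"
        by (simp add: lin[OF g] scale[OF g] algebra_simps)
      show ?case
        unfolding eq by (intro span_add span_scale span_diff span_base gx S[OF g] step)
    qed
    then have "\<alpha> g v \<in> span S" if "v \<in> span S" for v
      using span_add[OF _ span_base[OF S[OF g]], of "\<alpha> g v - \<alpha> g 0"] that by simp
    moreover have "continuous_on UNIV (\<alpha> g)"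
      by (auto simp: continuous_on_iff isom[OF g])
    ultimately have "\<alpha> g ` closure (span S) \<subseteq> closure (span S)"
      by (intro image_closure_subset) (auto intro: continuous_on_subset closure_subset[THEN subsetD])
    then show ?thesis using v by (auto simp: W_def)
  qed
  let ?\<psi> = "inv_into W \<phi>"
  define \<beta> where "\<beta> g x = \<phi> (\<alpha> g (?\<psi> x))" for g x
  have carr: "carrier ?V = \<phi> ` W" by (simp add: transported_hilbert_def)
  have \<beta>: "\<beta> g (\<phi> v) = \<phi> (\<alpha> g v)" if "v \<in> W" for g v
    using that by (simp add: \<beta>_def inv_into_f_f[OF inj])
  have add: "\<phi> v \<oplus>\<^bsub>?V\<^esub> \<phi> w = \<phi> (v + w)" if "v \<in> W" "w \<in> W" for v w
    using that by (simp add: transported_hilbert_def inv_into_f_f[OF inj])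
  have smult: "r \<odot>\<^bsub>?V\<^esub> \<phi> v = \<phi> (r *\<^sub>R v)" if "v \<in> W" for r v
    using that by (simp add: transported_hilbert_def inv_into_f_f[OF inj])
  have act: "affine_isometric_action G ?V \<beta>"
    unfolding affine_isometric_action_def carr
    using one mult
    by (auto simp: \<beta> inv add smult W affine isom ip_dist_transported[OF sub cl inj])
  have hom: "homeomorphic_map (top_of_set W) (hilbert_topology ?V) \<phi>"
    by (rule hilbert_topology_transported[OF sub cl inj])
  then obtain \<kappa> where \<kappa>: "homeomorphic_maps (top_of_set W) (hilbert_topology ?V) \<phi> \<kappa>"
    by (auto simp: homeomorphic_map_maps)
  have topV: "topspace (hilbert_topology ?V) = \<phi> ` W"
    using hom by (metis homeomorphic_imp_surjective_map topspace_euclidean_subtopology)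
  have \<kappa>_eq: "\<kappa> x = ?\<psi> x" if "x \<in> \<phi> ` W" for x
    using that \<kappa> by (auto simp: homeomorphic_maps_def inv_into_f_f[OF inj])
  have topT: "topspace T = carrier G" using G by (simp add: topological_group_def)
  have "continuous_map (prod_topology T (hilbert_topology ?V)) (prod_topology T euclidean)
      (\<lambda>z. (fst z, \<kappa> (snd z)))"
    using \<kappa> unfolding homeomorphic_maps_def
    by (intro continuous_map_pairedI continuous_map_fst
         continuous_map_compose[OF continuous_map_snd, unfolded o_def])
      (auto intro: continuous_map_into_fulltopology)
  from continuous_map_compose[OF this cont]
  have c: "continuous_map (prod_topology T (hilbert_topology ?V)) (top_of_set W)
      (\<lambda>z. \<alpha> (fst z) (\<kappa> (snd z)))"
    by (auto simp: continuous_map_in_subtopology o_def topT topV \<kappa>_eq inv inv_into_into)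
  have "continuous_map (prod_topology T (hilbert_topology ?V)) (hilbert_topology ?V)
      (\<lambda>z. \<phi> (\<alpha> (fst z) (\<kappa> (snd z))))"
    using continuous_map_compose[OF c homeomorphic_imp_continuous_map[OF hom]] by (simp add: o_def)
  then have "continuous_map (prod_topology T (hilbert_topology ?V)) (hilbert_topology ?V)
      (\<lambda>(g, x). \<beta> g x)"
    by (rule continuous_map_eq) (auto simp: topT topV \<kappa>_eq \<beta>_def)
  then have "\<exists>x\<in>carrier ?V. \<forall>g\<in>carrier G. \<beta> g x = x"
    using FH[unfolded property_FH_def, THEN spec[of _ ?V], THEN spec[of _ \<beta>]] act
      real_hilbert_transported[OF sub cl inj] by fast
  then obtain x where x: "x \<in> carrier ?V" "\<And>g. g \<in> carrier G \<Longrightarrow> \<beta> g x = x"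
    by (elim bexE) simp
  then obtain v where v: "v \<in> W" "x = \<phi> v" by (auto simp: carr)
  have "\<alpha> g v = v" if "g \<in> carrier G" for g
    using x(2)[OF that] v inv[OF that v(1)] inj by (simp add: \<beta> inj_on_eq_iff)
  then show ?thesis by blast
qed

end

theory Submission
  imports Defs
begin

text \<open>
  Let \<open>n\<^sub>2\<close> be the set of all \<open>x \<in> M\<close> with \<open>\<tau>(x\<^sup>*x) < \<infinity>\<close>.  As \<open>p \<le> 2\<close>, it contains
  \<open>M \<inter> L\<^sup>p\<close>, so \<open>u \<mapsto> u - 1\<close> is a continuous cocycle for the action of \<open>G\<close> by left multiplication on
  the completion of \<open>n\<^sub>2\<close>.  A fixed point of the affine action gives a real linear functional \<open>F\<close> on
  \<open>n\<^sub>2\<close> with \<open>|F x| \<le> R \<parallel>x\<parallel>\<^sub>2\<close> and \<open>F((u - 1)\<^sup>* x) = - Re \<tau>(x\<^sup>* (u - 1))\<close>.  If \<open>h\<close> is a finite sum of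
  operators \<open>(u - 1)\<^sup>* (u - 1)\<close> and \<open>c = f(h) h\<close> is a contraction, then the value of \<open>F\<close> at \<open>c\<^sup>2\<close>
  shows \<open>\<tau>(c\<^sup>2) \<le> R\<^sup>2\<close>, and therefore \<open>\<tau>(kh (1 + kh)\<^sup>-\<^sup>1) \<le> R\<^sup>2\<close> for all \<open>k\<close>.  These operators
  \<open>kh (1 + kh)\<^sup>-\<^sup>1\<close> form a directed set whose supremum \<open>e\<close> is
  the projection onto the complement of the vectors fixed by \<open>G\<close>; hence \<open>\<tau>(e) \<le> R\<^sup>2\<close> by normality.
  As \<open>\<tau>(e)\<close> is finite, the \<open>p\<close>-norm, the \<open>2\<close>-norm and the strong topology agree on bounded subsets of
  \<open>M e\<close>, and this makes the restriction to \<open>ran(e)\<close> a homeomorphism onto a closed subgroup.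

  Operators are treated as real linear maps; those of \<open>M\<close> commute with multiplication by \<open>\<i>\<close>.
  The \<open>p\<close>-norm is a metric by the triangle inequality for \<open>1 \<le> p \<le> 2\<close>, which follows from a
  Hoelder inequality that only needs pairings of functions of two positive operators.
\<close>

section \<open>Bounded operators on a real Hilbert space\<close>

text \<open>The bound rests on one computation. Each summand of \<open>adj c * c\<close> has the
  form \<open>adj v * y\<close> with \<open>v = u - 1\<close>, so the cocycle identity makes the
  value of F at \<open>adj c * c\<close> minus the squared 2-norm of c. As c is a contraction,
  boundedness of F gives norm^2 <= R norm, hence norm <= R, uniformly in h and f. The fixed vector
  lies in a completion, but only its pairing F with operators enters, so no operator has to be
  attached to it. Replacing h by kh does not change the bound and drives the bounded transform
  towards the range projection of h; this is how a projection is reached. Real linear operators fit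
  property (FH), which concerns real Hilbert spaces and yields only real parts of traces; no
  information on complex linearity is lost, because multiplication by \<i> lies in the algebra and
  forces its commutant to be complex linear. Neither G nor the Hilbert space is assumed countable or
  separable: normality is applied to a net, and separability of the predual supplies a countable
  separating family of vectors in place of a dense sequence.\<close>

class hilbert = real_inner + complete_space

instance hilbert \<subseteq> banach ..

instance complex_hilbert \<subseteq> hilbert ..

text \<open>Midpoints of elements of S lie in S, so the parallelogram law bounds the distance
  between two nearly optimal points and a minimising sequence is Cauchy. Optimality of the limit
  under perturbation in the direction z is orthogonality.\<close>

lemma closed_subspace_nearest:
  fixes S :: "'a::hilbert set"
  assumes cl: "closed S" and sub: "subspace S"
  obtains y where "y \<in> S" "\<And>z. z \<in> S \<Longrightarrow> inner (x - y) z = 0"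
proof -
  define D where "D = (\<lambda>y. (norm (x - y))\<^sup>2) ` S"
  define d where "d = Inf D"
  have ne: "D \<noteq> {}" using subspace_0[OF sub] by (auto simp: D_def)
  have bd: "bdd_below D" by (rule bdd_belowI[of _ 0]) (auto simp: D_def)
  have dle: "d \<le> (norm (x - y))\<^sup>2" if "y \<in> S" for y
    unfolding d_def by (rule cInf_lower) (use that bd in \<open>auto simp: D_def\<close>)
  have "\<exists>y\<in>S. (norm (x - y))\<^sup>2 < d + 1 / Suc n" for n
    using cInf_lessD[OF ne, of "d + 1 / Suc n"] by (auto simp: D_def d_def)
  then obtain y where yS: "\<And>n. y n \<in> S" and y: "\<And>n. (norm (x - y n))\<^sup>2 < d + 1 / Suc n"
    by metis
  have par: "(norm (y n - y m))\<^sup>2 \<le> 2 / Suc n + 2 / Suc m" for n m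
  proof -
    have "(1/2) *\<^sub>R (y n + y m) \<in> S"
      using sub yS by (simp add: subspace_add subspace_scale)
    from dle[OF this] have 1: "d \<le> (norm (x - (1/2) *\<^sub>R (y n + y m)))\<^sup>2" .
    have "(norm (y n - y m))\<^sup>2 = 2 * (norm (x - y n))\<^sup>2 + 2 * (norm (x - y m))\<^sup>2
        - 4 * (norm (x - (1/2) *\<^sub>R (y n + y m)))\<^sup>2"
      by (simp add: power2_norm_eq_inner algebra_simps inner_commute)
    then show ?thesis using 1 y[of n] y[of m] by simp
  qed
  have "Cauchy y"
  proof (rule metric_CauchyI)
    fix \<epsilon> :: real assume e: "\<epsilon> > 0"
    obtain N where N: "4 / \<epsilon>\<^sup>2 < real N" using reals_Archimedean2 by blast
    have "dist (y m) (y n) < \<epsilon>" if "m \<ge> N" "n \<ge> N" for m n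
    proof -
      have "4 / \<epsilon>\<^sup>2 > 0" using e by simp
      then have N0: "N > 0" using N by (metis gr0I of_nat_0 order_less_asym)
      have "2 / Suc m \<le> 2 / Suc N" "2 / Suc n \<le> 2 / Suc N"
        using that by (auto intro!: divide_left_mono)
      then have "(norm (y m - y n))\<^sup>2 \<le> 4 / Suc N" using par[of m n] by simp
      also have "\<dots> < 4 / N" using N0 by (intro divide_strict_left_mono) auto
      also have "\<dots> < \<epsilon>\<^sup>2" using N N0 e by (simp add: field_simps)
      finally show ?thesis using e by (simp add: dist_norm power_less_imp_less_base)
    qed
    then show "\<exists>M. \<forall>m\<ge>M. \<forall>n\<ge>M. dist (y m) (y n) < \<epsilon>" by blast
  qed
  then obtain l where l: "y \<longlonglongrightarrow> l" using Cauchy_convergent convergent_def by blast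
  have lS: "l \<in> S" using closed_sequentially[OF cl] yS l by blast
  have "(norm (x - l))\<^sup>2 \<le> d"
  proof (rule LIMSEQ_le)
    show "(\<lambda>n. (norm (x - y n))\<^sup>2) \<longlonglongrightarrow> (norm (x - l))\<^sup>2" by (intro tendsto_intros l)
    have "(\<lambda>n. 1 / real (Suc n)) \<longlonglongrightarrow> 0" by (rule LIMSEQ_Suc[OF lim_1_over_n])
    from tendsto_add[OF tendsto_const[of d] this] show "(\<lambda>n. d + 1 / Suc n) \<longlonglongrightarrow> d" by simp
    show "\<exists>N. \<forall>n\<ge>N. (norm (x - y n))\<^sup>2 \<le> d + 1 / Suc n"
      using y by (metis less_imp_le)
  qed
  then have min: "(norm (x - l))\<^sup>2 \<le> (norm (x - z))\<^sup>2" if "z \<in> S" for z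
    using dle[OF that] by (rule order_trans)
  have "inner (x - l) z = 0" if "z \<in> S" for z
  proof (cases "z = 0")
    case False
    \<comment> \<open>The minimiser of the squared norm of \<open>x - l - t z\<close> as a quadratic
      polynomial in t.\<close>
    define t where "t = inner (x - l) z / inner z z"
    have zz: "inner z z > 0" using False by simp
    have "l + t *\<^sub>R z \<in> S" using sub lS that by (simp add: subspace_add subspace_scale)
    from min[OF this] have "(norm (x - l))\<^sup>2 \<le> (norm ((x - l) - t *\<^sub>R z))\<^sup>2" by (simp add: algebra_simps)
    also have "\<dots> = (norm (x - l))\<^sup>2 - 2 * t * inner (x - l) z + t\<^sup>2 * inner z z"
      by (simp only: power2_norm_eq_inner) (simp add: inner_diff_left inner_diff_right inner_commute power2_eq_square algebra_simps)
    also have "\<dots> = (norm (x - l))\<^sup>2 - (inner (x - l) z)\<^sup>2 / inner z z"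
      using zz by (simp add: t_def power2_eq_square field_simps)
    finally have "(inner (x - l) z)\<^sup>2 / inner z z \<le> 0" by simp
    then show ?thesis using zz by (simp add: divide_le_0_iff)
  qed simp
  with lS show thesis by (rule that)
qed

text \<open>The kernel is a hyperplane: for w orthogonal to it, \<open>v - (f v / f w) w\<close>
  lies in the kernel, and pairing with w computes \<open>f v\<close>.\<close>

lemma riesz_representation:
  fixes f :: "'a::hilbert \<Rightarrow> real"
  assumes f: "bounded_linear f"
  obtains z where "\<And>x. f x = inner x z"
proof (cases "\<forall>x. f x = 0")
  case True
  then show ?thesis using that[of 0] by simp
next
  case False
  then obtain x where x: "f x \<noteq> 0" by blast
  interpret bounded_linear f by fact
  define S where "S = {x. f x = 0}"
  have "closed S" unfolding S_def by (intro closed_Collect_eq continuous_intros continuous_on)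
  moreover have "subspace S" by (auto simp: S_def subspace_def add scale)
  ultimately obtain y where y: "y \<in> S" "\<And>z. z \<in> S \<Longrightarrow> inner (x - y) z = 0"
    using closed_subspace_nearest by blast
  define w where "w = x - y"
  have fw: "f w \<noteq> 0" using x y(1) by (simp add: w_def S_def diff)
  then have w0: "w \<noteq> 0" using zero by auto
  show ?thesis
  proof (rule that)
    fix v
    have "v - (f v / f w) *\<^sub>R w \<in> S" using fw by (simp add: S_def diff scale)
    then have "inner w (v - (f v / f w) *\<^sub>R w) = 0" using y(2) by (simp add: w_def)
    then have "inner v w = (f v / f w) * inner w w" by (simp add: inner_diff_right inner_commute)
    then show "f v = inner v ((f w / inner w w) *\<^sub>R w)" using fw w0 by simp
  qed
qed

text \<open>
  The operators of \<open>'a \<Rightarrow>\<^sub>L 'a\<close>, copied so that composition can be the multiplication of a ring.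
\<close>

typedef (overloaded) 'a bop = "UNIV :: ('a::hilbert \<Rightarrow>\<^sub>L 'a) set" ..

setup_lifting type_definition_bop

lift_definition ap :: "'a::hilbert bop \<Rightarrow> 'a \<Rightarrow> 'a" is blinfun_apply .

lemma bop_eqI: "(\<And>\<xi>. ap x \<xi> = ap y \<xi>) \<Longrightarrow> x = y"
  by transfer (auto intro: blinfun_eqI)

section \<open>The Banach algebra of bounded operators\<close>

instantiation bop :: (hilbert) real_vector
begin
lift_definition zero_bop :: "'a bop" is 0 .
lift_definition plus_bop :: "'a bop \<Rightarrow> 'a bop \<Rightarrow> 'a bop" is "(+)" .
lift_definition minus_bop :: "'a bop \<Rightarrow> 'a bop \<Rightarrow> 'a bop" is "(-)" .
lift_definition uminus_bop :: "'a bop \<Rightarrow> 'a bop" is uminus .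
lift_definition scaleR_bop :: "real \<Rightarrow> 'a bop \<Rightarrow> 'a bop" is scaleR .
instance
proof
  fix x y z :: "'a bop" and a b :: real
  show "x + y + z = x + (y + z)" "x + y = y + x" by (transfer, rule add.assoc, transfer, rule add.commute)
  show "0 + x = x" "- x + x = 0" "x - y = x + - y" by (transfer, simp)+
  show "a *\<^sub>R (x + y) = a *\<^sub>R x + a *\<^sub>R y" "(a + b) *\<^sub>R x = a *\<^sub>R x + b *\<^sub>R x"
    by (transfer, rule scaleR_add_right, transfer, rule scaleR_add_left)
  show "a *\<^sub>R b *\<^sub>R x = (a * b) *\<^sub>R x" "1 *\<^sub>R x = x" by (transfer, simp)+
qed
end

instantiation bop :: (hilbert) real_normed_vector
begin
lift_definition norm_bop :: "'a bop \<Rightarrow> real" is norm .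
definition sgn_bop :: "'a bop \<Rightarrow> 'a bop" where "sgn_bop x = x /\<^sub>R norm x"
definition dist_bop :: "'a bop \<Rightarrow> 'a bop \<Rightarrow> real" where "dist_bop x y = norm (x - y)"
definition uniformity_bop :: "('a bop \<times> 'a bop) filter"
  where "uniformity_bop = (INF e\<in>{0<..}. principal {(x, y). dist x y < e})"
definition open_bop :: "'a bop set \<Rightarrow> bool"
  where "open_bop U \<longleftrightarrow> (\<forall>x\<in>U. eventually (\<lambda>(x', y). x' = x \<longrightarrow> y \<in> U) uniformity)"
instance
proof
  fix x y :: "'a bop" and a :: real
  show "(norm x = 0) = (x = 0)" by transfer simp
  show "norm (x + y) \<le> norm x + norm y" by transfer (rule norm_triangle_ineq)
  show "norm (a *\<^sub>R x) = \<bar>a\<bar> * norm x" by transfer simp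
qed (simp_all add: dist_bop_def sgn_bop_def uniformity_bop_def open_bop_def)
end

instance bop :: (hilbert) banach
proof
  fix X :: "nat \<Rightarrow> 'a bop" assume X: "Cauchy X"
  have dist: "dist x y = dist (Rep_bop x) (Rep_bop y)" for x y :: "'a bop"
    by (metis dist_bop_def dist_norm minus_bop.rep_eq norm_bop.rep_eq)
  have "Cauchy (\<lambda>n. Rep_bop (X n))" using X by (simp add: Cauchy_def dist)
  then have "convergent (\<lambda>n. Rep_bop (X n))" by (rule Cauchy_convergent)
  then obtain L where "(\<lambda>n. Rep_bop (X n)) \<longlonglongrightarrow> L"
    unfolding convergent_def ..
  then have "X \<longlonglongrightarrow> Abs_bop L" by (simp add: tendsto_iff dist Abs_bop_inverse)
  then show "convergent X" by (auto simp: convergent_def)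
qed

instantiation bop :: (hilbert) "{monoid_mult, real_normed_algebra}"
begin
lift_definition one_bop :: "'a bop" is id_blinfun .
lift_definition times_bop :: "'a bop \<Rightarrow> 'a bop \<Rightarrow> 'a bop" is blinfun_compose .
instance
proof
  fix x y z :: "'a bop" and a :: real
  show "x * y * z = x * (y * z)" by (transfer, auto intro!: blinfun_eqI)
  show "1 * x = x" "x * 1 = x" by (transfer, auto intro!: blinfun_eqI)+
  show "(x + y) * z = x * z + y * z" "x * (y + z) = x * y + x * z"
    by (transfer, auto intro!: blinfun_eqI simp: blinfun.bilinear_simps)+
  show "a *\<^sub>R x * y = a *\<^sub>R (x * y)" "x * a *\<^sub>R y = a *\<^sub>R (x * y)"
    by (transfer, auto intro!: blinfun_eqI simp: blinfun.bilinear_simps)+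
  show "norm (x * y) \<le> norm x * norm y" by transfer (rule norm_blinfun_compose)
qed
end

lemma ap_simps [simp]:
  "ap 0 \<xi> = 0" "ap 1 \<xi> = \<xi>" "ap (x + y) \<xi> = ap x \<xi> + ap y \<xi>" "ap (x - y) \<xi> = ap x \<xi> - ap y \<xi>"
  "ap (- x) \<xi> = - ap x \<xi>" "ap (r *\<^sub>R x) \<xi> = r *\<^sub>R ap x \<xi>" "ap (x * y) \<xi> = ap x (ap y \<xi>)"
  by (transfer, simp add: blinfun.bilinear_simps)+

lemma ap_sum: "ap (sum f I) \<xi> = (\<Sum>i\<in>I. ap (f i) \<xi>)"
  by (induction I rule: infinite_finite_induct) auto

lemma bounded_linear_ap: "bounded_linear (ap x)"
  by transfer (rule blinfun.bounded_linear_right)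

lemmas ap_arg_simps =
  linear_0[OF bounded_linear.linear[OF bounded_linear_ap]]
  linear_add[OF bounded_linear.linear[OF bounded_linear_ap]]
  linear_diff[OF bounded_linear.linear[OF bounded_linear_ap]]
  linear_neg[OF bounded_linear.linear[OF bounded_linear_ap]]
  linear_scale[OF bounded_linear.linear[OF bounded_linear_ap]]

lemmas tendsto_ap [tendsto_intros] = bounded_linear.tendsto[OF bounded_linear_ap]
lemmas continuous_on_ap [continuous_intros] = bounded_linear.continuous_on[OF bounded_linear_ap]

lemma norm_ap: "norm (ap x \<xi>) \<le> norm x * norm \<xi>"
  by transfer (rule norm_blinfun)

lemma norm_bop_bound: "0 \<le> b \<Longrightarrow> (\<And>\<xi>. norm (ap x \<xi>) \<le> b * norm \<xi>) \<Longrightarrow> norm x \<le> b"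
  by transfer (rule norm_blinfun_bound)

lemma norm_bop_one: "norm (1 :: 'a::hilbert bop) \<le> 1"
  by (rule norm_bop_bound) auto

lemma ex_bop: "bounded_linear f \<Longrightarrow> \<exists>x. ap x = f"
  by transfer (metis bounded_linear_Blinfun_apply)

lemma tendsto_bop_ap: "(x \<longlongrightarrow> y) F \<Longrightarrow> ((\<lambda>n. ap (x n) \<xi>) \<longlongrightarrow> ap y \<xi>) F"
proof -
  assume "(x \<longlongrightarrow> y) F"
  moreover have "bounded_linear (\<lambda>x. ap x \<xi>)"
    by (rule bounded_linear_intro[of _ "norm \<xi>"]) (auto simp: norm_ap)
  ultimately show ?thesis using bounded_linear.tendsto by blast
qed

subsection \<open>Adjoints and order\<close>

lemma ex_adj: "\<exists>y. \<forall>\<xi> \<eta>. inner (ap x \<xi>) \<eta> = inner \<xi> (ap y \<eta>)"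
proof -
  have "\<exists>z. \<forall>\<xi>. inner (ap x \<xi>) \<eta> = inner \<xi> z" for \<eta>
    using riesz_representation[of "\<lambda>\<xi>. inner (ap x \<xi>) \<eta>"]
      bounded_linear_compose[OF bounded_linear_inner_left bounded_linear_ap] by metis
  then obtain g where g: "\<And>\<eta> \<xi>. inner (ap x \<xi>) \<eta> = inner \<xi> (g \<eta>)" by metis
  have "bounded_linear g"
  proof (rule bounded_linear_intro[of _ "norm x"])
    show "g (v + w) = g v + g w" for v w
      by (rule vector_eq_ldot[THEN iffD1]) (simp add: inner_add_right flip: g)
    show "g (r *\<^sub>R v) = r *\<^sub>R g v" for r v
      by (rule vector_eq_ldot[THEN iffD1]) (simp flip: g)
    show "norm (g \<eta>) \<le> norm \<eta> * norm x" for \<eta>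
    proof -
      have "norm (g \<eta>) * norm (g \<eta>) = inner (ap x (g \<eta>)) \<eta>"
        by (simp add: g flip: power2_norm_eq_inner power2_eq_square)
      also have "\<dots> \<le> norm (ap x (g \<eta>)) * norm \<eta>" by (rule norm_cauchy_schwarz)
      also have "\<dots> \<le> norm x * norm (g \<eta>) * norm \<eta>" by (intro mult_right_mono norm_ap) simp
      finally have "norm (g \<eta>) * norm (g \<eta>) \<le> norm (g \<eta>) * (norm \<eta> * norm x)" by (simp add: ac_simps)
      then show ?thesis by (cases "norm (g \<eta>) = 0") (simp_all add: mult_le_cancel_left)
    qed
  qed
  then show ?thesis using ex_bop g by metis
qed

definition adj :: "'a::hilbert bop \<Rightarrow> 'a bop"
  where "adj x = (SOME y. \<forall>\<xi> \<eta>. inner (ap x \<xi>) \<eta> = inner \<xi> (ap y \<eta>))"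

lemma inner_ap_left: "inner (ap x \<xi>) \<eta> = inner \<xi> (ap (adj x) \<eta>)"
  unfolding adj_def using someI_ex[OF ex_adj[of x]] by blast

lemma inner_ap_right: "inner \<xi> (ap x \<eta>) = inner (ap (adj x) \<xi>) \<eta>"
  by (metis inner_ap_left inner_commute)

lemma adj_unique: "(\<And>\<xi> \<eta>. inner (ap x \<xi>) \<eta> = inner \<xi> (ap y \<eta>)) \<Longrightarrow> adj x = y"
  by (rule bop_eqI, rule vector_eq_ldot[THEN iffD1]) (simp flip: inner_ap_left)

lemma adj_adj [simp]: "adj (adj x) = x"
  by (rule adj_unique) (simp add: inner_ap_right)

lemma adj_simps [simp]:
  "adj 0 = 0" "adj 1 = 1" "adj (x + y) = adj x + adj y" "adj (x - y) = adj x - adj y"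
  "adj (- x) = - adj x" "adj (r *\<^sub>R x) = r *\<^sub>R adj x" "adj (x * y) = adj y * adj x"
  by (rule adj_unique; simp add: inner_simps inner_ap_left)+

lemma adj_power [simp]: "adj (x ^ n) = adj x ^ n"
  by (induction n) (auto simp: power_commutes)

lemma adj_sum: "adj (sum f I) = (\<Sum>i\<in>I. adj (f i))"
  by (induction I rule: infinite_finite_induct) auto

lemma norm_adj [simp]: "norm (adj x) = norm x"
proof -
  have *: "norm (adj x) \<le> norm x" for x :: "'a bop"
  proof (rule norm_bop_bound)
    fix \<eta>
    have "norm (ap (adj x) \<eta>) * norm (ap (adj x) \<eta>) = inner (ap x (ap (adj x) \<eta>)) \<eta>"
      by (simp add: inner_ap_left flip: power2_norm_eq_inner power2_eq_square)
    also have "\<dots> \<le> norm (ap x (ap (adj x) \<eta>)) * norm \<eta>" by (rule norm_cauchy_schwarz)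
    also have "\<dots> \<le> norm x * norm (ap (adj x) \<eta>) * norm \<eta>" by (intro mult_right_mono norm_ap) simp
    finally have "norm (ap (adj x) \<eta>) * norm (ap (adj x) \<eta>) \<le> norm (ap (adj x) \<eta>) * (norm x * norm \<eta>)"
      by (simp add: ac_simps)
    then show "norm (ap (adj x) \<eta>) \<le> norm x * norm \<eta>"
      by (cases "norm (ap (adj x) \<eta>) = 0") (simp_all add: mult_le_cancel_left)
  qed simp
  show ?thesis using *[of x] *[of "adj x"] by simp
qed

lemma tendsto_adj [tendsto_intros]: "(x \<longlongrightarrow> y) F \<Longrightarrow> ((\<lambda>n. adj (x n)) \<longlongrightarrow> adj y) F"
  by (rule bounded_linear.tendsto[OF bounded_linear_intro[of _ 1]]) auto

text \<open>The C*-identity, from Cauchy-Schwarz for the form of \<open>adj x * x\<close>.\<close>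

lemma norm_adj_mult_self: "norm (adj x * x) = (norm x)\<^sup>2"
proof (rule antisym)
  show "norm (adj x * x) \<le> (norm x)\<^sup>2"
    using norm_mult_ineq[of "adj x" x] by (simp add: power2_eq_square)
  have "norm x \<le> sqrt (norm (adj x * x))"
  proof (rule norm_bop_bound)
    fix \<xi>
    have "(norm (ap x \<xi>))\<^sup>2 = inner \<xi> (ap (adj x * x) \<xi>)"
      by (simp add: power2_norm_eq_inner inner_ap_left)
    also have "\<dots> \<le> norm \<xi> * norm (ap (adj x * x) \<xi>)" by (rule norm_cauchy_schwarz)
    also have "\<dots> \<le> norm \<xi> * (norm (adj x * x) * norm \<xi>)" by (intro mult_left_mono norm_ap) simp
    finally have "(norm (ap x \<xi>))\<^sup>2 \<le> norm (adj x * x) * (norm \<xi>)\<^sup>2"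
      by (simp add: power2_eq_square ac_simps)
    then show "norm (ap x \<xi>) \<le> sqrt (norm (adj x * x)) * norm \<xi>"
      by (metis abs_norm_cancel real_sqrt_abs real_sqrt_le_mono real_sqrt_mult)
  qed simp
  then show "(norm x)\<^sup>2 \<le> norm (adj x * x)"
    by (metis norm_ge_zero power_mono real_sqrt_pow2)
qed

text \<open>Polarisation. Over the reals symmetry is essential: the form of a rotation by a right
  angle vanishes.\<close>

lemma self_adjoint_eq_0:
  assumes "adj x = x" "\<And>\<xi>. inner \<xi> (ap x \<xi>) = 0"
  shows "x = 0"
proof (rule bop_eqI, rule vector_eq_ldot[THEN iffD1], intro allI)
  fix \<xi> \<eta>
  have "inner (\<eta> + \<xi>) (ap x (\<eta> + \<xi>)) = 0" by (rule assms)
  then have "inner \<eta> (ap x \<xi>) + inner \<xi> (ap x \<eta>) = 0"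
    by (simp add: inner_simps ap_arg_simps assms)
  moreover have "inner \<xi> (ap x \<eta>) = inner \<eta> (ap x \<xi>)"
    by (metis assms(1) inner_ap_left inner_commute)
  ultimately show "inner \<eta> (ap x \<xi>) = inner \<eta> (ap 0 \<xi>)" by simp
qed

instantiation bop :: (hilbert) ordered_real_vector
begin
text \<open>Over the reals a nonnegative quadratic form does not force symmetry, so self-adjointness
  of the difference is part of the order.\<close>

definition less_eq_bop :: "'a bop \<Rightarrow> 'a bop \<Rightarrow> bool"
  where "x \<le> y \<longleftrightarrow> adj (y - x) = y - x \<and> (\<forall>\<xi>. 0 \<le> inner \<xi> (ap (y - x) \<xi>))"
definition less_bop :: "'a bop \<Rightarrow> 'a bop \<Rightarrow> bool"
  where "x < y \<longleftrightarrow> x \<le> y \<and> x \<noteq> (y :: 'a bop)"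
instance
proof
  fix x y z :: "'a bop" and a b :: real
  show anti: "x = y" if "x \<le> y" "y \<le> x"
    using that self_adjoint_eq_0[of "y - x"] unfolding less_eq_bop_def
    by (simp add: inner_diff_right order_antisym)
  show "(x < y) = (x \<le> y \<and> \<not> y \<le> x)" using anti by (auto simp: less_bop_def)
  show "x \<le> x" by (simp add: less_eq_bop_def)
  show "x \<le> z" if "x \<le> y" "y \<le> z"
  proof -
    have "z - x = (z - y) + (y - x)" by simp
    then show ?thesis using that unfolding less_eq_bop_def
      by (metis (no_types, opaque_lifting) adj_simps(3) ap_simps(3) inner_add_right add_nonneg_nonneg)
  qed
  show "z + x \<le> z + y" if "x \<le> y" using that by (simp add: less_eq_bop_def)
  show "a *\<^sub>R x \<le> a *\<^sub>R y" if "x \<le> y" "0 \<le> a"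
  proof -
    have "a *\<^sub>R y - a *\<^sub>R x = a *\<^sub>R (y - x)" by (simp add: scaleR_diff_right)
    then show ?thesis using that unfolding less_eq_bop_def by (metis adj_simps(6) ap_simps(6) inner_scaleR_right mult_nonneg_nonneg)
  qed
  show "a *\<^sub>R x \<le> b *\<^sub>R x" if "a \<le> b" "0 \<le> x"
  proof -
    have "b *\<^sub>R x - a *\<^sub>R x = (b - a) *\<^sub>R x" by (simp add: scaleR_diff_left)
    then show ?thesis using that unfolding less_eq_bop_def
      by (metis adj_simps(6) ap_simps(6) diff_zero inner_scaleR_right mult_nonneg_nonneg diff_ge_0_iff_ge)
  qed
qed
end

lemma bop_nonneg_iff: "0 \<le> x \<longleftrightarrow> adj x = x \<and> (\<forall>\<xi>. 0 \<le> inner \<xi> (ap x \<xi>))"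
  by (simp add: less_eq_bop_def)

lemma bop_leI:
  "adj x = x \<Longrightarrow> adj y = y \<Longrightarrow> (\<And>\<xi>. inner \<xi> (ap x \<xi>) \<le> inner \<xi> (ap y \<xi>)) \<Longrightarrow> x \<le> y"
  by (simp add: less_eq_bop_def inner_diff_right)

lemma bop_leD: "x \<le> y \<Longrightarrow> inner \<xi> (ap x \<xi>) \<le> inner \<xi> (ap y \<xi>)"
  by (simp add: less_eq_bop_def inner_diff_right)

lemma adj_nonneg: "0 \<le> x \<Longrightarrow> adj x = x"
  by (simp add: bop_nonneg_iff)

lemma adj_mult_self_nonneg [simp]: "0 \<le> adj x * x"
  by (simp add: bop_nonneg_iff flip: inner_ap_left)

lemma conj_nonneg: "0 \<le> a \<Longrightarrow> 0 \<le> adj x * a * x"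
  by (simp add: bop_nonneg_iff mult.assoc flip: inner_ap_left)

lemma conj_mono: "a \<le> b \<Longrightarrow> adj x * a * x \<le> adj x * b * x"
  using conj_nonneg[of "b - a" x] by (simp add: algebra_simps)

lemma one_nonneg_bop [simp]: "0 \<le> (1 :: 'a::hilbert bop)"
  by (simp add: bop_nonneg_iff)

lemma le_norm_bop: "adj x = x \<Longrightarrow> x \<le> norm x *\<^sub>R 1"
proof (rule bop_leI)
  fix \<xi>
  have "inner \<xi> (ap x \<xi>) \<le> norm \<xi> * norm (ap x \<xi>)" by (rule norm_cauchy_schwarz)
  also have "\<dots> \<le> norm \<xi> * (norm x * norm \<xi>)" by (intro mult_left_mono norm_ap) simp
  also have "\<dots> = inner \<xi> (ap (norm x *\<^sub>R 1) \<xi>)" by (simp add: dot_square_norm power2_eq_square)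
  finally show "inner \<xi> (ap x \<xi>) \<le> inner \<xi> (ap (norm x *\<^sub>R 1) \<xi>)" .
qed simp_all

text \<open>Cauchy--Schwarz for the form of a positive operator, with \<open>\<eta> = a\<xi>\<close>.\<close>

lemma norm_ap_square_le:
  assumes "0 \<le> a" "a \<le> r *\<^sub>R 1"
  shows "(norm (ap a \<xi>))\<^sup>2 \<le> r * inner \<xi> (ap a \<xi>)"
proof -
  have sym: "inner \<xi> (ap a \<eta>) = inner \<eta> (ap a \<xi>)" for \<xi> \<eta>
    by (metis adj_nonneg[OF assms(1)] inner_ap_left inner_commute)
  define A B C where "A = inner \<xi> (ap a \<xi>)" and "B = (norm (ap a \<xi>))\<^sup>2"
    and "C = inner (ap a \<xi>) (ap a (ap a \<xi>))"
  have A0: "0 \<le> A" using assms(1) by (simp add: bop_nonneg_iff A_def)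
  have CB: "C \<le> r * B" using bop_leD[OF assms(2), of "ap a \<xi>"]
    by (simp add: B_def C_def power2_norm_eq_inner)
  have q: "0 \<le> A - 2 * t * B + t\<^sup>2 * C" for t
  proof -
    have "0 \<le> inner (\<xi> - t *\<^sub>R ap a \<xi>) (ap a (\<xi> - t *\<^sub>R ap a \<xi>))"
      using assms(1) by (simp add: bop_nonneg_iff)
    also have "\<dots> = A - 2 * t * B + t\<^sup>2 * C"
      unfolding A_def B_def C_def power2_norm_eq_inner
      by (simp add: inner_simps ap_arg_simps algebra_simps power2_eq_square sym[of \<xi> "ap a \<xi>"])
    finally show ?thesis .
  qed
  have B0: "0 \<le> B" by (simp add: B_def)
  show ?thesis
  proof (cases "B = 0")
    case True
    have "0 \<le> r \<or> \<xi> = 0"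
    proof (rule ccontr)
      assume "\<not> (0 \<le> r \<or> \<xi> = 0)"
      then have "r * inner \<xi> \<xi> < 0" by (simp add: mult_neg_pos)
      moreover have "A \<le> r * inner \<xi> \<xi>" using bop_leD[OF assms(2), of \<xi>] by (simp add: A_def)
      ultimately show False using A0 by simp
    qed
    then show ?thesis using True A0 by (auto simp: A_def[symmetric] B_def[symmetric] ap_arg_simps) (auto simp: A_def)
  next
    case False
    then have Bp: "0 < B" using B0 by simp
    have rp: "0 < r"
    proof (rule ccontr)
      assume "\<not> 0 < r"
      then have "C \<le> 0" using CB Bp mult_nonpos_nonneg[of r B] by simp
      then have "0 \<le> A - 2 * t * B" if "t > 0" for t
        using q[of t] mult_nonneg_nonpos[of "t\<^sup>2" C] by simp
      \<comment> \<open>At this t the right-hand side equals \<open>- A - 2\<close>.\<close>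
      from this[of "(A + 1) / B"] show False using A0 Bp by (simp add: add_nonneg_pos)
    qed
    \<comment> \<open>The value \<open>t = 1 / r\<close> minimises the quadratic once C is bounded
      by \<open>r * B\<close>.\<close>
    have "0 \<le> A - 2 * (1/r) * B + (1/r)\<^sup>2 * (r * B)"
      using q[of "1/r"] mult_left_mono[OF CB, of "(1/r)\<^sup>2"] by simp
    also have "\<dots> = A - B / r" using rp by (simp add: power2_eq_square field_simps)
    finally show ?thesis using rp by (simp add: A_def B_def field_simps)
  qed
qed

lemma norm_le_of_bop_le:
  fixes a :: "'a::hilbert bop"
  assumes "0 \<le> a" "a \<le> r *\<^sub>R 1" "0 \<le> r"
  shows "norm a \<le> r"
proof (rule norm_bop_bound[OF assms(3)])
  fix \<xi>
  have "(norm (ap a \<xi>))\<^sup>2 \<le> r * inner \<xi> (ap a \<xi>)" by (rule norm_ap_square_le[OF assms(1,2)])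
  also have "\<dots> \<le> r * (r * inner \<xi> \<xi>)"
    using bop_leD[OF assms(2), of \<xi>] assms(3) by (intro mult_left_mono) auto
  also have "\<dots> = (r * norm \<xi>)\<^sup>2" by (simp add: power2_eq_square power_mult_distrib dot_square_norm)
  finally show "norm (ap a \<xi>) \<le> r * norm \<xi>"
    by (rule power2_le_imp_le) (simp add: assms(3))
qed

section \<open>Continuous functional calculus\<close>

definition pe :: "real poly \<Rightarrow> 'a::hilbert bop \<Rightarrow> 'a bop"
  where "pe q a = (\<Sum>i\<le>degree q. coeff q i *\<^sub>R a ^ i)"

lemma pe_eq_sum: "degree q \<le> n \<Longrightarrow> pe q a = (\<Sum>i\<le>n. coeff q i *\<^sub>R a ^ i)"
  unfolding pe_def by (rule sum.mono_neutral_left) (auto simp: coeff_eq_0)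

lemma pe_0 [simp]: "pe 0 a = 0"
  by (simp add: pe_def)

lemma pe_pCons [simp]: "pe (pCons c q) a = c *\<^sub>R 1 + a * pe q a"
proof -
  have "pe (pCons c q) a = (\<Sum>i\<le>Suc (degree q). coeff (pCons c q) i *\<^sub>R a ^ i)"
    by (rule pe_eq_sum) (simp add: degree_pCons_le)
  then show ?thesis
    by (simp add: sum.atMost_Suc_shift pe_def sum_distrib_left del: sum.atMost_Suc)
qed

lemma pe_1 [simp]: "pe 1 a = 1"
  by (simp add: one_pCons)

lemma pe_add: "pe (p + q) a = pe p a + pe q a"
  by (induction p q rule: poly_induct2) (auto simp: algebra_simps)

lemma pe_smult: "pe (Polynomial.smult c q) a = c *\<^sub>R pe q a"
  by (induction q) (auto simp: algebra_simps)

lemma pe_diff: "pe (p - q) a = pe p a - pe q a"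
  using pe_add[of p "Polynomial.smult (-1) q" a] pe_smult[of "-1" q a] by simp

lemma pe_sum: "pe (sum f I) a = (\<Sum>i\<in>I. pe (f i) a)"
  by (induction I rule: infinite_finite_induct) (auto simp: pe_add)

lemma pe_commute:
  assumes "a * b = b * a" shows "pe q a * b = b * pe q a"
proof (induction q)
  case (pCons c q)
  have "a * pe q a * b = b * (a * pe q a)"
    by (metis assms mult.assoc pCons.IH)
  then show ?case by (simp add: algebra_simps)
qed simp

lemma pe_mult: "pe (p * q) a = pe p a * pe q a"
  by (induction p) (auto simp: algebra_simps pe_add pe_smult)

lemma pe_power: "pe (p ^ n) a = pe p a ^ n"
  by (induction n) (auto simp: pe_mult)

lemma adj_pe: "adj (pe q a) = pe q (adj a)"
  by (simp add: pe_def adj_sum)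

subsection \<open>Positivity\<close>

text \<open>Roots are not yet available, since the functional calculus is built on this positivity.
  Half of each exponent is split off symmetrically as r, leaving one of 1, a, b and ab with
  \<open>b = 1 - a\<close>. The last is positive because \<open>a + b = 1\<close> gives
  \<open>ab = bab + aba\<close>.\<close>

lemma nonneg_power_mult_power:
  fixes a :: "'a::hilbert bop"
  assumes a: "0 \<le> a" "a \<le> 1"
  shows "0 \<le> a ^ i * (1 - a) ^ j"
proof -
  let ?b = "1 - a"
  have adja: "adj a = a" by (rule adj_nonneg[OF a(1)])
  have com: "a * ?b = ?b * a" by (simp add: algebra_simps)
  then have com': "a ^ i * ?b = ?b * a ^ i" for i
    by (induction i) (simp_all, metis mult.assoc)
  have com2: "a ^ i * ?b ^ j = ?b ^ j * a ^ i" for i j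
    by (induction j) (simp_all, metis com' mult.assoc)
  have "a * ?b = ?b * a * ?b + a * ?b * a" by (simp add: algebra_simps)
  moreover have "0 \<le> adj ?b * a * ?b" "0 \<le> adj a * ?b * a"
    by (rule conj_nonneg; use a in simp)+
  ultimately have ab: "0 \<le> a * ?b" using adja add_nonneg_nonneg[of "?b * a * ?b" "a * ?b * a"] by simp
  define x where "x = a ^ (i mod 2) * ?b ^ (j mod 2)"
  have "i mod 2 = 0 \<or> i mod 2 = 1" "j mod 2 = 0 \<or> j mod 2 = 1" by auto
  then have "0 \<le> x" using a ab by (auto simp: x_def)
  define r where "r = a ^ (i div 2) * ?b ^ (j div 2)"
  have adjr: "adj r = r" by (simp add: r_def adja com2)
  have com3: "?b ^ j * (a ^ i * z) = a ^ i * (?b ^ j * z)" for i j z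
    by (simp only: com2[symmetric] flip: mult.assoc)
  have "i = i div 2 + (i mod 2 + i div 2)" "j = j div 2 + (j mod 2 + j div 2)" by presburger+
  then have "a ^ i * ?b ^ j = a ^ (i div 2 + (i mod 2 + i div 2)) * ?b ^ (j div 2 + (j mod 2 + j div 2))"
    by simp
  also have "\<dots> = r * x * r"
    unfolding r_def x_def power_add mult.assoc com2[symmetric] com3 ..
  finally show ?thesis using conj_nonneg[OF \<open>0 \<le> x\<close>, of r] by (simp add: adjr)
qed

text \<open>The coefficient of \<open>X\<^sup>m\<close> at the \<open>k\<close>-th Bernstein polynomial of degree \<open>n\<close>.\<close>

definition bernstein_coeff :: "nat \<Rightarrow> nat \<Rightarrow> nat \<Rightarrow> real"
  where "bernstein_coeff n m k = (\<Prod>i<m. (real k - real i) / (real n - real i))"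

text \<open>The product is a ratio of falling factorials and cancels against
  \<open>n choose k\<close> to a smaller binomial coefficient; for k < m one of its factors is
  zero.\<close>

lemma bernstein_coeff_choose:
  assumes "m \<le> n" "k \<le> n"
  shows "bernstein_coeff n m k * (n choose k) = (if k < m then 0 else (n - m) choose (k - m))"
  using assms
proof (induction m)
  case 0
  then show ?case by (simp add: bernstein_coeff_def)
next
  case (Suc m)
  have rec: "bernstein_coeff n (Suc m) k = bernstein_coeff n m k * ((real k - real m) / (real n - real m))"
    by (simp add: bernstein_coeff_def)
  show ?case
  proof (cases "k < Suc m")
    case True
    then have "bernstein_coeff n (Suc m) k = 0"
      unfolding bernstein_coeff_def by (intro prod_zero) auto
    then show ?thesis using True by simp
  next
    case False
    then obtain j where k: "k = Suc (m + j)" by (metis Suc_leI less_imp_Suc_add not_less_eq not_less)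
    obtain l where n: "n = Suc (m + l)" using Suc.prems by (metis Suc_le_D add_Suc less_eqE)
    have "real (Suc j) * (Suc l choose Suc j) = real (Suc l) * (l choose j)"
      by (metis Suc_times_binomial of_nat_mult)
    then have h: "real (Suc l choose Suc j) * (real (Suc j) / real (Suc l)) = (l choose j)"
      by (simp add: field_simps)
    have "bernstein_coeff n m k * (n choose k) = (Suc l choose Suc j)"
      using Suc False n k by simp
    then have "bernstein_coeff n (Suc m) k * (n choose k) = (Suc l choose Suc j) * (real (Suc j) / real (Suc l))"
      unfolding rec by (simp add: n k mult.commute mult.left_commute)
    also have "\<dots> = (l choose j)" by (rule h)
    finally show ?thesis using False by (simp add: n k)
  qed
qed

text \<open>Expand \<open>X^m = X^m (X + (1 - X))^(n - m)\<close> by the binomial theorem.\<close>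

lemma monom_eq_bernstein_sum:
  assumes "m \<le> n"
  shows "(\<Sum>k\<le>n. Polynomial.smult (bernstein_coeff n m k * (n choose k)) ([:0, 1:] ^ k * [:1, -1:] ^ (n - k)))
    = [:0, 1:] ^ m"
proof -
  let ?X = "[:0, 1:] :: real poly" and ?Y = "[:1, -1:] :: real poly"
  have "(\<Sum>k\<le>n. Polynomial.smult (bernstein_coeff n m k * (n choose k)) (?X ^ k * ?Y ^ (n - k)))
      = (\<Sum>k=m..n. of_nat ((n - m) choose (k - m)) * (?X ^ k * ?Y ^ (n - k)))"
    by (rule sum.mono_neutral_cong_right)
      (use assms in \<open>auto simp: bernstein_coeff_choose of_nat_poly\<close>)
  also have "\<dots> = (\<Sum>k\<le>n - m. of_nat ((n - m) choose k) * (?X ^ (k + m) * ?Y ^ (n - m - k)))"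
    by (rule sum.reindex_bij_witness[of _ "\<lambda>k. k + m" "\<lambda>k. k - m"]) (use assms in auto)
  also have "\<dots> = ?X ^ m * (\<Sum>k\<le>n - m. of_nat ((n - m) choose k) * ?X ^ k * ?Y ^ (n - m - k))"
    by (simp add: sum_distrib_left power_add ac_simps)
  also have "\<dots> = ?X ^ m * (?X + ?Y) ^ (n - m)" by (simp only: binomial_ring)
  also have "?X + ?Y = 1" by (simp add: one_pCons)
  finally show ?thesis by simp
qed

text \<open>Products of m factors of absolute value at most 1 differ by at most the sum of the
  differences of their factors, and each of these is at most m / (n - m).\<close>

lemma bernstein_coeff_approx:
  assumes "2 * m < n" "k \<le> n"
  shows "\<bar>(real k / real n) ^ m - bernstein_coeff n m k\<bar> \<le> real (m * m) / real (n - m)"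
proof -
  have diff: "real k / real n - (real k - real i) / (real n - real i) = real i * (real n - real k) / (real n * (real n - real i))"
    if "i < m" for i
    using that assms by (simp add: field_simps)
  have "norm ((\<Prod>i<m. real k / real n) - (\<Prod>i<m. (real k - real i) / (real n - real i)))
      \<le> (\<Sum>i<m. norm (real k / real n - (real k - real i) / (real n - real i)))"
  proof (rule norm_prod_diff)
    fix i assume "i \<in> {..<m}"
    then have i: "i < m" by simp
    show "norm (real k / real n) \<le> 1" using assms by (simp add: divide_le_eq)
    \<comment> \<open>For k < i the factor is negative; \<open>2 * m < n\<close> still keeps i - k
      below n - i.\<close>
    have "\<bar>real k - real i\<bar> \<le> real n - real i" using i assms by linarith
    then show "norm ((real k - real i) / (real n - real i)) \<le> 1"
      using i assms by (simp add: divide_le_eq)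
  qed
  also have "\<dots> \<le> (\<Sum>i<m. real m / real (n - m))"
  proof (rule sum_mono)
    fix i assume "i \<in> {..<m}"
    then have i: "i < m" by simp
    have "real i * (real n - real k) / (real n * (real n - real i)) \<le> real m * real n / (real n * real (n - m))"
      using i assms by (intro frac_le mult_mono mult_pos_pos) (auto simp: of_nat_diff)
    moreover have "0 \<le> real i * (real n - real k) / (real n * (real n - real i))"
      using i assms by (intro divide_nonneg_nonneg mult_nonneg_nonneg) auto
    ultimately show "norm (real k / real n - (real k - real i) / (real n - real i)) \<le> real m / real (n - m)"
      using assms by (simp only: diff[OF i] real_norm_def abs_of_nonneg) (simp add: of_nat_diff)
  qed
  finally show ?thesis by (simp add: bernstein_coeff_def)
qed

lemma bop_nonneg_of_eps:
  fixes x :: "'a::hilbert bop"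
  assumes "\<And>\<epsilon>. \<epsilon> > 0 \<Longrightarrow> - (\<epsilon> *\<^sub>R 1) \<le> x" "adj x = x"
  shows "0 \<le> x"
  unfolding bop_nonneg_iff
proof (intro conjI allI)
  fix \<xi>
  have "0 \<le> inner \<xi> (ap x \<xi>) + \<epsilon>" if "\<epsilon> > 0" for \<epsilon>
  proof -
    define \<delta> where "\<delta> = \<epsilon> / (inner \<xi> \<xi> + 1)"
    have p: "inner \<xi> \<xi> + 1 > 0" by (simp add: add_nonneg_pos)
    then have "\<delta> > 0" using that by (simp add: \<delta>_def)
    from bop_leD[OF assms(1)[OF this], of \<xi>] have "0 \<le> inner \<xi> (ap x \<xi>) + \<delta> * inner \<xi> \<xi>" by simp
    also have "\<delta> * inner \<xi> \<xi> \<le> \<epsilon>" using p that by (simp add: \<delta>_def field_simps)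
    finally show ?thesis by simp
  qed
  then show "0 \<le> inner \<xi> (ap x \<xi>)" by (rule field_le_epsilon)
qed fact

text \<open>The coefficients \<open>c k\<close> of q in the Bernstein basis of degree n approach the
  nonnegative values q(k / n) uniformly in k, while the operators \<open>B k\<close> are positive
  with sum 1. Positivity on the interval thus passes to operators without spectral theory.\<close>

lemma pe_nonneg_unit:
  assumes a: "0 \<le> a" "a \<le> 1" and q: "\<And>t. 0 \<le> t \<Longrightarrow> t \<le> 1 \<Longrightarrow> 0 \<le> poly q t"
  shows "0 \<le> pe q a"
proof (rule bop_nonneg_of_eps)
  show "adj (pe q a) = pe q a" by (simp add: adj_pe adj_nonneg a)
  fix \<epsilon> :: real assume eps: "\<epsilon> > 0"
  define d where "d = degree q"
  define C where "C = (\<Sum>m\<le>d. \<bar>coeff q m\<bar> * real (m * m))"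
  have C0: "C \<ge> 0" unfolding C_def by (intro sum_nonneg) auto
  obtain N where N: "C / \<epsilon> < real N" using reals_Archimedean2 by blast
  \<comment> \<open>The summand \<open>2 * d + 1\<close> meets the hypothesis of
    \<open>bernstein_coeff_approx\<close>; N brings C / (n - d) below \<epsilon>.\<close>
  define n where "n = N + 2 * d + 1"
  define c where "c k = (\<Sum>m\<le>d. coeff q m * bernstein_coeff n m k)" for k
  define B where "B k = real (n choose k) *\<^sub>R (a ^ k * (1 - a) ^ (n - k))" for k
  have B0: "0 \<le> B k" for k unfolding B_def by (intro scaleR_nonneg_nonneg nonneg_power_mult_power a) simp
  have mon: "a ^ m = (\<Sum>k\<le>n. bernstein_coeff n m k *\<^sub>R B k)" if "m \<le> d" for m
  proof -
    have "m \<le> n" using that by (simp add: n_def)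
    from arg_cong[OF monom_eq_bernstein_sum[OF this], of "\<lambda>p. pe p a"] show ?thesis
      by (simp add: pe_sum pe_smult pe_mult pe_power B_def)
  qed
  have qa: "pe q a = (\<Sum>k\<le>n. c k *\<^sub>R B k)"
    unfolding pe_def d_def[symmetric] c_def
    by (simp add: mon scaleR_sum_right scaleR_sum_left) (rule sum.swap)
  have one: "(\<Sum>k\<le>n. B k) = 1"
    using mon[of 0] by (simp add: bernstein_coeff_def)
  have c: "- \<epsilon> \<le> c k" if "k \<le> n" for k
  proof -
    have n0: "0 < n" by (simp add: n_def)
    have "poly q (real k / real n) - c k = (\<Sum>m\<le>d. coeff q m * ((real k / real n) ^ m - bernstein_coeff n m k))"
      by (simp add: poly_altdef c_def d_def algebra_simps sum_subtractf)
    also have "\<dots> \<le> (\<Sum>m\<le>d. \<bar>coeff q m\<bar> * (real (m * m) / real (n - d)))"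
    proof (rule sum_mono)
      fix m assume "m \<in> {..d}"
      then have m: "m \<le> d" by simp
      have "\<bar>(real k / real n) ^ m - bernstein_coeff n m k\<bar> \<le> real (m * m) / real (n - m)"
        by (rule bernstein_coeff_approx) (use that m in \<open>auto simp: n_def\<close>)
      also have "\<dots> \<le> real (m * m) / real (n - d)"
        using m by (intro divide_left_mono mult_pos_pos) (auto simp: n_def)
      finally have "\<bar>coeff q m\<bar> * \<bar>(real k / real n) ^ m - bernstein_coeff n m k\<bar>
          \<le> \<bar>coeff q m\<bar> * (real (m * m) / real (n - d))" by (rule mult_left_mono) simp
      then show "coeff q m * ((real k / real n) ^ m - bernstein_coeff n m k)
          \<le> \<bar>coeff q m\<bar> * (real (m * m) / real (n - d))" by (metis abs_le_D1 abs_mult)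
    qed
    also have "\<dots> = C / real (n - d)" by (simp add: C_def sum_divide_distrib)
    also have "\<dots> \<le> \<epsilon>"
    proof -
      have "C \<le> \<epsilon> * real N" using N eps by (simp add: field_simps)
      also have "\<dots> \<le> \<epsilon> * real (n - d)" using eps by (simp add: n_def)
      finally show ?thesis by (simp add: divide_le_eq n_def)
    qed
    finally have "poly q (real k / real n) - c k \<le> \<epsilon>" .
    moreover have "0 \<le> poly q (real k / real n)" by (rule q) (use that n0 in auto)
    ultimately show ?thesis by simp
  qed
  have "- (\<epsilon> *\<^sub>R 1) = (\<Sum>k\<le>n. (- \<epsilon>) *\<^sub>R B k)" unfolding scaleR_sum_right[symmetric] one by simp
  also have "\<dots> \<le> pe q a" unfolding qa by (intro sum_mono scaleR_right_mono c B0) auto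
  finally show "- (\<epsilon> *\<^sub>R 1) \<le> pe q a" .
qed

lemma pe_pcompose_scale: "pe (pcompose q [:0, r:]) a = pe q (r *\<^sub>R a)"
  by (induction q) (auto simp: pcompose_pCons pe_add pe_mult pe_smult)

lemma pe_nonneg:
  assumes a: "0 \<le> a" "a \<le> K *\<^sub>R 1" and q: "\<And>t. 0 \<le> t \<Longrightarrow> t \<le> K \<Longrightarrow> 0 \<le> poly q t"
    and K: "0 < K"
  shows "0 \<le> pe q a"
proof -
  have "(1 / K) *\<^sub>R a \<le> (1 / K) *\<^sub>R (K *\<^sub>R 1)" using a(2) K by (intro scaleR_left_mono) auto
  moreover have "0 \<le> (1 / K) *\<^sub>R a" using a(1) K by (intro scaleR_nonneg_nonneg) auto
  ultimately have "0 \<le> pe (pcompose q [:0, K:]) ((1 / K) *\<^sub>R a)"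
    using K by (intro pe_nonneg_unit) (auto simp: poly_pcompose intro!: q)
  then show ?thesis using K by (simp add: pe_pcompose_scale)
qed

text \<open>Positivity of \<open>c^2 - q^2\<close> at a bounds \<open>adj (pe q a) * pe q a\<close>,
  and the C*-identity takes the root.\<close>

lemma pe_norm_bound:
  assumes a: "0 \<le> a" "norm a \<le> K" and q: "\<And>t. 0 \<le> t \<Longrightarrow> t \<le> K \<Longrightarrow> \<bar>poly q t\<bar> \<le> c" and K: "0 < K"
  shows "norm (pe q a) \<le> c"
proof -
  have c0: "0 \<le> c" using q[of 0] K by simp
  have aK: "a \<le> K *\<^sub>R 1"
    using le_norm_bop[OF adj_nonneg[OF a(1)]] scaleR_right_mono[OF a(2) one_nonneg_bop] by (rule order_trans)
  have "0 \<le> pe (Polynomial.smult (c\<^sup>2) 1 - q * q) a"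
  proof (rule pe_nonneg[OF a(1) aK _ K])
    fix t assume "0 \<le> t" "t \<le> K"
    then have "\<bar>poly q t\<bar>\<^sup>2 \<le> c\<^sup>2" by (intro power_mono q) auto
    then show "0 \<le> poly (Polynomial.smult (c\<^sup>2) 1 - q * q) t" by (simp add: power2_eq_square)
  qed
  moreover have adj: "adj (pe q a) = pe q a" by (simp add: adj_pe adj_nonneg a)
  ultimately have "adj (pe q a) * pe q a \<le> (c\<^sup>2) *\<^sub>R 1" by (simp add: pe_diff pe_smult pe_mult)
  then have "norm (adj (pe q a) * pe q a) \<le> c\<^sup>2" by (intro norm_le_of_bop_le) auto
  then have "(norm (pe q a))\<^sup>2 \<le> c\<^sup>2" by (simp only: norm_adj_mult_self)
  then show ?thesis using c0 by (rule power2_le_imp_le)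
qed

subsection \<open>Continuous functions\<close>

text \<open>Continuity on the whole half-line is a condition independent of the operator, so one f
  serves for a, its multiples and functions of it.\<close>

abbreviation cont0 :: "(real \<Rightarrow> real) \<Rightarrow> bool"
  where "cont0 \<equiv> continuous_on {0..}"

lemma cont0_on: "cont0 f \<Longrightarrow> continuous_on {0..K} f"
  by (rule continuous_on_subset) auto

lemma ex_poly_uniform_limit:
  assumes "continuous_on {0..K} f"
  obtains q :: "nat \<Rightarrow> real poly" where "uniform_limit {0..K} (\<lambda>n. poly (q n)) f sequentially"
proof -
  have "\<exists>q. \<forall>x\<in>{0..K}. \<bar>f x - poly q x\<bar> < 1 / Suc n" for n
  proof -
    obtain g where g: "real_polynomial_function g" "\<And>x. x \<in> {0..K} \<Longrightarrow> \<bar>f x - g x\<bar> < 1 / Suc n"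
      using Stone_Weierstrass_real_polynomial_function[OF compact_Icc assms, of "1 / Suc n"] by auto
    then obtain c m where "g = (\<lambda>x. \<Sum>i\<le>m. c i * x ^ i)" by (auto simp: real_polynomial_function_iff_sum)
    then have "g = poly (\<Sum>i\<le>m. monom (c i) i)" by (auto simp: poly_sum poly_monom)
    with g show ?thesis by blast
  qed
  then obtain q where q: "\<And>n x. x \<in> {0..K} \<Longrightarrow> \<bar>f x - poly (q n) x\<bar> < 1 / Suc n" by metis
  have "uniform_limit {0..K} (\<lambda>n. poly (q n)) f sequentially"
  proof (rule uniform_limitI)
    fix e :: real assume "e > 0"
    with LIMSEQ_Suc[OF lim_1_over_n] have "\<forall>\<^sub>F n in sequentially. 1 / real (Suc n) < e"
      by (rule order_tendstoD)
    then show "\<forall>\<^sub>F n in sequentially. \<forall>x\<in>{0..K}. dist (poly (q n) x) (f x) < e"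
    proof eventually_elim
      case (elim n)
      show ?case
      proof
        fix x assume "x \<in> {0..K}"
        from q[OF this, of n] elim show "dist (poly (q n) x) (f x) < e"
          by (simp add: dist_real_def abs_minus_commute)
      qed
    qed
  qed
  then show thesis by (rule that)
qed

text \<open>Quantifying over all approximating sequences copies the form of \<open>op_fun\<close>,
  with which it is identified later; \<open>fc_eqI'\<close> shows that the limit exists and does not
  depend on the sequence.\<close>

definition fc :: "(real \<Rightarrow> real) \<Rightarrow> 'a::hilbert bop \<Rightarrow> 'a bop"
  where "fc f a = (THE b. \<forall>q. uniform_limit {0..norm a} (\<lambda>n. poly (q n)) f sequentially \<longrightarrow>
    (\<lambda>n. pe (q n) a) \<longlonglongrightarrow> b)"

lemma pe_uniform_limit_unique:
  assumes a: "0 \<le> a" and q: "uniform_limit {0..norm a} (\<lambda>n. poly (q n)) f sequentially"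
    and q': "uniform_limit {0..norm a} (\<lambda>n. poly (q' n)) f sequentially"
  shows "(\<lambda>n. pe (q n) a - pe (q' n) a) \<longlonglongrightarrow> 0"
proof (cases "norm a = 0")
  \<comment> \<open>\<open>pe_norm_bound\<close> asks for an interval of positive length, so a = 0
    is settled through the constant coefficients.\<close>
  case True
  have "(\<lambda>n. poly (q n) 0 - poly (q' n) 0) \<longlonglongrightarrow> f 0 - f 0"
    using q q' True by (intro tendsto_diff tendsto_uniform_limitI[where x = 0 and S = "{0..norm a}"]) auto
  then have "(\<lambda>n. (poly (q n) 0 - poly (q' n) 0) *\<^sub>R (1 :: 'a bop)) \<longlonglongrightarrow> 0 *\<^sub>R 1"
    by (intro tendsto_scaleR) auto
  moreover have "pe p 0 = poly p 0 *\<^sub>R (1 :: 'a bop)" for p by (induction p) auto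
  ultimately show ?thesis using True by (simp add: scaleR_diff_left)
next
  case False
  then have K: "0 < norm a" by simp
  have u: "uniform_limit {0..norm a} (\<lambda>n t. poly (q n) t - poly (q' n) t) (\<lambda>t. f t - f t) sequentially"
    by (intro uniform_limit_intros q q')
  show ?thesis
  proof (rule metric_LIMSEQ_I)
    fix e :: real assume e: "e > 0"
    then have "\<forall>\<^sub>F n in sequentially. \<forall>t\<in>{0..norm a}. dist (poly (q n) t - poly (q' n) t) (f t - f t) < e / 2"
      by (intro uniform_limitD[OF u]) simp
    then obtain N where N: "\<And>n t. n \<ge> N \<Longrightarrow> t \<in> {0..norm a} \<Longrightarrow> \<bar>poly (q n) t - poly (q' n) t\<bar> < e / 2"
      unfolding eventually_sequentially dist_real_def by (simp del: atLeastAtMost_iff) blast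
    have "dist (pe (q n) a - pe (q' n) a) 0 < e" if "n \<ge> N" for n
    proof -
      have "norm (pe (q n - q' n) a) \<le> e / 2"
        by (rule pe_norm_bound[OF a order_refl _ K]) (use N that in force)
      then show ?thesis using e by (simp add: pe_diff dist_norm)
    qed
    then show "\<exists>N. \<forall>n\<ge>N. dist (pe (q n) a - pe (q' n) a) 0 < e" by blast
  qed
qed

lemma uniform_limit_reindex:
  assumes "uniform_limit S f l F" "filterlim r F G"
  shows "uniform_limit S (\<lambda>n. f (r n)) l G"
proof (rule uniform_limitI)
  fix e :: real assume "e > 0"
  from uniform_limitD[OF assms(1) this] show "\<forall>\<^sub>F n in G. \<forall>x\<in>S. dist (f (r n) x) (l x) < e"
    using assms(2) by (auto simp: filterlim_iff)
qed

text \<open>If it were not Cauchy, two reindexings of the sequence would stay apart; but both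
  converge uniformly to f, and then \<open>pe_uniform_limit_unique\<close> brings them
  together.\<close>

lemma pe_uniform_limit_Cauchy:
  assumes a: "0 \<le> a" and q: "uniform_limit {0..norm a} (\<lambda>n. poly (q n)) f sequentially"
  shows "Cauchy (\<lambda>n. pe (q n) a)"
proof (rule ccontr)
  assume "\<not> Cauchy (\<lambda>n. pe (q n) a)"
  then obtain e where e: "e > 0" and
    "\<And>M. \<exists>m\<ge>M. \<exists>n\<ge>M. \<not> dist (pe (q m) a) (pe (q n) a) < e" unfolding Cauchy_def by blast
  then obtain r s where rs: "\<And>M. r M \<ge> M" "\<And>M. s M \<ge> M" "\<And>M. \<not> dist (pe (q (r M)) a) (pe (q (s M)) a) < e"
    by metis
  have "filterlim r sequentially sequentially" "filterlim s sequentially sequentially"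
    using rs(1,2) by (auto intro: filterlim_at_top_mono[OF filterlim_ident])
  from pe_uniform_limit_unique[OF a uniform_limit_reindex[OF q this(1)] uniform_limit_reindex[OF q this(2)]]
  have "(\<lambda>n. pe (q (r n)) a - pe (q (s n)) a) \<longlonglongrightarrow> 0" .
  then show False using e rs(3) by (auto simp: LIMSEQ_def dist_norm)
qed

lemma fc_eqI':
  assumes a: "0 \<le> a" and f: "continuous_on {0..norm a} f"
  shows "\<exists>!b. \<forall>q. uniform_limit {0..norm a} (\<lambda>n. poly (q n)) f sequentially \<longrightarrow>
    (\<lambda>n. pe (q n) a) \<longlonglongrightarrow> b"
proof -
  obtain q where q: "uniform_limit {0..norm a} (\<lambda>n. poly (q n)) f sequentially"
    using ex_poly_uniform_limit[OF f] .
  have "convergent (\<lambda>n. pe (q n) a)" by (rule Cauchy_convergent[OF pe_uniform_limit_Cauchy[OF a q]])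
  then obtain b where b: "(\<lambda>n. pe (q n) a) \<longlonglongrightarrow> b" unfolding convergent_def ..
  have "(\<lambda>n. pe (q' n) a) \<longlonglongrightarrow> b"
    if "uniform_limit {0..norm a} (\<lambda>n. poly (q' n)) f sequentially" for q'
    using tendsto_diff[OF b pe_uniform_limit_unique[OF a q that]] by simp
  then show ?thesis using q LIMSEQ_unique by metis
qed

lemma fc_tendsto:
  assumes "0 \<le> a" "cont0 f" "norm a \<le> K" "uniform_limit {0..K} (\<lambda>n. poly (q n)) f sequentially"
  shows "(\<lambda>n. pe (q n) a) \<longlonglongrightarrow> fc f a"
  using theI'[OF fc_eqI'[OF assms(1) cont0_on[OF assms(2)]], folded fc_def]
    uniform_limit_on_subset[OF assms(4)] assms(3) by auto

lemma fc_eqI: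
  assumes "0 \<le> a" "cont0 f" "uniform_limit {0..norm a} (\<lambda>n. poly (q n)) f sequentially"
    "(\<lambda>n. pe (q n) a) \<longlonglongrightarrow> b"
  shows "fc f a = b"
  using fc_tendsto[OF assms(1,2) order_refl assms(3)] assms(4) by (rule LIMSEQ_unique)

lemma fc_poly: "0 \<le> a \<Longrightarrow> fc (poly q) a = pe q a"
  by (rule fc_eqI[where q = "\<lambda>_. q"]) (auto intro!: continuous_intros uniform_limit_const)

lemma fc_id: "0 \<le> a \<Longrightarrow> fc (\<lambda>t. t) a = a"
  using fc_poly[of a "[:0, 1:]"] by (simp add: poly_pCons[abs_def])

lemma fc_const: "0 \<le> a \<Longrightarrow> fc (\<lambda>t. c) a = c *\<^sub>R 1"
  using fc_poly[of a "[:c:]"] by (simp add: poly_pCons[abs_def])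

lemma fc_cong:
  assumes "0 \<le> a" "\<And>t. 0 \<le> t \<Longrightarrow> t \<le> norm a \<Longrightarrow> f t = g t"
  shows "fc f a = fc g a"
proof -
  have "uniform_limit {0..norm a} (\<lambda>n. poly (q n)) f sequentially \<longleftrightarrow>
      uniform_limit {0..norm a} (\<lambda>n. poly (q n)) g sequentially" for q
    by (rule uniform_limit_cong') (use assms in auto)
  then show ?thesis by (simp add: fc_def)
qed

lemma uniform_limit_poly_comb:
  fixes f g :: "real \<Rightarrow> real"
  assumes "uniform_limit {0..K} (\<lambda>n. poly (p n)) f sequentially" "uniform_limit {0..K} (\<lambda>n. poly (q n)) g sequentially"
  shows "uniform_limit {0..K} (\<lambda>n. poly (p n + q n)) (\<lambda>t. f t + g t) sequentially"
    "uniform_limit {0..K} (\<lambda>n. poly (Polynomial.smult c (p n))) (\<lambda>t. c * f t) sequentially"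
proof -
  show "uniform_limit {0..K} (\<lambda>n. poly (p n + q n)) (\<lambda>t. f t + g t) sequentially"
    using uniform_limit_add[where X = "{0..K}" and f = "\<lambda>n. poly (p n)" and g = "\<lambda>n. poly (q n)"] assms
    by (simp add: poly_add[abs_def])
  have "(\<lambda>n. poly (Polynomial.smult c (p n))) = (\<lambda>n t. c * poly (p n) t)" by (simp add: fun_eq_iff)
  then show "uniform_limit {0..K} (\<lambda>n. poly (Polynomial.smult c (p n))) (\<lambda>t. c * f t) sequentially"
    using bounded_linear.uniform_limit[OF bounded_linear_mult_right assms(1)] by simp
qed

lemma fc_add:
  assumes "0 \<le> a" "cont0 f" "cont0 g"
  shows "fc (\<lambda>t. f t + g t) a = fc f a + fc g a"
proof -
  obtain p where p: "uniform_limit {0..norm a} (\<lambda>n. poly (p n)) f sequentially"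
    using ex_poly_uniform_limit[OF cont0_on[OF assms(2)]] .
  obtain q where q: "uniform_limit {0..norm a} (\<lambda>n. poly (q n)) g sequentially"
    using ex_poly_uniform_limit[OF cont0_on[OF assms(3)]] .
  show ?thesis
    using uniform_limit_poly_comb(1)[OF p q]
      tendsto_add[OF fc_tendsto[OF assms(1,2) order_refl p] fc_tendsto[OF assms(1,3) order_refl q]]
    by (intro fc_eqI) (auto simp: pe_add assms intro!: continuous_intros)
qed

lemma fc_scale:
  assumes "0 \<le> a" "cont0 f"
  shows "fc (\<lambda>t. c * f t) a = c *\<^sub>R fc f a"
proof -
  obtain p where p: "uniform_limit {0..norm a} (\<lambda>n. poly (p n)) f sequentially"
    using ex_poly_uniform_limit[OF cont0_on[OF assms(2)]] .
  show ?thesis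
    using uniform_limit_poly_comb(2)[OF p p]
      tendsto_scaleR[OF tendsto_const[of c] fc_tendsto[OF assms(1,2) order_refl p]]
    by (intro fc_eqI[where q = "\<lambda>n. Polynomial.smult c (p n)"])
      (auto simp: pe_smult assms intro!: continuous_intros)
qed

lemma fc_diff:
  assumes "0 \<le> a" "cont0 f" "cont0 g"
  shows "fc (\<lambda>t. f t - g t) a = fc f a - fc g a"
proof -
  have "cont0 (\<lambda>t. - 1 * g t)" using assms by (intro continuous_intros)
  then show ?thesis
    using fc_add[OF assms(1,2), of "\<lambda>t. - 1 * g t"] fc_scale[OF assms(1,3), of "-1"] by simp
qed

lemma fc_mult:
  assumes "0 \<le> a" "cont0 f" "cont0 g"
  shows "fc (\<lambda>t. f t * g t) a = fc f a * fc g a"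
proof -
  obtain p where p: "uniform_limit {0..norm a} (\<lambda>n. poly (p n)) f sequentially"
    using ex_poly_uniform_limit[OF cont0_on[OF assms(2)]] .
  obtain q where q: "uniform_limit {0..norm a} (\<lambda>n. poly (q n)) g sequentially"
    using ex_poly_uniform_limit[OF cont0_on[OF assms(3)]] .
  have bd: "bounded (h ` {0..norm a})" if "cont0 h" for h
    by (intro compact_imp_bounded compact_continuous_image cont0_on[OF that] compact_Icc)
  have "(\<lambda>n. poly (p n * q n)) = (\<lambda>n t. poly (p n) t * poly (q n) t)" by (simp add: fun_eq_iff)
  then have "uniform_limit {0..norm a} (\<lambda>n. poly (p n * q n)) (\<lambda>t. f t * g t) sequentially"
    using uniform_lim_mult[OF p q bd bd] assms by simp
  then show ?thesis
    using tendsto_mult[OF fc_tendsto[OF assms(1,2) order_refl p] fc_tendsto[OF assms(1,3) order_refl q]]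
    by (intro fc_eqI) (auto simp: pe_mult assms intro!: continuous_intros)
qed

lemma adj_fc:
  assumes "0 \<le> a" "cont0 f"
  shows "adj (fc f a) = fc f a"
proof -
  obtain p where p: "uniform_limit {0..norm a} (\<lambda>n. poly (p n)) f sequentially"
    using ex_poly_uniform_limit[OF cont0_on[OF assms(2)]] .
  have "(\<lambda>n. adj (pe (p n) a)) \<longlonglongrightarrow> adj (fc f a)"
    by (intro tendsto_adj fc_tendsto[OF assms order_refl p])
  then show ?thesis
    using fc_tendsto[OF assms order_refl p] LIMSEQ_unique by (auto simp: adj_pe adj_nonneg[OF assms(1)])
qed

lemma fc_commute:
  assumes "0 \<le> a" "cont0 f" "a * b = b * a"
  shows "fc f a * b = b * fc f a"
proof -
  obtain p where p: "uniform_limit {0..norm a} (\<lambda>n. poly (p n)) f sequentially"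
    using ex_poly_uniform_limit[OF cont0_on[OF assms(2)]] .
  note l = fc_tendsto[OF assms(1,2) order_refl p]
  show ?thesis
    using tendsto_mult[OF l tendsto_const[of b]] tendsto_mult[OF tendsto_const[of b] l]
    by (auto simp: pe_commute[OF assms(3)] intro: LIMSEQ_unique)
qed

lemma fc_norm_bound:
  assumes "0 \<le> a" "cont0 f" "\<And>t. 0 \<le> t \<Longrightarrow> t \<le> norm a \<Longrightarrow> \<bar>f t\<bar> \<le> c"
  shows "norm (fc f a) \<le> c"
proof (cases "norm a = 0")
  case True
  then have "fc f a = f 0 *\<^sub>R 1" using fc_cong[OF assms(1), of f "\<lambda>_. f 0"] fc_const[OF assms(1)] by auto
  moreover have "\<bar>f 0\<bar> * norm (1 :: 'a bop) \<le> c * 1"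
    using assms(3)[of 0] True norm_bop_one by (intro mult_mono) auto
  ultimately show ?thesis by simp
next
  case False
  obtain p where p: "uniform_limit {0..norm a} (\<lambda>n. poly (p n)) f sequentially"
    using ex_poly_uniform_limit[OF cont0_on[OF assms(2)]] .
  have "norm (fc f a) \<le> c + e" if "e > 0" for e
  proof (rule tendsto_upperbound)
    show "(\<lambda>n. norm (pe (p n) a)) \<longlonglongrightarrow> norm (fc f a)"
      by (intro tendsto_norm fc_tendsto[OF assms(1,2) order_refl p])
    from uniform_limitD[OF p that]
    show "\<forall>\<^sub>F n in sequentially. norm (pe (p n) a) \<le> c + e"
    proof eventually_elim
      case (elim n)
      show ?case
      proof (rule pe_norm_bound[OF assms(1) order_refl])
        fix t assume t: "0 \<le> t" "t \<le> norm a"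
        then show "\<bar>poly (p n) t\<bar> \<le> c + e"
          using bspec[OF elim, of t] assms(3)[OF t] by (auto simp: dist_real_def)
      qed (use False in simp)
    qed
  qed simp
  then show ?thesis by (rule field_le_epsilon)
qed

text \<open>On the relevant interval f is the square of \<open>sqrt \<bar>f\<bar>\<close>, which is
  continuous everywhere, so f(a) has the form \<open>adj y * y\<close>.\<close>

lemma fc_nonneg:
  assumes "0 \<le> a" "cont0 f" "\<And>t. 0 \<le> t \<Longrightarrow> t \<le> norm a \<Longrightarrow> 0 \<le> f t"
  shows "0 \<le> fc f a"
proof -
  define g where "g t = sqrt \<bar>f t\<bar>" for t
  have g: "cont0 g" unfolding g_def by (intro continuous_intros assms)
  have "fc f a = fc (\<lambda>t. g t * g t) a"
    by (rule fc_cong[OF assms(1)]) (use assms(3) in \<open>auto simp: g_def\<close>)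
  also have "\<dots> = adj (fc g a) * fc g a" by (simp add: fc_mult adj_fc assms g)
  finally show ?thesis by simp
qed

lemma fc_mono:
  assumes "0 \<le> a" "cont0 f" "cont0 g" "\<And>t. 0 \<le> t \<Longrightarrow> t \<le> norm a \<Longrightarrow> f t \<le> g t"
  shows "fc f a \<le> fc g a"
proof -
  have "0 \<le> fc (\<lambda>t. g t - f t) a" by (rule fc_nonneg) (use assms in \<open>auto intro!: continuous_intros\<close>)
  then show ?thesis by (simp add: fc_diff assms)
qed

lemma fc_uniform_limit:
  assumes "0 \<le> a" "\<And>n. cont0 (f n)" "cont0 g" "uniform_limit {0..norm a} f g sequentially"
  shows "(\<lambda>n. fc (f n) a) \<longlonglongrightarrow> fc g a"
proof (rule metric_LIMSEQ_I)
  fix e :: real assume e: "e > 0"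
  then obtain N where N: "\<And>n t. n \<ge> N \<Longrightarrow> t \<in> {0..norm a} \<Longrightarrow> \<bar>f n t - g t\<bar> < e / 2"
    using uniform_limitD[OF assms(4), of "e/2"] unfolding eventually_sequentially dist_real_def
    by (simp del: atLeastAtMost_iff) blast
  have "dist (fc (f n) a) (fc g a) < e" if "n \<ge> N" for n
  proof -
    have "norm (fc (\<lambda>t. f n t - g t) a) \<le> e / 2"
      using N[OF that] by (intro fc_norm_bound) (auto intro!: continuous_intros assms less_imp_le)
    then show ?thesis using e by (simp add: fc_diff assms dist_norm)
  qed
  then show "\<exists>N. \<forall>n\<ge>N. dist (fc (f n) a) (fc g a) < e" by blast
qed

lemma pe_fc:
  assumes "0 \<le> a" "cont0 g"
  shows "pe q (fc g a) = fc (\<lambda>t. poly q (g t)) a"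
proof (induction q)
  case (pCons c q)
  have "fc (\<lambda>t. c + g t * poly q (g t)) a = fc (\<lambda>t. c) a + fc g a * fc (\<lambda>t. poly q (g t)) a"
    by (subst fc_add, simp_all add: assms continuous_on_const continuous_on_mult continuous_on_poly)
      (rule fc_mult; intro assms continuous_intros)
  then show ?case by (simp add: pCons fc_const assms)
qed (simp add: fc_const assms)

lemma fc_compose:
  assumes "0 \<le> a" "cont0 g" "cont0 f" "\<And>t. 0 \<le> t \<Longrightarrow> 0 \<le> g t"
  shows "fc f (fc g a) = fc (\<lambda>t. f (g t)) a"
proof -
  have fg: "cont0 (\<lambda>t. f (g t))"
    by (rule continuous_on_compose2[OF assms(3,2)]) (use assms(4) in auto)
  have "bounded (g ` {0..norm a})"
    by (intro compact_imp_bounded compact_continuous_image cont0_on[OF assms(2)] compact_Icc)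
  then obtain L where L: "\<And>t. t \<in> {0..norm a} \<Longrightarrow> g t \<le> L"
    by (auto simp: bounded_iff) (metis abs_le_D1 atLeastAtMost_iff)
  \<comment> \<open>One polynomial approximation of f must serve both the values of g and the
    operator g(a).\<close>
  define K where "K = max L (norm (fc g a))"
  obtain p where p: "uniform_limit {0..K} (\<lambda>n. poly (p n)) f sequentially"
    using ex_poly_uniform_limit[OF cont0_on[OF assms(3)]] .
  have g0: "0 \<le> fc g a" by (rule fc_nonneg) (use assms in auto)
  have "(\<lambda>n. pe (p n) (fc g a)) \<longlonglongrightarrow> fc f (fc g a)"
    by (rule fc_tendsto[OF g0 assms(3) _ p]) (simp add: K_def)
  moreover have "(\<lambda>n. fc (\<lambda>t. poly (p n) (g t)) a) \<longlonglongrightarrow> fc (\<lambda>t. f (g t)) a"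
    by (intro fc_uniform_limit uniform_limit_compose'[OF p] assms fg continuous_intros)
      (use L assms(4) in \<open>auto simp: K_def le_max_iff_disj\<close>)
  ultimately show ?thesis by (simp add: pe_fc assms) (metis LIMSEQ_unique)
qed

lemma fc_scaleR:
  assumes "0 \<le> a" "0 \<le> k" "cont0 f"
  shows "fc f (k *\<^sub>R a) = fc (\<lambda>t. f (k * t)) a"
proof -
  have "cont0 (\<lambda>t. k * t)" by (intro continuous_intros)
  moreover have "fc (\<lambda>t. k * t) a = k *\<^sub>R a" by (simp add: fc_scale fc_id assms)
  ultimately show ?thesis using fc_compose[OF assms(1), of "\<lambda>t. k * t" f] assms by simp
qed

lemma fc_conj_unitary:
  assumes a: "0 \<le> a" and f: "cont0 f" and u: "u * adj u = 1" "adj u * u = 1"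
  shows "fc f (adj u * a * u) = adj u * fc f a * u"
proof -
  define K where "K = max (norm a) (norm (adj u * a * u))"
  obtain p where p: "uniform_limit {0..K} (\<lambda>n. poly (p n)) f sequentially"
    using ex_poly_uniform_limit[OF cont0_on[OF f]] .
  have pe: "pe q (adj u * a * u) = adj u * pe q a * u" for q
  proof (induction q)
    case (pCons c q)
    have "adj u * a * u * (adj u * pe q a * u) = adj u * a * (u * adj u) * pe q a * u" by (simp add: mult.assoc)
    then have "adj u * a * u * (adj u * pe q a * u) = adj u * a * pe q a * u" by (simp add: u)
    then show ?case by (simp only: pe_pCons pCons) (simp add: u algebra_simps)
  qed simp
  have "(\<lambda>n. pe (p n) (adj u * a * u)) \<longlonglongrightarrow> fc f (adj u * a * u)"
    by (rule fc_tendsto[OF conj_nonneg[OF a] f _ p]) (simp add: K_def)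
  moreover have "(\<lambda>n. adj u * pe (p n) a * u) \<longlonglongrightarrow> adj u * fc f a * u"
    by (intro tendsto_intros fc_tendsto[OF a f _ p]) (simp add: K_def)
  ultimately show ?thesis by (simp add: pe) (rule LIMSEQ_unique)
qed

subsection \<open>Square roots and absolute values\<close>

definition opsqrt :: "'a::hilbert bop \<Rightarrow> 'a bop"
  where "opsqrt a = fc sqrt a"

lemma cont0_sqrt: "cont0 sqrt"
  by (intro continuous_intros)

lemma opsqrt_nonneg: "0 \<le> a \<Longrightarrow> 0 \<le> opsqrt a"
  unfolding opsqrt_def by (rule fc_nonneg) (auto intro: cont0_sqrt)

lemma opsqrt_square: "0 \<le> a \<Longrightarrow> opsqrt a * opsqrt a = a"
proof -
  assume a: "0 \<le> a"
  have "opsqrt a * opsqrt a = fc (\<lambda>t. sqrt t * sqrt t) a"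
    unfolding opsqrt_def by (rule fc_mult[symmetric]) (auto intro: a cont0_sqrt)
  also have "\<dots> = fc (\<lambda>t. t) a" by (rule fc_cong[OF a]) auto
  finally show ?thesis by (simp add: fc_id a)
qed

text \<open>In the calculus of b the operator a is the square function, so \<open>fc_compose\<close>
  evaluates the root of a as sqrt(t^2) = t at b.\<close>

lemma opsqrt_unique:
  assumes "0 \<le> b" "b * b = a"
  shows "opsqrt a = b"
proof -
  have c: "cont0 (\<lambda>t. t * t)" by (intro continuous_intros)
  have "fc (\<lambda>t. t * t) b = a" using assms by (simp add: fc_mult fc_id continuous_on_id)
  then have "opsqrt a = fc (\<lambda>t. sqrt (t * t)) b"
    using fc_compose[OF assms(1) c cont0_sqrt] by (simp add: opsqrt_def)
  also have "\<dots> = fc (\<lambda>t. t) b" by (rule fc_cong[OF assms(1)]) auto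
  finally show ?thesis by (simp add: fc_id assms)
qed

definition opabs :: "'a::hilbert bop \<Rightarrow> 'a bop"
  where "opabs x = opsqrt (adj x * x)"

lemma opabs_nonneg [simp]: "0 \<le> opabs x"
  by (simp add: opabs_def opsqrt_nonneg)

lemma opabs_square: "opabs x * opabs x = adj x * x"
  by (simp add: opabs_def opsqrt_square)

lemma adj_opabs [simp]: "adj (opabs x) = opabs x"
  by (simp add: adj_nonneg)

lemma norm_opabs [simp]: "norm (opabs x) = norm x"
proof -
  have "(norm (opabs x))\<^sup>2 = (norm x)\<^sup>2"
    by (metis norm_adj_mult_self adj_opabs opabs_square)
  then show ?thesis by (simp add: power2_eq_iff_nonneg)
qed

section \<open>Von Neumann algebras of real operators\<close>

text \<open>The bounded transform \<open>a (1 + a)^-1\<close>. It is operator monotone and stays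
  below 1, so it turns unbounded increasing families of operators into bounded ones.\<close>

definition resolvent :: "'a::hilbert bop \<Rightarrow> 'a bop"
  where "resolvent a = fc (\<lambda>t. t / (1 + t)) a"

lemma cont0_resolvent: "cont0 (\<lambda>t. t / (1 + t))" "cont0 (\<lambda>t. 1 / (1 + t))"
  by (intro continuous_intros; simp)+

lemma resolvent_inverse:
  assumes "0 \<le> a"
  shows "resolvent a = 1 - fc (\<lambda>t. 1 / (1 + t)) a" "(1 + a) * fc (\<lambda>t. 1 / (1 + t)) a = 1"
proof -
  have "fc (\<lambda>t. t / (1 + t)) a = fc (\<lambda>t. 1 - 1 / (1 + t)) a"
    by (rule fc_cong[OF assms]) (simp add: field_simps)
  also have "\<dots> = fc (\<lambda>t. 1) a - fc (\<lambda>t. 1 / (1 + t)) a"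
    by (rule fc_diff[OF assms _ cont0_resolvent(2)]) (intro continuous_intros)
  finally show "resolvent a = 1 - fc (\<lambda>t. 1 / (1 + t)) a" by (simp add: resolvent_def fc_const assms)
  have c: "cont0 (\<lambda>t. 1 + t)" by (intro continuous_intros)
  have "fc (\<lambda>t. 1 + t) a = 1 + a" by (subst fc_add) (auto simp: fc_const fc_id assms intro!: continuous_intros)
  then have "(1 + a) * fc (\<lambda>t. 1 / (1 + t)) a = fc (\<lambda>t. (1 + t) * (1 / (1 + t))) a"
    by (simp only: fc_mult[OF assms c cont0_resolvent(2)])
  also have "\<dots> = fc (\<lambda>t. 1) a" by (rule fc_cong[OF assms]) simp
  finally show "(1 + a) * fc (\<lambda>t. 1 / (1 + t)) a = 1" by (simp add: fc_const assms)
qed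

lemma resolvent_nonneg: "0 \<le> a \<Longrightarrow> 0 \<le> resolvent a"
  unfolding resolvent_def by (intro fc_nonneg cont0_resolvent) auto

lemma resolvent_le_self: "0 \<le> a \<Longrightarrow> resolvent a \<le> a"
  using fc_mono[OF _ cont0_resolvent(1) continuous_on_id, of a]
  by (simp add: resolvent_def fc_id divide_le_eq algebra_simps)

lemma resolvent_le_1: "0 \<le> a \<Longrightarrow> resolvent a \<le> 1"
  using fc_mono[OF _ cont0_resolvent(1) continuous_on_const, of a 1]
  by (simp add: resolvent_def fc_const divide_le_eq)

text \<open>Conversely the transform controls a on bounded sets: t <= K gives t / (1 + K) <= t / (1
  + t).\<close>

lemma le_resolvent:
  assumes "0 \<le> a" "norm a \<le> K" "0 \<le> K"
  shows "(1 / (1 + K)) *\<^sub>R a \<le> resolvent a"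
proof -
  have "fc (\<lambda>t. 1 / (1 + K) * t) a \<le> resolvent a"
    unfolding resolvent_def
  proof (rule fc_mono[OF assms(1) _ cont0_resolvent(1)])
    show "cont0 (\<lambda>t. 1 / (1 + K) * t)" by (intro continuous_intros)
    fix t assume "0 \<le> t" "t \<le> norm a"
    then have "t / (1 + K) \<le> t / (1 + t)" using assms by (intro divide_left_mono) auto
    then show "1 / (1 + K) * t \<le> t / (1 + t)" by simp
  qed
  then show ?thesis by (simp only: fc_scale[OF assms(1) continuous_on_id] fc_id[OF assms(1)])
qed

text \<open>
  With \<open>\<eta> = (1 + b)\<^sup>-\<^sup>1 \<xi>\<close> and \<open>\<zeta> = (1 + a)\<^sup>-\<^sup>1 \<xi>\<close>, expand \<open>\<langle>(1 + a)(\<zeta> - \<eta>), \<zeta> - \<eta>\<rangle> \<ge> 0\<close>.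
\<close>

lemma resolvent_mono:
  assumes a: "0 \<le> a" and ab: "a \<le> b"
  shows "resolvent a \<le> resolvent b"
proof -
  have b: "0 \<le> b" using assms by (rule order_trans)
  define p where "p = fc (\<lambda>t. 1 / (1 + t)) a"
  define q where "q = fc (\<lambda>t. 1 / (1 + t)) b"
  have p: "ap (1 + a) (ap p \<xi>) = \<xi>" and q: "ap (1 + b) (ap q \<xi>) = \<xi>" for \<xi>
    using resolvent_inverse(2)[OF a] resolvent_inverse(2)[OF b] unfolding p_def q_def
    by (metis ap_simps(2,7))+
  have sym: "inner \<xi> (ap (1 + a) \<eta>) = inner \<eta> (ap (1 + a) \<xi>)" for \<xi> \<eta>
    by (metis adj_nonneg[OF a] adj_simps(2,3) inner_ap_left inner_commute)
  have "q \<le> p"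
  proof (rule bop_leI)
    show "adj p = p" "adj q = q" by (simp_all add: p_def q_def adj_fc cont0_resolvent a b)
    fix \<xi>
    let ?\<eta> = "ap q \<xi>" and ?\<zeta> = "ap p \<xi>"
    have "0 \<le> 1 + a" using a by (simp add: add_nonneg_nonneg)
    then have "0 \<le> inner (?\<zeta> - ?\<eta>) (ap (1 + a) (?\<zeta> - ?\<eta>))" by (simp only: bop_nonneg_iff)
    also have "\<dots> = inner \<xi> ?\<zeta> - 2 * inner \<xi> ?\<eta> + inner ?\<eta> (ap (1 + a) ?\<eta>)"
      unfolding ap_arg_simps inner_diff_left inner_diff_right p sym[of ?\<zeta> ?\<eta>]
      by (simp add: inner_commute)
    also have "inner ?\<eta> (ap (1 + a) ?\<eta>) \<le> inner ?\<eta> (ap (1 + b) ?\<eta>)"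
      by (rule bop_leD) (simp add: ab)
    also have "\<dots> = inner \<xi> ?\<eta>" by (simp only: q inner_commute)
    finally show "inner \<xi> ?\<eta> \<le> inner \<xi> ?\<zeta>" by simp
  qed
  then show ?thesis by (simp add: resolvent_inverse a b p_def q_def)
qed

section \<open>Strong limits of monotone sequences of operators\<close>

lemma strong_limit_nonneg:
  assumes "\<And>n. 0 \<le> x n" "\<And>\<xi>. (\<lambda>n. ap (x n) \<xi>) \<longlonglongrightarrow> ap y \<xi>"
  shows "0 \<le> y"
proof -
  have q: "(\<lambda>n. inner \<xi> (ap (x n) \<eta>)) \<longlonglongrightarrow> inner \<xi> (ap y \<eta>)" for \<xi> \<eta>
    by (intro tendsto_intros assms)
  \<comment> \<open>Taking adjoints is not strongly continuous, but it is continuous for the weak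
    convergence \<open>q\<close>.\<close>
  have "inner \<xi> (ap (adj y) \<eta>) = inner \<xi> (ap y \<eta>)" for \<xi> \<eta>
  proof (rule LIMSEQ_unique[OF _ q])
    have "inner \<xi> (ap (x n) \<eta>) = inner \<eta> (ap (x n) \<xi>)" for n
      by (metis adj_nonneg[OF assms(1)] inner_ap_left inner_commute)
    then show "(\<lambda>n. inner \<xi> (ap (x n) \<eta>)) \<longlonglongrightarrow> inner \<xi> (ap (adj y) \<eta>)"
      using q[of \<eta> \<xi>] by (simp add: inner_ap_right[of \<xi> "adj y"] inner_commute)
  qed
  then have "adj y = y" by (intro bop_eqI, intro vector_eq_ldot[THEN iffD1]) simp
  moreover have "0 \<le> inner \<xi> (ap y \<xi>)" for \<xi>
    using assms(1) by (intro LIMSEQ_le_const[OF q]) (auto simp: bop_nonneg_iff)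
  ultimately show ?thesis by (simp add: bop_nonneg_iff)
qed

text \<open>For the positive difference \<open>x n - x m\<close>, \<open>norm_ap_square_le\<close>
  bounds the squared distance of the image vectors by K times the increment of the bounded
  increasing sequence \<open>c\<close> of numbers.\<close>

lemma incseq_strong_limit:
  fixes x :: "nat \<Rightarrow> 'a::hilbert bop"
  assumes mono: "\<And>n. x n \<le> x (Suc n)" and 0: "\<And>n. 0 \<le> x n" and bd: "\<And>n. x n \<le> K *\<^sub>R 1"
  obtains y where "\<And>\<xi>. (\<lambda>n. ap (x n) \<xi>) \<longlonglongrightarrow> ap y \<xi>" "\<And>n. x n \<le> y" "0 \<le> y" "y \<le> K *\<^sub>R 1"
proof -
  have monoD: "x m \<le> x n" if "m \<le> n" for m n by (rule lift_Suc_mono_le[of x, OF mono that])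
  have conv: "convergent (\<lambda>n. ap (x n) \<xi>)" for \<xi>
  proof (rule Cauchy_convergent)
    define c where "c n = inner \<xi> (ap (x n) \<xi>)" for n
    have "incseq c" unfolding incseq_def c_def using monoD bop_leD by blast
    moreover have "c n \<le> K * inner \<xi> \<xi>" for n using bop_leD[OF bd, of \<xi> n] by (simp add: c_def)
    ultimately have "convergent c" by (metis incseq_convergent convergent_def)
    then have C: "Cauchy c" by (rule convergent_Cauchy)
    have est: "(dist (ap (x n) \<xi>) (ap (x m) \<xi>))\<^sup>2 \<le> K * dist (c n) (c m)" if "m \<le> n" for m n
    proof -
      have "0 \<le> x n - x m" using monoD[OF that] by simp
      moreover have "x n - x m \<le> K *\<^sub>R 1" using bd[of n] 0[of m] by (metis diff_mono diff_zero)
      ultimately have "(norm (ap (x n - x m) \<xi>))\<^sup>2 \<le> K * inner \<xi> (ap (x n - x m) \<xi>)"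
        by (rule norm_ap_square_le)
      moreover have "c m \<le> c n" using \<open>incseq c\<close> that by (simp add: incseq_def)
      ultimately show ?thesis by (simp add: dist_norm c_def inner_diff_right)
    qed
    show "Cauchy (\<lambda>n. ap (x n) \<xi>)"
    proof (rule metric_CauchyI)
      fix e :: real assume e: "e > 0"
      then have "e\<^sup>2 / (\<bar>K\<bar> + 1) > 0" by simp
      from metric_CauchyD[OF C this]
      obtain M where M: "\<And>m n. m \<ge> M \<Longrightarrow> n \<ge> M \<Longrightarrow> dist (c m) (c n) < e\<^sup>2 / (\<bar>K\<bar> + 1)" by blast
      have lt: "dist (ap (x n) \<xi>) (ap (x m) \<xi>) < e" if "m \<ge> M" "n \<ge> M" "m \<le> n" for m n
      proof -
        have "(dist (ap (x n) \<xi>) (ap (x m) \<xi>))\<^sup>2 \<le> K * dist (c n) (c m)" by (rule est[OF that(3)])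
        also have "\<dots> \<le> (\<bar>K\<bar> + 1) * dist (c n) (c m)" by (intro mult_right_mono) auto
        also have "\<dots> < (\<bar>K\<bar> + 1) * (e\<^sup>2 / (\<bar>K\<bar> + 1))"
          using M[of n m] that by (intro mult_strict_left_mono) auto
        also have "\<dots> = e\<^sup>2" by (simp add: add_nonneg_eq_0_iff)
        finally show ?thesis using e by (intro power2_less_imp_less[of _ e]) auto
      qed
      then show "\<exists>M. \<forall>m\<ge>M. \<forall>n\<ge>M. dist (ap (x m) \<xi>) (ap (x n) \<xi>) < e"
        by (metis dist_commute nle_le)
    qed
  qed
  then obtain g where g: "\<And>\<xi>. (\<lambda>n. ap (x n) \<xi>) \<longlonglongrightarrow> g \<xi>" unfolding convergent_def by metis
  have K: "norm (x n) \<le> \<bar>K\<bar>" for n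
    using norm_le_of_bop_le[OF 0 order_trans[OF bd[of n] scaleR_right_mono[OF abs_ge_self one_nonneg_bop]]] by simp
  have "bounded_linear g"
  proof (rule bounded_linear_intro[of _ "\<bar>K\<bar>"])
    fix \<xi> \<eta> and r :: real
    show "g (\<xi> + \<eta>) = g \<xi> + g \<eta>"
      using tendsto_add[OF g g] g[of "\<xi> + \<eta>"] by (auto simp: ap_arg_simps intro: LIMSEQ_unique)
    show "g (r *\<^sub>R \<xi>) = r *\<^sub>R g \<xi>"
      using tendsto_scaleR[OF tendsto_const[of r] g] g[of "r *\<^sub>R \<xi>"] by (auto simp: ap_arg_simps intro: LIMSEQ_unique)
    show "norm (g \<xi>) \<le> norm \<xi> * \<bar>K\<bar>"
    proof (rule tendsto_upperbound[OF tendsto_norm[OF g]])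
      show "\<forall>\<^sub>F n in sequentially. norm (ap (x n) \<xi>) \<le> norm \<xi> * \<bar>K\<bar>"
        using order_trans[OF norm_ap mult_right_mono[OF K norm_ge_zero]]
        by (intro always_eventually) (simp add: mult.commute)
    qed simp
  qed
  then obtain y where y: "ap y = g" using ex_bop by blast
  show thesis
  proof (rule that)
    show l: "(\<lambda>n. ap (x n) \<xi>) \<longlonglongrightarrow> ap y \<xi>" for \<xi> using g y by simp
    show "0 \<le> y" by (rule strong_limit_nonneg[OF 0 l])
    have "0 \<le> K *\<^sub>R 1 - y"
      by (rule strong_limit_nonneg[of "\<lambda>n. K *\<^sub>R 1 - x n"]) (use bd in \<open>auto intro!: tendsto_intros l\<close>)
    then show "y \<le> K *\<^sub>R 1" by simp
    fix m
    have "0 \<le> y - x m"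
    proof (rule strong_limit_nonneg[of "\<lambda>n. x (n + m) - x m"])
      show "0 \<le> x (n + m) - x m" for n using monoD[of m "n + m"] by simp
      show "(\<lambda>n. ap (x (n + m) - x m) \<xi>) \<longlonglongrightarrow> ap (y - x m) \<xi>" for \<xi>
        using tendsto_diff[OF LIMSEQ_ignore_initial_segment[OF l[of \<xi>], of m] tendsto_const[of "ap (x m) \<xi>"]] by simp
    qed
    then show "x m \<le> y" by simp
  qed
qed

section \<open>Von Neumann algebras as bicommutants\<close>

definition cent :: "'a::hilbert bop set \<Rightarrow> 'a bop set"
  where "cent S = {x. \<forall>y\<in>S. x * y = y * x}"

text \<open>Commutants are taken among real linear operators. For a complex algebra they coincide
  with the complex ones, because multiplication by \<i> belongs to the algebra
  (\<open>II_bops\<close>, \<open>cent_bops\<close>).\<close>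

locale vna =
  fixes A :: "'a::hilbert bop set"
  assumes bicommutant: "cent (cent A) = A"
    and adj_closed: "x \<in> A \<Longrightarrow> adj x \<in> A"
begin

lemma memI: "(\<And>y. y \<in> cent A \<Longrightarrow> x * y = y * x) \<Longrightarrow> x \<in> A"
  by (subst bicommutant[symmetric]) (simp add: cent_def)

lemma memD: "x \<in> A \<Longrightarrow> y \<in> cent A \<Longrightarrow> x * y = y * x"
  by (simp add: cent_def)

lemma adj_cent: "y \<in> cent A \<Longrightarrow> adj y \<in> cent A"
  unfolding cent_def using adj_closed by (auto, metis adj_adj adj_simps(7))

lemma zero_closed [simp, intro]: "0 \<in> A"
  and one_closed [simp, intro]: "1 \<in> A"
  and add_closed [simp, intro]: "x \<in> A \<Longrightarrow> y \<in> A \<Longrightarrow> x + y \<in> A"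
  and diff_closed [simp, intro]: "x \<in> A \<Longrightarrow> y \<in> A \<Longrightarrow> x - y \<in> A"
  and scaleR_closed [simp, intro]: "x \<in> A \<Longrightarrow> r *\<^sub>R x \<in> A"
  and minus_closed [simp, intro]: "x \<in> A \<Longrightarrow> - x \<in> A"
  by (rule memI, simp add: memD algebra_simps)+

lemma mult_closed [simp, intro]: "x \<in> A \<Longrightarrow> y \<in> A \<Longrightarrow> x * y \<in> A"
  by (rule memI) (metis memD mult.assoc)

lemma adj_mem_iff [simp]: "adj x \<in> A \<longleftrightarrow> x \<in> A"
  using adj_closed[of x] adj_closed[of "adj x"] by auto

lemma sum_closed [intro]: "(\<And>i. i \<in> I \<Longrightarrow> f i \<in> A) \<Longrightarrow> sum f I \<in> A"
  by (induction I rule: infinite_finite_induct) auto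

lemma fc_closed [intro]: "a \<in> A \<Longrightarrow> 0 \<le> a \<Longrightarrow> cont0 f \<Longrightarrow> fc f a \<in> A"
  by (rule memI) (metis memD fc_commute)

lemma strong_limit_closed:
  assumes "\<And>n. x n \<in> A" "\<And>\<xi>. (\<lambda>n. ap (x n) \<xi>) \<longlonglongrightarrow> ap y \<xi>"
  shows "y \<in> A"
proof (rule memI, rule bop_eqI)
  fix z \<xi> assume z: "z \<in> cent A"
  have "(\<lambda>n. ap (x n) (ap z \<xi>)) \<longlonglongrightarrow> ap z (ap y \<xi>)"
    using tendsto_ap[OF assms(2)[of \<xi>], of z] memD[OF assms(1) z] by (simp flip: ap_simps(7))
  with assms(2)[of "ap z \<xi>"] show "ap (y * z) \<xi> = ap (z * y) \<xi>"
    by (auto intro: LIMSEQ_unique)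
qed

lemma opabs_closed [intro]: "x \<in> A \<Longrightarrow> opabs x \<in> A"
  unfolding opabs_def opsqrt_def by (intro fc_closed mult_closed adj_closed cont0_sqrt) auto

end

section \<open>Traces\<close>

text \<open>Normality is required for arbitrary directed sets, because the supremum in
  \<open>kernel_compl_finite_trace\<close> runs over the finite subsets of a possibly uncountable
  set.\<close>

locale traced = vna A for A :: "'a::hilbert bop set" +
  fixes \<tau> :: "'a bop \<Rightarrow> ennreal"
  assumes tr_add: "x \<in> A \<Longrightarrow> 0 \<le> x \<Longrightarrow> y \<in> A \<Longrightarrow> 0 \<le> y \<Longrightarrow> \<tau> (x + y) = \<tau> x + \<tau> y"
    and tr_scale: "x \<in> A \<Longrightarrow> 0 \<le> x \<Longrightarrow> 0 \<le> c \<Longrightarrow> \<tau> (c *\<^sub>R x) = ennreal c * \<tau> x"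
    and tracial: "x \<in> A \<Longrightarrow> \<tau> (adj x * x) = \<tau> (x * adj x)"
    and faithful: "x \<in> A \<Longrightarrow> 0 \<le> x \<Longrightarrow> \<tau> x = 0 \<Longrightarrow> x = 0"
    and normal: "D \<subseteq> A \<Longrightarrow> (\<And>x. x \<in> D \<Longrightarrow> 0 \<le> x) \<Longrightarrow> D \<noteq> {} \<Longrightarrow>
      (\<And>x y. x \<in> D \<Longrightarrow> y \<in> D \<Longrightarrow> \<exists>z\<in>D. x \<le> z \<and> y \<le> z) \<Longrightarrow> s \<in> A \<Longrightarrow> (\<And>x. x \<in> D \<Longrightarrow> x \<le> s) \<Longrightarrow>
      (\<And>z. z \<in> A \<Longrightarrow> 0 \<le> z \<Longrightarrow> (\<And>x. x \<in> D \<Longrightarrow> x \<le> z) \<Longrightarrow> s \<le> z) \<Longrightarrow> \<tau> s = (SUP x\<in>D. \<tau> x)"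
begin

lemma tr_0 [simp]: "\<tau> 0 = 0"
  using tr_scale[of 0 0] by simp

lemma tr_mono: "x \<in> A \<Longrightarrow> y \<in> A \<Longrightarrow> 0 \<le> x \<Longrightarrow> x \<le> y \<Longrightarrow> \<tau> x \<le> \<tau> y"
  using tr_add[of x "y - x"] by (simp add: le_iff_add)

lemma tr_incseq:
  assumes x: "\<And>n. x n \<in> A" "\<And>n. 0 \<le> x n" "\<And>n. x n \<le> x (Suc n)" "\<And>n. x n \<le> y"
    and y: "y \<in> A" "\<And>\<xi>. (\<lambda>n. ap (x n) \<xi>) \<longlonglongrightarrow> ap y \<xi>"
  shows "\<tau> y = (SUP n. \<tau> (x n))"
proof -
  have monoD: "x m \<le> x n" if "m \<le> n" for m n by (rule lift_Suc_mono_le[of x, OF x(3) that])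
  have "\<tau> y = (SUP z\<in>range x. \<tau> z)"
  proof (rule normal)
    show "\<exists>z\<in>range x. v \<le> z \<and> w \<le> z" if "v \<in> range x" "w \<in> range x" for v w
      using that monoD max.cobounded1 max.cobounded2 by (metis rangeE rangeI)
    show "y \<le> z" if "z \<in> A" "0 \<le> z" "\<And>w. w \<in> range x \<Longrightarrow> w \<le> z" for z
    proof -
      have "0 \<le> z - y"
        by (rule strong_limit_nonneg[of "\<lambda>n. z - x n"]) (use that in \<open>auto intro!: tendsto_intros y\<close>)
      then show ?thesis by simp
    qed
  qed (use x y in auto)
  then show ?thesis by (simp add: image_comp comp_def)
qed

text \<open>With s the root of a, traciality for \<open>s * x\<close> moves x into the middle, where
  \<open>x * adj x\<close> is at most its norm.\<close>

lemma tr_conj_le: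
  assumes "a \<in> A" "0 \<le> a" "x \<in> A"
  shows "\<tau> (adj x * a * x) \<le> ennreal ((norm x)\<^sup>2) * \<tau> a"
proof -
  obtain s where s: "s \<in> A" "adj s = s" "s * s = a"
    using assms by (metis opsqrt_square adj_nonneg opsqrt_nonneg opsqrt_def fc_closed cont0_sqrt)
  have "adj (s * x) * (s * x) = adj x * (s * s) * x" by (simp only: adj_simps s(2) mult.assoc)
  then have "\<tau> (adj x * a * x) = \<tau> ((s * x) * adj (s * x))"
    using tracial[of "s * x"] assms(3) s(1) unfolding s(3) by (metis mult_closed)
  also have "(s * x) * adj (s * x) = adj s * (x * adj x) * s" by (simp add: s(2) mult.assoc)
  also have "\<tau> \<dots> \<le> \<tau> ((norm x)\<^sup>2 *\<^sub>R a)"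
  proof (rule tr_mono)
    have x0: "0 \<le> x * adj x" using adj_mult_self_nonneg[of "adj x"] by simp
    show "0 \<le> adj s * (x * adj x) * s" by (rule conj_nonneg[OF x0])
    have "norm (x * adj x) = (norm x)\<^sup>2" using norm_adj_mult_self[of "adj x"] by simp
    then have "x * adj x \<le> (norm x)\<^sup>2 *\<^sub>R 1" using le_norm_bop[OF adj_nonneg[OF x0]] by simp
    from conj_mono[OF this, of s] show "adj s * (x * adj x) * s \<le> (norm x)\<^sup>2 *\<^sub>R a"
      by (simp add: s)
  qed (use s(1) assms in auto)
  also have "\<dots> = ennreal ((norm x)\<^sup>2) * \<tau> a" by (rule tr_scale) (use assms in auto)
  finally show ?thesis .
qed

subsection \<open>The Hilbert--Schmidt form\<close>

definition N2 :: "'a bop set"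
  where "N2 = {x \<in> A. \<tau> (adj x * x) < \<infinity>}"

lemma N2_A: "x \<in> N2 \<Longrightarrow> x \<in> A"
  by (simp add: N2_def)

lemma N2_adj: "x \<in> N2 \<Longrightarrow> adj x \<in> N2"
  using tracial[of x] by (simp add: N2_def)

lemma N2_mult_left: "x \<in> N2 \<Longrightarrow> y \<in> A \<Longrightarrow> y * x \<in> N2"
proof -
  assume x: "x \<in> N2" and y: "y \<in> A"
  have "adj (y * x) * (y * x) = adj x * (adj y * y) * x" by (simp add: mult.assoc)
  also have "\<dots> \<le> adj x * ((norm y)\<^sup>2 *\<^sub>R 1) * x"
    by (rule conj_mono) (use le_norm_bop[of "adj y * y"] in \<open>simp add: norm_adj_mult_self\<close>)
  finally have "\<tau> (adj (y * x) * (y * x)) \<le> \<tau> ((norm y)\<^sup>2 *\<^sub>R (adj x * x))"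
    using x y by (intro tr_mono) (auto simp: N2_def simp del: adj_simps)
  also have "\<dots> = ennreal ((norm y)\<^sup>2) * \<tau> (adj x * x)" using x by (intro tr_scale) (auto simp: N2_def)
  also have "\<dots> < \<infinity>" using x by (auto simp: N2_def ennreal_mult_less_top)
  finally show ?thesis using x y by (auto simp: N2_def)
qed

lemma N2_mult_right: "x \<in> N2 \<Longrightarrow> y \<in> A \<Longrightarrow> x * y \<in> N2"
  using N2_adj[OF N2_mult_left[OF N2_adj, of x "adj y"]] by simp

lemma N2_scale: "x \<in> N2 \<Longrightarrow> r *\<^sub>R x \<in> N2"
  using N2_mult_left[of x "r *\<^sub>R 1"] by auto

lemma N2_0: "0 \<in> N2"
  by (simp add: N2_def)

text \<open>Positivity of \<open>adj (x - y) * (x - y)\<close> bounds the mixed terms of the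
  expansion by the squares.\<close>

lemma N2_add:
  assumes "x \<in> N2" "y \<in> N2" shows "x + y \<in> N2"
proof -
  have xy: "x \<in> A" "y \<in> A" "\<tau> (adj x * x) < \<infinity>" "\<tau> (adj y * y) < \<infinity>" using assms by (auto simp: N2_def)
  have "0 \<le> adj (x - y) * (x - y)" by (rule adj_mult_self_nonneg)
  then have "adj (x + y) * (x + y) \<le> 2 *\<^sub>R (adj x * x + adj y * y)"
    by (simp add: algebra_simps scaleR_2) (metis add.commute add_left_mono add_0_right)?
  then have "\<tau> (adj (x + y) * (x + y)) \<le> \<tau> (2 *\<^sub>R (adj x * x + adj y * y))"
    using xy by (intro tr_mono) (auto simp del: adj_simps)
  also have "\<dots> = ennreal 2 * (\<tau> (adj x * x) + \<tau> (adj y * y))"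
    using xy by (subst tr_scale) (auto simp: tr_add add_nonneg_nonneg)
  also have "\<dots> < \<infinity>" using xy by (simp add: ennreal_mult_less_top)
  finally show ?thesis using xy by (auto simp: N2_def)
qed

lemma N2_diff: "x \<in> N2 \<Longrightarrow> y \<in> N2 \<Longrightarrow> x - y \<in> N2"
  using N2_add[of x "(-1) *\<^sub>R y"] N2_scale[of y "-1"] by simp

section \<open>The trace as a linear functional and its inner product\<close>

definition Fin :: "'a bop set"
  where "Fin = {a \<in> A. 0 \<le> a \<and> \<tau> a < \<infinity>}"

text \<open>The trace has meaning only on positive elements; this extends it to differences of
  elements of finite trace. Additivity makes the value independent of the chosen difference
  (\<open>trd_diff\<close>).\<close>

definition trd :: "'a bop \<Rightarrow> real"
  where "trd a = (SOME r. \<exists>b\<in>Fin. \<exists>c\<in>Fin. a = b - c \<and> r = enn2real (\<tau> b) - enn2real (\<tau> c))"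

lemma Fin_add: "b \<in> Fin \<Longrightarrow> c \<in> Fin \<Longrightarrow> b + c \<in> Fin \<and> enn2real (\<tau> (b + c)) = enn2real (\<tau> b) + enn2real (\<tau> c)"
  by (auto simp: Fin_def tr_add enn2real_plus add_nonneg_nonneg)

lemma Fin_scale: "b \<in> Fin \<Longrightarrow> 0 \<le> r \<Longrightarrow> r *\<^sub>R b \<in> Fin \<and> enn2real (\<tau> (r *\<^sub>R b)) = r * enn2real (\<tau> b)"
  by (auto simp: Fin_def tr_scale enn2real_mult ennreal_mult_less_top scaleR_nonneg_nonneg)

lemma trd_diff:
  assumes "b \<in> Fin" "c \<in> Fin"
  shows "trd (b - c) = enn2real (\<tau> b) - enn2real (\<tau> c)"
  unfolding trd_def
proof (rule some_equality)
  fix r assume "\<exists>b'\<in>Fin. \<exists>c'\<in>Fin. b - c = b' - c' \<and> r = enn2real (\<tau> b') - enn2real (\<tau> c')"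
  then obtain b' c' where h: "b' \<in> Fin" "c' \<in> Fin" "b - c = b' - c'"
    and r: "r = enn2real (\<tau> b') - enn2real (\<tau> c')" by blast
  have "b + c' = b' + c" using h(3) by (simp add: algebra_simps)
  then show "r = enn2real (\<tau> b) - enn2real (\<tau> c)"
    using Fin_add[of b c'] Fin_add[of b' c] h assms r by auto
qed (use assms in blast)

text \<open>The real part of the trace of \<open>adj y * x\<close>: the symmetrised product is
  self-adjoint and hence accessible to \<open>trd\<close>.\<close>

definition ip :: "'a bop \<Rightarrow> 'a bop \<Rightarrow> real"
  where "ip x y = trd (adj y * x + adj x * y) / 2"

text \<open>Polarisation exhibits the symmetrised product as a difference of two elements of finite
  trace.\<close>

lemma ip_decomp:
  assumes "x \<in> N2" "y \<in> N2"
  obtains b c where "b \<in> Fin" "c \<in> Fin" "adj y * x + adj x * y = b - c"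
    "ip x y = (enn2real (\<tau> b) - enn2real (\<tau> c)) / 2"
    "b = (1/2) *\<^sub>R (adj (x + y) * (x + y))" "c = (1/2) *\<^sub>R (adj (x - y) * (x - y))"
proof -
  define b where "b = (1/2) *\<^sub>R (adj (x + y) * (x + y))"
  define c where "c = (1/2) *\<^sub>R (adj (x - y) * (x - y))"
  have F: "adj z * z \<in> Fin" if "z \<in> N2" for z using that by (auto simp: N2_def Fin_def)
  have bc: "b \<in> Fin" "c \<in> Fin" unfolding b_def c_def
    using Fin_scale F N2_add N2_diff assms by (simp_all del: adj_simps)
  have "2 *\<^sub>R (b - c) = 2 *\<^sub>R (adj y * x + adj x * y)"
    by (simp add: b_def c_def scaleR_diff_right algebra_simps) (simp add: scaleR_2 algebra_simps)
  then have eq: "adj y * x + adj x * y = b - c" by simp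
  have "ip x y = (enn2real (\<tau> b) - enn2real (\<tau> c)) / 2" unfolding ip_def eq by (simp add: trd_diff bc)
  with bc eq show thesis using that b_def c_def by blast
qed

lemma ip_commute: "ip x y = ip y x"
  by (simp add: ip_def add.commute)

lemma ip_self:
  assumes "x \<in> N2" shows "ip x x = enn2real (\<tau> (adj x * x))"
proof -
  have F: "adj x * x \<in> Fin" "0 \<in> Fin" using assms by (auto simp: N2_def Fin_def)
  have "adj x * x + adj x * x = 2 *\<^sub>R (adj x * x) - 0" by (simp add: scaleR_2)
  then show ?thesis unfolding ip_def using trd_diff[of "2 *\<^sub>R (adj x * x)" 0] F Fin_scale[of "adj x * x" 2] by simp
qed

lemma tr_eq_ip: "x \<in> N2 \<Longrightarrow> \<tau> (adj x * x) = ennreal (ip x x)"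
  by (simp add: ip_self N2_def)

lemma ip_nonneg: "x \<in> N2 \<Longrightarrow> 0 \<le> ip x x"
  by (simp add: ip_self)

lemma ip_add_left:
  assumes "x \<in> N2" "y \<in> N2" "z \<in> N2"
  shows "ip (x + y) z = ip x z + ip y z"
proof -
  obtain b c where 1: "b \<in> Fin" "c \<in> Fin" "adj z * x + adj x * z = b - c"
    "ip x z = (enn2real (\<tau> b) - enn2real (\<tau> c)) / 2" using ip_decomp[OF assms(1,3)] by metis
  obtain b' c' where 2: "b' \<in> Fin" "c' \<in> Fin" "adj z * y + adj y * z = b' - c'"
    "ip y z = (enn2real (\<tau> b') - enn2real (\<tau> c')) / 2" using ip_decomp[OF assms(2,3)] by metis
  have "adj z * (x + y) + adj (x + y) * z = (adj z * x + adj x * z) + (adj z * y + adj y * z)"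
    by (simp add: algebra_simps)
  also have "\<dots> = (b + b') - (c + c')" by (simp add: 1 2)
  finally have "ip (x + y) z = trd ((b + b') - (c + c')) / 2" unfolding ip_def by (rule arg_cong)
  then show ?thesis using trd_diff[of "b + b'" "c + c'"] Fin_add[of b b'] Fin_add[of c c'] 1 2
    by (simp add: field_simps)
qed

lemma ip_scale_left:
  assumes "x \<in> N2" "z \<in> N2"
  shows "ip (r *\<^sub>R x) z = r * ip x z"
proof -
  obtain b c where 1: "b \<in> Fin" "c \<in> Fin" "adj z * x + adj x * z = b - c"
    "ip x z = (enn2real (\<tau> b) - enn2real (\<tau> c)) / 2" using ip_decomp[OF assms] by metis
  have eq: "adj z * (r *\<^sub>R x) + adj (r *\<^sub>R x) * z = r *\<^sub>R (b - c)"
    by (simp add: scaleR_add_right flip: 1(3))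
  show ?thesis
  proof (cases "0 \<le> r")
    case True
    have "ip (r *\<^sub>R x) z = trd (r *\<^sub>R b - r *\<^sub>R c) / 2" unfolding ip_def eq by (simp add: scaleR_diff_right)
    then show ?thesis using trd_diff[of "r *\<^sub>R b" "r *\<^sub>R c"] Fin_scale[of b r] Fin_scale[of c r] 1 True
      by (simp add: right_diff_distrib diff_divide_distrib)
  next
    \<comment> \<open>\<open>Fin\<close> is closed only under nonnegative multiples, so b and c
      exchange their places.\<close>
    case False
    have "ip (r *\<^sub>R x) z = trd ((-r) *\<^sub>R c - (-r) *\<^sub>R b) / 2" unfolding ip_def eq by (simp add: scaleR_diff_right)
    then show ?thesis using trd_diff[of "(-r) *\<^sub>R c" "(-r) *\<^sub>R b"] Fin_scale[of b "-r"] Fin_scale[of c "-r"] 1 False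
      by (simp add: right_diff_distrib diff_divide_distrib)
  qed
qed

lemma ip_diff_left:
  "x \<in> N2 \<Longrightarrow> y \<in> N2 \<Longrightarrow> z \<in> N2 \<Longrightarrow> ip (x - y) z = ip x z - ip y z"
  using ip_add_left[of x "(-1) *\<^sub>R y" z] ip_scale_left[of y z "-1"] N2_scale[of y "-1"] by simp

lemma ip_add_right: "x \<in> N2 \<Longrightarrow> y \<in> N2 \<Longrightarrow> z \<in> N2 \<Longrightarrow> ip z (x + y) = ip z x + ip z y"
  and ip_diff_right: "x \<in> N2 \<Longrightarrow> y \<in> N2 \<Longrightarrow> z \<in> N2 \<Longrightarrow> ip z (x - y) = ip z x - ip z y"
  and ip_scale_right: "x \<in> N2 \<Longrightarrow> z \<in> N2 \<Longrightarrow> ip z (r *\<^sub>R x) = r * ip z x"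
  unfolding ip_commute[of z] by (rule ip_add_left ip_diff_left ip_scale_left; assumption)+

lemma ip_mult_left: "ip (m * x) y = ip x (adj m * y)"
  by (simp add: ip_def mult.assoc)

text \<open>Traciality is the case x = y; polarisation does the rest.\<close>

lemma ip_adj:
  assumes "x \<in> N2" "y \<in> N2"
  shows "ip (adj x) (adj y) = ip x y"
proof -
  have q: "ip (adj z) (adj z) = ip z z" if "z \<in> N2" for z
    using that tracial[of z] by (simp add: ip_self N2_adj N2_A)
  have p: "4 * ip v w = ip (v + w) (v + w) - ip (v - w) (v - w)" if "v \<in> N2" "w \<in> N2" for v w
    using that by (simp add: ip_add_left ip_add_right ip_diff_left ip_diff_right N2_add N2_diff ip_commute)
  have "4 * ip (adj x) (adj y) = 4 * ip x y"
    using p[OF assms] p[OF N2_adj[OF assms(1)] N2_adj[OF assms(2)]]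
      q[OF N2_add[OF assms]] q[OF N2_diff[OF assms]] by simp
  then show ?thesis by simp
qed

lemma ip_mult_right:
  assumes "x \<in> N2" "y \<in> N2" "m \<in> A"
  shows "ip (x * m) y = ip x (y * adj m)"
proof -
  have "ip (x * m) y = ip (adj m * adj x) (adj y)"
    using ip_adj[of "x * m" y] assms by (simp add: N2_mult_right)
  also have "\<dots> = ip (adj x) (m * adj y)" by (simp add: ip_mult_left)
  also have "\<dots> = ip x (y * adj m)"
    using ip_adj[of x "y * adj m"] assms by (simp add: N2_mult_right)
  finally show ?thesis .
qed

lemma ip_young:
  assumes "x \<in> N2" "y \<in> N2"
  shows "2 * ip x y \<le> ip x x + ip y y"
  using ip_nonneg[OF N2_diff[OF assms]] assms
  by (simp add: ip_diff_left ip_diff_right N2_diff ip_commute)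

lemma ip_cauchy_schwarz:
  assumes x: "x \<in> N2" and y: "y \<in> N2"
  shows "\<bar>ip x y\<bar> \<le> sqrt (ip x x) * sqrt (ip y y)"
proof -
  have q: "0 \<le> ip x x - 2 * t * ip x y + t\<^sup>2 * ip y y" for t
  proof -
    have "0 \<le> ip (x - t *\<^sub>R y) (x - t *\<^sub>R y)" by (intro ip_nonneg N2_diff N2_scale x y)
    also have "\<dots> = ip x x - 2 * t * ip x y + t\<^sup>2 * ip y y"
      using x y by (simp add: ip_diff_left ip_diff_right ip_scale_left ip_scale_right N2_diff N2_scale
          ip_commute[of y x] power2_eq_square algebra_simps)
    finally show ?thesis .
  qed
  have "(ip x y)\<^sup>2 \<le> ip x x * ip y y"
  proof (cases "ip y y = 0")
    case True
    have "ip x y = 0"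
    proof (rule ccontr)
      assume "ip x y \<noteq> 0"
      then show False using q[of "(ip x x + 1) / (2 * ip x y)"] True by simp
    qed
    then show ?thesis using True by simp
  next
    case False
    then have "ip y y > 0" using ip_nonneg[OF y] by simp
    then show ?thesis using q[of "ip x y / ip y y"] by (simp add: field_simps power2_eq_square)
  qed
  then show ?thesis by (metis real_sqrt_abs real_sqrt_le_mono real_sqrt_mult)
qed

lemma ip_mult_le:
  assumes "x \<in> N2" "m \<in> A"
  shows "ip (m * x) (m * x) \<le> (norm m)\<^sup>2 * ip x x" "ip (x * m) (x * m) \<le> (norm m)\<^sup>2 * ip x x"
proof -
  have r: "ip (z * m) (z * m) \<le> (norm m)\<^sup>2 * ip z z" if "z \<in> N2" "m \<in> A" for z m
  proof -
    have "ennreal (ip (z * m) (z * m)) = \<tau> (adj m * (adj z * z) * m)"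
      using that by (simp add: mult.assoc N2_mult_right flip: tr_eq_ip)
    also have "\<dots> \<le> ennreal ((norm m)\<^sup>2) * \<tau> (adj z * z)"
      by (rule tr_conj_le) (use that in \<open>auto simp: N2_A\<close>)
    also have "\<dots> = ennreal ((norm m)\<^sup>2 * ip z z)"
      using that by (simp add: tr_eq_ip ennreal_mult ip_nonneg)
    finally show ?thesis using that by (subst (asm) ennreal_le_iff) (auto simp: ip_nonneg)
  qed
  show "ip (x * m) (x * m) \<le> (norm m)\<^sup>2 * ip x x" by (rule r[OF assms])
  show "ip (m * x) (m * x) \<le> (norm m)\<^sup>2 * ip x x"
    using r[OF N2_adj[OF assms(1)], of "adj m"] assms ip_adj[of x x] ip_adj[of "m * x" "m * x"]
    by (simp add: N2_mult_left)
qed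

end

section \<open>The noncommutative Minkowski inequality\<close>

lemma cont0_powr: "0 < p \<Longrightarrow> cont0 (\<lambda>t. t powr p)"
  by (intro continuous_on_powr' continuous_intros) auto

lemma cont0_shift_powr: "0 < \<epsilon> \<Longrightarrow> cont0 (\<lambda>t. (\<epsilon> + t) powr r)"
  by (intro continuous_on_powr continuous_intros) (auto simp: add_pos_nonneg less_imp_neq dest: add_pos_nonneg)

context traced
begin

definition pnorm_pow :: "real \<Rightarrow> 'a bop \<Rightarrow> ennreal"
  where "pnorm_pow p x = \<tau> (fc (\<lambda>t. t powr p) (opabs x))"

lemma ip_self_cong: "adj x * x = adj y * y \<Longrightarrow> ip x x = ip y y"
  by (simp add: ip_def)

text \<open>Rescaling x by the root of \<mu> and y by its inverse leaves the mixed term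
  unchanged.\<close>

lemma ip_young_weighted:
  assumes "x \<in> N2" "y \<in> N2" "0 < \<mu>"
  shows "2 * ip x y \<le> \<mu> * ip x x + ip y y / \<mu>"
proof -
  have "2 * ip (sqrt \<mu> *\<^sub>R x) ((1 / sqrt \<mu>) *\<^sub>R y) \<le> ip (sqrt \<mu> *\<^sub>R x) (sqrt \<mu> *\<^sub>R x)
      + ip ((1 / sqrt \<mu>) *\<^sub>R y) ((1 / sqrt \<mu>) *\<^sub>R y)"
    by (intro ip_young N2_scale assms)
  moreover have "sqrt \<mu> * (sqrt \<mu> * z) = \<mu> * z" for z using assms by (simp flip: mult.assoc)
  moreover have "1 / sqrt \<mu> * (1 / sqrt \<mu> * z) = z / \<mu>" for z using assms by (simp add: field_simps)
  ultimately show ?thesis using assms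
    by (simp only: ip_scale_left ip_scale_right N2_scale) simp
qed

lemma tr_opabs_square: "\<tau> (adj (opabs x) * opabs x) = \<tau> (adj x * x)"
  by (simp add: opabs_square)

lemma opabs_N2: "x \<in> N2 \<Longrightarrow> opabs x \<in> N2"
  using tr_opabs_square by (auto simp: N2_def simp del: adj_opabs)

subsubsection \<open>The pairing of two functional calculi\<close>

text \<open>The real part of the trace of \<open>adj W * g(h) * W * f(a)\<close>. It behaves like
  the integral of f(s) g(t) against a positive measure on the product of two spectra, although a and
  h do not commute.\<close>

definition pairing :: "'a bop \<Rightarrow> 'a bop \<Rightarrow> 'a bop \<Rightarrow> (real \<Rightarrow> real) \<Rightarrow> (real \<Rightarrow> real) \<Rightarrow> real"
  where "pairing W a h f g = ip (W * fc f a) (fc g h * W)"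

context
  fixes W a h
  assumes W: "W \<in> N2" and a: "a \<in> A" "0 \<le> a" and h: "h \<in> A" "0 \<le> h"
begin

abbreviation "T \<equiv> pairing W a h"

lemma mem_N2: "cont0 f \<Longrightarrow> W * fc f a \<in> N2" "cont0 f \<Longrightarrow> fc f h * W \<in> N2"
  using W a h by (simp_all add: N2_mult_left N2_mult_right fc_closed)

text \<open>One factor f(a) and one factor g(h) cross to the other side of the inner product as
  their own adjoints.\<close>

lemma pairing_square:
  assumes "cont0 f" "cont0 g"
  shows "T (\<lambda>t. f t * f t) (\<lambda>t. g t * g t) = ip (fc g h * W * fc f a) (fc g h * W * fc f a)"
proof -
  have "T (\<lambda>t. f t * f t) (\<lambda>t. g t * g t) = ip (W * fc f a * fc f a) (fc g h * (fc g h * W))"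
    unfolding pairing_def fc_mult[OF a(2) assms(1,1)] fc_mult[OF h(2) assms(2,2)] by (simp only: mult.assoc)
  also have "\<dots> = ip (W * fc f a) (fc g h * (fc g h * W) * adj (fc f a))"
    using assms a h W by (intro ip_mult_right mem_N2 N2_mult_left) auto
  also have "\<dots> = ip (W * fc f a) (adj (fc g h) * (fc g h * W * fc f a))"
    using assms a h by (simp add: adj_fc mult.assoc)
  also have "\<dots> = ip (fc g h * W * fc f a) (fc g h * W * fc f a)"
    by (simp only: mult.assoc ip_mult_left)
  finally show ?thesis .
qed

text \<open>Roots of f and g turn the pairing into a squared 2-norm.\<close>

lemma pairing_nonneg:
  assumes "cont0 f" "cont0 g" "\<And>t. 0 \<le> t \<Longrightarrow> t \<le> norm a \<Longrightarrow> 0 \<le> f t"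
    "\<And>t. 0 \<le> t \<Longrightarrow> t \<le> norm h \<Longrightarrow> 0 \<le> g t"
  shows "0 \<le> T f g"
proof -
  define f' g' where "f' t = sqrt \<bar>f t\<bar>" and "g' t = sqrt \<bar>g t\<bar>" for t
  have c: "cont0 f'" "cont0 g'" unfolding f'_def g'_def by (intro continuous_intros assms)+
  have "fc f a = fc (\<lambda>t. f' t * f' t) a" by (rule fc_cong[OF a(2)]) (use assms in \<open>auto simp: f'_def\<close>)
  moreover have "fc g h = fc (\<lambda>t. g' t * g' t) h" by (rule fc_cong[OF h(2)]) (use assms in \<open>auto simp: g'_def\<close>)
  ultimately have "T f g = T (\<lambda>t. f' t * f' t) (\<lambda>t. g' t * g' t)" by (simp add: pairing_def)
  also have "\<dots> = ip (fc g' h * W * fc f' a) (fc g' h * W * fc f' a)" by (rule pairing_square[OF c])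
  also have "\<dots> \<ge> 0" using c a by (intro ip_nonneg N2_mult_right mem_N2) auto
  finally show ?thesis .
qed

lemma pairing_add_left: "cont0 f \<Longrightarrow> cont0 f' \<Longrightarrow> cont0 g \<Longrightarrow> T (\<lambda>t. f t + f' t) g = T f g + T f' g"
  and pairing_diff_left: "cont0 f \<Longrightarrow> cont0 f' \<Longrightarrow> cont0 g \<Longrightarrow> T (\<lambda>t. f t - f' t) g = T f g - T f' g"
  and pairing_scale_left: "cont0 f \<Longrightarrow> cont0 g \<Longrightarrow> T (\<lambda>t. c * f t) g = c * T f g"
  and pairing_add_right: "cont0 f \<Longrightarrow> cont0 g' \<Longrightarrow> cont0 g \<Longrightarrow> T f (\<lambda>t. g t + g' t) = T f g + T f g'"
  and pairing_diff_right: "cont0 f \<Longrightarrow> cont0 g' \<Longrightarrow> cont0 g \<Longrightarrow> T f (\<lambda>t. g t - g' t) = T f g - T f g'"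
  and pairing_scale_right: "cont0 f \<Longrightarrow> cont0 g \<Longrightarrow> T f (\<lambda>t. c * g t) = c * T f g"
  using a h by (simp_all add: pairing_def fc_add fc_diff fc_scale distrib_left distrib_right left_diff_distrib
      right_diff_distrib ip_add_left ip_diff_left ip_scale_left ip_add_right ip_diff_right ip_scale_right mem_N2)

lemma pairing_sum_right:
  assumes "cont0 f" "\<And>i. i \<in> I \<Longrightarrow> cont0 (g i)"
  shows "T f (\<lambda>t. \<Sum>i\<in>I. g i t) = (\<Sum>i\<in>I. T f (g i))"
  using assms(2)
proof (induction I rule: infinite_finite_induct)
  case (insert i I)
  then show ?case using assms(1) by (simp add: pairing_add_right continuous_on_sum)
qed (use pairing_scale_right[OF assms(1) continuous_on_const, of 0 0] in auto)

lemma pairing_bound: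
  assumes "cont0 f" "cont0 g" "\<And>t. 0 \<le> t \<Longrightarrow> t \<le> norm h \<Longrightarrow> \<bar>g t\<bar> \<le> c"
  shows "\<bar>T f g\<bar> \<le> c * (norm (fc f a) * ip W W)"
proof -
  have gc: "norm (fc g h) \<le> c" by (rule fc_norm_bound) (use assms h in auto)
  have "\<bar>T f g\<bar> \<le> sqrt (ip (W * fc f a) (W * fc f a)) * sqrt (ip (fc g h * W) (fc g h * W))"
    unfolding pairing_def by (intro ip_cauchy_schwarz mem_N2 assms)
  also have "\<dots> \<le> sqrt ((norm (fc f a))\<^sup>2 * ip W W) * sqrt ((norm (fc g h))\<^sup>2 * ip W W)"
    using W a h assms by (intro mult_mono real_sqrt_le_mono ip_mult_le) (auto simp: ip_nonneg mem_N2)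
  also have "\<dots> = norm (fc g h) * (norm (fc f a) * ip W W)"
    using ip_nonneg[OF W] by (simp add: real_sqrt_mult)
  also have "\<dots> \<le> c * (norm (fc f a) * ip W W)"
    using gc ip_nonneg[OF W] by (intro mult_right_mono) auto
  finally show ?thesis .
qed

text \<open>
  The partition of unity by Bernstein polynomials in \<open>h\<close> reduces the inequality to the scalar one
  at the nodes.
\<close>

lemma pairing_le:
  assumes cont: "cont0 \<phi>" "cont0 \<psi>" "cont0 \<phi>'" "cont0 \<psi>'"
    and le: "\<And>s t. 0 \<le> s \<Longrightarrow> 0 \<le> t \<Longrightarrow> \<phi> s * \<psi> t \<le> \<phi>' s + \<psi>' t"
  shows "T \<phi> \<psi> \<le> T \<phi>' (\<lambda>_. 1) + T (\<lambda>_. 1) \<psi>'"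
proof (rule field_le_epsilon)
  fix \<eta> :: real assume eta: "\<eta> > 0"
  \<comment> \<open>The two summands are the factors with which the approximation errors of \<psi>
    and \<psi>' enter through \<open>pairing_bound\<close>.\<close>
  define C where "C = norm (fc \<phi> a) * ip W W + norm (fc (\<lambda>_. 1) a) * ip W W"
  have C0: "0 \<le> C" using ip_nonneg[OF W] by (simp add: C_def)
  define e where "e = \<eta> / (C + 1)"
  have e: "e > 0" using eta C0 by (simp add: e_def add_nonneg_pos)
  \<comment> \<open>The summand 1 makes the rescaling of the spectrum to the unit interval a
    division by a positive number.\<close>
  define K where "K = norm h + 1"
  have K: "K > 0" by (simp add: K_def add_nonneg_pos)
  have approx: "\<exists>N. \<forall>n\<ge>N. \<forall>t. 0 \<le> t \<and> t \<le> norm h \<longrightarrow>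
      \<bar>f t - (\<Sum>k\<le>n. f (K * (k / n)) * Bernstein n k (t / K))\<bar> \<le> e" if "cont0 f" for f
  proof -
    have "continuous_on {0..1} (\<lambda>t. f (K * t))"
      by (rule continuous_on_compose2[OF that]) (use K in \<open>auto intro!: continuous_intros\<close>)
    from Bernstein_Weierstrass[OF this e] obtain N where
      N: "\<And>n x. N \<le> n \<Longrightarrow> x \<in> {0..1} \<Longrightarrow> \<bar>f (K * x) - (\<Sum>k\<le>n. f (K * (k / n)) * Bernstein n k x)\<bar> < e" by blast
    show ?thesis
    proof (intro exI allI impI)
      fix n t assume "N \<le> n" "0 \<le> t \<and> t \<le> norm h"
      then show "\<bar>f t - (\<Sum>k\<le>n. f (K * (k / n)) * Bernstein n k (t / K))\<bar> \<le> e"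
        using N[of n "t / K"] K by (simp add: K_def)
    qed
  qed
  obtain N1 where N1: "\<And>n t. n \<ge> N1 \<Longrightarrow> 0 \<le> t \<Longrightarrow> t \<le> norm h \<Longrightarrow>
      \<bar>\<psi> t - (\<Sum>k\<le>n. \<psi> (K * (k / n)) * Bernstein n k (t / K))\<bar> \<le> e" using approx[OF cont(2)] by blast
  obtain N2 where N2: "\<And>n t. n \<ge> N2 \<Longrightarrow> 0 \<le> t \<Longrightarrow> t \<le> norm h \<Longrightarrow>
      \<bar>\<psi>' t - (\<Sum>k\<le>n. \<psi>' (K * (k / n)) * Bernstein n k (t / K))\<bar> \<le> e" using approx[OF cont(4)] by blast
  define n where "n = max N1 N2"
  define B where "B k t = Bernstein n k (t / K)" for k t
  define y where "y k = K * (real k / real n)" for k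
  have y0: "0 \<le> y k" for k using K by (simp add: y_def)
  have Bc: "cont0 (B k)" for k unfolding B_def Bernstein_def by (intro continuous_intros) (use K in auto)
  have B0: "0 \<le> B k t" if "0 \<le> t" "t \<le> norm h" for k t
    unfolding B_def using that K by (intro Bernstein_nonneg) (auto simp: K_def)
  have B1: "(\<lambda>_. 1) = (\<lambda>t. \<Sum>k\<le>n. B k t)" by (simp add: B_def sum_Bernstein fun_eq_iff)
  define \<psi>n where "\<psi>n t = (\<Sum>k\<le>n. \<psi> (y k) * B k t)" for t
  define \<psi>n' where "\<psi>n' t = (\<Sum>k\<le>n. \<psi>' (y k) * B k t)" for t
  have c: "cont0 \<psi>n" "cont0 \<psi>n'" unfolding \<psi>n_def \<psi>n'_def by (intro continuous_intros Bc)+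
  have one: "cont0 (\<lambda>_. 1)" by (intro continuous_intros)
  have 1: "T \<phi> \<psi> - T \<phi> \<psi>n \<le> e * (norm (fc \<phi> a) * ip W W)"
  proof -
    have "T \<phi> \<psi> - T \<phi> \<psi>n = T \<phi> (\<lambda>t. \<psi> t - \<psi>n t)" by (simp add: pairing_diff_right cont c)
    also have "\<dots> \<le> \<bar>\<dots>\<bar>" by simp
    also have "\<dots> \<le> e * (norm (fc \<phi> a) * ip W W)"
      by (intro pairing_bound continuous_intros cont c)
        (use N1[of n] in \<open>auto simp: n_def \<psi>n_def y_def B_def\<close>)
    finally show ?thesis .
  qed
  have 2: "T (\<lambda>_. 1) \<psi>n' - T (\<lambda>_. 1) \<psi>' \<le> e * (norm (fc (\<lambda>_. 1) a) * ip W W)"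
  proof -
    have "T (\<lambda>_. 1) \<psi>n' - T (\<lambda>_. 1) \<psi>' = T (\<lambda>_. 1) (\<lambda>t. \<psi>n' t - \<psi>' t)" by (simp add: pairing_diff_right cont c one)
    also have "\<dots> \<le> \<bar>\<dots>\<bar>" by simp
    also have "\<dots> \<le> e * (norm (fc (\<lambda>_. 1) a) * ip W W)"
      by (intro pairing_bound continuous_intros cont c)
        (use N2[of n] in \<open>auto simp: n_def \<psi>n'_def y_def B_def abs_minus_commute\<close>)
    finally show ?thesis .
  qed
  have "T \<phi> \<psi>n = (\<Sum>k\<le>n. \<psi> (y k) * T \<phi> (B k))"
    unfolding \<psi>n_def by (simp add: pairing_sum_right pairing_scale_right cont Bc continuous_on_mult_left)
  also have "\<dots> \<le> (\<Sum>k\<le>n. T \<phi>' (B k) + \<psi>' (y k) * T (\<lambda>_. 1) (B k))"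
  proof (rule sum_mono)
    fix k
    \<comment> \<open>At the fixed node \<open>y k\<close> the hypothesis is an inequality between
      functions of s alone, and pairing with the nonnegative \<open>B k\<close> preserves
      it.\<close>
    have "0 \<le> T (\<lambda>s. (\<phi>' s + \<psi>' (y k) * 1) - \<psi> (y k) * \<phi> s) (B k)"
      by (intro pairing_nonneg continuous_intros cont Bc B0) (use le[OF _ y0] in \<open>auto simp: mult.commute\<close>)
    also have "\<dots> = (T \<phi>' (B k) + \<psi>' (y k) * T (\<lambda>_. 1) (B k)) - \<psi> (y k) * T \<phi> (B k)"
      by (subst pairing_diff_left, (intro continuous_intros cont Bc)+,
          subst pairing_add_left, (intro continuous_intros cont Bc)+,
          simp only: pairing_scale_left[OF one Bc] pairing_scale_left[OF cont(1) Bc])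
    finally show "\<psi> (y k) * T \<phi> (B k) \<le> T \<phi>' (B k) + \<psi>' (y k) * T (\<lambda>_. 1) (B k)" by simp
  qed
  also have "\<dots> = T \<phi>' (\<lambda>_. 1) + T (\<lambda>_. 1) \<psi>n'"
  proof -
    have "T \<phi>' (\<lambda>_. 1) = (\<Sum>k\<le>n. T \<phi>' (B k))"
      by (subst B1) (rule pairing_sum_right[OF cont(3) Bc])
    moreover have "T (\<lambda>_. 1) \<psi>n' = (\<Sum>k\<le>n. \<psi>' (y k) * T (\<lambda>_. 1) (B k))"
      unfolding \<psi>n'_def by (simp add: pairing_sum_right pairing_scale_right one Bc continuous_on_mult_left)
    ultimately show ?thesis by (simp add: sum.distrib)
  qed
  finally have "T \<phi> \<psi> \<le> T \<phi>' (\<lambda>_. 1) + T (\<lambda>_. 1) \<psi>' + e * C"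
    using 1 2 by (simp add: C_def algebra_simps)
  also have "e * C \<le> \<eta>" using eta C0 by (simp add: e_def field_simps)
  finally show "T \<phi> \<psi> \<le> T \<phi>' (\<lambda>_. 1) + T (\<lambda>_. 1) \<psi>' + \<eta>" by simp
qed

end

text \<open>On [0, K] one has t^2 = t^(2 - p) t^p <= K^(2 - p) t^p. This is where p <= 2 makes
  bounded elements of finite p-norm square integrable.\<close>

lemma pnorm_pow_finite_N2:
  assumes x: "x \<in> A" and p: "0 < p" "p \<le> 2" and K: "norm x \<le> K" "0 < K"
  shows "\<tau> (adj x * x) \<le> ennreal (K powr (2 - p)) * pnorm_pow p x"
proof -
  let ?a = "opabs x"
  have c: "cont0 (\<lambda>t. t * t)" "cont0 (\<lambda>t. K powr (2 - p) * t powr p)"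
    by (intro continuous_intros cont0_powr p)+
  have "adj x * x = fc (\<lambda>t. t * t) ?a" by (simp add: fc_mult fc_id continuous_on_id opabs_square)
  also have "\<dots> \<le> fc (\<lambda>t. K powr (2 - p) * t powr p) ?a"
  proof (rule fc_mono[OF opabs_nonneg c])
    fix t :: real assume t: "0 \<le> t" "t \<le> norm ?a"
    have "t * t = t powr (2 - p) * t powr p" using t by (cases "t = 0") (auto simp: power2_eq_square simp flip: powr_add)
    also have "\<dots> \<le> K powr (2 - p) * t powr p"
      using t K p by (intro mult_right_mono powr_mono2) auto
    finally show "t * t \<le> K powr (2 - p) * t powr p" .
  qed
  also have "\<dots> = K powr (2 - p) *\<^sub>R fc (\<lambda>t. t powr p) ?a" by (simp add: fc_scale cont0_powr p)
  finally have "\<tau> (adj x * x) \<le> \<tau> (K powr (2 - p) *\<^sub>R fc (\<lambda>t. t powr p) ?a)"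
    using x p by (intro tr_mono scaleR_closed fc_closed opabs_closed cont0_powr) auto
  also have "\<dots> = ennreal (K powr (2 - p)) * pnorm_pow p x"
    unfolding pnorm_pow_def using x p by (intro tr_scale fc_closed fc_nonneg opabs_closed cont0_powr) auto
  finally show ?thesis .
qed

lemma pnorm_pow_N2: "x \<in> A \<Longrightarrow> 0 < p \<Longrightarrow> p \<le> 2 \<Longrightarrow> pnorm_pow p x < \<infinity> \<Longrightarrow> x \<in> N2"
proof -
  assume h: "x \<in> A" "0 < p" "p \<le> 2" "pnorm_pow p x < \<infinity>"
  then have "\<tau> (adj x * x) \<le> ennreal ((norm x + 1) powr (2 - p)) * pnorm_pow p x"
    by (intro pnorm_pow_finite_N2) (auto simp: add_nonneg_pos)
  also have "\<dots> < \<infinity>" using h by (simp add: ennreal_mult_less_top)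
  finally show ?thesis using h by (simp add: N2_def)
qed

text \<open>Young's inequality with the weights (2 - p) / p and (2 p - 2) / p, which sum to 1, for X
  and Y below. The powers of r in X and Y are chosen to cancel in the product.\<close>

lemma weighted_young:
  fixes p :: real
  assumes p: "1 \<le> p" "p < 2" and l: "0 < r" and s: "0 \<le> s" and u: "0 < u"
  shows "s powr (2 - p) * u powr (2 * p - 2) \<le>
    (2 - p) / p * r powr (2 - 2 * p) * s powr p + (2 * p - 2) / p * r powr (2 - p) * u powr p"
proof (cases "s = 0")
  case True
  then show ?thesis using p by simp
next
  case False
  then have s: "0 < s" using s by simp
  define X Y where "X = r powr (2 - 2 * p) * s powr p" and "Y = r powr (2 - p) * u powr p"
  have XY: "0 < X" "0 < Y" using s u l by (auto simp: X_def Y_def)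
  have young: "X powr ((2 - p) / p) * Y powr ((2 * p - 2) / p) \<le> (2 - p) / p * X + (2 * p - 2) / p * Y"
    by (rule Youngs_inequality_0) (use p XY in \<open>auto simp: field_simps\<close>)
  have X: "X powr ((2 - p) / p) = r powr ((2 - 2 * p) * (2 - p) / p) * s powr (2 - p)"
    using p by (simp add: X_def powr_mult powr_powr)
  have Y: "Y powr ((2 * p - 2) / p) = r powr ((2 - p) * (2 * p - 2) / p) * u powr (2 * p - 2)"
    using p by (simp add: Y_def powr_mult powr_powr)
  have prod: "X powr ((2 - p) / p) * Y powr ((2 * p - 2) / p) = s powr (2 - p) * u powr (2 * p - 2)"
  proof -
    have "(2 - 2 * p) * (2 - p) / p + (2 - p) * (2 * p - 2) / p = 0"
      unfolding add_divide_distrib[symmetric] by (simp add: algebra_simps)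
    then have "r powr ((2 - 2 * p) * (2 - p) / p) * r powr ((2 - p) * (2 * p - 2) / p) = 1"
      using l by (simp flip: powr_add)
    then show ?thesis unfolding X Y by (simp add: mult.assoc mult.left_commute)
        (metis mult.assoc mult.commute mult_1)
  qed
  show ?thesis using young unfolding prod by (simp add: X_def Y_def mult.assoc)
qed

text \<open>The trace of \<open>|S|^2 (\<epsilon> + |S|)^(p - 2)\<close>, which increases to the
  p-th power of the p-norm as \<epsilon> decreases to 0. The shift keeps the negative power bounded,
  so the value is finite for every S in N2.\<close>

definition pnorm_reg :: "real \<Rightarrow> real \<Rightarrow> 'a bop \<Rightarrow> real"
  where "pnorm_reg p \<epsilon> S = ip S (S * fc (\<lambda>t. (\<epsilon> + t) powr (p - 2)) (opabs S))"

text \<open>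
  Hoelder's inequality in the form of Young, with the regularised dual element
  \<open>Z = S (\<epsilon> + |S|)\<^sup>p\<^sup>-\<^sup>2\<close> of \<open>S\<close>.  The factor \<open>g = (\<delta> + |x|)\<^sup>(\<^sup>2\<^sup>-\<^sup>p\<^sup>)\<^sup>/\<^sup>2\<close> is moved from \<open>x\<close> to \<open>Z\<close>, and
  then \<open>\<parallel>Z g\<parallel>\<^sub>2\<close> is a pairing of functions of \<open>|x|\<close> and \<open>|S|\<close>.
\<close>

lemma ip_dual_le:
  assumes x: "x \<in> N2" and S: "S \<in> N2" and p: "1 \<le> p" "p < 2" and r: "0 < r" and \<epsilon>: "0 < \<epsilon>"
    and fin: "pnorm_pow p x < \<infinity>"
  shows "ip x (S * fc (\<lambda>t. (\<epsilon> + t) powr (p - 2)) (opabs S)) \<le>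
    1 / p * r powr (1 - p) * enn2real (pnorm_pow p x) + (1 - 1 / p) * r * pnorm_reg p \<epsilon> S"
proof -
  define a h where "a = opabs x" and "h = opabs S"
  have a: "a \<in> A" "0 \<le> a" "a \<in> N2" and h: "h \<in> A" "0 \<le> h" "h \<in> N2"
    unfolding a_def h_def using x S by (auto simp: N2_A opabs_N2)
  have cs: "cont0 (\<lambda>t. (\<epsilon> + t) powr s)" for s by (rule cont0_shift_powr[OF \<epsilon>])
  note fcm = fc_mult[OF h(2) cs cs, symmetric]
  \<comment> \<open>W is a contraction in N2, which powers of \<open>\<epsilon> + h\<close> need not
    be; \<open>hW\<close> trades a factor h for W and one more power of
    \<open>\<epsilon> + h\<close>. Hence a, h and W fit the pairing.\<close>
  define W where "W = fc (\<lambda>t. t / (\<epsilon> + t)) h"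
  have Wc: "cont0 (\<lambda>t. t / (\<epsilon> + t))" by (intro continuous_intros) (use \<epsilon> in auto)
  have hW: "h * fc (\<lambda>t. (\<epsilon> + t) powr (s - 1)) h = fc (\<lambda>t. (\<epsilon> + t) powr s) h * W" for s
  proof -
    have "h * fc (\<lambda>t. (\<epsilon> + t) powr (s - 1)) h = fc (\<lambda>t. t * (\<epsilon> + t) powr (s - 1)) h"
      by (simp add: fc_mult fc_id h cs continuous_on_id)
    also have "\<dots> = fc (\<lambda>t. (\<epsilon> + t) powr s * (t / (\<epsilon> + t))) h"
      by (rule fc_cong[OF h(2)]) (use \<epsilon> in \<open>simp add: powr_diff\<close>)
    also have "\<dots> = fc (\<lambda>t. (\<epsilon> + t) powr s) h * W" unfolding W_def by (rule fc_mult[OF h(2) cs Wc])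
    finally show ?thesis .
  qed
  have W: "W \<in> N2"
  proof -
    have "h * fc (\<lambda>t. (\<epsilon> + t) powr (0 - 1)) h = fc (\<lambda>t. (\<epsilon> + t) powr 0) h * W" by (rule hW)
    also have "fc (\<lambda>t. (\<epsilon> + t) powr 0) h = fc (\<lambda>t. 1) h"
      by (rule fc_cong[OF h(2)]) (use \<epsilon> in auto)
    finally have "W = h * fc (\<lambda>t. (\<epsilon> + t) powr (0 - 1)) h" using h(2) by (simp add: fc_const)
    also have "\<dots> \<in> N2" by (intro N2_mult_right fc_closed cs h)
    finally show ?thesis .
  qed
  have W1: "norm W \<le> 1" unfolding W_def
    by (rule fc_norm_bound[OF h(2) Wc]) (use \<epsilon> in \<open>auto simp: divide_le_eq\<close>)
  define T where "T = pairing W a h"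
  note T_simps = pairing_add_right[OF W a(1,2) h(1,2), folded T_def] pairing_scale_right[OF W a(1,2) h(1,2), folded T_def]
    pairing_add_left[OF W a(1,2) h(1,2), folded T_def] pairing_scale_left[OF W a(1,2) h(1,2), folded T_def]
  have one: "cont0 (\<lambda>_. 1)" by (intro continuous_intros)
  have fc1: "fc (\<lambda>_. 1) a = 1" "fc (\<lambda>_. 1) h = 1" by (simp_all add: fc_const a h)
  define X where "X = enn2real (pnorm_pow p x)"
  define Z where "Z = S * fc (\<lambda>t. (\<epsilon> + t) powr (p - 2)) h"
  have Z: "Z \<in> N2" unfolding Z_def by (intro N2_mult_right fc_closed cs S h)
  define K where "K = ip S Z"
  have SS: "adj (S * m) * (S * m) = adj (h * m) * (h * m)" for m
    using opabs_square[of S] by (simp add: h_def mult.assoc) (metis mult.assoc)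
  \<comment> \<open>W carries h / (\<epsilon> + h) on both sides, so the power p becomes
    \<open>h^2 (\<epsilon> + h)^(p - 2)\<close>.\<close>
  have TK: "T (\<lambda>_. 1) (\<lambda>t. (\<epsilon> + t) powr p) = K"
  proof -
    have eq: "(\<epsilon> + t) powr s = (\<epsilon> + t) powr (s / 2) * (\<epsilon> + t) powr (s / 2)" for t s by (simp flip: powr_add)
    have "T (\<lambda>_. 1) (\<lambda>t. (\<epsilon> + t) powr p) = T (\<lambda>_. 1 * 1) (\<lambda>t. (\<epsilon> + t) powr (p / 2) * (\<epsilon> + t) powr (p / 2))"
      by (simp flip: eq)
    also have "\<dots> = ip (fc (\<lambda>t. (\<epsilon> + t) powr (p / 2)) h * W) (fc (\<lambda>t. (\<epsilon> + t) powr (p / 2)) h * W)"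
      unfolding T_def using pairing_square[OF W a(1,2) h(1,2) one cs] by (simp add: fc1)
    also have "\<dots> = ip (h * fc (\<lambda>t. (\<epsilon> + t) powr (p / 2 - 1)) h) (h * fc (\<lambda>t. (\<epsilon> + t) powr (p / 2 - 1)) h)"
      by (simp only: hW)
    also have "\<dots> = ip (S * fc (\<lambda>t. (\<epsilon> + t) powr (p / 2 - 1)) h) (S * fc (\<lambda>t. (\<epsilon> + t) powr (p / 2 - 1)) h)"
      by (rule ip_self_cong) (rule SS[symmetric])
    also have "\<dots> = ip S (S * fc (\<lambda>t. (\<epsilon> + t) powr (p / 2 - 1)) h * adj (fc (\<lambda>t. (\<epsilon> + t) powr (p / 2 - 1)) h))"
      by (intro ip_mult_right N2_mult_right fc_closed cs S h)
    also have "\<dots> = ip S (S * (fc (\<lambda>t. (\<epsilon> + t) powr (p / 2 - 1)) h * fc (\<lambda>t. (\<epsilon> + t) powr (p / 2 - 1)) h))"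
      by (simp add: adj_fc h cs mult.assoc)
    also have "fc (\<lambda>t. (\<epsilon> + t) powr (p / 2 - 1)) h * fc (\<lambda>t. (\<epsilon> + t) powr (p / 2 - 1)) h
        = fc (\<lambda>t. (\<epsilon> + t) powr (p - 2)) h"
      unfolding fcm using eq[of _ "p - 2"] by (simp add: diff_divide_distrib)
    finally show ?thesis by (simp add: K_def Z_def)
  qed
  \<comment> \<open>The contraction W can only decrease the 2-norm of
    \<open>a^(p / 2)\<close>.\<close>
  have TX: "T (\<lambda>s. s powr p) (\<lambda>_. 1) \<le> X"
  proof -
    have eq: "s powr p = s powr (p / 2) * s powr (p / 2)" if "0 \<le> s" for s by (simp flip: powr_add)
    have cp: "cont0 (\<lambda>s. s powr (p / 2))" using p by (intro cont0_powr) auto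
    let ?f = "fc (\<lambda>s. s powr (p / 2)) a"
    have ff: "adj ?f * ?f = fc (\<lambda>s. s powr p) a"
      using a p by (simp add: adj_fc cp flip: fc_mult powr_add)
    then have "\<tau> (adj ?f * ?f) < \<infinity>" using fin by (simp add: pnorm_pow_def a_def)
    then have fN: "?f \<in> N2" using a cp by (auto simp: N2_def intro!: fc_closed)
    have "T (\<lambda>s. s powr p) (\<lambda>_. 1) = T (\<lambda>s. s powr (p / 2) * s powr (p / 2)) (\<lambda>_. 1 * 1)"
      by (simp flip: powr_add)
    also have "\<dots> = ip (W * ?f) (W * ?f)"
      unfolding T_def using pairing_square[OF W a(1,2) h(1,2) cp one] by (simp add: fc1)
    also have "\<dots> \<le> (norm W)\<^sup>2 * ip ?f ?f" using W by (intro ip_mult_le fN) (auto simp: N2_A)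
    also have "\<dots> \<le> 1 * ip ?f ?f"
      using W1 by (intro mult_right_mono ip_nonneg fN) (simp add: power_le_one)
    also have "\<dots> = X" unfolding ip_self[OF fN] ff by (simp add: X_def pnorm_pow_def a_def)
    finally show ?thesis .
  qed
  define C where "C = T (\<lambda>_. 1) (\<lambda>t. (\<epsilon> + t) powr (2 * p - 2))"
  have main: "2 * ip x Z \<le> r powr (1 - p) * X + (\<delta> powr (2 - p) * C
      + (2 - p) / p * r powr (2 - 2 * p) * X + (2 * p - 2) / p * r powr (2 - p) * K) / r powr (1 - p)"
    if \<delta>: "\<delta> > 0" for \<delta>
  proof -
    have cd: "cont0 (\<lambda>t. (\<delta> + t) powr s)" for s by (rule cont0_shift_powr[OF \<delta>])
    \<comment> \<open>The shift by \<delta> makes the weight g invertible with inverse g'. Its cost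
      is the term with C, which vanishes in the limit because 2 - p > 0.\<close>
    define g g' where "g = fc (\<lambda>t. (\<delta> + t) powr ((2 - p) / 2)) a" and "g' = fc (\<lambda>t. (\<delta> + t) powr - ((2 - p) / 2)) a"
    have gA: "g \<in> A" "g' \<in> A" "adj g = g" "adj g' = g'"
      unfolding g_def g'_def using a cd by (auto intro!: fc_closed adj_fc)
    have "g' * g = fc (\<lambda>t. (\<delta> + t) powr - ((2 - p) / 2) * (\<delta> + t) powr ((2 - p) / 2)) a"
      unfolding g_def g'_def by (rule fc_mult[OF a(2) cd cd, symmetric])
    also have "\<dots> = fc (\<lambda>_. 1) a"
      by (rule fc_cong[OF a(2)]) (use \<delta> in \<open>simp flip: powr_add\<close>)
    finally have gg: "g' * g = 1" by (simp add: fc1)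
    have "ip x Z = ip (x * g' * g) Z" by (simp add: mult.assoc gg)
    also have "\<dots> = ip (x * g') (Z * g)" using x Z gA by (subst ip_mult_right) (auto intro: N2_mult_right)
    \<comment> \<open>The weight \<open>r powr (1 - p)\<close> gives both terms in X the same power
      of r: their coefficients 1 and (2 - p) / p add up to 2 / p.\<close>
    finally have "2 * ip x Z \<le> r powr (1 - p) * ip (x * g') (x * g') + ip (Z * g) (Z * g) / r powr (1 - p)"
      using ip_young_weighted[of "x * g'" "Z * g" "r powr (1 - p)"] x Z gA r by (simp add: N2_mult_right)
    moreover have "ip (x * g') (x * g') \<le> X"
    proof -
      have "adj (x * g') * (x * g') = g' * (adj x * x) * g'" by (simp add: gA mult.assoc)
      also have "\<dots> = (g' * a) * (a * g')" by (simp add: a_def mult.assoc flip: opabs_square)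
      also have "g' * a = a * g'" unfolding g'_def by (rule fc_commute[OF a(2) cd refl])
      also have "a * g' = fc (\<lambda>t. t * (\<delta> + t) powr - ((2 - p) / 2)) a"
        unfolding g'_def by (simp add: fc_mult fc_id a cd continuous_on_id)
      also have "\<dots> * \<dots> = fc (\<lambda>t. (t * (\<delta> + t) powr - ((2 - p) / 2)) * (t * (\<delta> + t) powr - ((2 - p) / 2))) a"
        by (rule fc_mult[OF a(2), symmetric]; intro continuous_intros cd)
      also have "\<dots> \<le> fc (\<lambda>t. t powr p) a"
      proof (rule fc_mono[OF a(2)])
        show "cont0 (\<lambda>t. t * (\<delta> + t) powr - ((2 - p) / 2) * (t * (\<delta> + t) powr - ((2 - p) / 2)))"
          by (intro continuous_intros cd)
        show "cont0 (\<lambda>t. t powr p)" using p by (intro cont0_powr) auto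
        fix t :: real assume t: "0 \<le> t"
        show "t * (\<delta> + t) powr - ((2 - p) / 2) * (t * (\<delta> + t) powr - ((2 - p) / 2)) \<le> t powr p"
        proof (cases "t = 0")
          case False
          have "t * (\<delta> + t) powr - ((2 - p) / 2) * (t * (\<delta> + t) powr - ((2 - p) / 2))
              = t powr 2 * ((\<delta> + t) powr - ((2 - p) / 2) * (\<delta> + t) powr - ((2 - p) / 2))"
            using t False by (simp add: power2_eq_square)
          also have "\<dots> = t powr 2 * (\<delta> + t) powr (p - 2)" by (simp flip: powr_add)
          also have "\<dots> \<le> t powr 2 * t powr (p - 2)"
            using t False \<delta> p by (intro mult_left_mono powr_mono2') auto
          also have "\<dots> = t powr p" by (simp flip: powr_add)
          finally show ?thesis .
        qed simp
      qed
      finally have "\<tau> (adj (x * g') * (x * g')) \<le> pnorm_pow p x"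
        unfolding pnorm_pow_def a_def[symmetric] using x gA a p
        by (intro tr_mono fc_closed cont0_powr mult_closed adj_closed) (auto simp: N2_A simp del: adj_simps)
      then show ?thesis unfolding X_def using x gA fin by (simp only: ip_self N2_mult_right) (auto intro: enn2real_mono)
    qed
    moreover have "ip (Z * g) (Z * g) \<le> \<delta> powr (2 - p) * C
      + (2 - p) / p * r powr (2 - 2 * p) * X + (2 * p - 2) / p * r powr (2 - p) * K"
    proof -
      let ?G = "fc (\<lambda>t. (\<epsilon> + t) powr (p - 1)) h"
      have "ip (Z * g) (Z * g) = ip (h * (fc (\<lambda>t. (\<epsilon> + t) powr (p - 2)) h * g)) (h * (fc (\<lambda>t. (\<epsilon> + t) powr (p - 2)) h * g))"
        unfolding Z_def mult.assoc by (rule ip_self_cong) (rule SS)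
      also have "\<dots> = ip (?G * W * g) (?G * W * g)" using hW[of "p - 1"] by (simp add: mult.assoc[symmetric])
      also have "\<dots> = T (\<lambda>t. (\<delta> + t) powr ((2 - p) / 2) * (\<delta> + t) powr ((2 - p) / 2))
          (\<lambda>t. (\<epsilon> + t) powr (p - 1) * (\<epsilon> + t) powr (p - 1))"
        unfolding T_def g_def using pairing_square[OF W a(1,2) h(1,2) cd cs] by simp
      also have "\<dots> = T (\<lambda>t. (\<delta> + t) powr (2 - p)) (\<lambda>t. (\<epsilon> + t) powr (2 * p - 2))"
        by (simp flip: powr_add)
      also have "\<dots> \<le> T (\<lambda>s. ((2 - p) / p * r powr (2 - 2 * p)) * s powr p) (\<lambda>_. 1)
          + T (\<lambda>_. 1) (\<lambda>t. \<delta> powr (2 - p) * (\<epsilon> + t) powr (2 * p - 2) + ((2 * p - 2) / p * r powr (2 - p)) * (\<epsilon> + t) powr p)"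
        unfolding T_def
      proof (rule pairing_le[OF W a(1,2) h(1,2) cd cs])
        show "cont0 (\<lambda>s. (2 - p) / p * r powr (2 - 2 * p) * s powr p)"
          "cont0 (\<lambda>t. \<delta> powr (2 - p) * (\<epsilon> + t) powr (2 * p - 2) + (2 * p - 2) / p * r powr (2 - p) * (\<epsilon> + t) powr p)"
          using p by (auto intro!: continuous_intros cs cont0_powr)
        fix s t :: real assume st: "0 \<le> s" "0 \<le> t"
        \<comment> \<open>Subadditivity of a power with exponent in (0, 1]: a fraction in [0, 1] is
          at most its power.\<close>
        have "(\<delta> + s) powr (2 - p) \<le> \<delta> powr (2 - p) + s powr (2 - p)"
        proof -
          have sub: "v powr (2 - p) \<ge> v / (\<delta> + s) * (\<delta> + s) powr (2 - p)" if "0 \<le> v" "v \<le> \<delta> + s" for v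
          proof -
            have "v / (\<delta> + s) \<le> (v / (\<delta> + s)) powr (2 - p)"
            proof (cases "v = 0")
              case False
              then show ?thesis using powr_mono'[of "2 - p" 1 "v / (\<delta> + s)"] that p \<delta> st by (simp add: divide_le_eq)
            qed simp
            then have "v / (\<delta> + s) * (\<delta> + s) powr (2 - p) \<le> (v / (\<delta> + s)) powr (2 - p) * (\<delta> + s) powr (2 - p)"
              by (intro mult_right_mono) auto
            also have "\<dots> = v powr (2 - p)" using that \<delta> st by (simp add: powr_divide)
            finally show ?thesis .
          qed
          have "(\<delta> + s) powr (2 - p) = \<delta> / (\<delta> + s) * (\<delta> + s) powr (2 - p) + s / (\<delta> + s) * (\<delta> + s) powr (2 - p)"
            using \<delta> st by (simp flip: distrib_right add_divide_distrib)
          also have "\<dots> \<le> \<delta> powr (2 - p) + s powr (2 - p)" using sub[of \<delta>] sub[of s] \<delta> st by simp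
          finally show ?thesis .
        qed
        then have "(\<delta> + s) powr (2 - p) * (\<epsilon> + t) powr (2 * p - 2)
            \<le> (\<delta> powr (2 - p) + s powr (2 - p)) * (\<epsilon> + t) powr (2 * p - 2)" by (rule mult_right_mono) simp
        also have "\<dots> = \<delta> powr (2 - p) * (\<epsilon> + t) powr (2 * p - 2) + s powr (2 - p) * (\<epsilon> + t) powr (2 * p - 2)"
          by (simp add: distrib_right)
        also have "s powr (2 - p) * (\<epsilon> + t) powr (2 * p - 2) \<le>
            (2 - p) / p * r powr (2 - 2 * p) * s powr p + (2 * p - 2) / p * r powr (2 - p) * (\<epsilon> + t) powr p"
          by (rule weighted_young[OF p r st(1)]) (use \<epsilon> st in simp)
        finally show "(\<delta> + s) powr (2 - p) * (\<epsilon> + t) powr (2 * p - 2) \<le>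
            (2 - p) / p * r powr (2 - 2 * p) * s powr p +
            (\<delta> powr (2 - p) * (\<epsilon> + t) powr (2 * p - 2) + (2 * p - 2) / p * r powr (2 - p) * (\<epsilon> + t) powr p)"
          by simp
      qed
      also have "\<dots> = ((2 - p) / p * r powr (2 - 2 * p)) * T (\<lambda>s. s powr p) (\<lambda>_. 1)
          + (\<delta> powr (2 - p) * C + ((2 * p - 2) / p * r powr (2 - p)) * K)"
      proof -
        have cp: "cont0 (\<lambda>s. s powr p)" using p by (intro cont0_powr) auto
        have c1: "cont0 (\<lambda>t. c * (\<epsilon> + t) powr s)" for c s by (intro continuous_intros cs)
        show ?thesis unfolding C_def TK[symmetric]
          by (simp only: T_simps(1)[OF one c1 c1] T_simps(2)[OF one cs] T_simps(4)[OF cp one])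
      qed
      also have "((2 - p) / p * r powr (2 - 2 * p)) * T (\<lambda>s. s powr p) (\<lambda>_. 1) \<le> ((2 - p) / p * r powr (2 - 2 * p)) * X"
        using p by (intro mult_left_mono TX) auto
      finally show ?thesis by simp
    qed
    ultimately show ?thesis
      by (smt (verit, best) divide_right_mono mult_left_mono powr_ge_zero)
  qed
  have lim: "((\<lambda>\<delta>. r powr (1 - p) * X + (\<delta> powr (2 - p) * C
      + (2 - p) / p * r powr (2 - 2 * p) * X + (2 * p - 2) / p * r powr (2 - p) * K) / r powr (1 - p))
      \<longlongrightarrow> r powr (1 - p) * X + (0 * C
      + (2 - p) / p * r powr (2 - 2 * p) * X + (2 * p - 2) / p * r powr (2 - p) * K) / r powr (1 - p)) (at_right 0)"
  proof (intro tendsto_intros)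
    show "((\<lambda>\<delta>. \<delta> powr (2 - p)) \<longlongrightarrow> 0) (at_right 0)"
      using p by (intro tendsto_zero_powrI tendsto_ident_at tendsto_const)
        (auto simp: eventually_at_right_less intro: eventually_mono[OF eventually_at_right_less])
  qed (use r in auto)
  have "2 * ip x Z \<le> r powr (1 - p) * X + (0 * C
      + (2 - p) / p * r powr (2 - 2 * p) * X + (2 * p - 2) / p * r powr (2 - p) * K) / r powr (1 - p)"
  proof (rule tendsto_lowerbound[OF lim])
    show "\<forall>\<^sub>F \<delta> in at_right 0. 2 * ip x Z \<le> r powr (1 - p) * X + (\<delta> powr (2 - p) * C
      + (2 - p) / p * r powr (2 - 2 * p) * X + (2 * p - 2) / p * r powr (2 - p) * K) / r powr (1 - p)"
      using eventually_at_right_less[of "0 :: real"] by eventually_elim (rule main)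
  qed simp
  also have "\<dots> = r powr (1 - p) * X + (2 - p) / p * r powr (1 - p) * X + (2 * p - 2) / p * r * K"
  proof -
    have "r powr (2 - 2 * p) = r powr (1 - p) * r powr (1 - p)" "r powr (2 - p) = r powr (1 - p) * r"
      using r by (simp_all flip: powr_add) (simp add: powr_mult_base powr_add[symmetric] mult.commute)
    then show ?thesis using r by (simp add: add_divide_distrib)
  qed
  also have "\<dots> = 2 * (1 / p * r powr (1 - p) * X + (1 - 1 / p) * r * K)"
    using p by (simp add: field_simps)
  finally show ?thesis by (simp add: X_def K_def Z_def pnorm_reg_def h_def)
qed

text \<open>The functions \<open>k n\<close> increase to \<open>t powr p\<close>, uniformly on
  bounded sets, so normality passes the bound to the limit. The trace of \<open>k n\<close> at h is
  the regularised norm with \<epsilon> = 1 / (n + 1).\<close>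

lemma pnorm_pow_le_of_reg:
  assumes S: "S \<in> N2" and p: "1 \<le> p" "p < 2" and le: "\<And>\<epsilon>. 0 < \<epsilon> \<Longrightarrow> pnorm_reg p \<epsilon> S \<le> R"
  shows "pnorm_pow p S \<le> ennreal R"
proof -
  define h where "h = opabs S"
  have h: "h \<in> A" "0 \<le> h" using S by (auto simp: h_def N2_A)
  define k where "k n t = t * (t * (1 / real (Suc n) + t) powr (p - 2))" for n t
  have cs: "cont0 (\<lambda>t. (1 / real (Suc n) + t) powr s)" for n s by (rule cont0_shift_powr) simp
  have ck: "cont0 (k n)" for n unfolding k_def by (intro continuous_intros cs)
  have cp: "cont0 (\<lambda>t. t powr p)" using p by (intro cont0_powr) auto
  have k_le: "k n t \<le> k (Suc n) t" "k n t \<le> t powr p" "t powr p - k n t \<le> 1 / real (Suc n) * (1 + t)"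
    "0 \<le> k n t" if t: "0 \<le> t" for n t
  proof -
    have e: "1 / real (Suc n) > 0" by simp
    show "k n t \<le> k (Suc n) t" unfolding k_def using t p
      by (intro mult_left_mono powr_mono2') (auto intro!: add_pos_nonneg divide_left_mono)
    show "0 \<le> k n t" unfolding k_def using t by simp
    show "k n t \<le> t powr p" "t powr p - k n t \<le> 1 / real (Suc n) * (1 + t)"
    proof -
      have "k n t \<le> t powr p \<and> t powr p - k n t \<le> 1 / real (Suc n) * (1 + t)"
      proof (cases "t = 0")
        case False
        then have t0: "0 < t" using t by simp
        define \<epsilon> where "\<epsilon> = 1 / real (Suc n)"
        have eps: "\<epsilon> > 0" by (simp add: \<epsilon>_def)
        \<comment> \<open>Then \<open>k n t\<close> is t^p v^(2 - p) with v <= v^(2 - p) <= 1, so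
          the error is at most t^p (1 - v) <= \<epsilon> t^(p - 1).\<close>
        define v where "v = t / (\<epsilon> + t)"
        have v: "0 < v" "v \<le> 1" using t0 eps by (auto simp: v_def divide_le_eq)
        have "k n t = t powr 2 * (\<epsilon> + t) powr (p - 2)" using t0 by (simp add: k_def \<epsilon>_def power2_eq_square)
        also have "\<dots> = t powr p * (t powr (2 - p) * (\<epsilon> + t) powr (p - 2))" using t0
          by (simp flip: powr_add mult.assoc)
        also have "t powr (2 - p) * (\<epsilon> + t) powr (p - 2) = v powr (2 - p)"
          using t0 eps by (simp add: v_def powr_divide powr_diff field_simps)
        finally have k: "k n t = t powr p * v powr (2 - p)" .
        have "v powr (2 - p) \<le> 1" using v p by (simp add: powr_le1)
        then have 1: "k n t \<le> t powr p" using mult_left_mono[of "v powr (2 - p)" 1 "t powr p"] by (simp add: k)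
        have "v \<le> v powr (2 - p)" using powr_mono'[of "2 - p" 1 v] v p by simp
        then have "t powr p * v \<le> k n t" unfolding k by (intro mult_left_mono) auto
        then have "t powr p - k n t \<le> t powr p * (1 - v)" by (simp add: algebra_simps)
        also have "1 - v = \<epsilon> / (\<epsilon> + t)" using eps t0 by (simp add: v_def field_simps)
        also have "t powr p * (\<epsilon> / (\<epsilon> + t)) \<le> t powr p * (\<epsilon> / t)"
          using eps t0 by (intro mult_left_mono divide_left_mono) auto
        also have "\<dots> = \<epsilon> * t powr (p - 1)" using t0 by (simp add: powr_diff)
        also have "t powr (p - 1) \<le> 1 + t"
        proof (cases "t \<le> 1")
          case True
          then have "t powr (p - 1) \<le> 1" using t0 p by (simp add: powr_le1)
          then show ?thesis using t0 by simp
        next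
          case False
          then have "t powr (p - 1) \<le> t powr 1" using p by (intro powr_mono) auto
          then show ?thesis using t0 by simp
        qed
        finally have "t powr p - k n t \<le> \<epsilon> * (1 + t)" using eps by (simp add: mult_left_mono)
        then show ?thesis using 1 by (simp add: \<epsilon>_def)
      qed (simp add: k_def)
      then show "k n t \<le> t powr p" "t powr p - k n t \<le> 1 / real (Suc n) * (1 + t)" by auto
    qed
  qed
  have "pnorm_pow p S = (SUP n. \<tau> (fc (k n) h))"
    unfolding pnorm_pow_def h_def[symmetric]
  proof (rule tr_incseq)
    show "fc (k n) h \<in> A" for n by (intro fc_closed h ck)
    show "fc (\<lambda>t. t powr p) h \<in> A" by (intro fc_closed h cp)
    show "0 \<le> fc (k n) h" for n by (intro fc_nonneg h ck k_le)
    show "fc (k n) h \<le> fc (k (Suc n)) h" for n by (intro fc_mono h ck k_le)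
    show "fc (k n) h \<le> fc (\<lambda>t. t powr p) h" for n by (intro fc_mono h ck cp k_le)
    fix \<xi>
    show "(\<lambda>n. ap (fc (k n) h) \<xi>) \<longlonglongrightarrow> ap (fc (\<lambda>t. t powr p) h) \<xi>"
    proof (intro tendsto_bop_ap fc_uniform_limit h ck cp uniform_limitI)
      fix e :: real assume e: "e > 0"
      have "(\<lambda>n. 1 / real (Suc n) * (1 + norm h)) \<longlonglongrightarrow> 0 * (1 + norm h)"
        by (intro tendsto_intros LIMSEQ_Suc[OF lim_1_over_n])
      then have "\<forall>\<^sub>F n in sequentially. 1 / real (Suc n) * (1 + norm h) < e"
        using e by (intro order_tendstoD(2)) auto
      then show "\<forall>\<^sub>F n in sequentially. \<forall>t\<in>{0..norm h}. dist (k n t) (t powr p) < e"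
      proof eventually_elim
        case (elim n)
        show ?case
        proof
          fix t assume "t \<in> {0..norm h}"
          then have t: "0 \<le> t" "t \<le> norm h" by auto
          have "1 / real (Suc n) * (1 + t) \<le> 1 / real (Suc n) * (1 + norm h)" using t by (intro mult_left_mono) auto
          then show "dist (k n t) (t powr p) < e" using k_le[OF t(1), of n] elim by (simp add: dist_real_def)
        qed
      qed
    qed
  qed
  also have "\<dots> \<le> ennreal R"
  proof (rule SUP_least)
    fix n
    let ?c = "fc (\<lambda>t. (1 / real (Suc n) + t) powr (p - 2)) h"
    let ?d = "fc (\<lambda>t. (1 / real (Suc n) + t) powr ((p - 2) / 2)) h"
    have d: "?d \<in> A" "adj ?d = ?d" by (intro fc_closed adj_fc cs h)+
    have dd: "?d * ?d = ?c"
      by (subst fc_mult[OF h(2) cs cs, symmetric]) (simp only: powr_add[symmetric] field_sum_of_halves)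
    have comm: "?d * h = h * ?d" by (intro fc_commute cs h refl)
    have Sd: "S * ?d \<in> N2" by (intro N2_mult_right S d)
    have "fc (k n) h = h * (h * ?c)"
      unfolding k_def
      by (simp only: fc_mult[OF h(2) continuous_on_id continuous_on_mult[OF continuous_on_id cs]]
          fc_mult[OF h(2) continuous_on_id cs] fc_id[OF h(2)])
    also have "\<dots> = ?d * (h * h) * ?d"
    proof -
      have "h * (?d * z) = ?d * (h * z)" for z by (simp only: comm flip: mult.assoc)
      then show ?thesis by (simp only: dd[symmetric] mult.assoc)
    qed
    also have "h * h = adj S * S" by (simp add: h_def opabs_square)
    also have "?d * (adj S * S) * ?d = adj (S * ?d) * (S * ?d)" by (simp only: adj_simps d mult.assoc)
    finally have "\<tau> (fc (k n) h) = ennreal (ip (S * ?d) (S * ?d))" using tr_eq_ip[OF Sd] by simp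
    also have "ip (S * ?d) (S * ?d) = ip S (S * ?d * adj ?d)" by (intro ip_mult_right S Sd d)
    also have "\<dots> = pnorm_reg p (1 / real (Suc n)) S" unfolding d(2) mult.assoc dd unfolding pnorm_reg_def h_def ..
    also have "ennreal \<dots> \<le> ennreal R" by (intro ennreal_leI le) simp
    finally show "\<tau> (fc (k n) h) \<le> ennreal R" .
  qed
  finally show ?thesis .
qed

section \<open>Minkowski's inequality and unitary invariance of the p-norm\<close>

lemma pnorm_pow_2: "x \<in> A \<Longrightarrow> pnorm_pow 2 x = \<tau> (adj x * x)"
proof -
  have "fc (\<lambda>t. t powr 2) (opabs x) = fc (\<lambda>t. t * t) (opabs x)"
    by (rule fc_cong) (auto simp: power2_eq_square)
  then show ?thesis by (simp add: pnorm_pow_def fc_mult fc_id continuous_on_id opabs_square)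
qed

text \<open>Splitting K, the regularised norm of x + y, as \<open>ip x Z + ip y Z\<close> and using
  \<open>ip_dual_le\<close> with the weights r and 1 - r, the terms with K add up to (1 - 1 / p) K
  and are absorbed on the left. Keeping r free replaces Hoelder's inequality for norms.\<close>

lemma pnorm_pow_add_le:
  assumes x: "x \<in> A" and y: "y \<in> A" and p: "1 \<le> p" "p \<le> 2" and r: "0 < r" "r < 1"
    and fin: "pnorm_pow p x < \<infinity>" "pnorm_pow p y < \<infinity>"
  shows "pnorm_pow p (x + y) \<le> ennreal (r powr (1 - p) * enn2real (pnorm_pow p x)
    + (1 - r) powr (1 - p) * enn2real (pnorm_pow p y))"
proof -
  have N2: "x \<in> N2" "y \<in> N2" using pnorm_pow_N2[of _ p] x y p fin by auto
  then have S: "x + y \<in> N2" by (rule N2_add)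
  show ?thesis
  proof (cases "p = 2")
    \<comment> \<open>At p = 2 the expansion of the square and \<open>ip_young_weighted\<close> with
      weight (1 - r) / r give the same bound.\<close>
    case True
    have "2 * ip x y \<le> (1 - r) / r * ip x x + ip y y / ((1 - r) / r)"
      using r by (intro ip_young_weighted N2) auto
    then have "ip (x + y) (x + y) \<le> ip x x * (1 + (1 - r) / r) + ip y y * (1 + r / (1 - r))"
      using N2 by (simp add: ip_add_left ip_add_right N2_add ip_commute[of y x] algebra_simps)
    also have "1 + (1 - r) / r = 1 / r" using r by (simp add: field_simps)
    also have "1 + r / (1 - r) = 1 / (1 - r)" using r by (simp add: field_simps)
    finally have le: "ip (x + y) (x + y) \<le> 1 / r * ip x x + 1 / (1 - r) * ip y y" by simp
    have "pnorm_pow p (x + y) = ennreal (ip (x + y) (x + y))"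
      using x y by (simp only: True pnorm_pow_2 add_closed tr_eq_ip[OF S])
    also have "\<dots> \<le> ennreal (1 / r * ip x x + 1 / (1 - r) * ip y y)" by (rule ennreal_leI[OF le])
    also have "\<dots> = ennreal (r powr (1 - p) * enn2real (pnorm_pow p x) + (1 - r) powr (1 - p) * enn2real (pnorm_pow p y))"
      using x y r N2 by (simp add: True pnorm_pow_2 ip_self powr_minus_divide)
    finally show ?thesis .
  next
    case False
    then have p: "1 \<le> p" "p < 2" using p by auto
    define X Y where "X = enn2real (pnorm_pow p x)" and "Y = enn2real (pnorm_pow p y)"
    show ?thesis unfolding X_def[symmetric] Y_def[symmetric]
    proof (rule pnorm_pow_le_of_reg[OF S p])
      fix \<epsilon> :: real assume e: "\<epsilon> > 0"
      let ?Z = "(x + y) * fc (\<lambda>t. (\<epsilon> + t) powr (p - 2)) (opabs (x + y))"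
      define K where "K = pnorm_reg p \<epsilon> (x + y)"
      have Z: "?Z \<in> N2" using x y by (intro N2_mult_right S fc_closed opabs_closed cont0_shift_powr e) auto
      have "K = ip x ?Z + ip y ?Z" unfolding K_def pnorm_reg_def by (rule ip_add_left[OF N2 Z])
      also have "\<dots> \<le> (1 / p * r powr (1 - p) * X + (1 - 1 / p) * r * K)
          + (1 / p * (1 - r) powr (1 - p) * Y + (1 - 1 / p) * (1 - r) * K)"
        unfolding X_def Y_def K_def using r by (intro add_mono ip_dual_le N2 S p e fin) auto
      also have "\<dots> = 1 / p * (r powr (1 - p) * X + (1 - r) powr (1 - p) * Y) + (1 - 1 / p) * K"
        by (simp add: algebra_simps diff_divide_distrib)
      finally have "1 / p * K \<le> 1 / p * (r powr (1 - p) * X + (1 - r) powr (1 - p) * Y)"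
        by (simp add: algebra_simps)
      then show "pnorm_reg p \<epsilon> (x + y) \<le> r powr (1 - p) * X + (1 - r) powr (1 - p) * Y"
        using p unfolding K_def[symmetric] by (simp add: divide_le_cancel)
    qed
  qed
qed

definition pnorm :: "real \<Rightarrow> 'a bop \<Rightarrow> real"
  where "pnorm p x = enn2real (pnorm_pow p x) powr (1 / p)"

theorem minkowski:
  assumes x: "x \<in> A" and y: "y \<in> A" and p: "1 \<le> p" "p \<le> 2"
    and fin: "pnorm_pow p x < \<infinity>" "pnorm_pow p y < \<infinity>"
  shows "pnorm_pow p (x + y) < \<infinity>" "pnorm p (x + y) \<le> pnorm p x + pnorm p y"
proof -
  have "pnorm_pow p (x + y) \<le> ennreal ((1/2) powr (1 - p) * enn2real (pnorm_pow p x)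
    + (1 - 1/2) powr (1 - p) * enn2real (pnorm_pow p y))"
    by (intro pnorm_pow_add_le assms) auto
  then show fin': "pnorm_pow p (x + y) < \<infinity>" using ennreal_less_top le_less_trans infinity_ennreal_def by metis
  show "pnorm p (x + y) \<le> pnorm p x + pnorm p y"
  proof (rule field_le_epsilon)
    fix e :: real assume e: "e > 0"
    \<comment> \<open>Adding e / 2 keeps both numbers positive, so that the ratio below lies
      strictly between 0 and 1.\<close>
    define X Y where "X = pnorm p x + e / 2" and "Y = pnorm p y + e / 2"
    have XY: "X > 0" "Y > 0" unfolding X_def Y_def pnorm_def using e by (auto intro!: add_nonneg_pos)
    have Np: "enn2real (pnorm_pow p z) \<le> Z powr p" if "pnorm p z \<le> Z" for z Z
    proof -
      have "enn2real (pnorm_pow p z) = pnorm p z powr p" using p by (simp add: pnorm_def powr_powr)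
      also have "\<dots> \<le> Z powr p" using that p by (intro powr_mono2) (auto simp: pnorm_def)
      finally show ?thesis .
    qed
    \<comment> \<open>The minimiser over r of \<open>r^(1 - p) X^p + (1 - r)^(1 - p) Y^p\<close>
      when p > 1; the value there is (X + Y)^p.\<close>
    define r where "r = X / (X + Y)"
    have r: "0 < r" "r < 1" "1 - r = Y / (X + Y)" using XY by (auto simp: r_def field_simps)
    have s: "0 < X + Y" using XY by simp
    have "enn2real (pnorm_pow p (x + y)) \<le> r powr (1 - p) * enn2real (pnorm_pow p x)
        + (1 - r) powr (1 - p) * enn2real (pnorm_pow p y)"
      using pnorm_pow_add_le[OF x y p r(1,2) fin] by (intro enn2real_leI) auto
    also have "\<dots> \<le> r powr (1 - p) * X powr p + (1 - r) powr (1 - p) * Y powr p"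
      using e by (intro add_mono mult_left_mono Np) (auto simp: X_def Y_def)
    also have "\<dots> = (X + Y) powr p"
    proof -
      have "(Z / (X + Y)) powr (1 - p) * Z powr p = Z / (X + Y) * (X + Y) powr p" if "0 < Z" for Z
      proof -
        have "(Z / (X + Y)) powr (1 - p) * Z powr p = Z powr (1 - p) * Z powr p / (X + Y) powr (1 - p)"
          using that s by (simp add: powr_divide)
        also have "\<dots> = Z / (X + Y) powr (1 - p)" using that by (simp flip: powr_add)
        also have "\<dots> = Z / (X + Y) * (X + Y) powr p" using s by (simp add: powr_diff)
        finally show ?thesis .
      qed
      then have "r powr (1 - p) * X powr p + (1 - r) powr (1 - p) * Y powr p
          = X / (X + Y) * (X + Y) powr p + Y / (X + Y) * (X + Y) powr p"         unfolding r(3) unfolding r_def using XY by simp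
      also have "\<dots> = (X + Y) powr p" using s by (simp flip: distrib_right add_divide_distrib)
      finally show ?thesis .
    qed
    finally have "enn2real (pnorm_pow p (x + y)) powr (1 / p) \<le> ((X + Y) powr p) powr (1 / p)"
      using p by (intro powr_mono2) auto
    then show "pnorm p (x + y) \<le> pnorm p x + pnorm p y + e"
      using p s by (simp add: powr_powr pnorm_def[of p "x + y"]) (simp add: X_def Y_def)
  qed
qed

lemma pnorm_pow_cong: "adj x * x = adj y * y \<Longrightarrow> pnorm_pow p x = pnorm_pow p y"
  by (simp add: pnorm_pow_def opabs_def)

lemma pnorm_pow_0: "0 < p \<Longrightarrow> pnorm_pow p 0 = 0"
proof -
  assume "0 < p"
  moreover have "opabs (0 :: 'a bop) = 0" by (metis norm_opabs norm_eq_zero)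
  ultimately have "fc (\<lambda>t. t powr p) (opabs (0 :: 'a bop)) = fc (\<lambda>t. 0) 0"
    by (simp only:) (rule fc_cong, auto)
  then show ?thesis by (simp add: pnorm_pow_def fc_const)
qed

lemma pnorm_eq_0:
  assumes "x \<in> A" "1 \<le> p" "p \<le> 2" "pnorm_pow p x < \<infinity>" "pnorm p x = 0"
  shows "x = 0"
proof -
  have "pnorm_pow p x = 0" using assms by (auto simp: pnorm_def enn2real_eq_0_iff)
  then have "\<tau> (adj x * x) \<le> 0"
    using pnorm_pow_finite_N2[of x p "norm x + 1"] assms by (simp add: add_nonneg_pos)
  then have "adj x * x = 0" using assms(1) by (intro faithful) auto
  then show ?thesis using norm_adj_mult_self[of x] by simp
qed

text \<open>Left multiplication preserves the absolute value, right multiplication conjugates it by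
  u. The trace is invariant under conjugation because \<open>tr_conj_le\<close> applies to u and to
  \<open>adj u\<close>, both of norm at most 1.\<close>

lemma pnorm_pow_unitary:
  assumes x: "x \<in> A" and u: "u \<in> A" "adj u * u = 1" "u * adj u = 1" and p: "0 < p"
  shows "pnorm_pow p (u * x) = pnorm_pow p x" "pnorm_pow p (x * u) = pnorm_pow p x"
proof -
  show "pnorm_pow p (u * x) = pnorm_pow p x"
    by (rule pnorm_pow_cong) (simp add: mult.assoc, simp flip: mult.assoc add: u)
  have conj: "(adj u * a * u) * (adj u * b * u) = adj u * (a * b) * u" for a b
  proof -
    have "(adj u * a * u) * (adj u * b * u) = adj u * a * (u * adj u) * b * u" by (simp only: mult.assoc)
    then show ?thesis by (simp add: u mult.assoc)
  qed
  have "opabs (x * u) = adj u * opabs x * u"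
    unfolding opabs_def[of "x * u"]
    by (rule opsqrt_unique) (simp_all add: conj conj_nonneg opabs_square, simp add: mult.assoc)
  then have "fc (\<lambda>t. t powr p) (opabs (x * u)) = adj u * fc (\<lambda>t. t powr p) (opabs x) * u"
    using fc_conj_unitary[OF opabs_nonneg cont0_powr[OF p] u(3,2), of x] by simp
  moreover have "\<tau> (adj u * b * u) = \<tau> b" if "b \<in> A" "0 \<le> b" for b
  proof (rule antisym)
    have le: "\<tau> (adj v * c * v) \<le> \<tau> c" if "v \<in> A" "adj v * v = 1" "c \<in> A" "0 \<le> c" for v c
    proof -
      have "(norm v)\<^sup>2 \<le> 1" unfolding norm_adj_mult_self[of v, symmetric] that(2) by (rule norm_bop_one)
      then have "ennreal ((norm v)\<^sup>2) * \<tau> c \<le> 1 * \<tau> c" by (intro mult_right_mono) auto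
      then show ?thesis using tr_conj_le[OF that(3,4,1)] by simp
    qed
    show "\<tau> (adj u * b * u) \<le> \<tau> b" using that u by (intro le)
    have "adj (adj u) * (adj u * b * u) * adj u = (u * adj u) * b * (u * adj u)" by (simp add: mult.assoc)
    then show "\<tau> b \<le> \<tau> (adj u * b * u)"
      using le[of "adj u" "adj u * b * u"] that u conj_nonneg[OF that(2), of u] by simp
  qed
  ultimately show "pnorm_pow p (x * u) = pnorm_pow p x"
    unfolding pnorm_pow_def using x p by (simp add: fc_closed fc_nonneg opabs_closed cont0_powr)
qed

end

section \<open>A projection of finite trace\<close>

lemma ex_projection:
  fixes S :: "'a::hilbert set"
  assumes cl: "closed S" and sub: "subspace S"
  obtains P where "adj P = P" "P * P = P" "\<And>\<xi>. ap P \<xi> \<in> S" "\<And>\<xi>. \<xi> \<in> S \<Longrightarrow> ap P \<xi> = \<xi>"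
proof -
  have "\<exists>y. y \<in> S \<and> (\<forall>z\<in>S. inner (x - y) z = 0)" for x
    by (rule closed_subspace_nearest[OF cl sub, of x]) blast
  then obtain f where "\<forall>x. f x \<in> S \<and> (\<forall>z\<in>S. inner (x - f x) z = 0)"
    using choice[of "\<lambda>x y. y \<in> S \<and> (\<forall>z\<in>S. inner (x - y) z = 0)"] by blast
  then have f: "\<And>x. f x \<in> S" "\<And>x z. z \<in> S \<Longrightarrow> inner (x - f x) z = 0" by auto
  have uniq: "f x = y" if "y \<in> S" "\<And>z. z \<in> S \<Longrightarrow> inner (x - y) z = 0" for x y
  proof -
    have d: "f x - y \<in> S" using f that sub by (simp add: subspace_diff)
    have "inner (f x - y) (f x - y) = inner (x - y) (f x - y) - inner (x - f x) (f x - y)"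
      by (simp add: inner_diff_left)
    also have "\<dots> = 0" using that(2)[OF d] f(2)[OF d] by simp
    finally show ?thesis by simp
  qed
  have "bounded_linear f"
  proof (rule bounded_linear_intro[of _ 1])
    show "f (x + y) = f x + f y" for x y
    proof (rule uniq)
      show "f x + f y \<in> S" by (intro subspace_add sub f)
      show "inner (x + y - (f x + f y)) z = 0" if "z \<in> S" for z
        using f(2)[OF that, of x] f(2)[OF that, of y] by (simp add: inner_diff_left inner_add_left)
    qed
    show "f (r *\<^sub>R x) = r *\<^sub>R f x" for x r
    proof (rule uniq)
      show "r *\<^sub>R f x \<in> S" by (intro subspace_scale sub f)
      show "inner (r *\<^sub>R x - r *\<^sub>R f x) z = 0" if "z \<in> S" for z
        using f(2)[OF that, of x] by (simp flip: scaleR_diff_right)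
    qed
    show "norm (f x) \<le> norm x * 1" for x
    proof -
      have "(norm (f x))\<^sup>2 = inner x (f x)" using f(2)[OF f(1)[of x], of x] by (simp add: power2_norm_eq_inner inner_diff_left)
      also have "\<dots> \<le> norm x * norm (f x)" by (rule norm_cauchy_schwarz)
      finally show ?thesis by (cases "norm (f x) = 0") (auto simp: power2_eq_square)
    qed
  qed
  then obtain P where P: "ap P = f" using ex_bop by blast
  show thesis
  proof (rule that)
    show "ap P \<xi> \<in> S" for \<xi> by (simp add: P f)
    show fix_S: "ap P \<xi> = \<xi>" if "\<xi> \<in> S" for \<xi> unfolding P by (rule uniq[OF that]) simp
    show "P * P = P" by (rule bop_eqI) (simp add: fix_S[unfolded P] P f(1))
    show "adj P = P"
    proof (rule adj_unique)
      fix \<xi> \<eta>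
      have "inner (f \<xi>) \<eta> = inner (f \<xi>) (f \<eta>)" using f(2)[OF f(1)[of \<xi>], of \<eta>] by (simp add: inner_diff_left) (simp add: inner_commute)
      moreover have "inner \<xi> (f \<eta>) = inner (f \<xi>) (f \<eta>)" using f(2)[OF f(1)[of \<eta>], of \<xi>] by (simp add: inner_diff_left)
      ultimately show "inner (ap P \<xi>) \<eta> = inner \<xi> (ap P \<eta>)" by (simp add: P)
    qed
  qed
qed

lemma quad_add_le:
  assumes "0 \<le> a"
  shows "inner (\<xi> + \<eta>) (ap a (\<xi> + \<eta>)) \<le> 2 * inner \<xi> (ap a \<xi>) + 2 * inner \<eta> (ap a \<eta>)"
proof -
  have "0 \<le> inner (\<xi> - \<eta>) (ap a (\<xi> - \<eta>))" using assms by (simp add: bop_nonneg_iff)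
  then show ?thesis by (simp add: inner_simps ap_arg_simps)
qed

lemma sum_adj_mult_nonneg: "0 \<le> (\<Sum>v\<in>I. adj v * v)"
  by (intro sum_nonneg) simp

context traced
begin

definition kernel_compl :: "'a bop set \<Rightarrow> 'a bop"
  where "kernel_compl V = (SOME e. adj e = e \<and> e * e = e \<and> e \<in> A \<and> (\<forall>\<xi>. ap e \<xi> = 0 \<longleftrightarrow> (\<forall>v\<in>V. ap v \<xi> = 0)))"

text \<open>The common kernel S is invariant under the commutant of A, which is closed under
  adjoints; hence the projection onto S commutes with the commutant and lies in the
  bicommutant.\<close>

lemma kernel_compl:
  assumes "V \<subseteq> A"
  shows "adj (kernel_compl V) = kernel_compl V" "kernel_compl V * kernel_compl V = kernel_compl V"
    "kernel_compl V \<in> A" "ap (kernel_compl V) \<xi> = 0 \<longleftrightarrow> (\<forall>v\<in>V. ap v \<xi> = 0)"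
proof -
  define S where "S = {\<xi>. \<forall>v\<in>V. ap v \<xi> = 0}"
  have sub: "subspace S" by (auto simp: S_def subspace_def ap_arg_simps)
  have "S = (\<Inter>v\<in>V. {\<xi>. ap v \<xi> = 0})" by (auto simp: S_def)
  then have cl: "closed S" by (auto intro!: closed_INT closed_Collect_eq continuous_intros)
  obtain P where P: "adj P = P" "P * P = P" "\<And>\<xi>. ap P \<xi> \<in> S" "\<And>\<xi>. \<xi> \<in> S \<Longrightarrow> ap P \<xi> = \<xi>"
    using ex_projection[OF cl sub] by metis
  have PyP: "P * (y * P) = y * P" if "y \<in> cent A" for y
  proof (rule bop_eqI)
    fix \<xi>
    have "ap v (ap y (ap P \<xi>)) = 0" if "v \<in> V" for v
    proof -
      have "v * y = y * v" using assms that \<open>y \<in> cent A\<close> by (intro memD) auto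
      then have "ap v (ap y (ap P \<xi>)) = ap y (ap v (ap P \<xi>))" by (metis ap_simps(7))
      then show ?thesis using P(3)[of \<xi>] that by (simp add: S_def ap_arg_simps)
    qed
    then have "ap y (ap P \<xi>) \<in> S" by (simp add: S_def)
    then show "ap (P * (y * P)) \<xi> = ap (y * P) \<xi>" by (simp add: P(4))
  qed
  have PA: "P \<in> A"
  proof (rule memI)
    fix y assume y: "y \<in> cent A"
    have "adj (P * (adj y * P)) = adj (adj y * P)" by (simp only: PyP[OF adj_cent[OF y]])
    then have "P * (y * P) = P * y" by (simp add: P(1) mult.assoc)
    then show "P * y = y * P" using PyP[OF y] by simp
  qed
  have "\<exists>e. adj e = e \<and> e * e = e \<and> e \<in> A \<and> (\<forall>\<xi>. ap e \<xi> = 0 \<longleftrightarrow> (\<forall>v\<in>V. ap v \<xi> = 0))"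
  proof (intro exI conjI allI)
    show "adj (1 - P) = 1 - P" "1 - P \<in> A" by (auto simp: P PA)
    show "(1 - P) * (1 - P) = 1 - P" by (simp add: algebra_simps P)
    show "ap (1 - P) \<xi> = 0 \<longleftrightarrow> (\<forall>v\<in>V. ap v \<xi> = 0)" for \<xi>
      using P(3,4)[of \<xi>] by (auto simp: S_def)
  qed
  from someI_ex[OF this, folded kernel_compl_def] show
    "adj (kernel_compl V) = kernel_compl V" "kernel_compl V * kernel_compl V = kernel_compl V"
    "kernel_compl V \<in> A" "ap (kernel_compl V) \<xi> = 0 \<longleftrightarrow> (\<forall>v\<in>V. ap v \<xi> = 0)" by auto
qed

section \<open>Trace bound for the orthogonal complement of the fixed vectors\<close>

context
  fixes V :: "'a bop set" and F :: "'a bop \<Rightarrow> real" and R :: real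
  assumes V: "V \<subseteq> N2"
    and F_add: "\<And>x y. x \<in> N2 \<Longrightarrow> y \<in> N2 \<Longrightarrow> F (x + y) = F x + F y"
    and F_bound: "\<And>x. x \<in> N2 \<Longrightarrow> \<bar>F x\<bar> \<le> R * sqrt (ip x x)"
    and F_cocycle: "\<And>v x. v \<in> V \<Longrightarrow> x \<in> N2 \<Longrightarrow> F (adj v * x) = - ip v x"
begin

lemma V_A: "V \<subseteq> A"
  using V N2_A by blast

lemma F_sum: "(\<And>i. i \<in> I \<Longrightarrow> f i \<in> N2) \<Longrightarrow> finite I \<Longrightarrow> F (sum f I) = (\<Sum>i\<in>I. F (f i)) \<and> sum f I \<in> N2"
proof (induction I rule: infinite_finite_induct)
  case empty
  have "F (0 + 0) = F 0 + F 0" by (intro F_add N2_0)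
  then show ?case by (simp add: N2_0)
qed (auto simp: F_add N2_add)

text \<open>With \<open>c = g(h) h\<close>, the element \<open>adj c * c\<close> is the sum of the
  \<open>adj v * (v * g(h) * c)\<close>. The cocycle identity moves each v into the inner product,
  where the v recombine to h and F takes the value \<open>- ip c c\<close>. Since norm c <= 1,
  \<open>F_bound\<close> gives \<open>ip c c <= R sqrt (ip c c)\<close>.\<close>

lemma ip_fc_le:
  assumes I: "finite I" "I \<subseteq> V" and h: "h = (\<Sum>v\<in>I. adj v * v)"
    and g: "cont0 g" "\<And>t. 0 \<le> t \<Longrightarrow> \<bar>g t * t\<bar> \<le> 1" and R: "0 \<le> R"
  shows "fc (\<lambda>t. g t * t) h \<in> N2" "ip (fc (\<lambda>t. g t * t) h) (fc (\<lambda>t. g t * t) h) \<le> R\<^sup>2"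
proof -
  define c where "c = fc (\<lambda>t. g t * t) h"
  have h0: "0 \<le> h" unfolding h by (rule sum_adj_mult_nonneg)
  have vN: "v \<in> N2" "v \<in> A" if "v \<in> I" for v using that I V V_A by auto
  have hN: "h \<in> N2" unfolding h
    by (rule conjunct2[OF F_sum]) (auto intro: N2_mult_left adj_closed vN I)
  have hA: "h \<in> A" using hN by (rule N2_A)
  have gA: "fc g h \<in> A" by (intro fc_closed hA h0 g)
  have cg: "c = fc g h * h" unfolding c_def by (simp add: fc_mult fc_id h0 g continuous_on_id)
  have cgt: "cont0 (\<lambda>t. g t * t)" by (intro continuous_intros g)
  have adjc: "adj c = c" unfolding c_def by (rule adj_fc[OF h0 cgt])
  have cN: "c \<in> N2" unfolding cg by (intro N2_mult_left hN gA)
  then show "fc (\<lambda>t. g t * t) h \<in> N2" by (simp add: c_def)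
  have c1: "norm c \<le> 1" unfolding c_def by (rule fc_norm_bound[OF h0 cgt g(2)])
  have ipsum: "(\<Sum>i\<in>I. ip (f i) z) = ip (sum f I) z \<and> sum f I \<in> N2"
    if "\<And>i. i \<in> I \<Longrightarrow> f i \<in> N2" "z \<in> N2" for f z
    using I(1) that(1)
  proof (induction I rule: finite_induct)
    case empty
    then show ?case using ip_scale_left[OF that(2) that(2), of 0] by (simp add: N2_0)
  qed (auto simp: ip_add_left N2_add that(2))
  have "adj c * c = h * fc g h * c" using adjc by (simp add: cg adj_fc h0 g adj_nonneg)
  also have "\<dots> = (\<Sum>v\<in>I. adj v * (v * fc g h * c))" unfolding h by (simp add: sum_distrib_right mult.assoc)
  finally have "F (adj c * c) = (\<Sum>v\<in>I. F (adj v * (v * fc g h * c)))"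
    using conjunct1[OF F_sum[of I "\<lambda>v. adj v * (v * fc g h * c)"]] I vN gA cN
    by (simp add: N2_mult_left adj_closed)
  also have "\<dots> = (\<Sum>v\<in>I. - ip v (v * fc g h * c))"
    using I vN gA cN by (intro sum.cong refl F_cocycle N2_mult_left mult_closed) auto
  also have "\<dots> = - (\<Sum>v\<in>I. ip (fc g h * (adj v * v)) c)"
    unfolding sum_negf[symmetric]
    by (simp only: ip_mult_left adj_fc[OF h0 g(1)] adj_adj mult.assoc)
  also have "(\<Sum>v\<in>I. ip (fc g h * (adj v * v)) c) = ip (\<Sum>v\<in>I. fc g h * (adj v * v)) c"
    using ipsum[of "\<lambda>v. fc g h * (adj v * v)" c] vN gA cN by (simp add: N2_mult_left adj_closed)
  also have "(\<Sum>v\<in>I. fc g h * (adj v * v)) = c" by (simp add: cg h sum_distrib_left)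
  finally have Fc: "F (adj c * c) = - ip c c" .
  have "ip c c \<le> \<bar>F (adj c * c)\<bar>" by (simp add: Fc)
  also have "\<dots> \<le> R * sqrt (ip (adj c * c) (adj c * c))"
    using cN by (intro F_bound N2_mult_left) (auto simp: N2_A)
  also have "\<dots> \<le> R * sqrt (ip c c)"
  proof (intro mult_left_mono real_sqrt_le_mono R)
    have "ip (adj c * c) (adj c * c) \<le> (norm (adj c))\<^sup>2 * ip c c" using cN by (intro ip_mult_le) (auto simp: N2_A)
    also have "\<dots> \<le> 1 * ip c c" using c1 by (intro mult_right_mono ip_nonneg cN) (simp add: power_le_one)
    finally show "ip (adj c * c) (adj c * c) \<le> ip c c" by simp
  qed
  finally have "sqrt (ip c c) * sqrt (ip c c) \<le> R * sqrt (ip c c)" by (simp add: ip_nonneg cN)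
  then have "sqrt (ip c c) \<le> R" using R ip_nonneg[OF cN]
    by (cases "ip c c = 0") (simp_all del: real_sqrt_mult_self add: mult_le_cancel_right)
  then have "(sqrt (ip c c))\<^sup>2 \<le> R\<^sup>2" by (intro power_mono) (auto simp: ip_nonneg cN)
  then show "ip (fc (\<lambda>t. g t * t) h) (fc (\<lambda>t. g t * t) h) \<le> R\<^sup>2" by (simp add: c_def[symmetric] ip_nonneg cN)
qed

text \<open>The root of \<theta> is not g(t) t with g continuous at 0 (unless k = 0), so
  \<open>ip_fc_le\<close> does not apply to it directly. The functions \<sigma> do have this form, f
  = \<theta> \<sigma>^2 lies below \<sigma>^2, and f increases to \<theta>, uniformly because
  \<theta> - f = \<theta> (1 + \<sigma>) (1 - \<sigma>) <= 2 k / j.\<close>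

lemma tr_resolvent_le:
  assumes I: "finite I" "I \<subseteq> V" and h: "h = (\<Sum>v\<in>I. adj v * v)" and R: "0 \<le> R" and k: "0 \<le> k"
  shows "\<tau> (resolvent (k *\<^sub>R h)) \<le> ennreal (R\<^sup>2)"
proof -
  have h0: "0 \<le> h" unfolding h by (rule sum_adj_mult_nonneg)
  have hA: "h \<in> A" unfolding h using I V_A by (intro sum_closed mult_closed adj_closed) auto
  define \<theta> where "\<theta> t = k * t / (1 + k * t)" for t
  define g where "g j t = real j / (1 + real j * t)" for j t
  define \<sigma> where "\<sigma> j t = g j t * t" for j t
  have res: "resolvent (k *\<^sub>R h) = fc \<theta> h"
    unfolding resolvent_def \<theta>_def by (rule fc_scaleR[OF h0 k cont0_resolvent(1)])
  have pos: "1 + c * t > 0" if "0 \<le> c" "0 \<le> t" for c t :: real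
    using that by (simp add: add_pos_nonneg)
  have cg: "cont0 (g j)" for j unfolding g_def using pos[of "real j"]
    by (intro continuous_intros) (auto simp: less_imp_neq[symmetric] dest: pos)
  have cs: "cont0 (\<sigma> j)" for j unfolding \<sigma>_def by (intro continuous_intros cg)
  have cx: "cont0 \<theta>" unfolding \<theta>_def using pos[OF k] by (intro continuous_intros) (metis atLeast_iff less_irrefl)
  define f where "f j t = \<theta> t * (\<sigma> j t * \<sigma> j t)" for j t
  have cf: "cont0 (f j)" for j unfolding f_def by (intro continuous_intros cs cx)
  have \<theta>: "0 \<le> \<theta> t" "\<theta> t \<le> 1" "\<theta> t \<le> k * t" if "0 \<le> t" for t
  proof -
    have "0 \<le> s / (1 + s) \<and> s / (1 + s) \<le> 1 \<and> s / (1 + s) \<le> s" if "0 \<le> s" for s :: real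
      using that by (auto simp: divide_le_eq distrib_left)
    from this[of "k * t"] show "0 \<le> \<theta> t" "\<theta> t \<le> 1" "\<theta> t \<le> k * t"
      using that k by (auto simp: \<theta>_def)
  qed
  have \<sigma>: "0 \<le> \<sigma> j t" "\<sigma> j t \<le> 1" "\<sigma> j t \<le> \<sigma> (Suc j) t" "1 - \<sigma> j t = 1 / (1 + real j * t)"
    if "0 \<le> t" for j t
  proof -
    have p: "1 + real j * t > 0" "1 + real (Suc j) * t > 0" using that pos by auto
    have eq: "1 - \<sigma> i t = 1 / (1 + real i * t)" for i
      using pos[of "real i" t] that by (simp add: \<sigma>_def g_def field_simps)
    show "0 \<le> \<sigma> j t" using p that by (simp add: \<sigma>_def g_def)
    show "1 - \<sigma> j t = 1 / (1 + real j * t)" by (rule eq)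
    then show "\<sigma> j t \<le> 1" using p by (smt (verit) divide_nonneg_pos)
    have "1 / (1 + real (Suc j) * t) \<le> 1 / (1 + real j * t)"
      using p that by (intro divide_left_mono mult_pos_pos) (auto simp: distrib_right)
    then show "\<sigma> j t \<le> \<sigma> (Suc j) t" using eq[of j] eq[of "Suc j"] by simp
  qed
  have f_le: "f j t \<le> \<theta> t" "0 \<le> f j t" "f j t \<le> \<sigma> j t * \<sigma> j t" "f j t \<le> f (Suc j) t" "0 < j \<Longrightarrow> \<theta> t - f j t \<le> 2 * k / real j"
    if t: "0 \<le> t" for j t
  proof -
    have "\<sigma> j t * \<sigma> j t \<le> 1" using \<sigma>[OF t, of j] mult_mono[of "\<sigma> j t" 1 "\<sigma> j t" 1] by simp
    then show "f j t \<le> \<theta> t" unfolding f_def using mult_left_mono[of "\<sigma> j t * \<sigma> j t" 1 "\<theta> t"] \<theta>[OF t] by simp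
    show "0 \<le> f j t" unfolding f_def using \<theta>[OF t] \<sigma>[OF t, of j] by simp
    show "f j t \<le> \<sigma> j t * \<sigma> j t"
      unfolding f_def using mult_right_mono[of "\<theta> t" 1 "\<sigma> j t * \<sigma> j t"] \<theta>[OF t] by simp
    show "f j t \<le> f (Suc j) t" unfolding f_def
      using \<theta>[OF t] \<sigma>[OF t, of j] \<sigma>[OF t, of "Suc j"] by (intro mult_left_mono mult_mono) auto
    show "\<theta> t - f j t \<le> 2 * k / real j" if "0 < j"
    proof (cases "t = 0")
      case True
      then show ?thesis using \<theta>[OF t] k by (auto simp: f_def \<theta>_def \<sigma>_def g_def)
    next
      case False
      then have jt: "0 < real j" "0 < t" using t that by auto
      have "\<theta> t - f j t = \<theta> t * ((1 + \<sigma> j t) * (1 - \<sigma> j t))" by (simp add: f_def algebra_simps)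
      also have "\<dots> \<le> (k * t) * (2 * (1 / (1 + real j * t)))"
        unfolding \<sigma>(4)[OF t] using \<theta>[OF t] \<sigma>[OF t, of j] pos[of "real j" t] t k
        by (intro mult_mono mult_right_mono) auto
      also have "\<dots> \<le> (k * t) * (2 * (1 / (real j * t)))"
        using jt k by (intro mult_left_mono divide_left_mono) (simp_all add: add_pos_pos)
      also have "\<dots> = 2 * k / real j" using jt by simp
      finally show ?thesis .
    qed
  qed
  have "\<tau> (fc \<theta> h) = (SUP j. \<tau> (fc (f j) h))"
  proof (rule tr_incseq)
    show "fc (f j) h \<in> A" for j by (intro fc_closed hA h0 cf)
    show "fc \<theta> h \<in> A" by (intro fc_closed hA h0 cx)
    show "0 \<le> fc (f j) h" for j by (intro fc_nonneg h0 cf f_le)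
    show "fc (f j) h \<le> fc (f (Suc j)) h" for j by (intro fc_mono h0 cf f_le)
    show "fc (f j) h \<le> fc \<theta> h" for j by (intro fc_mono h0 cf cx f_le)
    fix \<xi>
    show "(\<lambda>n. ap (fc (f n) h) \<xi>) \<longlonglongrightarrow> ap (fc \<theta> h) \<xi>"
    proof (intro tendsto_bop_ap fc_uniform_limit h0 cf cx uniform_limitI)
      fix e :: real assume e: "e > 0"
      have "(\<lambda>j. 2 * k * (1 / real j)) \<longlonglongrightarrow> 2 * k * 0" by (intro tendsto_intros lim_1_over_n)
      then have "\<forall>\<^sub>F j in sequentially. 2 * k / real j < e" using e by (intro order_tendstoD(2)) auto
      then show "\<forall>\<^sub>F j in sequentially. \<forall>t\<in>{0..norm h}. dist (f j t) (\<theta> t) < e"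
        using eventually_gt_at_top[of 0]
      proof eventually_elim
        case (elim j)
        show ?case
        proof
          fix t assume "t \<in> {0..norm h}"
          then show "dist (f j t) (\<theta> t) < e" using f_le[of t j] elim by (simp add: dist_real_def)
        qed
      qed
    qed
  qed
  also have "\<dots> \<le> ennreal (R\<^sup>2)"
  proof (rule SUP_least)
    fix j
    have bd: "\<bar>g j t * t\<bar> \<le> 1" if "0 \<le> t" for t using \<sigma>[OF that, of j] by (simp add: \<sigma>_def)
    note N = ip_fc_le[OF I h cg bd R, folded \<sigma>_def]
    have "fc (f j) h \<le> fc (\<lambda>t. \<sigma> j t * \<sigma> j t) h"
      by (intro fc_mono h0 cf f_le continuous_intros cs)
    also have "\<dots> = adj (fc (\<sigma> j) h) * fc (\<sigma> j) h" by (simp add: fc_mult adj_fc h0 cs)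
    finally have "\<tau> (fc (f j) h) \<le> \<tau> (adj (fc (\<sigma> j) h) * fc (\<sigma> j) h)"
      by (intro tr_mono fc_closed hA h0 cf fc_nonneg f_le mult_closed adj_closed cs)
    also have "\<dots> = ennreal (ip (fc (\<sigma> j) h) (fc (\<sigma> j) h))" by (rule tr_eq_ip[OF N(1)])
    also have "\<dots> \<le> ennreal (R\<^sup>2)" by (rule ennreal_leI[OF N(2)])
    finally show "\<tau> (fc (f j) h) \<le> ennreal (R\<^sup>2)" .
  qed
  finally show ?thesis by (simp add: res)
qed

text \<open>
  The resolvents of the elements \<open>k h\<close>, \<open>h = \<Sum>\<^sub>v v\<^sup>* v\<close> over finite subsets of \<open>V\<close>, form a directed
  set with supremum \<open>e\<close>.
\<close>

theorem kernel_compl_finite_trace: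
  assumes R: "0 \<le> R"
  shows "\<tau> (kernel_compl V) \<le> ennreal (R\<^sup>2)"
proof -
  define e where "e = kernel_compl V"
  note e = kernel_compl[OF V_A, folded e_def]
  define H where "H I = (\<Sum>v\<in>I. adj v * v)" for I :: "'a bop set"
  define D where "D = {resolvent (real k *\<^sub>R H I) | k I. finite I \<and> I \<subseteq> V}"
  have H0: "0 \<le> H I" for I unfolding H_def by (rule sum_adj_mult_nonneg)
  have kH0: "0 \<le> real k *\<^sub>R H I" for k I by (intro scaleR_nonneg_nonneg H0) simp
  have HA: "H I \<in> A" if "I \<subseteq> V" for I
    unfolding H_def using that V_A by (intro sum_closed mult_closed adj_closed) auto
  have Hmono: "H I \<le> H J" if "I \<subseteq> J" "finite J" for I J
    unfolding H_def using that by (intro sum_mono2) auto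
  have DI: "resolvent (real k *\<^sub>R H I) \<in> D" if "finite I" "I \<subseteq> V" for k I using that by (auto simp: D_def)
  have He: "H I * e = H I" if "I \<subseteq> V" for I
  proof -
    have "v * (1 - e) = 0" if "v \<in> I" for v
    proof (rule bop_eqI)
      fix \<xi>
      have "ap e (\<xi> - ap e \<xi>) = 0" using e(2) by (simp add: ap_arg_simps) (metis ap_simps(7))
      then show "ap (v * (1 - e)) \<xi> = ap 0 \<xi>" using e(4) that \<open>I \<subseteq> V\<close> by auto
    qed
    then have "H I * (1 - e) = 0" by (simp add: H_def sum_distrib_right mult.assoc)
    then show ?thesis by (simp add: algebra_simps)
  qed
  have D_le: "0 \<le> r" "r \<le> e" "r \<in> A" "r \<le> 1" "r * e = r" "e * r = r" if rD: "r \<in> D" for r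
  proof -
    obtain k I where kI: "finite I" "I \<subseteq> V" and r: "r = resolvent (real k *\<^sub>R H I)" using rD by (auto simp: D_def)
    show r0: "0 \<le> r" unfolding r by (rule resolvent_nonneg[OF kH0])
    show "r \<in> A" unfolding r resolvent_def by (intro fc_closed scaleR_closed HA kI kH0 cont0_resolvent)
    show r1: "r \<le> 1" unfolding r by (rule resolvent_le_1[OF kH0])
    let ?g = "fc (\<lambda>t. 1 / (1 + t)) (real k *\<^sub>R H I)"
    have "r = fc (\<lambda>t. 1 / (1 + t) * t) (real k *\<^sub>R H I)" unfolding r resolvent_def by simp
    also have "\<dots> = ?g * (real k *\<^sub>R H I)" by (simp only: fc_mult[OF kH0 cont0_resolvent(2) continuous_on_id] fc_id[OF kH0])
    finally have rg: "r = ?g * (real k *\<^sub>R H I)" .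
    show re: "r * e = r" unfolding rg by (simp add: mult.assoc He kI)
    from arg_cong[OF this, of adj] show er: "e * r = r" by (simp add: e(1) adj_nonneg[OF r0])
    have "r = adj e * r * e" by (simp add: e(1) re er)
    also have "\<dots> \<le> adj e * 1 * e" by (rule conj_mono[OF r1])
    finally show "r \<le> e" by (simp add: e)
  qed
  have eA: "0 \<le> e" using adj_mult_self_nonneg[of e] e by simp
  have dir: "\<exists>z\<in>D. x \<le> z \<and> y \<le> z" if xy: "x \<in> D" "y \<in> D" for x y
  proof -
    obtain k I where kI: "finite I" "I \<subseteq> V" and x: "x = resolvent (real k *\<^sub>R H I)" using xy(1) by (auto simp: D_def)
    obtain l J where lJ: "finite J" "J \<subseteq> V" and y: "y = resolvent (real l *\<^sub>R H J)" using xy(2) by (auto simp: D_def)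
    have "real k *\<^sub>R H I \<le> real (max k l) *\<^sub>R H (I \<union> J)" "real l *\<^sub>R H J \<le> real (max k l) *\<^sub>R H (I \<union> J)"
      using kI lJ by (intro scaleR_mono Hmono H0; auto)+
    from this[THEN resolvent_mono[OF kH0]]
    have "x \<le> resolvent (real (max k l) *\<^sub>R H (I \<union> J))" "y \<le> resolvent (real (max k l) *\<^sub>R H (I \<union> J))"
      unfolding x y by auto
    then show ?thesis using DI[of "I \<union> J" "max k l"] kI lJ by auto
  qed
  \<comment> \<open>The vectors on which the forms of \<open>1 - r\<close> become arbitrarily small.
    T is a closed subspace containing the ranges of all \<open>adj v\<close>, and these span a dense
    subspace of the range of e.\<close>
  define T where "T = {\<eta>. \<forall>\<epsilon>>0. \<exists>r\<in>D. inner \<eta> (ap (1 - r) \<eta>) < \<epsilon>}"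
  have q0: "0 \<le> 1 - r" if "r \<in> D" for r using D_le[OF that] by simp
  have qmono: "inner \<eta> (ap (1 - z) \<eta>) \<le> inner \<eta> (ap (1 - r) \<eta>)" if "r \<le> z" for r z \<eta>
    using bop_leD[OF that, of \<eta>] by (simp add: inner_diff_right)
  have T_range: "ap (adj v) \<zeta> \<in> T" if v: "v \<in> V" for v \<zeta>
  proof -
    have "\<exists>r\<in>D. inner (ap (adj v) \<zeta>) (ap (1 - r) (ap (adj v) \<zeta>)) < \<epsilon>" if \<epsilon>: "\<epsilon> > 0" for \<epsilon>
    proof -
      \<comment> \<open>For b = \<open>adj v * v\<close> the form of \<open>1 - r\<close> at
        \<open>adj v\<close> applied to \<zeta> is governed by the norm of b / (1 + k b), which is
        at most 1 / k.\<close>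
      obtain k where k: "(norm \<zeta>)\<^sup>2 / \<epsilon> < real k" using reals_Archimedean2 by blast
      have "(norm \<zeta>)\<^sup>2 / \<epsilon> \<ge> 0" using \<epsilon> by simp
      then have k0: "0 < real k" using k by linarith
      define b where "b = adj v * v"
      have b0: "0 \<le> b" by (simp add: b_def)
      define r where "r = resolvent (real k *\<^sub>R H {v})"
      have Hv: "H {v} = b" by (simp add: H_def b_def)
      define y where "y = fc (\<lambda>t. 1 / (1 + t)) (real k *\<^sub>R b)"
      have y_alt: "y = fc (\<lambda>t. 1 / (1 + real k * t)) b"
        unfolding y_def by (rule fc_scaleR[OF b0 _ cont0_resolvent(2)]) simp
      have ry: "1 - r = y" using resolvent_inverse(1)[OF kH0[of k "{v}"]] by (simp add: r_def y_def Hv)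
      have ck: "cont0 (\<lambda>t. 1 / (1 + real k * t))"
        by (intro continuous_intros) (use k0 in \<open>auto simp: add_pos_nonneg less_imp_neq[symmetric]\<close>)
      have y0: "0 \<le> y" unfolding y_alt by (rule fc_nonneg[OF b0 ck]) auto
      have yb: "y * b = b * y" unfolding y_alt by (rule fc_commute[OF b0 ck refl])
      have sb: "opsqrt y * b = b * opsqrt y" unfolding opsqrt_def by (rule fc_commute[OF y0 cont0_sqrt yb])
      then obtain s where s: "adj s = s" "s * s = y" "s * b = b * s"
        using y0 by (metis adj_nonneg opsqrt_nonneg opsqrt_square)
      have "(norm (s * adj v))\<^sup>2 = (norm (v * s))\<^sup>2"
        using norm_adj[of "v * s"] by (simp add: s)
      also have "\<dots> = norm (adj (v * s) * (v * s))" by (rule norm_adj_mult_self[symmetric])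
      also have "adj (v * s) * (v * s) = s * b * s" by (simp add: s b_def mult.assoc)
      also have "\<dots> = b * y" by (simp add: s mult.assoc)
      also have "\<dots> = fc (\<lambda>t. t * (1 / (1 + real k * t))) b"
        unfolding y_alt by (simp only: fc_mult[OF b0 continuous_on_id ck] fc_id[OF b0])
      also have "norm \<dots> \<le> 1 / real k"
      proof (rule fc_norm_bound[OF b0 continuous_on_mult[OF continuous_on_id ck]])
        fix t :: real assume t: "0 \<le> t"
        then have "1 + real k * t > 0" using k0 by (simp add: add_pos_nonneg)
        then show "\<bar>t * (1 / (1 + real k * t))\<bar> \<le> 1 / real k" using t k0 by (simp add: field_simps)
      qed
      finally have ns: "(norm (s * adj v))\<^sup>2 \<le> 1 / real k" .
      have "inner (ap (adj v) \<zeta>) (ap (1 - r) (ap (adj v) \<zeta>)) = (norm (ap (s * adj v) \<zeta>))\<^sup>2"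
        unfolding ry by (simp add: power2_norm_eq_inner inner_ap_left s(1) flip: s(2))
      also have "\<dots> \<le> (norm (s * adj v) * norm \<zeta>)\<^sup>2" by (intro power_mono norm_ap) simp
      also have "\<dots> \<le> 1 / real k * (norm \<zeta>)\<^sup>2"
        unfolding power_mult_distrib by (intro mult_right_mono ns) simp
      also have "\<dots> < \<epsilon>" using k k0 \<epsilon> by (simp add: field_simps)
      finally show ?thesis using DI[of "{v}" k] v by (auto simp: r_def)
    qed
    then show ?thesis by (simp add: T_def)
  qed
  have T_sub: "subspace T"
    unfolding subspace_def
  proof (intro conjI ballI allI)
    have "resolvent (real 0 *\<^sub>R H {}) \<in> D" by (rule DI) auto
    then show "0 \<in> T" by (auto simp: T_def ap_arg_simps)
    show "\<xi> + \<eta> \<in> T" if "\<xi> \<in> T" "\<eta> \<in> T" for \<xi> \<eta>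
      unfolding T_def
    proof (intro CollectI allI impI)
      fix \<epsilon> :: real assume "\<epsilon> > 0"
      then have "\<epsilon> / 4 > 0" by simp
      then obtain r r' where r: "r \<in> D" "inner \<xi> (ap (1 - r) \<xi>) < \<epsilon> / 4" "r' \<in> D" "inner \<eta> (ap (1 - r') \<eta>) < \<epsilon> / 4"
        using \<open>\<xi> \<in> T\<close> \<open>\<eta> \<in> T\<close> unfolding T_def by blast
      obtain z where z: "z \<in> D" "r \<le> z" "r' \<le> z" using dir r by blast
      have "inner (\<xi> + \<eta>) (ap (1 - z) (\<xi> + \<eta>)) \<le> 2 * inner \<xi> (ap (1 - z) \<xi>) + 2 * inner \<eta> (ap (1 - z) \<eta>)"
        by (rule quad_add_le[OF q0[OF z(1)]])
      also have "\<dots> < \<epsilon>" using qmono[OF z(2), of \<xi>] qmono[OF z(3), of \<eta>] r by linarith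
      finally show "\<exists>r\<in>D. inner (\<xi> + \<eta>) (ap (1 - r) (\<xi> + \<eta>)) < \<epsilon>" using z by blast
    qed
    show "c *\<^sub>R \<xi> \<in> T" if xT: "\<xi> \<in> T" for c \<xi>
      unfolding T_def
    proof (intro CollectI allI impI)
      fix \<epsilon> :: real assume e: "\<epsilon> > 0"
      then have "\<epsilon> / (c\<^sup>2 + 1) > 0" by (simp add: add_nonneg_pos)
      then obtain r where r: "r \<in> D" "inner \<xi> (ap (1 - r) \<xi>) < \<epsilon> / (c\<^sup>2 + 1)" using xT unfolding T_def by blast
      have nn: "0 \<le> inner \<xi> (ap (1 - r) \<xi>)" using q0[OF r(1)] by (simp only: bop_nonneg_iff)
      have "inner (c *\<^sub>R \<xi>) (ap (1 - r) (c *\<^sub>R \<xi>)) = c\<^sup>2 * inner \<xi> (ap (1 - r) \<xi>)"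
        by (simp add: ap_arg_simps power2_eq_square flip: scaleR_diff_right)
      also have "\<dots> \<le> (c\<^sup>2 + 1) * inner \<xi> (ap (1 - r) \<xi>)" using nn by (intro mult_right_mono) auto
      also have "\<dots> < (c\<^sup>2 + 1) * (\<epsilon> / (c\<^sup>2 + 1))" using r(2) by (intro mult_strict_left_mono) (auto simp: add_nonneg_pos)
      also have "\<dots> = \<epsilon>" using e by (simp add: add_nonneg_eq_0_iff)
      finally show "\<exists>r\<in>D. inner (c *\<^sub>R \<xi>) (ap (1 - r) (c *\<^sub>R \<xi>)) < \<epsilon>" using r by blast
    qed
  qed
  have T_closed: "closed T"
    unfolding closed_sequential_limits
  proof (intro allI impI, elim conjE)
    fix x l assume x: "\<forall>n. x n \<in> T" and l: "x \<longlonglongrightarrow> l"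
    show "l \<in> T"
      unfolding T_def
    proof (intro CollectI allI impI)
      fix \<epsilon> :: real assume e: "\<epsilon> > 0"
      \<comment> \<open>\<open>quad_add_le\<close> doubles both forms, so each of them may cost
        \<epsilon> / 4.\<close>
      define d where "d = sqrt (\<epsilon> / 4)"
      have d: "d > 0" "d\<^sup>2 = \<epsilon> / 4" using e by (auto simp: d_def)
      obtain n where n: "dist (x n) l < d" using LIMSEQ_D[OF l d(1)] by (auto simp: dist_norm)
      have "\<epsilon> / 4 > 0" using e by simp
      then obtain r where r: "r \<in> D" "inner (x n) (ap (1 - r) (x n)) < \<epsilon> / 4" using x unfolding T_def by blast
      have "inner (l - x n) (ap (1 - r) (l - x n)) \<le> inner (l - x n) (ap 1 (l - x n))"
        using D_le(1)[OF r(1)] by (intro bop_leD) simp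
      also have "\<dots> = (dist (x n) l)\<^sup>2" by (simp add: dist_norm power2_norm_eq_inner inner_diff_left inner_diff_right inner_commute)
      also have "\<dots> < \<epsilon> / 4" unfolding d(2)[symmetric] using n by (intro power_strict_mono) auto
      finally have 1: "inner (l - x n) (ap (1 - r) (l - x n)) < \<epsilon> / 4" .
      have "inner l (ap (1 - r) l) \<le> 2 * inner (x n) (ap (1 - r) (x n)) + 2 * inner (l - x n) (ap (1 - r) (l - x n))"
        using quad_add_le[OF q0[OF r(1)], of "x n" "l - x n"] by simp
      also have "\<dots> < \<epsilon>" using 1 r(2) by linarith
      finally show "\<exists>r\<in>D. inner l (ap (1 - r) l) < \<epsilon>" using r by blast
    qed
  qed
  have eT: "ap e \<xi> \<in> T" for \<xi>
  proof -
    obtain y where y: "y \<in> T" "\<And>z. z \<in> T \<Longrightarrow> inner (ap e \<xi> - y) z = 0"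
      using closed_subspace_nearest[OF T_closed T_sub] by blast
    define \<eta> where "\<eta> = ap e \<xi> - y"
    \<comment> \<open>The component \<eta> of e \<xi> orthogonal to T is orthogonal to the range of
      every \<open>adj v\<close>, hence killed by every v and by e; being also a component of e
      \<xi>, it vanishes.\<close>
    have "ap v \<eta> = 0" if "v \<in> V" for v
      by (rule vector_eq_rdot[THEN iffD1])
        (use y(2)[OF T_range[OF that]] in \<open>simp add: \<eta>_def[symmetric] inner_ap_left\<close>)
    then have "ap e \<eta> = 0" using e(4) by blast
    then have "inner \<eta> (ap e \<xi>) = 0" by (metis e(1) inner_ap_left inner_zero_left)
    then have "inner \<eta> \<eta> = 0" using y(2)[OF y(1)] by (simp add: \<eta>_def inner_diff_right)
    then show ?thesis using y(1) by (simp add: \<eta>_def)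
  qed
  have "\<tau> e = (SUP r\<in>D. \<tau> r)"
  proof (rule normal)
    show "D \<subseteq> A" "\<And>r. r \<in> D \<Longrightarrow> 0 \<le> r" "\<And>r. r \<in> D \<Longrightarrow> r \<le> e" using D_le by auto
    show "D \<noteq> {}" using DI[of "{}" 0] by auto
    show "\<exists>z\<in>D. x \<le> z \<and> y \<le> z" if "x \<in> D" "y \<in> D" for x y by (rule dir[OF that])
    show "e \<in> A" by (rule e)
    fix z assume z: "z \<in> A" "0 \<le> z" "\<And>r. r \<in> D \<Longrightarrow> r \<le> z"
    show "e \<le> z"
    proof (rule bop_leI[OF e(1) adj_nonneg[OF z(2)]])
      fix \<xi>
      show "inner \<xi> (ap e \<xi>) \<le> inner \<xi> (ap z \<xi>)"
      proof (rule field_le_epsilon)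
        fix \<epsilon> :: real assume "\<epsilon> > 0"
        then obtain r where r: "r \<in> D" "inner (ap e \<xi>) (ap (1 - r) (ap e \<xi>)) < \<epsilon>"
          using eT[of \<xi>] unfolding T_def by blast
        \<comment> \<open>As \<open>e * r * e = r\<close>, compressing \<open>1 - r\<close> by e
          leaves \<open>e - r\<close>, so r nearly attains e at \<xi>.\<close>
        have "inner (ap e \<xi>) (ap (1 - r) (ap e \<xi>)) = inner \<xi> (ap (e * (1 - r) * e) \<xi>)"
          by (simp add: inner_ap_left e(1) mult.assoc)
        also have "e * (1 - r) * e = e - r" using D_le(5,6)[OF r(1)] by (simp add: algebra_simps e(2))
        finally have "inner \<xi> (ap e \<xi>) < inner \<xi> (ap r \<xi>) + \<epsilon>" using r(2) by (simp add: inner_diff_right)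
        also have "inner \<xi> (ap r \<xi>) \<le> inner \<xi> (ap z \<xi>)" by (rule bop_leD[OF z(3)[OF r(1)]])
        finally show "inner \<xi> (ap e \<xi>) \<le> inner \<xi> (ap z \<xi>) + \<epsilon>" by simp
      qed
    qed
  qed
  also have "\<dots> \<le> ennreal (R\<^sup>2)"
    by (rule SUP_least) (auto simp: D_def H_def intro!: tr_resolvent_le R)
  finally show ?thesis by (simp add: e_def)
qed

end
end

section \<open>Trace norms and the strong topology on a finite corner\<close>

text \<open>The form of x vanishes on the range of 1 - e, and for positive x this kills the vectors
  themselves by \<open>norm_ap_square_le\<close>. Compression by e then allows the norm as the
  constant.\<close>

lemma nonneg_le_projection:
  assumes x: "0 \<le> x" "x \<le> K *\<^sub>R e" and e: "adj e = e" "e * e = e"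
  shows "x * e = x" "e * x = x" "norm x \<le> c \<Longrightarrow> x \<le> c *\<^sub>R e"
proof -
  have e01: "0 \<le> e" "0 \<le> 1 - e"
    using adj_mult_self_nonneg[of e] adj_mult_self_nonneg[of "1 - e"] e by (simp_all add: algebra_simps)
  then have e1: "e \<le> 1" by simp
  have "e * (1 - e) = 0" by (simp add: algebra_simps e)
  then have e0: "ap e (ap (1 - e) \<xi>) = 0" for \<xi> by (metis ap_simps(1,7))
  have "x * (1 - e) = 0"
  proof (rule bop_eqI)
    fix \<xi>
    let ?\<eta> = "ap (1 - e) \<xi>"
    have xn: "x \<le> norm x *\<^sub>R 1" by (rule le_norm_bop[OF adj_nonneg[OF x(1)]])
    have "inner ?\<eta> (ap x ?\<eta>) \<le> 0" using bop_leD[OF x(2), of ?\<eta>] by (simp only: ap_simps(6) e0) simp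
    then have "norm x * inner ?\<eta> (ap x ?\<eta>) \<le> 0" by (simp add: mult_nonneg_nonpos)
    then have "(norm (ap x ?\<eta>))\<^sup>2 \<le> 0" using norm_ap_square_le[OF x(1) xn, of ?\<eta>] by linarith
    then show "ap (x * (1 - e)) \<xi> = ap 0 \<xi>" by simp
  qed
  then show xe: "x * e = x" by (simp add: algebra_simps)
  from arg_cong[OF this, of adj] show ex: "e * x = x" by (simp add: e adj_nonneg[OF x(1)])
  assume "norm x \<le> c"
  then have "x \<le> c *\<^sub>R 1"
    using le_norm_bop[OF adj_nonneg[OF x(1)]] scaleR_right_mono[OF _ one_nonneg_bop] order_trans by blast
  from conj_mono[OF this, of e] show "x \<le> c *\<^sub>R e" by (simp add: e ex xe)
qed

locale finite_corner = traced A \<tau> for A :: "'a::hilbert bop set" and \<tau> +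
  fixes e :: "'a bop"
  assumes e_A: "e \<in> A" and e_adj: "adj e = e" and e_idem: "e * e = e" and e_fin: "\<tau> e < \<infinity>"
begin

lemma e_nonneg: "0 \<le> e" and e_le_1: "e \<le> 1"
  using adj_mult_self_nonneg[of e] adj_mult_self_nonneg[of "1 - e"] e_adj e_idem
  by (simp_all add: algebra_simps)

text \<open>The positive cone of \<open>e A e\<close>. Describing it by the order makes closure
  under domination immediate; \<open>nonneg_le_projection\<close> recovers the absorption of
  e.\<close>

definition E :: "'a bop set"
  where "E = {x \<in> A. 0 \<le> x \<and> (\<exists>K. x \<le> K *\<^sub>R e)}"

lemma E_D: "x \<in> E \<Longrightarrow> x \<in> A" "x \<in> E \<Longrightarrow> 0 \<le> x" "x \<in> E \<Longrightarrow> norm x \<le> c \<Longrightarrow> x \<le> c *\<^sub>R e"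
  using nonneg_le_projection(3)[OF _ _ e_adj e_idem] by (auto simp: E_def)

lemma E_I: "x \<in> A \<Longrightarrow> 0 \<le> x \<Longrightarrow> x \<le> K *\<^sub>R e \<Longrightarrow> x \<in> E"
  by (auto simp: E_def)

lemma E_add: "x \<in> E \<Longrightarrow> y \<in> E \<Longrightarrow> x + y \<in> E"
proof -
  assume x: "x \<in> E" and y: "y \<in> E"
  have "x + y \<le> (norm x + norm y) *\<^sub>R e"
    using E_D(3)[OF x order_refl] E_D(3)[OF y order_refl] by (simp add: scaleR_add_left add_mono)
  then show ?thesis using x y by (intro E_I) (auto simp: E_D add_nonneg_nonneg)
qed

lemma E_scale: "x \<in> E \<Longrightarrow> 0 \<le> c \<Longrightarrow> c *\<^sub>R x \<in> E"
proof -
  assume x: "x \<in> E" and c: "0 \<le> c"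
  have "c *\<^sub>R x \<le> (c * norm x) *\<^sub>R e"
    using scaleR_left_mono[OF E_D(3)[OF x order_refl] c] by simp
  then show ?thesis using x c by (intro E_I) (auto simp: E_D scaleR_nonneg_nonneg)
qed

lemma E_le: "x \<in> E \<Longrightarrow> y \<in> A \<Longrightarrow> 0 \<le> y \<Longrightarrow> y \<le> x \<Longrightarrow> y \<in> E"
  by (auto simp: E_def intro: order_trans)

lemma e_E: "e \<in> E"
  by (rule E_I[of _ 1]) (simp_all add: e_A e_nonneg)

lemma E_0: "0 \<in> E"
  by (rule E_I[of _ 0]) auto

text \<open>Both the trace and the vector functionals have these properties, so one continuity lemma
  compares the 2-norm and the strong topology in both directions.\<close>

definition normal_functional :: "('a bop \<Rightarrow> real) \<Rightarrow> bool"
  where "normal_functional \<phi> \<longleftrightarrow> (\<forall>x\<in>E. 0 \<le> \<phi> x) \<and> (\<forall>x\<in>E. \<forall>y\<in>E. \<phi> (x + y) = \<phi> x + \<phi> y) \<and>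
    (\<forall>x\<in>E. \<forall>c\<ge>0. \<phi> (c *\<^sub>R x) = c * \<phi> x) \<and>
    (\<forall>x y. (\<forall>n. x n \<in> E \<and> x n \<le> x (Suc n)) \<and> y \<in> E \<and> (\<forall>\<xi>. (\<lambda>n. ap (x n) \<xi>) \<longlonglongrightarrow> ap y \<xi>) \<longrightarrow>
      (\<lambda>n. \<phi> (x n)) \<longlonglongrightarrow> \<phi> y)"

lemma normal_functionalD:
  assumes "normal_functional \<phi>"
  shows "x \<in> E \<Longrightarrow> 0 \<le> \<phi> x" "x \<in> E \<Longrightarrow> y \<in> E \<Longrightarrow> \<phi> (x + y) = \<phi> x + \<phi> y"
    "x \<in> E \<Longrightarrow> 0 \<le> c \<Longrightarrow> \<phi> (c *\<^sub>R x) = c * \<phi> x"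
    "(\<And>n. z n \<in> E) \<Longrightarrow> (\<And>n. z n \<le> z (Suc n)) \<Longrightarrow> y \<in> E \<Longrightarrow> (\<And>\<xi>. (\<lambda>n. ap (z n) \<xi>) \<longlonglongrightarrow> ap y \<xi>) \<Longrightarrow>
      (\<lambda>n. \<phi> (z n)) \<longlonglongrightarrow> \<phi> y"
  using assms unfolding normal_functional_def by blast+

lemma normal_functional_mono:
  assumes "normal_functional \<phi>" "x \<in> E" "y \<in> E" "x \<le> y"
  shows "\<phi> x \<le> \<phi> y"
proof -
  have "y - x \<in> E" by (rule E_le[OF assms(3)]) (use assms E_D in auto)
  then show ?thesis
    using normal_functionalD(2)[OF assms(1,2), of "y - x"] normal_functionalD(1)[OF assms(1), of "y - x"] by simp
qed

lemma normal_functional_sum: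
  assumes "normal_functional \<phi>" "\<And>i. i \<in> I \<Longrightarrow> f i \<in> E" "finite I"
  shows "sum f I \<in> E \<and> \<phi> (sum f I) = (\<Sum>i\<in>I. \<phi> (f i))"
  using assms(3,2)
proof (induction I rule: finite_induct)
  case empty
  have "\<phi> (0 *\<^sub>R e) = 0 * \<phi> e" by (rule normal_functionalD[OF assms(1) e_E]) simp
  then show ?case by (simp add: E_0)
qed (auto simp: E_add normal_functionalD[OF assms(1)])

lemma normal_functional_decseq:
  assumes \<phi>: "normal_functional \<phi>" and z: "\<And>n. z n \<in> E" "\<And>n. z (Suc n) \<le> z n"
    and y: "y \<in> E" "\<And>\<xi>. (\<lambda>n. ap (z n) \<xi>) \<longlonglongrightarrow> ap y \<xi>"
  shows "(\<lambda>n. \<phi> (z n)) \<longlonglongrightarrow> \<phi> y"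
proof -
  have z0: "z n \<le> z 0" for n by (induction n) (auto intro: order_trans z)
  have y0: "y \<le> z 0"
  proof -
    have "0 \<le> z 0 - y"
      by (rule strong_limit_nonneg[of "\<lambda>n. z 0 - z n"]) (use z0 in \<open>auto intro!: tendsto_diff y\<close>)
    then show ?thesis by simp
  qed
  have d: "z 0 - w \<in> E" "\<phi> (z 0 - w) = \<phi> (z 0) - \<phi> w" if "w \<in> E" "w \<le> z 0" for w
  proof -
    show m: "z 0 - w \<in> E" by (rule E_le[OF z(1)[of 0]]) (use z that E_D in auto)
    show "\<phi> (z 0 - w) = \<phi> (z 0) - \<phi> w"
      using normal_functionalD(2)[OF \<phi> m that(1)] by simp
  qed
  have "(\<lambda>n. \<phi> (z 0 - z n)) \<longlonglongrightarrow> \<phi> (z 0 - y)"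
    by (rule normal_functionalD(4)[OF \<phi>]) (use d z z0 y y0 in \<open>auto intro!: tendsto_diff\<close>)
  then have "(\<lambda>n. \<phi> (z 0) - \<phi> (z n)) \<longlonglongrightarrow> \<phi> (z 0) - \<phi> y" by (simp add: d z z0 y y0)
  from tendsto_diff[OF tendsto_const[of "\<phi> (z 0)"] this] show ?thesis by simp
qed

lemma tr_E_finite: "x \<in> E \<Longrightarrow> \<tau> x < \<infinity>"
proof -
  assume x: "x \<in> E"
  have "\<tau> x \<le> \<tau> (norm x *\<^sub>R e)" using x e_A by (intro tr_mono scaleR_closed) (auto intro: E_D)
  also have "\<dots> = ennreal (norm x) * \<tau> e" by (intro tr_scale e_A e_nonneg) simp
  also have "\<dots> < \<infinity>" using e_fin by (simp add: ennreal_mult_less_top)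
  finally show ?thesis .
qed

lemma normal_functional_trace: "normal_functional (\<lambda>x. enn2real (\<tau> x))"
  unfolding normal_functional_def
proof (intro conjI ballI allI impI)
  fix x y assume "x \<in> E" "y \<in> E"
  then show "enn2real (\<tau> (x + y)) = enn2real (\<tau> x) + enn2real (\<tau> y)"
    using tr_E_finite by (simp add: tr_add E_D enn2real_plus)
next
  fix x and c :: real assume "x \<in> E" "0 \<le> c"
  then show "enn2real (\<tau> (c *\<^sub>R x)) = c * enn2real (\<tau> x)"
    by (simp add: tr_scale E_D enn2real_mult)
next
  fix x :: "nat \<Rightarrow> 'a bop" and y
  assume "(\<forall>n. x n \<in> E \<and> x n \<le> x (Suc n)) \<and> y \<in> E \<and> (\<forall>\<xi>. (\<lambda>n. ap (x n) \<xi>) \<longlonglongrightarrow> ap y \<xi>)"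
  then have x: "\<And>n. x n \<in> E" "\<And>n. x n \<le> x (Suc n)" and y: "y \<in> E" "\<And>\<xi>. (\<lambda>n. ap (x n) \<xi>) \<longlonglongrightarrow> ap y \<xi>" by auto
  have monoD: "x m \<le> x n" if "m \<le> n" for m n by (rule lift_Suc_mono_le[of x, OF x(2) that])
  have xy: "x n \<le> y" for n
  proof -
    have "0 \<le> y - x n"
    proof (rule strong_limit_nonneg[of "\<lambda>m. x (m + n) - x n"])
      show "0 \<le> x (m + n) - x n" for m using monoD[of n "m + n"] by simp
      show "(\<lambda>m. ap (x (m + n) - x n) \<xi>) \<longlonglongrightarrow> ap (y - x n) \<xi>" for \<xi>
        using tendsto_diff[OF LIMSEQ_ignore_initial_segment[OF y(2)[of \<xi>], of n] tendsto_const[of "ap (x n) \<xi>"]] by simp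
    qed
    then show ?thesis by simp
  qed
  have "\<tau> y = (SUP n. \<tau> (x n))" by (rule tr_incseq) (use x y xy E_D in auto)
  moreover have "incseq (\<lambda>n. \<tau> (x n))" unfolding incseq_def using monoD x E_D by (auto intro: tr_mono)
  ultimately have "(\<lambda>n. \<tau> (x n)) \<longlonglongrightarrow> \<tau> y" using LIMSEQ_SUP by metis
  then show "(\<lambda>n. enn2real (\<tau> (x n))) \<longlonglongrightarrow> enn2real (\<tau> y)"
    using tr_E_finite[OF y(1)] by (intro tendsto_enn2real) auto
qed simp

lemma normal_functional_vector: "normal_functional (\<lambda>x. inner \<xi> (ap x \<xi>))"
  unfolding normal_functional_def
  by (auto simp: inner_add_right E_def bop_nonneg_iff intro!: tendsto_inner)

text \<open>
  If \<open>\<phi>(a\<^sub>n)\<close> is summable for all \<open>\<phi> \<in> \<Phi>\<close>, then the strong limits \<open>c\<^sub>n\<close> of the resolvents of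
  \<open>a\<^sub>n + \<dots> + a\<^sub>m\<close> decrease to an element on which all \<open>\<phi> \<in> \<Phi>\<close> vanish, and \<open>a\<^sub>n\<close> is bounded by a
  multiple of \<open>c\<^sub>n\<close>.  The resolvents replace suprema, which need not exist for operators.
\<close>

lemma normal_functional_continuous:
  assumes \<Phi>: "\<And>\<phi>. \<phi> \<in> \<Phi> \<Longrightarrow> normal_functional \<phi>"
    and sep: "\<And>x. x \<in> E \<Longrightarrow> (\<And>\<phi>. \<phi> \<in> \<Phi> \<Longrightarrow> \<phi> x = 0) \<Longrightarrow> x = 0"
    and \<psi>: "normal_functional \<psi>"
    and a: "\<And>n. a n \<in> E" "\<And>n. norm (a n) \<le> K"
    and sum: "\<And>\<phi>. \<phi> \<in> \<Phi> \<Longrightarrow> summable (\<lambda>n. \<phi> (a n))"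
  shows "(\<lambda>n. \<psi> (a n)) \<longlonglongrightarrow> 0"
proof -
  have K: "0 \<le> K" using a(2)[of 0] norm_ge_zero order_trans by blast
  have a0: "0 \<le> a n" "a n \<in> A" for n using a E_D by auto
  define s where "s n m = (\<Sum>k<m. a (n + k))" for n m
  define r where "r n m = resolvent (s n m)" for n m
  have sE: "s n m \<in> E" for n m
    unfolding s_def using normal_functional_sum[OF \<psi>, of "{..<m}" "\<lambda>k. a (n + k)"] a by auto
  have s0: "0 \<le> s n m" for n m by (rule E_D(2)[OF sE])
  have r0: "0 \<le> r n m" "r n m \<le> 1" "r n m \<le> s n m" for n m
    unfolding r_def by (intro resolvent_nonneg resolvent_le_1 resolvent_le_self s0)+
  have rA: "r n m \<in> A" for n m unfolding r_def resolvent_def by (intro fc_closed E_D[OF sE] s0 cont0_resolvent)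
  have rE: "r n m \<in> E" for n m by (rule E_le[OF sE rA r0(1,3)])
  have re: "r n m \<le> e" for n m
  proof -
    have "norm (r n m) \<le> 1" by (rule norm_le_of_bop_le) (use r0 in auto)
    then show ?thesis using E_D(3)[OF rE, of n m 1] by simp
  qed
  have rmono: "r n m \<le> r n (Suc m)" for n m
    unfolding r_def by (rule resolvent_mono[OF s0]) (simp add: s_def a0)
  \<comment> \<open>Dropping the first term of a sum decreases it, which makes the limits
    \<open>c n\<close> decreasing in n.\<close>
  have r_shift: "r (Suc n) m \<le> r n (Suc m)" for n m
    unfolding r_def
  proof (rule resolvent_mono[OF s0])
    have "s n (Suc m) = a n + s (Suc n) m" unfolding s_def by (subst sum.lessThan_Suc_shift) simp
    then show "s (Suc n) m \<le> s n (Suc m)" using a0 by simp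
  qed
  have r1: "r n m \<le> 1 *\<^sub>R 1" for n m using r0 by simp
  have "\<exists>y. (\<forall>\<xi>. (\<lambda>m. ap (r n m) \<xi>) \<longlonglongrightarrow> ap y \<xi>) \<and> (\<forall>m. r n m \<le> y) \<and> 0 \<le> y \<and> y \<le> 1" for n
    using incseq_strong_limit[of "r n" 1, OF rmono r0(1) r1] by (metis scaleR_one)
  then obtain c where c: "\<And>n \<xi>. (\<lambda>m. ap (r n m) \<xi>) \<longlonglongrightarrow> ap (c n) \<xi>" "\<And>n m. r n m \<le> c n" "\<And>n. 0 \<le> c n"
    "\<And>n. c n \<le> 1" by metis
  have cA: "c n \<in> A" for n by (rule strong_limit_closed[OF rA c(1)])
  have ce: "c n \<le> e" for n
  proof -
    have "0 \<le> e - c n"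
      by (rule strong_limit_nonneg[of "\<lambda>m. e - r n m"]) (use re in \<open>auto intro!: tendsto_diff c\<close>)
    then show ?thesis by simp
  qed
  have cE: "c n \<in> E" for n by (rule E_le[OF e_E cA c(3) ce])
  have cdec: "c (Suc n) \<le> c n" for n
  proof -
    have rc: "r (Suc n) m \<le> c n" for m by (rule order_trans[OF r_shift c(2)])
    have "0 \<le> c n - c (Suc n)"
    proof (rule strong_limit_nonneg[of "\<lambda>m. c n - r (Suc n) m"])
      show "(\<lambda>m. ap (c n - r (Suc n) m) \<xi>) \<longlonglongrightarrow> ap (c n - c (Suc n)) \<xi>" for \<xi>
        using tendsto_diff[OF tendsto_const[of "ap (c n) \<xi>"] c(1)[of "Suc n" \<xi>]] by simp
    qed (simp add: rc)
    then show ?thesis by simp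
  qed
  have c1: "1 - c n \<le> 1 *\<^sub>R 1" "0 \<le> 1 - c n" "1 - c n \<le> 1 - c (Suc n)" for n using c cdec by auto
  \<comment> \<open>The limit of the decreasing sequence c is taken through the increasing sequence
    \<open>1 - c n\<close>.\<close>
  obtain y where y: "\<And>\<xi>. (\<lambda>n. ap (1 - c n) \<xi>) \<longlonglongrightarrow> ap y \<xi>" "\<And>n. 1 - c n \<le> y" "0 \<le> y" "y \<le> 1 *\<^sub>R 1"
    using incseq_strong_limit[of "\<lambda>n. 1 - c n" 1, OF c1(3,2,1)] by metis
  define d where "d = 1 - y"
  have d: "(\<lambda>n. ap (c n) \<xi>) \<longlonglongrightarrow> ap d \<xi>" for \<xi>
    using tendsto_diff[OF tendsto_const[of \<xi>] y(1)[of \<xi>]] by (simp add: d_def)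
  have d0: "0 \<le> d" "d \<le> c n" for n
    using y(2)[of n] y(4) by (simp_all add: d_def) (metis add.commute diff_le_eq)
  have dE: "d \<in> E" by (rule E_le[OF cE strong_limit_closed[OF cA d] d0])
  have "\<phi> d = 0" if \<phi>: "\<phi> \<in> \<Phi>" for \<phi>
  proof -
    note nf = \<Phi>[OF \<phi>]
    \<comment> \<open>The resolvent lies below its argument, so \<phi> of it is at most a tail of a
      convergent series.\<close>
    have "\<phi> d \<le> (\<Sum>k. \<phi> (a (k + n)))" for n
    proof -
      have "\<phi> d \<le> \<phi> (c n)" by (rule normal_functional_mono[OF nf dE cE d0(2)])
      also have "\<phi> (c n) \<le> (\<Sum>k. \<phi> (a (k + n)))"
      proof (rule LIMSEQ_le_const2)
        show "(\<lambda>m. \<phi> (r n m)) \<longlonglongrightarrow> \<phi> (c n)" by (rule normal_functionalD(4)[OF nf rE rmono cE c(1)])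
        have "\<phi> (r n m) \<le> (\<Sum>k. \<phi> (a (k + n)))" for m
        proof -
          have "\<phi> (r n m) \<le> \<phi> (s n m)" by (rule normal_functional_mono[OF nf rE sE r0(3)])
          also have "\<dots> = (\<Sum>k<m. \<phi> (a (k + n)))"
            unfolding s_def using normal_functional_sum[OF nf, of "{..<m}" "\<lambda>k. a (n + k)"] a by (simp add: add.commute)
          also have "\<dots> \<le> (\<Sum>k. \<phi> (a (k + n)))"
            by (rule sum_le_suminf) (use summable_ignore_initial_segment[OF sum[OF \<phi>]] normal_functionalD(1)[OF nf a(1)] in auto)
          finally show ?thesis .
        qed
        then show "\<exists>N. \<forall>m\<ge>N. \<phi> (r n m) \<le> (\<Sum>k. \<phi> (a (k + n)))" by blast
      qed
      finally show ?thesis .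
    qed
    moreover have "(\<lambda>n. \<Sum>k. \<phi> (a (k + n))) \<longlonglongrightarrow> 0" by (rule suminf_exist_split2[OF sum[OF \<phi>]])
    ultimately have "\<phi> d \<le> 0" by (intro LIMSEQ_le_const) auto
    then show ?thesis using normal_functionalD(1)[OF nf dE] by simp
  qed
  then have "d = 0" by (rule sep[OF dE])
  then have lim: "(\<lambda>n. \<psi> (c n)) \<longlonglongrightarrow> 0"
    using normal_functional_decseq[OF \<psi> cE cdec dE d] normal_functionalD(3)[OF \<psi> e_E, of 0] by simp
  \<comment> \<open>\<open>a n\<close> is the one-term sum \<open>s n 1\<close>, and
    \<open>le_resolvent\<close> bounds it by 1 + K times its resolvent.\<close>
  have le: "\<psi> (a n) \<le> (1 + K) * \<psi> (c n)" for n
  proof -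
    have "a n = s n 1" by (simp add: s_def)
    then have "(1 / (1 + K)) *\<^sub>R a n \<le> r n 1" unfolding r_def using le_resolvent[OF a0(1) a(2) K, of n] by simp
    also have "\<dots> \<le> c n" by (rule c)
    finally have le: "(1 / (1 + K)) *\<^sub>R a n \<le> c n" .
    have "1 / (1 + K) * \<psi> (a n) = \<psi> ((1 / (1 + K)) *\<^sub>R a n)"
      by (rule normal_functionalD(3)[OF \<psi> a(1), symmetric]) (use K in simp)
    also have "\<dots> \<le> \<psi> (c n)" by (rule normal_functional_mono[OF \<psi> E_scale[OF a(1)] cE le]) (use K in simp)
    finally show ?thesis using K by (simp add: field_simps)
  qed
  show ?thesis
  proof (rule tendsto_sandwich)
    show "\<forall>\<^sub>F n in sequentially. 0 \<le> \<psi> (a n)" using normal_functionalD(1)[OF \<psi> a(1)] by simp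
    show "\<forall>\<^sub>F n in sequentially. \<psi> (a n) \<le> (1 + K) * \<psi> (c n)" using le by simp
    show "(\<lambda>n. (1 + K) * \<psi> (c n)) \<longlonglongrightarrow> 0" using tendsto_mult_left[OF lim, of "1 + K"] by simp
  qed simp
qed

lemma adj_mult_self_E:
  assumes "x \<in> A" "x * e = x"
  shows "adj x * x \<in> E" "x \<in> N2"
proof -
  have ex: "e * adj x = adj x" using arg_cong[OF assms(2), of adj] by (simp add: e_adj)
  have "adj x * x = adj e * (adj x * x) * e" by (simp add: e_adj mult.assoc assms) (simp add: ex flip: mult.assoc)
  also have "\<dots> \<le> adj e * (norm (adj x * x) *\<^sub>R 1) * e" by (intro conj_mono le_norm_bop) simp
  also have "\<dots> = norm (adj x * x) *\<^sub>R e" by (simp add: e_adj e_idem)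
  finally show m: "adj x * x \<in> E" using assms by (intro E_I) auto
  then show "x \<in> N2" using tr_E_finite assms by (auto simp: N2_def)
qed

text \<open>A counterexample sequence can be chosen with squared 2-norms below 2^-n, which is
  summable. Then \<open>normal_functional_continuous\<close> with the trace as separating functional
  (by faithfulness) makes the vector functional tend to 0.\<close>

lemma ip_small_imp_strong_small:
  assumes \<epsilon>: "0 < \<epsilon>"
  shows "\<exists>\<delta>>0. \<forall>x\<in>A. x * e = x \<and> norm x \<le> B \<and> ip x x < \<delta> \<longrightarrow> norm (ap x \<xi>) < \<epsilon>"
proof (rule ccontr)
  assume neg: "\<not> ?thesis"
  have "\<exists>x\<in>A. x * e = x \<and> norm x \<le> B \<and> ip x x < (1/2) ^ n \<and> \<epsilon> \<le> norm (ap x \<xi>)" for n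
  proof -
    have "(1/2 :: real) ^ n > 0" by simp
    then show ?thesis using neg by (meson not_less)
  qed
  then obtain x where x: "\<And>n. x n \<in> A" "\<And>n. x n * e = x n" "\<And>n. norm (x n) \<le> B"
    "\<And>n. ip (x n) (x n) < (1/2) ^ n" "\<And>n. \<epsilon> \<le> norm (ap (x n) \<xi>)" by metis
  have N: "x n \<in> N2" "adj (x n) * x n \<in> E" for n using adj_mult_self_E x by auto
  have "(\<lambda>n. inner \<xi> (ap (adj (x n) * x n) \<xi>)) \<longlonglongrightarrow> 0"
  proof (rule normal_functional_continuous[where \<Phi> = "{\<lambda>x. enn2real (\<tau> x)}" and K = "B\<^sup>2"])
    show "\<phi> \<in> {\<lambda>x. enn2real (\<tau> x)} \<Longrightarrow> normal_functional \<phi>" for \<phi> using normal_functional_trace by simp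
    show "normal_functional (\<lambda>x. inner \<xi> (ap x \<xi>))" by (rule normal_functional_vector)
    show "y = 0" if "y \<in> E" "\<And>\<phi>. \<phi> \<in> {\<lambda>x. enn2real (\<tau> x)} \<Longrightarrow> \<phi> y = 0" for y
      using that(2)[of "\<lambda>x. enn2real (\<tau> x)"] tr_E_finite[OF that(1)] E_D[OF that(1)]
      by (intro faithful) (auto simp: enn2real_eq_0_iff)
    show "norm (adj (x n) * x n) \<le> B\<^sup>2" for n unfolding norm_adj_mult_self by (intro power_mono x) simp
    show "summable (\<lambda>n. \<phi> (adj (x n) * x n))" if "\<phi> \<in> {\<lambda>x. enn2real (\<tau> x)}" for \<phi>
    proof (rule summable_comparison_test')
      show "summable (\<lambda>n. (1/2 :: real) ^ n)" by (rule summable_geometric) simp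
      show "norm (\<phi> (adj (x n) * x n)) \<le> (1/2) ^ n" for n
        using that x(4)[of n] ip_self[OF N(1)[of n]] by simp
    qed
  qed (rule N)
  then have "\<forall>\<^sub>F n in sequentially. inner \<xi> (ap (adj (x n) * x n) \<xi>) < \<epsilon>\<^sup>2"
    using \<epsilon> by (intro order_tendstoD(2)) auto
  then obtain n where "inner \<xi> (ap (adj (x n) * x n) \<xi>) < \<epsilon>\<^sup>2" by (auto simp: eventually_sequentially)
  moreover have "inner \<xi> (ap (adj (x n) * x n) \<xi>) = (norm (ap (x n) \<xi>))\<^sup>2"
    by (simp add: power2_norm_eq_inner inner_ap_left)
  moreover have "\<epsilon>\<^sup>2 \<le> (norm (ap (x n) \<xi>))\<^sup>2" using x(5)[of n] \<epsilon> by (intro power_mono) auto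
  ultimately show False by simp
qed

text \<open>The converse exchanges the roles: countably many vector functionals separate, and the
  trace is the functional shown to be continuous. A diagonal choice makes \<open>x n\<close> small
  at the first n vectors.\<close>

lemma strong_small_imp_ip_small:
  assumes \<epsilon>: "0 < \<epsilon>"
    and sep: "\<And>x. x \<in> E \<Longrightarrow> (\<And>k. ap x (\<Xi> k) = 0) \<Longrightarrow> x = 0"
  shows "\<exists>n::nat. \<exists>\<delta>>0. \<forall>x\<in>A. x * e = x \<and> norm x \<le> B \<and> (\<forall>k<n. norm (ap x (\<Xi> k)) < \<delta>) \<longrightarrow> ip x x < \<epsilon>"
proof (rule ccontr)
  assume neg: "\<not> ?thesis"
  have "\<exists>x\<in>A. x * e = x \<and> norm x \<le> B \<and> (\<forall>k<n. norm (ap x (\<Xi> k)) < (1/2) ^ n) \<and> \<epsilon> \<le> ip x x" for n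
  proof -
    have "(1/2 :: real) ^ n > 0" by simp
    then show ?thesis using neg by (meson not_less)
  qed
  then obtain x where x: "\<And>n. x n \<in> A" "\<And>n. x n * e = x n" "\<And>n. norm (x n) \<le> B"
    "\<And>n k. k < n \<Longrightarrow> norm (ap (x n) (\<Xi> k)) < (1/2) ^ n" "\<And>n. \<epsilon> \<le> ip (x n) (x n)" by metis
  have N: "x n \<in> N2" "adj (x n) * x n \<in> E" for n using adj_mult_self_E x by auto
  let ?\<Phi> = "range (\<lambda>k x. inner (\<Xi> k) (ap x (\<Xi> k)))"
  have "(\<lambda>n. enn2real (\<tau> (adj (x n) * x n))) \<longlonglongrightarrow> 0"
  proof (rule normal_functional_continuous[where \<Phi> = ?\<Phi> and K = "B\<^sup>2"])
    show "\<phi> \<in> ?\<Phi> \<Longrightarrow> normal_functional \<phi>" for \<phi> using normal_functional_vector by auto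
    show "normal_functional (\<lambda>x. enn2real (\<tau> x))" by (rule normal_functional_trace)
    show "y = 0" if y: "y \<in> E" and z: "\<And>\<phi>. \<phi> \<in> ?\<Phi> \<Longrightarrow> \<phi> y = 0" for y
    proof (rule sep[OF y])
      fix k
      have "inner (\<Xi> k) (ap y (\<Xi> k)) = 0" using z by blast
      then have "(norm (ap y (\<Xi> k)))\<^sup>2 \<le> 0"
        using norm_ap_square_le[OF E_D(2)[OF y] le_norm_bop[OF adj_nonneg[OF E_D(2)[OF y]]], of "\<Xi> k"] by simp
      then show "ap y (\<Xi> k) = 0" by simp
    qed
    show "norm (adj (x n) * x n) \<le> B\<^sup>2" for n unfolding norm_adj_mult_self by (intro power_mono x) simp
    show "summable (\<lambda>n. \<phi> (adj (x n) * x n))" if "\<phi> \<in> ?\<Phi>" for \<phi>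
    proof -
      obtain k where \<phi>: "\<phi> = (\<lambda>x. inner (\<Xi> k) (ap x (\<Xi> k)))" using \<open>\<phi> \<in> ?\<Phi>\<close> by blast
      show ?thesis
      \<comment> \<open>The element \<open>x n\<close> is controlled at the k-th vector only for n >
        k.\<close>
      proof (rule summable_comparison_test'[where N = "Suc k"])
        show "summable (\<lambda>n. (1/2 :: real) ^ n)" by (rule summable_geometric) simp
        fix n assume "Suc k \<le> n"
        then have "norm (ap (x n) (\<Xi> k)) < (1/2) ^ n" by (intro x(4)) simp
        moreover have "(1/2 :: real) ^ n \<le> 1" by (rule power_le_one) auto
        ultimately have "norm (ap (x n) (\<Xi> k)) * norm (ap (x n) (\<Xi> k)) \<le> (1/2) ^ n * 1"
          by (intro mult_mono) auto
        moreover have "\<phi> (adj (x n) * x n) = norm (ap (x n) (\<Xi> k)) * norm (ap (x n) (\<Xi> k))"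
          unfolding \<phi> ap_simps inner_ap_left[symmetric] by (simp add: dot_square_norm power2_eq_square)
        ultimately show "norm (\<phi> (adj (x n) * x n)) \<le> (1/2) ^ n" by simp
      qed
    qed
  qed (rule N)
  then have "(\<lambda>n. ip (x n) (x n)) \<longlonglongrightarrow> 0" by (simp add: ip_self N)
  then have "\<forall>\<^sub>F n in sequentially. ip (x n) (x n) < \<epsilon>" using \<epsilon> by (intro order_tendstoD(2)) auto
  then show False using x(5) by (auto simp: eventually_sequentially not_less[symmetric])
qed

text \<open>The scalar inequality is t^p <= \<eta> + C t^2: if t^p exceeds \<eta>, then t >=
  \<eta>^(1 / p) and t^(p - 2) <= C. Finite trace of e is what makes the constant term
  integrable.\<close>

lemma pnorm_pow_corner:
  assumes x: "x \<in> A" "x * e = x" and p: "1 \<le> p" "p \<le> 2" and \<eta>: "0 < \<eta>"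
  shows "pnorm_pow p x \<le> ennreal (\<eta> * enn2real (\<tau> e) + \<eta> powr ((p - 2) / p) * ip x x)"
proof -
  define a where "a = opabs x"
  have a: "a \<in> A" "0 \<le> a" "a * a = adj x * x" using x by (auto simp: a_def opabs_square)
  have xN: "x \<in> N2" "adj x * x \<in> E" using adj_mult_self_E x by auto
  define C where "C = \<eta> powr ((p - 2) / p)"
  have C: "0 \<le> C" by (simp add: C_def)
  define b where "b = fc (\<lambda>t. t powr p) a"
  have cp: "cont0 (\<lambda>t. t powr p)" using p by (intro cont0_powr) auto
  have b: "b \<in> A" "0 \<le> b" unfolding b_def by (intro fc_closed fc_nonneg a cp; simp)+
  \<comment> \<open>On [0, norm a] one has t^p <= L t because p >= 1; hence b is dominated by a
    multiple of a and belongs to E.\<close>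
  define L where "L = norm a powr (p - 1) + 1"
  have ae: "a * (1 - e) = 0"
  proof (rule bop_eqI)
    fix \<xi>
    have "(norm (ap a (ap (1 - e) \<xi>)))\<^sup>2 = inner (ap (1 - e) \<xi>) (ap (a * a) (ap (1 - e) \<xi>))"
      by (simp only: power2_norm_eq_inner inner_ap_left adj_nonneg[OF a(2)] ap_simps(7))
    also have "\<dots> = (norm (ap (x * (1 - e)) \<xi>))\<^sup>2"
      by (simp only: a(3) power2_norm_eq_inner inner_ap_left ap_simps(7))
        (simp only: inner_ap_left ap_simps(7) adj_simps flip: inner_ap_right)?
    also have "x * (1 - e) = 0" by (simp add: algebra_simps x)
    finally show "ap (a * (1 - e)) \<xi> = ap 0 \<xi>" by simp
  qed
  have aE: "a \<in> E"
  proof (rule E_I[OF a(1,2), of "norm a"])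
    have ae': "a * e = a" using ae by (simp add: algebra_simps)
    have ea: "e * a = a" using arg_cong[OF ae', of adj] by (simp add: e_adj adj_nonneg[OF a(2)])
    have "adj e * a * e \<le> adj e * (norm a *\<^sub>R 1) * e" by (intro conj_mono le_norm_bop adj_nonneg a)
    then show "a \<le> norm a *\<^sub>R e" by (simp add: e_adj e_idem ae' ea)
  qed
  have bL: "b \<le> L *\<^sub>R a"
  proof -
    have "b \<le> fc (\<lambda>t. L * t) a"
      unfolding b_def
    proof (rule fc_mono[OF a(2) cp])
      show "cont0 (\<lambda>t. L * t)" by (intro continuous_intros)
      fix t :: real assume t: "0 \<le> t" "t \<le> norm a"
      show "t powr p \<le> L * t"
      proof (cases "t = 0")
        case False
        then have "t powr p = t powr (p - 1) * t" using t by (simp add: powr_diff)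
        also have "\<dots> \<le> norm a powr (p - 1) * t" using t p by (intro mult_right_mono powr_mono2) auto
        also have "\<dots> \<le> L * t" using t by (intro mult_right_mono) (auto simp: L_def)
        finally show ?thesis .
      qed simp
    qed
    then show ?thesis by (simp only: fc_scale[OF a(2) continuous_on_id] fc_id[OF a(2)])
  qed
  have L: "0 \<le> L" by (simp add: L_def add_nonneg_nonneg)
  have bE: "b \<in> E" by (rule E_le[OF E_scale[OF aE L] b bL])
  have "b \<le> \<eta> *\<^sub>R 1 + C *\<^sub>R (adj x * x)"
  proof -
    have cc: "cont0 (\<lambda>t. t * t)" "cont0 (\<lambda>t. C * (t * t))" "cont0 (\<lambda>_. \<eta>)" by (intro continuous_intros)+
    have "b \<le> fc (\<lambda>t. \<eta> + C * (t * t)) a"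
      unfolding b_def
    proof (rule fc_mono[OF a(2) cp])
      show "cont0 (\<lambda>t. \<eta> + C * (t * t))" by (intro continuous_intros)
      fix t :: real assume t: "0 \<le> t"
      show "t powr p \<le> \<eta> + C * (t * t)"
      proof (cases "t powr p \<le> \<eta>")
        case True
        then show ?thesis using C t by (simp add: add_increasing2)
      next
        case False
        then have t0: "0 < t" using \<eta> t by (cases "t = 0") auto
        have "\<eta> powr (1 / p) \<le> (t powr p) powr (1 / p)" using False \<eta> p by (intro powr_mono2) auto
        then have "\<eta> powr (1 / p) \<le> t" using t0 p by (simp add: powr_powr)
        then have "t powr (p - 2) \<le> (\<eta> powr (1 / p)) powr (p - 2)" using \<eta> p by (intro powr_mono2') auto
        then have "t powr (p - 2) \<le> C" by (simp add: C_def powr_powr)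
        then have "t powr (p - 2) * (t * t) \<le> C * (t * t)" by (rule mult_right_mono) simp
        moreover have "t powr (p - 2) * (t * t) = t powr p"
          using t0 by (simp add: powr_diff power2_eq_square)
        ultimately show ?thesis using \<eta> by simp
      qed
    qed
    also have "\<dots> = \<eta> *\<^sub>R 1 + C *\<^sub>R (a * a)"
      by (simp only: fc_add[OF a(2) cc(3,2)] fc_scale[OF a(2) cc(1)] fc_const[OF a(2)]
          fc_mult[OF a(2) continuous_on_id continuous_on_id] fc_id[OF a(2)])
    finally show ?thesis by (simp add: a)
  qed
  \<comment> \<open>Compression by e replaces \<eta> 1, whose trace may be infinite, by \<eta> e and
    leaves b and \<open>adj x * x\<close> unchanged.\<close>
  from conj_mono[OF this, of e] have "b \<le> \<eta> *\<^sub>R e + C *\<^sub>R (adj x * x)"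
  proof -
    have ex: "e * adj x = adj x" using arg_cong[OF x(2), of adj] by (simp add: e_adj)
    have "b \<le> norm b *\<^sub>R e" by (rule E_D(3)[OF bE order_refl])
    note bb = nonneg_le_projection(1,2)[OF b(2) this e_adj e_idem]
    have "adj e * b * e = b" by (simp add: e_adj bb)
    moreover have "adj e * (\<eta> *\<^sub>R 1 + C *\<^sub>R (adj x * x)) * e = \<eta> *\<^sub>R e + C *\<^sub>R (adj x * x)"
      by (simp add: distrib_left distrib_right e_adj e_idem mult.assoc x) (simp add: ex flip: mult.assoc)
    ultimately show ?thesis using \<open>adj e * b * e \<le> adj e * (\<eta> *\<^sub>R 1 + C *\<^sub>R (adj x * x)) * e\<close> by simp
  qed
  then have "pnorm_pow p x \<le> \<tau> (\<eta> *\<^sub>R e + C *\<^sub>R (adj x * x))"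
    unfolding pnorm_pow_def a_def[symmetric] b_def[symmetric] using b e_A x by (intro tr_mono) auto
  also have "\<dots> = \<tau> (\<eta> *\<^sub>R e) + \<tau> (C *\<^sub>R (adj x * x))"
    using e_A x e_nonneg \<eta> C by (intro tr_add) (auto intro!: scaleR_nonneg_nonneg)
  also have "\<dots> = ennreal \<eta> * \<tau> e + ennreal C * \<tau> (adj x * x)"
    using e_A x e_nonneg \<eta> C by (simp add: tr_scale)
  also have "\<dots> = ennreal (\<eta> * enn2real (\<tau> e) + C * ip x x)"
    using e_fin \<eta> C ip_nonneg[OF xN(1)] by (simp add: tr_eq_ip[OF xN(1)] ennreal_mult)
  finally show ?thesis by (simp add: C_def)
qed

lemma pnorm_pow_corner_finite: "x \<in> A \<Longrightarrow> x * e = x \<Longrightarrow> 1 \<le> p \<Longrightarrow> p \<le> 2 \<Longrightarrow> pnorm_pow p x < \<infinity>"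
  using pnorm_pow_corner[of x p 1] by (metis ennreal_less_top infinity_ennreal_def le_less_trans zero_less_one)

lemma ip_small_imp_pnorm_small:
  assumes p: "1 \<le> p" "p \<le> 2" and \<epsilon>: "0 < \<epsilon>"
  shows "\<exists>\<delta>>0. \<forall>x\<in>A. x * e = x \<and> ip x x < \<delta> \<longrightarrow> pnorm p x < \<epsilon>"
proof -
  define t where "t = enn2real (\<tau> e)"
  have t: "0 \<le> t" by (simp add: t_def)
  \<comment> \<open>The choice keeps \<eta> \<tau>(e) below half of \<epsilon>^p; \<delta> is then
    chosen so that C \<delta> is the other half.\<close>
  define \<eta> where "\<eta> = \<epsilon> powr p / (2 * (t + 1))"
  have \<eta>: "0 < \<eta>" using \<epsilon> t by (simp add: \<eta>_def)
  define C where "C = \<eta> powr ((p - 2) / p)"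
  have C: "0 < C" using \<eta> by (simp add: C_def)
  define \<delta> where "\<delta> = \<epsilon> powr p / (2 * C)"
  have \<delta>: "0 < \<delta>" using \<epsilon> C by (simp add: \<delta>_def)
  have "pnorm p x < \<epsilon>" if x: "x \<in> A" "x * e = x" "ip x x < \<delta>" for x
  proof -
    have "enn2real (pnorm_pow p x) \<le> \<eta> * t + C * ip x x"
      using pnorm_pow_corner[OF x(1,2) p \<eta>] \<eta> t C ip_nonneg[OF adj_mult_self_E(2)[OF x(1,2)]]
      by (intro enn2real_leI) (auto simp: C_def t_def)
    also have "\<dots> < \<epsilon> powr p / 2 + C * \<delta>"
    proof (rule add_le_less_mono)
      have "\<eta> * t \<le> \<eta> * (t + 1)" using \<eta> by simp
      also have "\<dots> = \<epsilon> powr p / 2"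
      proof -
        have "z / (2 * u) * u = z / 2" if "u \<noteq> 0" for z u :: real using that by simp
        then show ?thesis unfolding \<eta>_def using t by (metis add_nonneg_eq_0_iff zero_le_one zero_neq_one)
      qed
      finally show "\<eta> * t \<le> \<epsilon> powr p / 2" .
      show "C * ip x x < C * \<delta>" using C x(3) by simp
    qed
    also have "\<dots> = \<epsilon> powr p" using C by (simp add: \<delta>_def)
    finally have "enn2real (pnorm_pow p x) powr (1 / p) < (\<epsilon> powr p) powr (1 / p)"
      using p by (intro powr_less_mono2) auto
    then show ?thesis using p \<epsilon> by (simp add: pnorm_def powr_powr)
  qed
  with \<delta> show ?thesis by blast
qed

end

context traced
begin

text \<open>The norm bound B enters through the factor K^(2 - p) of
  \<open>pnorm_pow_finite_N2\<close>. It holds outside any corner, as continuity of the cocycle is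
  needed before e exists.\<close>

lemma pnorm_small_imp_ip_small:
  assumes p: "1 \<le> p" "p \<le> 2" and \<epsilon>: "0 < \<epsilon>"
  shows "\<exists>\<delta>>0. \<forall>x\<in>A. norm x \<le> B \<and> pnorm_pow p x < \<infinity> \<and> pnorm p x < \<delta> \<longrightarrow> ip x x < \<epsilon>"
proof -
  define K where "K = (\<bar>B\<bar> + 1) powr (2 - p)"
  have K: "0 < K" by (simp add: K_def)
  define \<delta> where "\<delta> = (\<epsilon> / K) powr (1 / p)"
  have "ip x x < \<epsilon>" if x: "x \<in> A" "norm x \<le> B" "pnorm_pow p x < \<infinity>" "pnorm p x < \<delta>" for x
  proof -
    have xN: "x \<in> N2" using pnorm_pow_N2[of x p] x p by auto
    have "ennreal (ip x x) \<le> ennreal K * pnorm_pow p x"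
      unfolding K_def tr_eq_ip[OF xN, symmetric] using x p by (intro pnorm_pow_finite_N2) auto
    also have "\<dots> = ennreal (K * enn2real (pnorm_pow p x))" using x K by (simp add: ennreal_mult)
    finally have "ip x x \<le> K * enn2real (pnorm_pow p x)" using K by (subst (asm) ennreal_le_iff) auto
    also have "enn2real (pnorm_pow p x) = pnorm p x powr p" using p by (simp add: pnorm_def powr_powr)
    also have "K * pnorm p x powr p < K * (\<delta> powr p)"
      using x(4) p K by (intro mult_strict_left_mono powr_less_mono2) (auto simp: pnorm_def)
    also have "\<dots> = \<epsilon>" using K \<epsilon> p by (simp add: \<delta>_def powr_powr)
    finally show ?thesis .
  qed
  moreover have "\<delta> > 0" using K \<epsilon> by (simp add: \<delta>_def)
  ultimately show ?thesis by blast
qed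

end

section \<open>Property (FH) for cocycles with values in a pre-Hilbert space\<close>

text \<open>
  The completion of the pre-Hilbert space \<open>(N, B)\<close> consists of the pointwise limits of the
  functions \<open>g \<mapsto> B b\<^sub>n (J g)\<close> for Cauchy sequences \<open>b\<close>, where \<open>J\<close> is an indexing of \<open>N\<close>.
\<close>

locale prehilbert =
  fixes N :: "'v::real_vector set" and B :: "'v \<Rightarrow> 'v \<Rightarrow> real" and J :: "'g \<Rightarrow> 'v"
  assumes N_sub: "subspace N"
    and B_commute: "x \<in> N \<Longrightarrow> y \<in> N \<Longrightarrow> B x y = B y x"
    and B_add: "x \<in> N \<Longrightarrow> y \<in> N \<Longrightarrow> z \<in> N \<Longrightarrow> B (x + y) z = B x z + B y z"
    and B_scale: "x \<in> N \<Longrightarrow> z \<in> N \<Longrightarrow> B (r *\<^sub>R x) z = r * B x z"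
    and B_nonneg: "x \<in> N \<Longrightarrow> 0 \<le> B x x"
    and J_surj: "N \<subseteq> range J"
begin

lemma N_simps [simp]: "0 \<in> N" "x \<in> N \<Longrightarrow> y \<in> N \<Longrightarrow> x + y \<in> N" "x \<in> N \<Longrightarrow> y \<in> N \<Longrightarrow> x - y \<in> N"
  "x \<in> N \<Longrightarrow> r *\<^sub>R x \<in> N"
  using N_sub by (auto simp: subspace_0 subspace_add subspace_diff subspace_scale)

lemma B_diff: "x \<in> N \<Longrightarrow> y \<in> N \<Longrightarrow> z \<in> N \<Longrightarrow> B (x - y) z = B x z - B y z"
  using B_add[of x "(-1) *\<^sub>R y" z] B_scale[of y z "-1"] N_simps(4)[of y "-1"] by simp

lemma B_0: "x \<in> N \<Longrightarrow> B 0 x = 0"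
  using B_scale[of 0 x 0] by simp

lemma B_right: "x \<in> N \<Longrightarrow> y \<in> N \<Longrightarrow> z \<in> N \<Longrightarrow> B z (x + y) = B z x + B z y"
  "x \<in> N \<Longrightarrow> y \<in> N \<Longrightarrow> z \<in> N \<Longrightarrow> B z (x - y) = B z x - B z y"
  "x \<in> N \<Longrightarrow> z \<in> N \<Longrightarrow> B z (r *\<^sub>R x) = r * B z x"
  by (simp_all add: B_commute[of z] B_add B_diff B_scale)

definition nrm :: "'v \<Rightarrow> real" where "nrm x = sqrt (B x x)"

lemma nrm_nonneg: "x \<in> N \<Longrightarrow> 0 \<le> nrm x"
  by (simp add: nrm_def B_nonneg)

lemma nrm_square: "x \<in> N \<Longrightarrow> (nrm x)\<^sup>2 = B x x"
  by (simp add: nrm_def B_nonneg)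

lemma cauchy_schwarz:
  assumes x: "x \<in> N" and y: "y \<in> N"
  shows "\<bar>B x y\<bar> \<le> nrm x * nrm y"
proof -
  have q: "0 \<le> B x x - 2 * t * B x y + t\<^sup>2 * B y y" for t
  proof -
    have "0 \<le> B (x - t *\<^sub>R y) (x - t *\<^sub>R y)" by (intro B_nonneg) (simp add: x y)
    also have "\<dots> = B x x - 2 * t * B x y + t\<^sup>2 * B y y"
      using x y by (simp add: B_diff B_right B_scale B_commute[of y x] power2_eq_square algebra_simps)
    finally show ?thesis .
  qed
  have "(B x y)\<^sup>2 \<le> B x x * B y y"
  proof (cases "B y y = 0")
    case True
    have "B x y = 0"
    proof (rule ccontr)
      assume "B x y \<noteq> 0"
      then show False using q[of "(B x x + 1) / (2 * B x y)"] True by simp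
    qed
    then show ?thesis using True by simp
  next
    case False
    then have "B y y > 0" using B_nonneg[OF y] by simp
    then show ?thesis using q[of "B x y / B y y"] by (simp add: field_simps power2_eq_square)
  qed
  then show ?thesis unfolding nrm_def by (metis real_sqrt_abs real_sqrt_le_mono real_sqrt_mult)
qed

lemma nrm_triangle:
  assumes "x \<in> N" "y \<in> N" shows "nrm (x + y) \<le> nrm x + nrm y"
proof (rule power2_le_imp_le)
  have "(nrm (x + y))\<^sup>2 = (nrm x)\<^sup>2 + 2 * B x y + (nrm y)\<^sup>2"
    using assms by (simp add: nrm_square B_add B_right B_commute[of y x])
  also have "\<dots> \<le> (nrm x)\<^sup>2 + 2 * (nrm x * nrm y) + (nrm y)\<^sup>2" using cauchy_schwarz[OF assms] by auto
  finally show "(nrm (x + y))\<^sup>2 \<le> (nrm x + nrm y)\<^sup>2" by (simp add: power2_sum)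
qed (use assms in \<open>simp add: nrm_nonneg\<close>)

lemma nrm_minus_commute: "x \<in> N \<Longrightarrow> y \<in> N \<Longrightarrow> nrm (x - y) = nrm (y - x)"
  by (simp add: nrm_def B_diff B_right)

lemma nrm_diff_triangle: "x \<in> N \<Longrightarrow> y \<in> N \<Longrightarrow> z \<in> N \<Longrightarrow> nrm (x - z) \<le> nrm (x - y) + nrm (y - z)"
  using nrm_triangle[of "x - y" "y - z"] by simp

lemma nrm_0: "nrm 0 = 0"
  by (simp add: nrm_def B_0)

text \<open>The vector x as a functional: the index g stands for the vector \<open>J g\<close>.
  Elements of the completion thus become functions on the group type, the only carriers over which
  \<open>property_FH\<close> quantifies.\<close>

definition ker :: "'v \<Rightarrow> 'g \<Rightarrow> real"
  where "ker x g = (if J g \<in> N then B x (J g) else 0)"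

lemma ker_bound: "x \<in> N \<Longrightarrow> \<bar>ker x g\<bar> \<le> nrm x * nrm (if J g \<in> N then J g else 0)"
  by (auto simp: ker_def cauchy_schwarz nrm_0)

lemma ker_linear: "x \<in> N \<Longrightarrow> y \<in> N \<Longrightarrow> ker (x + y) g = ker x g + ker y g"
  "x \<in> N \<Longrightarrow> y \<in> N \<Longrightarrow> ker (x - y) g = ker x g - ker y g" "x \<in> N \<Longrightarrow> ker (r *\<^sub>R x) g = r * ker x g"
  by (auto simp: ker_def B_add B_diff B_scale)

definition Cau :: "(nat \<Rightarrow> 'v) \<Rightarrow> bool"
  where "Cau b \<longleftrightarrow> range b \<subseteq> N \<and> (\<forall>e>0. \<exists>M. \<forall>m\<ge>M. \<forall>n\<ge>M. nrm (b m - b n) < e)"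

lemma Cau_N: "Cau b \<Longrightarrow> b n \<in> N"
  by (auto simp: Cau_def)

lemma Cau_add: "Cau b \<Longrightarrow> Cau b' \<Longrightarrow> Cau (\<lambda>n. b n + b' n)"
proof -
  assume b: "Cau b" and b': "Cau b'"
  have "\<exists>M. \<forall>m\<ge>M. \<forall>n\<ge>M. nrm ((b m + b' m) - (b n + b' n)) < e" if "e > 0" for e
  proof -
    obtain M M' where M: "\<And>m n. m \<ge> M \<Longrightarrow> n \<ge> M \<Longrightarrow> nrm (b m - b n) < e / 2"
      "\<And>m n. m \<ge> M' \<Longrightarrow> n \<ge> M' \<Longrightarrow> nrm (b' m - b' n) < e / 2"
      using b b' half_gt_zero[OF \<open>e > 0\<close>] unfolding Cau_def by meson
    have "nrm ((b m + b' m) - (b n + b' n)) < e" if "m \<ge> max M M'" "n \<ge> max M M'" for m n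
      using nrm_triangle[of "b m - b n" "b' m - b' n"] M(1)[of m n] M(2)[of m n] that b b'
      by (simp add: Cau_N algebra_simps)
    then show ?thesis by blast
  qed
  then show ?thesis unfolding Cau_def using Cau_N[OF b] Cau_N[OF b'] by auto
qed

lemma nrm_scale: "x \<in> N \<Longrightarrow> nrm (r *\<^sub>R x) = \<bar>r\<bar> * nrm x"
  by (simp add: nrm_def B_scale B_right real_sqrt_mult flip: mult.assoc)

lemma Cau_scale: "Cau b \<Longrightarrow> Cau (\<lambda>n. r *\<^sub>R b n)"
proof -
  assume b: "Cau b"
  have "\<exists>M. \<forall>m\<ge>M. \<forall>n\<ge>M. nrm (r *\<^sub>R b m - r *\<^sub>R b n) < e" if e: "e > 0" for e
  proof -
    have "e / (\<bar>r\<bar> + 1) > 0" using e by simp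
    then obtain M where M: "\<And>m n. m \<ge> M \<Longrightarrow> n \<ge> M \<Longrightarrow> nrm (b m - b n) < e / (\<bar>r\<bar> + 1)"
      using b unfolding Cau_def by meson
    have "nrm (r *\<^sub>R b m - r *\<^sub>R b n) < e" if "m \<ge> M" "n \<ge> M" for m n
    proof -
      have "nrm (r *\<^sub>R b m - r *\<^sub>R b n) = \<bar>r\<bar> * nrm (b m - b n)"
        using b by (simp add: Cau_N nrm_scale flip: scaleR_diff_right)
      also have "\<dots> \<le> (\<bar>r\<bar> + 1) * nrm (b m - b n)" using b by (intro mult_right_mono nrm_nonneg) (auto simp: Cau_N)
      also have "\<dots> < (\<bar>r\<bar> + 1) * (e / (\<bar>r\<bar> + 1))" using M[OF that] by (intro mult_strict_left_mono) auto
      finally show ?thesis by simp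
    qed
    then show ?thesis by blast
  qed
  then show ?thesis using b by (auto simp: Cau_def)
qed

lemma Cau_const: "x \<in> N \<Longrightarrow> Cau (\<lambda>_. x)"
  by (auto simp: Cau_def nrm_0)

lemma Cau_diff: "Cau b \<Longrightarrow> Cau b' \<Longrightarrow> Cau (\<lambda>n. b n - b' n)"
  using Cau_add[of b "\<lambda>n. (-1) *\<^sub>R b' n"] Cau_scale[of b' "-1"] by simp

lemma Cau_bounded: assumes b: "Cau b" obtains C where "C > 0" "\<And>n. nrm (b n) \<le> C"
proof -
  obtain M where M: "\<And>m n. m \<ge> M \<Longrightarrow> n \<ge> M \<Longrightarrow> nrm (b m - b n) < 1"
    using b zero_less_one unfolding Cau_def by meson
  define C where "C = (\<Sum>k\<le>M. nrm (b k)) + 1"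
  have nn: "0 \<le> nrm (b k)" for k by (rule nrm_nonneg[OF Cau_N[OF b]])
  have le: "nrm (b k) \<le> (\<Sum>k\<le>M. nrm (b k))" if "k \<le> M" for k
    using that by (intro member_le_sum) (auto simp: nn)
  have "nrm (b n) \<le> C" for n
  proof (cases "n \<le> M")
    case False
    then have "nrm (b n - b M) < 1" by (intro M) auto
    then show ?thesis using nrm_triangle[of "b n - b M" "b M"] le[of M] b by (simp add: C_def Cau_N)
  qed (use le in \<open>force simp: C_def\<close>)
  moreover have "C > 0" unfolding C_def by (simp add: add_nonneg_pos nn sum_nonneg)
  ultimately show thesis using that by blast
qed

lemma Cau_B_convergent:
  assumes b: "Cau b" and b': "Cau b'"
  shows "convergent (\<lambda>n. B (b n) (b' n))"
proof (rule Cauchy_convergent, rule metric_CauchyI)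
  fix e :: real assume e: "e > 0"
  obtain C C' where C: "C > 0" "\<And>n. nrm (b n) \<le> C" "C' > 0" "\<And>n. nrm (b' n) \<le> C'"
    using Cau_bounded[OF b] Cau_bounded[OF b'] by metis
  have "e / (2 * C) > 0" "e / (2 * C') > 0" using e C by auto
  then obtain M M' where M: "\<And>m n. m \<ge> M \<Longrightarrow> n \<ge> M \<Longrightarrow> nrm (b m - b n) < e / (2 * C')"
      "\<And>m n. m \<ge> M' \<Longrightarrow> n \<ge> M' \<Longrightarrow> nrm (b' m - b' n) < e / (2 * C)"
    using b b' unfolding Cau_def by meson
  have "dist (B (b m) (b' m)) (B (b n) (b' n)) < e" if mn: "m \<ge> max M M'" "n \<ge> max M M'" for m n
  proof -
    note bN = Cau_N[OF b] Cau_N[OF b']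
    have "\<bar>B (b m - b n) (b' m)\<bar> \<le> nrm (b m - b n) * C'"
      using bN by (intro order_trans[OF cauchy_schwarz] mult_left_mono C nrm_nonneg) auto
    also have "\<dots> < e / (2 * C') * C'" using mn C by (intro mult_strict_right_mono M) auto
    finally have 1: "\<bar>B (b m - b n) (b' m)\<bar> < e / 2" using C by simp
    have "\<bar>B (b n) (b' m - b' n)\<bar> \<le> C * nrm (b' m - b' n)"
      using bN by (intro order_trans[OF cauchy_schwarz] mult_right_mono C nrm_nonneg) auto
    also have "\<dots> < C * (e / (2 * C))" using mn C by (intro mult_strict_left_mono M) auto
    finally have 2: "\<bar>B (b n) (b' m - b' n)\<bar> < e / 2" using C by simp
    have "B (b m) (b' m) - B (b n) (b' n) = B (b m - b n) (b' m) + B (b n) (b' m - b' n)"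
      using bN by (simp add: B_diff B_right)
    then show ?thesis using 1 2 by (simp add: dist_real_def)
  qed
  then show "\<exists>M. \<forall>m\<ge>M. \<forall>n\<ge>M. dist (B (b m) (b' m)) (B (b n) (b' n)) < e" by blast
qed

definition rep :: "(nat \<Rightarrow> 'v) \<Rightarrow> ('g \<Rightarrow> real) \<Rightarrow> bool"
  where "rep b f \<longleftrightarrow> Cau b \<and> (\<forall>g. (\<lambda>n. ker (b n) g) \<longlonglongrightarrow> f g)"

lemma rep_Cau: "rep b f \<Longrightarrow> Cau b"
  by (simp add: rep_def)

lemma rep_N: "rep b f \<Longrightarrow> b n \<in> N"
  by (simp add: rep_def Cau_N)

lemma rep_add: "rep b f \<Longrightarrow> rep b' f' \<Longrightarrow> rep (\<lambda>n. b n + b' n) (\<lambda>g. f g + f' g)"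
  by (auto simp: rep_def Cau_add ker_linear Cau_N intro: tendsto_add)

lemma rep_diff: "rep b f \<Longrightarrow> rep b' f' \<Longrightarrow> rep (\<lambda>n. b n - b' n) (\<lambda>g. f g - f' g)"
  by (auto simp: rep_def Cau_diff ker_linear Cau_N intro: tendsto_diff)

lemma rep_scale: "rep b f \<Longrightarrow> rep (\<lambda>n. r *\<^sub>R b n) (\<lambda>g. r * f g)"
  by (auto simp: rep_def Cau_scale ker_linear Cau_N intro: tendsto_mult_left)

lemma rep_const: "x \<in> N \<Longrightarrow> rep (\<lambda>_. x) (ker x)"
  by (simp add: rep_def Cau_const)

lemma rep_unique: "rep b f \<Longrightarrow> rep b f' \<Longrightarrow> f = f'"
  unfolding rep_def by (metis LIMSEQ_unique ext)

lemma rep_exists: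
  assumes "Cau b" shows "\<exists>f. rep b f"
proof -
  have "convergent (\<lambda>n. ker (b n) g)" for g
    using Cau_B_convergent[OF assms Cau_const[of "J g"]] by (cases "J g \<in> N") (auto simp: ker_def convergent_const)
  then show ?thesis using assms unfolding rep_def convergent_def by metis
qed

text \<open>Compare b n with a fixed late term b M: their difference is small by the Cauchy
  property, and b M has an index g, at which \<open>ker (b n) g\<close> tends to 0. Surjectivity of
  J onto N is used here.\<close>

lemma rep_zero:
  assumes b: "rep b (\<lambda>_. 0)"
  shows "(\<lambda>n. nrm (b n)) \<longlonglongrightarrow> 0"
proof -
  note bN = rep_N[OF b]
  obtain C where C: "C > 0" "\<And>n. nrm (b n) \<le> C" using Cau_bounded[OF rep_Cau[OF b]] by metis
  have "(\<lambda>n. B (b n) (b n)) \<longlonglongrightarrow> 0"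
  proof (rule metric_LIMSEQ_I)
    fix e :: real assume e: "e > 0"
    then have "e / (2 * C) > 0" using C by simp
    then obtain M where M: "\<And>m n. m \<ge> M \<Longrightarrow> n \<ge> M \<Longrightarrow> nrm (b m - b n) < e / (2 * C)"
      using rep_Cau[OF b] unfolding Cau_def by meson
    obtain g where g: "J g = b M" using J_surj bN[of M] by (metis imageE subsetD)
    have "(\<lambda>n. ker (b n) g) \<longlonglongrightarrow> 0" using b by (simp add: rep_def)
    then obtain M' where M': "\<And>n. n \<ge> M' \<Longrightarrow> \<bar>ker (b n) g\<bar> < e / 2"
      using LIMSEQ_D[of _ 0 "e / 2"] e by (metis diff_zero half_gt_zero real_norm_def)
    have "dist (B (b n) (b n)) 0 < e" if n: "n \<ge> max M M'" for n
    proof -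
      have "\<bar>B (b n) (b n - b M)\<bar> \<le> C * nrm (b n - b M)"
        using bN by (intro order_trans[OF cauchy_schwarz] mult_right_mono C nrm_nonneg) auto
      also have "\<dots> < C * (e / (2 * C))" using n C by (intro mult_strict_left_mono M) auto
      finally have 1: "\<bar>B (b n) (b n - b M)\<bar> < e / 2" using C by simp
      have 2: "\<bar>B (b n) (b M)\<bar> < e / 2" using M'[of n] n by (simp add: ker_def g bN)
      have "B (b n) (b n) = B (b n) (b n - b M) + B (b n) (b M)" using bN by (simp add: B_right)
      then show ?thesis using 1 2 by (simp add: dist_real_def)
    qed
    then show "\<exists>M. \<forall>n\<ge>M. dist (B (b n) (b n)) 0 < e" by blast
  qed
  from tendsto_real_sqrt[OF this] show ?thesis by (simp add: nrm_def)
qed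

section \<open>The Hilbert space structure of the completion\<close>

definition ipf :: "('g \<Rightarrow> real) \<Rightarrow> ('g \<Rightarrow> real) \<Rightarrow> real"
  where "ipf f f' = lim (\<lambda>n. B ((SOME b. rep b f) n) ((SOME b. rep b f') n))"

text \<open>Two sequences representing the same function differ by a null sequence
  (\<open>rep_zero\<close>), so the choice in \<open>ipf\<close> does not affect the limit.\<close>

lemma ipf_tendsto:
  assumes b: "rep b f" and b': "rep b' f'"
  shows "(\<lambda>n. B (b n) (b' n)) \<longlonglongrightarrow> ipf f f'"
proof -
  define c c' where "c = (SOME b. rep b f)" and "c' = (SOME b. rep b f')"
  have c: "rep c f" "rep c' f'" unfolding c_def c'_def using someI[of "\<lambda>b. rep b f", OF b] someI[of "\<lambda>b. rep b f'", OF b'] by auto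
  have l: "(\<lambda>n. B (c n) (c' n)) \<longlonglongrightarrow> ipf f f'"
    using Cau_B_convergent[OF rep_Cau[OF c(1)] rep_Cau[OF c(2)]] unfolding ipf_def c_def[symmetric] c'_def[symmetric]
    by (rule convergent_LIMSEQ_iff[THEN iffD1])
  obtain C C' where C: "C > 0" "\<And>n. nrm (b n) \<le> C" "C' > 0" "\<And>n. nrm (c' n) \<le> C'"
    using Cau_bounded[OF rep_Cau[OF b]] Cau_bounded[OF rep_Cau[OF c(2)]] by metis
  note N = rep_N[OF b] rep_N[OF b'] rep_N[OF c(1)] rep_N[OF c(2)]
  have z: "(\<lambda>n. nrm (b n - c n)) \<longlonglongrightarrow> 0" "(\<lambda>n. nrm (b' n - c' n)) \<longlonglongrightarrow> 0"
    using rep_zero rep_diff[OF b c(1)] rep_diff[OF b' c(2)] by auto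
  have "(\<lambda>n. B (b n) (b' n) - B (c n) (c' n)) \<longlonglongrightarrow> 0"
  proof (rule tendsto_rabs_zero_cancel, rule tendsto_sandwich)
    show "\<forall>\<^sub>F n in sequentially. 0 \<le> \<bar>B (b n) (b' n) - B (c n) (c' n)\<bar>" by simp
    have "\<bar>B (b n) (b' n) - B (c n) (c' n)\<bar> \<le> C * nrm (b' n - c' n) + nrm (b n - c n) * C'" for n
    proof -
      have "B (b n) (b' n) - B (c n) (c' n) = B (b n) (b' n - c' n) + B (b n - c n) (c' n)"
        using N by (simp add: B_diff B_right)
      moreover have "\<bar>B (b n) (b' n - c' n)\<bar> \<le> C * nrm (b' n - c' n)"
        using N by (intro order_trans[OF cauchy_schwarz] mult_right_mono C nrm_nonneg) auto
      moreover have "\<bar>B (b n - c n) (c' n)\<bar> \<le> nrm (b n - c n) * C'"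
        using N by (intro order_trans[OF cauchy_schwarz] mult_left_mono C nrm_nonneg) auto
      ultimately show ?thesis by linarith
    qed
    then show "\<forall>\<^sub>F n in sequentially. \<bar>B (b n) (b' n) - B (c n) (c' n)\<bar> \<le> C * nrm (b' n - c' n) + nrm (b n - c n) * C'" by simp
    show "(\<lambda>n. C * nrm (b' n - c' n) + nrm (b n - c n) * C') \<longlonglongrightarrow> 0"
      using tendsto_add[OF tendsto_mult_left[OF z(2), of C] tendsto_mult_right[OF z(1), of C']] by simp
  qed simp
  from tendsto_add[OF this l] show ?thesis by simp
qed

definition Compl :: "('g \<Rightarrow> real) inner_module"
  where "Compl = \<lparr>carrier = {f. \<exists>b. rep b f}, monoid.mult = (\<lambda>f f'. f), one = (\<lambda>_. 0), ring.zero = (\<lambda>_. 0),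
    add = (\<lambda>f f' g. f g + f' g), smult = (\<lambda>r f g. r * f g), ip = ipf\<rparr>"

lemma Compl_simps: "f \<in> carrier Compl \<longleftrightarrow> (\<exists>b. rep b f)" "\<zero>\<^bsub>Compl\<^esub> = (\<lambda>_. 0)"
  "f \<oplus>\<^bsub>Compl\<^esub> f' = (\<lambda>g. f g + f' g)" "r \<odot>\<^bsub>Compl\<^esub> f = (\<lambda>g. r * f g)" "inner_module.ip Compl = ipf"
  by (simp_all add: Compl_def)

lemma rep_0: "rep (\<lambda>_. 0) (\<lambda>_. 0)"
proof -
  have "ker 0 = (\<lambda>_. 0)" by (rule ext) (simp add: ker_def B_0)
  then show ?thesis using rep_const[of 0] by simp
qed

lemma Compl_abelian_group: "abelian_group Compl"
proof (rule abelian_groupI)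
  fix x assume "x \<in> carrier Compl"
  then obtain b where "rep b x" by (auto simp: Compl_simps)
  from rep_scale[OF this, of "-1"] show "\<exists>y\<in>carrier Compl. y \<oplus>\<^bsub>Compl\<^esub> x = \<zero>\<^bsub>Compl\<^esub>"
    by (intro bexI[of _ "\<lambda>g. - 1 * x g"]) (auto simp: Compl_simps)
qed (auto simp: Compl_simps fun_eq_iff intro: rep_add rep_0)

lemma Compl_minus: "f \<in> carrier Compl \<Longrightarrow> f' \<in> carrier Compl \<Longrightarrow> f \<ominus>\<^bsub>Compl\<^esub> f' = (\<lambda>g. f g - f' g)"
proof -
  assume f: "f \<in> carrier Compl" "f' \<in> carrier Compl"
  obtain b where b: "rep b f'" using f by (auto simp: Compl_simps)
  have "(\<lambda>g. - 1 * f' g) \<in> carrier Compl" using rep_scale[OF b, of "-1"] by (auto simp: Compl_simps)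
  then have "\<ominus>\<^bsub>Compl\<^esub> f' = (\<lambda>g. - f' g)"
    using f by (intro abelian_group.minus_equality[OF Compl_abelian_group]) (auto simp: Compl_simps)
  then show ?thesis by (simp add: a_minus_def Compl_simps)
qed

lemma Compl_dist_tendsto:
  assumes b: "rep b f" and b': "rep b' f'"
  shows "(\<lambda>n. nrm (b n - b' n)) \<longlonglongrightarrow> ip_dist Compl f f'"
proof -
  have f: "f \<in> carrier Compl" "f' \<in> carrier Compl" using b b' by (auto simp: Compl_simps)
  have r: "rep (\<lambda>n. b n - b' n) (\<lambda>g. f g - f' g)" by (rule rep_diff[OF b b'])
  show ?thesis
    using tendsto_real_sqrt[OF ipf_tendsto[OF r r]] f by (simp add: nrm_def ip_dist_def Compl_minus Compl_simps)
qed

lemma Compl_dist_const: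
  assumes "x \<in> N" "y \<in> N" shows "ip_dist Compl (ker x) (ker y) = nrm (x - y)"
  using Compl_dist_tendsto[OF rep_const rep_const, OF assms] LIMSEQ_unique by auto

lemma rep_const_carrier: "x \<in> N \<Longrightarrow> ker x \<in> carrier Compl"
  using rep_const by (auto simp: Compl_simps)

sublocale C: Metric_space "carrier Compl" "ip_dist Compl"
proof
  fix x y
  show "0 \<le> ip_dist Compl x y"
  proof (cases "x \<in> carrier Compl \<and> y \<in> carrier Compl")
    case True
    then obtain b b' where b: "rep b x" "rep b' y" by (auto simp: Compl_simps)
    show ?thesis
      by (rule LIMSEQ_le_const[OF Compl_dist_tendsto[OF b]])
        (intro exI[of _ 0] allI impI nrm_nonneg N_simps rep_N[OF b(1)] rep_N[OF b(2)])
  qed (auto simp: ip_dist_def)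
  show "ip_dist Compl x y = ip_dist Compl y x"
  proof (cases "x \<in> carrier Compl \<and> y \<in> carrier Compl")
    case True
    then obtain b b' where b: "rep b x" "rep b' y" by (auto simp: Compl_simps)
    have "(\<lambda>n. nrm (b n - b' n)) = (\<lambda>n. nrm (b' n - b n))"
      by (rule ext) (rule nrm_minus_commute[OF rep_N[OF b(1)] rep_N[OF b(2)]])
    then show ?thesis
      using Compl_dist_tendsto[OF b] Compl_dist_tendsto[OF b(2,1)] LIMSEQ_unique by metis
  qed (auto simp: ip_dist_def)
next
  fix x y z assume xy: "x \<in> carrier Compl" "y \<in> carrier Compl"
  then obtain b b' where b: "rep b x" "rep b' y" by (auto simp: Compl_simps)
  show "ip_dist Compl x y = 0 \<longleftrightarrow> x = y"
  proof
    assume "x = y"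
    then show "ip_dist Compl x y = 0" using Compl_dist_tendsto[OF b(1), of b y] b by (auto simp: nrm_0 LIMSEQ_const_iff)
  next
    assume "ip_dist Compl x y = 0"
    then have l: "(\<lambda>n. nrm (b n - b' n)) \<longlonglongrightarrow> 0" using Compl_dist_tendsto[OF b] by simp
    show "x = y"
    proof
      fix g
      have r: "rep (\<lambda>n. b n - b' n) (\<lambda>g. x g - y g)" by (rule rep_diff[OF b])
      then have 1: "(\<lambda>n. ker (b n - b' n) g) \<longlonglongrightarrow> x g - y g" by (simp add: rep_def)
      have "(\<lambda>n. ker (b n - b' n) g) \<longlonglongrightarrow> 0"
      proof (rule Lim_null_comparison)
        show "(\<lambda>n. nrm (b n - b' n) * nrm (if J g \<in> N then J g else 0)) \<longlonglongrightarrow> 0"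
          using tendsto_mult_right[OF l, of "nrm (if J g \<in> N then J g else 0)"] by simp
        show "\<forall>\<^sub>F n in sequentially. norm (ker (b n - b' n) g) \<le> nrm (b n - b' n) * nrm (if J g \<in> N then J g else 0)"
          unfolding real_norm_def
          by (intro always_eventually allI ker_bound) (simp add: rep_N[OF b(1)] rep_N[OF b(2)])
      qed
      with 1 show "x g = y g" using LIMSEQ_unique by force
    qed
  qed
  assume "z \<in> carrier Compl"
  then obtain c where c: "rep c z" by (auto simp: Compl_simps)
  show "ip_dist Compl x z \<le> ip_dist Compl x y + ip_dist Compl y z"
  proof (rule LIMSEQ_le[OF Compl_dist_tendsto[OF b(1) c] tendsto_add[OF Compl_dist_tendsto[OF b] Compl_dist_tendsto[OF b(2) c]]])
    show "\<exists>M. \<forall>n\<ge>M. nrm (b n - c n) \<le> nrm (b n - b' n) + nrm (b' n - c n)"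
      by (intro exI allI impI nrm_diff_triangle rep_N[OF b(1)] rep_N[OF b(2)] rep_N[OF c])
  qed
qed

lemma rep_approx:
  assumes b: "rep b f" and e: "0 < e"
  shows "\<exists>M. \<forall>m\<ge>M. ip_dist Compl f (ker (b m)) \<le> e"
proof -
  obtain M where M: "\<And>m n. m \<ge> M \<Longrightarrow> n \<ge> M \<Longrightarrow> nrm (b m - b n) < e"
    using rep_Cau[OF b] e unfolding Cau_def by meson
  have "ip_dist Compl f (ker (b m)) \<le> e" if "m \<ge> M" for m
    by (rule LIMSEQ_le_const2[OF Compl_dist_tendsto[OF b rep_const[OF rep_N[OF b]]]])
      (use M that in \<open>auto intro!: exI[of _ M] less_imp_le\<close>)
  then show ?thesis by blast
qed

text \<open>Each \<open>\<sigma> k\<close> is within 1 / (k + 1) of some vector \<open>m k\<close>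
  of N. The sequence m is then Cauchy in N, and the function it represents is the limit.\<close>

lemma Compl_mcomplete: "C.mcomplete"
  unfolding C.mcomplete_def
proof (intro allI impI)
  fix \<sigma> assume \<sigma>: "C.MCauchy \<sigma>"
  then have \<sigma>C: "\<sigma> n \<in> carrier Compl" for n unfolding C.MCauchy_def by blast
  have "\<exists>m\<in>N. ip_dist Compl (\<sigma> k) (ker m) \<le> 1 / Suc k" for k
  proof -
    obtain b where b: "rep b (\<sigma> k)" using \<sigma>C[of k] by (auto simp: Compl_simps)
    have "(0::real) < 1 / Suc k" by simp
    from rep_approx[OF b this] show ?thesis using rep_N[OF b] by blast
  qed
  then obtain m where m: "\<And>k. m k \<in> N" "\<And>k. ip_dist Compl (\<sigma> k) (ker (m k)) \<le> 1 / Suc k" by metis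
  have small: "\<exists>M. \<forall>k\<ge>M. 1 / real (Suc k) < e" if "e > 0" for e
    using order_tendstoD(2)[OF LIMSEQ_Suc[OF lim_1_over_n] that] by (simp add: eventually_sequentially)
  have "Cau m"
    unfolding Cau_def
  proof (intro conjI allI impI)
    show "range m \<subseteq> N" using m by auto
    fix e :: real assume e: "e > 0"
    obtain M1 where M1: "\<And>k. k \<ge> M1 \<Longrightarrow> 1 / real (Suc k) < e / 3" using small[of "e / 3"] e by auto
    obtain M2 where M2: "\<And>k l. k \<ge> M2 \<Longrightarrow> l \<ge> M2 \<Longrightarrow> ip_dist Compl (\<sigma> k) (\<sigma> l) < e / 3"
      using \<sigma> e unfolding C.MCauchy_def by (metis divide_pos_pos zero_less_numeral)
    have "nrm (m k - m l) < e" if kl: "k \<ge> max M1 M2" "l \<ge> max M1 M2" for k l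
    proof -
      note K = rep_const_carrier[OF m(1)]
      have "nrm (m k - m l) = ip_dist Compl (ker (m k)) (ker (m l))" by (simp add: Compl_dist_const m)
      also have "\<dots> \<le> ip_dist Compl (ker (m k)) (\<sigma> k) + ip_dist Compl (\<sigma> k) (ker (m l))" by (intro C.triangle K \<sigma>C)
      also have "ip_dist Compl (\<sigma> k) (ker (m l)) \<le> ip_dist Compl (\<sigma> k) (\<sigma> l) + ip_dist Compl (\<sigma> l) (ker (m l))"
        by (intro C.triangle K \<sigma>C)
      finally have "nrm (m k - m l) \<le> ip_dist Compl (\<sigma> k) (ker (m k)) + ip_dist Compl (\<sigma> k) (\<sigma> l) + ip_dist Compl (\<sigma> l) (ker (m l))"
        by (simp add: C.commute)
      then show ?thesis using m(2)[of k] m(2)[of l] M1[of k] M1[of l] M2[of k l] kl by simp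
    qed
    then show "\<exists>M. \<forall>k\<ge>M. \<forall>l\<ge>M. nrm (m k - m l) < e" by blast
  qed
  then obtain f where f: "rep m f" using rep_exists by blast
  have fC: "f \<in> carrier Compl" using f by (auto simp: Compl_simps)
  have "limitin C.mtopology \<sigma> f sequentially"
    unfolding C.limitin_metric
  proof (intro conjI fC allI impI)
    fix e :: real assume e: "e > 0"
    obtain M1 where M1: "\<And>k. k \<ge> M1 \<Longrightarrow> 1 / real (Suc k) < e / 2" using small[of "e / 2"] e by auto
    obtain M2 where M2: "\<And>k. k \<ge> M2 \<Longrightarrow> ip_dist Compl f (ker (m k)) \<le> e / 2" using rep_approx[OF f, of "e / 2"] e by auto
    have "\<sigma> k \<in> carrier Compl \<and> ip_dist Compl (\<sigma> k) f < e" if k: "k \<ge> max M1 M2" for k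
    proof -
      have "ip_dist Compl (\<sigma> k) f \<le> ip_dist Compl (\<sigma> k) (ker (m k)) + ip_dist Compl (ker (m k)) f"
        by (intro C.triangle \<sigma>C rep_const_carrier m fC)
      also have "\<dots> < e" using m(2)[of k] M1[of k] M2[of k] k by (simp add: C.commute)
      finally show ?thesis using \<sigma>C by simp
    qed
    then show "\<forall>\<^sub>F k in sequentially. \<sigma> k \<in> carrier Compl \<and> ip_dist Compl (\<sigma> k) f < e"
      unfolding eventually_sequentially by blast
  qed
  then show "\<exists>x. limitin C.mtopology \<sigma> x sequentially" by blast
qed

lemma real_hilbert_Compl: "real_hilbert Compl"
proof -
  have "abelian_group real_field"
    by (rule abelian_groupI) (auto simp: real_field_def intro: exI[of _ "- x" for x])
  moreover have "Group.comm_monoid real_field"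
    by (rule comm_monoidI) (auto simp: real_field_def)
  ultimately have "cring real_field"
    by (rule cringI) (simp add: real_field_def algebra_simps)
  then have mod: "Module.module real_field Compl"
    by (rule moduleI[OF _ Compl_abelian_group])
      (auto simp: real_field_def Compl_simps algebra_simps intro: rep_scale)
  show ?thesis
    unfolding real_hilbert_def
  proof (intro conjI mod ballI allI impI Compl_mcomplete)
    fix v w assume "v \<in> carrier Compl" "w \<in> carrier Compl"
    then obtain b c where b: "rep b v" and c: "rep c w" by (auto simp: Compl_simps)
    have "(\<lambda>n. B (b n) (c n)) = (\<lambda>n. B (c n) (b n))" by (rule ext) (rule B_commute[OF rep_N[OF b] rep_N[OF c]])
    then show "inner_module.ip Compl v w = inner_module.ip Compl w v"
      using ipf_tendsto[OF b c] ipf_tendsto[OF c b] LIMSEQ_unique unfolding Compl_simps by metis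
    show "inner_module.ip Compl (r \<odot>\<^bsub>Compl\<^esub> v) w = r * inner_module.ip Compl v w" for r
      unfolding Compl_simps
      using ipf_tendsto[OF rep_scale[OF b, of r] c] tendsto_mult_left[OF ipf_tendsto[OF b c], of r]
      by (simp add: B_scale rep_N[OF b] rep_N[OF c] LIMSEQ_unique)
    fix u assume "u \<in> carrier Compl"
    then obtain a where a: "rep a u" by (auto simp: Compl_simps)
    show "inner_module.ip Compl (u \<oplus>\<^bsub>Compl\<^esub> v) w = inner_module.ip Compl u w + inner_module.ip Compl v w"
      unfolding Compl_simps
      using ipf_tendsto[OF rep_add[OF a b] c] tendsto_add[OF ipf_tendsto[OF a c] ipf_tendsto[OF b c]]
      by (simp add: B_add rep_N[OF a] rep_N[OF b] rep_N[OF c] LIMSEQ_unique)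
  next
    fix v assume v: "v \<in> carrier Compl" "v \<noteq> \<zero>\<^bsub>Compl\<^esub>"
    then obtain b where b: "rep b v" by (auto simp: Compl_simps)
    have z: "(\<lambda>_. 0) \<in> carrier Compl" using rep_0 by (auto simp: Compl_simps)
    have "ip_dist Compl v (\<lambda>_. 0) > 0" using v z by (intro C.mdist_pos_less) (auto simp: Compl_simps)
    then show "0 < inner_module.ip Compl v v" using v z by (simp add: ip_dist_def Compl_minus Compl_simps)
  qed
qed

end

section \<open>Affine actions on the completion and their fixed points\<close>

locale prehilbert_action = prehilbert N B J for N :: "'v::real_vector set" and B and J :: "'g \<Rightarrow> 'v" +
  fixes G :: "('g, 'm) monoid_scheme" and T :: "'g topology"
    and \<pi> \<pi>' :: "'g \<Rightarrow> 'v \<Rightarrow> 'v" and c :: "'g \<Rightarrow> 'v"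
  assumes topT: "topspace T = carrier G"
    and \<pi>_N: "u \<in> carrier G \<Longrightarrow> x \<in> N \<Longrightarrow> \<pi> u x \<in> N" "u \<in> carrier G \<Longrightarrow> x \<in> N \<Longrightarrow> \<pi>' u x \<in> N"
    and \<pi>_add: "u \<in> carrier G \<Longrightarrow> x \<in> N \<Longrightarrow> y \<in> N \<Longrightarrow> \<pi> u (x + y) = \<pi> u x + \<pi> u y"
    and \<pi>_isometry: "u \<in> carrier G \<Longrightarrow> x \<in> N \<Longrightarrow> B (\<pi> u x) (\<pi> u x) = B x x"
    and \<pi>_adj: "u \<in> carrier G \<Longrightarrow> x \<in> N \<Longrightarrow> y \<in> N \<Longrightarrow> B (\<pi> u x) y = B x (\<pi>' u y)"
    and c_N: "u \<in> carrier G \<Longrightarrow> c u \<in> N"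
    and one: "\<one>\<^bsub>G\<^esub> \<in> carrier G" "x \<in> N \<Longrightarrow> \<pi> \<one>\<^bsub>G\<^esub> x = x" "c \<one>\<^bsub>G\<^esub> = 0"
    and mult: "u \<in> carrier G \<Longrightarrow> v \<in> carrier G \<Longrightarrow> u \<otimes>\<^bsub>G\<^esub> v \<in> carrier G"
      "u \<in> carrier G \<Longrightarrow> v \<in> carrier G \<Longrightarrow> x \<in> N \<Longrightarrow> \<pi> (u \<otimes>\<^bsub>G\<^esub> v) x = \<pi> u (\<pi> v x)"
      "u \<in> carrier G \<Longrightarrow> v \<in> carrier G \<Longrightarrow> c (u \<otimes>\<^bsub>G\<^esub> v) = \<pi> u (c v) + c u"
    and cont: "u \<in> carrier G \<Longrightarrow> x \<in> N \<Longrightarrow> 0 < e \<Longrightarrow>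
      \<exists>U. openin T U \<and> u \<in> U \<and>
        (\<forall>v\<in>U. let d = \<pi> v x + c v - (\<pi> u x + c u) in B d d < e)"
begin

text \<open>Formally \<open><\<pi> u f + c u, J g> = <f, \<pi>' u (J g)> + <c u, J g>\<close>.
  Moving the linear part to the index defines the extended action pointwise, without extension by
  continuity.\<close>

definition act :: "'g \<Rightarrow> ('g \<Rightarrow> real) \<Rightarrow> 'g \<Rightarrow> real"
  where "act u f g = (if J g \<in> N then f (inv_into UNIV J (\<pi>' u (J g))) + B (c u) (J g) else 0)"

lemma \<pi>_diff: "u \<in> carrier G \<Longrightarrow> x \<in> N \<Longrightarrow> y \<in> N \<Longrightarrow> \<pi> u (x - y) = \<pi> u x - \<pi> u y"
  using \<pi>_add[of u "x - y" y] by simp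

lemma nrm_act: "u \<in> carrier G \<Longrightarrow> x \<in> N \<Longrightarrow> y \<in> N \<Longrightarrow> nrm (\<pi> u x - \<pi> u y) = nrm (x - y)"
  using \<pi>_isometry[of u "x - y"] by (simp add: nrm_def \<pi>_diff)

lemma rep_act:
  assumes u: "u \<in> carrier G" and b: "rep b f"
  shows "rep (\<lambda>n. \<pi> u (b n) + c u) (act u f)"
  unfolding rep_def
proof (intro conjI allI)
  note bN = rep_N[OF b]
  show "Cau (\<lambda>n. \<pi> u (b n) + c u)"
    using rep_Cau[OF b] u by (auto simp: Cau_def nrm_act \<pi>_N c_N bN)
  fix g
  show "(\<lambda>n. ker (\<pi> u (b n) + c u) g) \<longlonglongrightarrow> act u f g"
  proof (cases "J g \<in> N")
    case True
    define k where "k = inv_into UNIV J (\<pi>' u (J g))"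
    have m: "\<pi>' u (J g) \<in> N" using u True by (rule \<pi>_N)
    then have k: "J k = \<pi>' u (J g)" unfolding k_def using J_surj by (intro f_inv_into_f) auto
    have "ker (\<pi> u (b n) + c u) g = ker (b n) k + B (c u) (J g)" for n
      using True m u bN by (simp add: ker_def k B_add \<pi>_N c_N \<pi>_adj)
    moreover have "(\<lambda>n. ker (b n) k + B (c u) (J g)) \<longlonglongrightarrow> f k + B (c u) (J g)"
      using b by (intro tendsto_add tendsto_const) (simp add: rep_def)
    ultimately show ?thesis using True by (simp add: act_def k_def)
  qed (simp add: ker_def act_def)
qed

lemma act_const: "u \<in> carrier G \<Longrightarrow> x \<in> N \<Longrightarrow> act u (ker x) = ker (\<pi> u x + c u)"
  using rep_act[OF _ rep_const] rep_const[of "\<pi> u x + c u"] by (auto simp: \<pi>_N c_N intro: rep_unique)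

lemma act_dist:
  assumes "u \<in> carrier G" "f \<in> carrier Compl" "f' \<in> carrier Compl"
  shows "ip_dist Compl (act u f) (act u f') = ip_dist Compl f f'"
proof -
  obtain b b' where b: "rep b f" "rep b' f'" using assms by (auto simp: Compl_simps)
  show ?thesis
    using Compl_dist_tendsto[OF rep_act[OF assms(1) b(1)] rep_act[OF assms(1) b(2)]] Compl_dist_tendsto[OF b]
    by (simp add: nrm_act assms rep_N[OF b(1)] rep_N[OF b(2)] LIMSEQ_unique)
qed

lemma act_carrier: "u \<in> carrier G \<Longrightarrow> f \<in> carrier Compl \<Longrightarrow> act u f \<in> carrier Compl"
  unfolding Compl_simps using rep_act by blast

lemma affine_isometric_action_act: "affine_isometric_action G Compl act"
  unfolding affine_isometric_action_def
proof (intro conjI ballI allI act_carrier act_dist)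
  fix f assume "f \<in> carrier Compl"
  then obtain b where b: "rep b f" by (auto simp: Compl_simps)
  show "act \<one>\<^bsub>G\<^esub> f = f"
    using rep_act[OF one(1) b] b by (intro rep_unique[of b]) (simp_all add: one rep_N[OF b])
  fix u v assume uv: "u \<in> carrier G" "v \<in> carrier G"
  have "(\<lambda>n. \<pi> u (\<pi> v (b n) + c v) + c u) = (\<lambda>n. \<pi> (u \<otimes>\<^bsub>G\<^esub> v) (b n) + c (u \<otimes>\<^bsub>G\<^esub> v))"
    using uv rep_N[OF b] by (simp add: mult \<pi>_add \<pi>_N c_N add.assoc)
  then show "act (u \<otimes>\<^bsub>G\<^esub> v) f = act u (act v f)"
    using rep_act[OF mult(1)[OF uv] b] rep_act[OF uv(1) rep_act[OF uv(2) b]] rep_unique by metis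
next
  fix u f f' and t :: real
  show "act u (t \<odot>\<^bsub>Compl\<^esub> f \<oplus>\<^bsub>Compl\<^esub> (1 - t) \<odot>\<^bsub>Compl\<^esub> f') =
      t \<odot>\<^bsub>Compl\<^esub> act u f \<oplus>\<^bsub>Compl\<^esub> (1 - t) \<odot>\<^bsub>Compl\<^esub> act u f'"
    unfolding Compl_simps by (rule ext) (simp add: act_def algebra_simps)
qed assumption+

lemma continuous_act:
  "continuous_map (prod_topology T (hilbert_topology Compl)) (hilbert_topology Compl) (\<lambda>(u, f). act u f)"
  unfolding hilbert_topology_def C.continuous_map_to_metric
proof (intro ballI allI impI)
  fix z and e :: real assume z: "z \<in> topspace (prod_topology T C.mtopology)" and e: "e > 0"
  then obtain u f where uf: "z = (u, f)" "u \<in> carrier G" "f \<in> carrier Compl"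
    by (auto simp: topT)
  obtain b where b: "rep b f" using uf by (auto simp: Compl_simps)
  \<comment> \<open>Four distances occur: f to \<open>ker x\<close> twice, the motion of
    \<open>ker x\<close> from u to v, and f to h.\<close>
  have "e / 5 > 0" using e by simp
  from rep_approx[OF b this] obtain x where x: "x \<in> N" "ip_dist Compl f (ker x) \<le> e / 5" using rep_N[OF b] by blast
  have "(e / 5)\<^sup>2 > 0" using e by simp
  then obtain U where U: "openin T U" "u \<in> U"
    "\<And>v. v \<in> U \<Longrightarrow> B (\<pi> v x + c v - (\<pi> u x + c u)) (\<pi> v x + c v - (\<pi> u x + c u)) < (e / 5)\<^sup>2"
    using cont[OF uf(2) x(1)] unfolding Let_def by meson
  have U3: "nrm (\<pi> v x + c v - (\<pi> u x + c u)) < e / 5" if "v \<in> U" for v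
    unfolding nrm_def using U(3)[OF that] e by (intro real_less_lsqrt) auto
  show "\<exists>W. openin (prod_topology T C.mtopology) W \<and> z \<in> W \<and>
      (\<forall>y\<in>W. (case y of (u, f) \<Rightarrow> act u f) \<in> C.mball (case z of (u, f) \<Rightarrow> act u f) e)"
  proof (intro exI conjI ballI)
    show "openin (prod_topology T C.mtopology) (U \<times> C.mball f (e / 5))"
      using U by (simp add: openin_prod_Times_iff)
    show "z \<in> U \<times> C.mball f (e / 5)" using uf U e by simp
    fix y assume "y \<in> U \<times> C.mball f (e / 5)"
    then obtain v h where y: "y = (v, h)" "v \<in> U" "h \<in> carrier Compl" "ip_dist Compl f h < e / 5" by auto
    have v: "v \<in> carrier G" using y(2) U(1) topT openin_subset by blast
    note K = rep_const_carrier[OF x(1)]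
    have "ip_dist Compl (act u f) (act v h) \<le> ip_dist Compl (act u f) (act u (ker x)) + ip_dist Compl (act u (ker x)) (act v h)"
      by (intro C.triangle act_carrier uf v y K)
    also have "ip_dist Compl (act u (ker x)) (act v h)
        \<le> ip_dist Compl (act u (ker x)) (act v (ker x)) + ip_dist Compl (act v (ker x)) (act v h)"
      by (intro C.triangle act_carrier uf v y K)
    also have "ip_dist Compl (act u (ker x)) (act v (ker x)) < e / 5"
      using U3[OF y(2)] x uf v by (simp add: act_const Compl_dist_const \<pi>_N c_N nrm_minus_commute)
    also have "ip_dist Compl (act v (ker x)) (act v h) = ip_dist Compl (ker x) h" by (rule act_dist[OF v K y(3)])
    also have "ip_dist Compl (ker x) h \<le> ip_dist Compl (ker x) f + ip_dist Compl f h" by (intro C.triangle K uf y)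
    also have "ip_dist Compl (act u f) (act u (ker x)) = ip_dist Compl f (ker x)" by (rule act_dist[OF uf(2,3) K])
    finally have "ip_dist Compl (act u f) (act v h) < e" using x(2) y(4) e by (simp add: C.commute)
    then show "(case y of (u, f) \<Rightarrow> act u f) \<in> C.mball (case z of (u, f) \<Rightarrow> act u f) e"
      using uf y v by (simp add: act_carrier)
  qed
qed

text \<open>F is the pairing with a fixed point f, that is, evaluation of f at an index of x. It is
  a limit of the functionals \<open>B (b n)\<close>, hence additive and bounded, and the fixed point
  equation is the last identity.\<close>

theorem cocycle_functional:
  assumes "property_FH G T"
  obtains F R where "0 \<le> R" "\<And>x y. x \<in> N \<Longrightarrow> y \<in> N \<Longrightarrow> F (x + y) = F x + F y"
    "\<And>x. x \<in> N \<Longrightarrow> \<bar>F x\<bar> \<le> R * sqrt (B x x)"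
    "\<And>u x. u \<in> carrier G \<Longrightarrow> x \<in> N \<Longrightarrow> F x = F (\<pi>' u x) + B (c u) x"
proof -
  have "\<exists>f\<in>carrier Compl. \<forall>u\<in>carrier G. act u f = f"
    using assms[unfolded property_FH_def, THEN spec[of _ Compl], THEN spec[of _ act]]
      real_hilbert_Compl affine_isometric_action_act continuous_act by simp
  then obtain f where f: "f \<in> carrier Compl" "\<And>u. u \<in> carrier G \<Longrightarrow> act u f = f"
    by (elim bexE) simp
  obtain b where b: "rep b f" using f by (auto simp: Compl_simps)
  define F where "F x = f (inv_into UNIV J x)" for x
  have JJ: "J (inv_into UNIV J x) = x" if "x \<in> N" for x using J_surj that by (intro f_inv_into_f) auto
  have F: "(\<lambda>n. B (b n) x) \<longlonglongrightarrow> F x" if "x \<in> N" for x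
  proof -
    have "(\<lambda>n. ker (b n) (inv_into UNIV J x)) \<longlonglongrightarrow> F x" using b by (simp add: rep_def F_def)
    then show ?thesis using that by (simp add: ker_def JJ)
  qed
  obtain R where R: "R > 0" "\<And>n. nrm (b n) \<le> R" using Cau_bounded[OF rep_Cau[OF b]] by metis
  show thesis
  proof (rule that)
    show "0 \<le> R" using R by simp
    show "F (x + y) = F x + F y" if "x \<in> N" "y \<in> N" for x y
      using tendsto_add[OF F[OF that(1)] F[OF that(2)]] F[of "x + y"] that
      by (simp add: B_right rep_N[OF b] LIMSEQ_unique)
    show "\<bar>F x\<bar> \<le> R * sqrt (B x x)" if "x \<in> N" for x
      unfolding nrm_def[symmetric]
    proof (rule LIMSEQ_le_const2[OF tendsto_rabs[OF F[OF that]]])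
      show "\<exists>M. \<forall>n\<ge>M. \<bar>B (b n) x\<bar> \<le> R * nrm x"
        using that by (intro exI allI impI order_trans[OF cauchy_schwarz] mult_right_mono R nrm_nonneg rep_N[OF b])
    qed
    fix u x assume u: "u \<in> carrier G" and x: "x \<in> N"
    have "F x = act u f (inv_into UNIV J x)" by (simp add: f u F_def)
    then show "F x = F (\<pi>' u x) + B (c u) x" using x by (simp add: act_def JJ F_def)
  qed
qed

end

section \<open>Operators as functions\<close>

lemma norm_scaleC_ii: "norm (\<i> *\<^sub>C (\<xi> :: 'h::complex_hilbert)) = norm \<xi>"
proof -
  have "cinner (\<i> *\<^sub>C \<xi>) (\<i> *\<^sub>C \<xi>) = \<i> * cnj (\<i> * cinner \<xi> \<xi>)"
    by (metis cinner_commute cinner_scaleC_left)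
  also have "\<dots> = cnj (cinner \<xi> \<xi>)" by simp
  finally have "inner (\<i> *\<^sub>C \<xi>) (\<i> *\<^sub>C \<xi>) = inner \<xi> \<xi>" by (simp add: inner_eq_Re_cinner)
  then show ?thesis by (simp add: norm_eq_sqrt_inner)
qed

lemma scaleC_decomp: "c *\<^sub>C \<xi> = Re c *\<^sub>R \<xi> + Im c *\<^sub>R (\<i> *\<^sub>C (\<xi> :: 'h::complex_hilbert))"
proof -
  have "c = complex_of_real (Re c) + complex_of_real (Im c) * \<i>" by (simp add: complex_eq mult.commute)
  then have "c *\<^sub>C \<xi> = complex_of_real (Re c) *\<^sub>C \<xi> + complex_of_real (Im c) *\<^sub>C (\<i> *\<^sub>C \<xi>)"
    by (metis scaleC_add_left scaleC_scaleC)
  then show ?thesis by (simp only: scaleC_of_real)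
qed

lemma scaleC_ii_ii: "\<i> *\<^sub>C \<i> *\<^sub>C (\<xi> :: 'h::complex_hilbert) = - \<xi>"
  using scaleC_of_real[of "-1" \<xi>] by (simp add: scaleC_scaleC)

lemma ex_ii: "\<exists>I :: 'h::complex_hilbert bop. \<forall>\<xi>. ap I \<xi> = \<i> *\<^sub>C \<xi>"
proof -
  have "bounded_linear (\<lambda>\<xi> :: 'h. \<i> *\<^sub>C \<xi>)"
  proof (rule bounded_linear_intro[of _ 1])
    show "\<i> *\<^sub>C (r *\<^sub>R \<xi>) = r *\<^sub>R (\<i> *\<^sub>C (\<xi> :: 'h))" for r \<xi>
      by (metis scaleC_of_real scaleC_scaleC mult.commute)
  qed (simp_all add: scaleC_add_right norm_scaleC_ii)
  then show ?thesis using ex_bop by metis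
qed

definition II :: "'h::complex_hilbert bop"
  where "II = (SOME I. \<forall>\<xi>. ap I \<xi> = \<i> *\<^sub>C \<xi>)"

lemma ap_II [simp]: "ap II \<xi> = \<i> *\<^sub>C \<xi>"
  unfolding II_def using someI_ex[OF ex_ii] by blast

lemma II_II: "II * II = (- 1 :: 'h::complex_hilbert bop)"
  by (rule bop_eqI) (simp add: scaleC_ii_ii)

lemma cinner_scaleC_right: "cinner \<xi> (c *\<^sub>C \<eta>) = cnj c * cinner \<xi> \<eta>"
  by (metis cinner_commute cinner_scaleC_left complex_cnj_mult complex_cnj_cnj)

lemma adj_II [simp]: "adj II = - II"
proof (rule adj_unique)
  fix \<xi> \<eta> :: 'a
  have "inner (\<i> *\<^sub>C \<xi>) (\<i> *\<^sub>C \<i> *\<^sub>C \<eta>) = inner \<xi> (\<i> *\<^sub>C \<eta>)"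
    by (simp add: inner_eq_Re_cinner cinner_scaleC_left cinner_scaleC_right)
  then show "inner (ap II \<xi>) \<eta> = inner \<xi> (ap (- II) \<eta>)" by (simp add: scaleC_ii_ii)
qed

lemma cinner_eq: "cinner \<xi> \<eta> = Complex (inner \<xi> \<eta>) (- inner (\<i> *\<^sub>C \<xi>) (\<eta> :: 'h::complex_hilbert))"
  by (simp add: complex_eq_iff inner_eq_Re_cinner cinner_scaleC_left)

definition clin :: "'h::complex_hilbert bop \<Rightarrow> bool"
  where "clin x \<longleftrightarrow> x * II = II * x"

lemma clin_iff: "clin x \<longleftrightarrow> (\<forall>c \<xi>. ap x (c *\<^sub>C \<xi>) = c *\<^sub>C ap x \<xi>)"
proof
  assume c: "clin x"
  have "ap x (\<i> *\<^sub>C \<xi>) = \<i> *\<^sub>C ap x \<xi>" for \<xi> using c unfolding clin_def by (metis ap_II ap_simps(7))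
  then show "\<forall>c \<xi>. ap x (c *\<^sub>C \<xi>) = c *\<^sub>C ap x \<xi>"
    by (subst (1 2) scaleC_decomp) (simp add: ap_arg_simps)
qed (auto simp: clin_def intro: bop_eqI)

lemma clin_adj: "clin x \<Longrightarrow> clin (adj x)"
proof -
  assume "clin x"
  then have "adj (II * x) = adj (x * II)" by (simp add: clin_def)
  then show ?thesis by (simp add: clin_def)
qed

lemma bounded_ops_UNIV: "f \<in> bounded_ops UNIV \<longleftrightarrow> (\<exists>x. clin x \<and> ap x = (f :: 'h::complex_hilbert \<Rightarrow> 'h))"
proof
  assume f: "f \<in> bounded_ops UNIV"
  then obtain B where B: "\<And>\<xi>. norm (f \<xi>) \<le> B * norm \<xi>" by (auto simp: bounded_ops_def)
  have "bounded_linear f"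
  proof (rule bounded_linear_intro[of _ B])
    show "f (r *\<^sub>R \<xi>) = r *\<^sub>R f \<xi>" for r \<xi> using f by (simp add: bounded_ops_def flip: scaleC_of_real)
  qed (use f B in \<open>auto simp: bounded_ops_def mult.commute\<close>)
  then obtain x where x: "ap x = f" using ex_bop by blast
  moreover have "clin x" unfolding clin_iff x using f by (simp add: bounded_ops_def)
  ultimately show "\<exists>x. clin x \<and> ap x = f" by blast
next
  assume "\<exists>x. clin x \<and> ap x = f"
  then show "f \<in> bounded_ops UNIV"
    by (auto simp: bounded_ops_def clin_iff ap_arg_simps intro: norm_ap)
qed

lemma ap_bounded_ops: "ap x \<in> bounded_ops UNIV \<longleftrightarrow> clin x"
  by (metis bounded_ops_UNIV bop_eqI)

lemma inj_ap: "inj ap"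
  by (auto intro!: injI bop_eqI)

lemma ap_eq_iff [simp]: "ap x = ap y \<longleftrightarrow> x = y"
  by (metis bop_eqI)

lemma op_UNIV_simps:
  "compose UNIV (ap x) (ap y) = ap (x * y)" "op_one UNIV = ap 1" "op_zero UNIV = ap 0"
  "op_add UNIV (ap x) (ap y) = ap (x + y)" "op_diff UNIV (ap x) (ap y) = ap (x - y)"
  "op_scale UNIV (complex_of_real r) (ap x) = ap (r *\<^sub>R x)"
  by (auto simp: compose_def op_one_def op_zero_def op_add_def op_diff_def op_scale_def scaleC_of_real fun_eq_iff)

lemma cinner_ap:
  assumes "clin x" shows "cinner (ap x \<xi>) \<eta> = cinner \<xi> (ap (adj x) \<eta>)"
proof -
  have "\<i> *\<^sub>C ap x \<xi> = ap x (\<i> *\<^sub>C \<xi>)" using assms by (simp add: clin_iff)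
  then show ?thesis by (simp add: cinner_eq inner_ap_left)
qed

lemma op_adj_UNIV:
  assumes x: "clin x" shows "op_adj UNIV (ap x) = ap (adj x)"
  unfolding op_adj_def
proof (rule the_equality)
  show "ap (adj x) \<in> bounded_ops UNIV \<and> (\<forall>\<xi>\<in>UNIV. \<forall>\<eta>\<in>UNIV. cinner (ap x \<xi>) \<eta> = cinner \<xi> (ap (adj x) \<eta>))"
    using cinner_ap[OF x] clin_adj[OF x] by (simp add: ap_bounded_ops)
  fix y assume y: "y \<in> bounded_ops UNIV \<and> (\<forall>\<xi>\<in>UNIV. \<forall>\<eta>\<in>UNIV. cinner (ap x \<xi>) \<eta> = cinner \<xi> (y \<eta>))"
  then obtain z where z: "ap z = y" by (auto simp: bounded_ops_UNIV)
  have "adj x = z" by (rule adj_unique) (use y in \<open>simp add: inner_eq_Re_cinner z\<close>)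
  then show "y = ap (adj x)" by (simp add: z)
qed

text \<open>Multiplication by \<i> turns a skew operator into a self-adjoint one, to which the real
  polarisation lemma applies.\<close>

lemma clin_eq_0:
  assumes x: "clin x" and 0: "\<And>\<xi>. cinner (ap x \<xi>) \<xi> = 0" and skew: "adj x = - x"
  shows "x = 0"
proof -
  have "II * x = 0"
  proof (rule self_adjoint_eq_0)
    show "adj (II * x) = II * x" using x by (simp add: skew clin_def)
    have "cinner \<xi> (ap x \<xi>) = 0" for \<xi> by (metis 0 cinner_commute complex_cnj_zero)
    then show "inner \<xi> (ap (II * x) \<xi>) = 0" for \<xi>
      by (simp add: inner_eq_Re_cinner cinner_scaleC_right)
  qed
  then have "II * (II * x) = 0" by simp
  then show ?thesis by (simp add: II_II flip: mult.assoc)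
qed

text \<open>\<open>op_pos\<close> only asks for a form with values in the nonnegative reals. By
  complex linearity this forces self-adjointness, which the real order asks for explicitly.\<close>

lemma op_pos_UNIV: "op_pos UNIV (ap x) \<longleftrightarrow> clin x \<and> 0 \<le> x"
proof
  assume p: "op_pos UNIV (ap x)"
  then have c: "clin x" and q: "cinner (ap x \<xi>) \<xi> \<in> \<real>\<^sub>\<ge>\<^sub>0" for \<xi> by (auto simp: op_pos_def ap_bounded_ops)
  have "x - adj x = 0"
  proof (rule clin_eq_0)
    show "clin (x - adj x)" using c clin_adj[OF c] by (simp add: clin_def algebra_simps)
    fix \<xi>
    have "cinner (ap (adj x) \<xi>) \<xi> = cnj (cinner (ap x \<xi>) \<xi>)"
      by (subst cinner_commute) (simp add: cinner_ap[OF c])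
    also have "\<dots> = cinner (ap x \<xi>) \<xi>"
      using q[of \<xi>] by (auto simp: complex_nonneg_Reals_iff complex_eq_iff)
    moreover have "cinner (ap x \<xi>) \<xi> = cinner (ap (x - adj x) \<xi>) \<xi> + cinner (ap (adj x) \<xi>) \<xi>"
      by (simp flip: cinner_add_left)
    ultimately show "cinner (ap (x - adj x) \<xi>) \<xi> = 0" by simp
  qed simp
  then show "clin x \<and> 0 \<le> x"
    using c q by (auto simp: bop_nonneg_iff inner_eq_Re_cinner inner_commute complex_nonneg_Reals_iff)
      (metis c cinner_ap)
next
  assume x: "clin x \<and> 0 \<le> x"
  have "cinner (ap x \<xi>) \<xi> \<in> \<real>\<^sub>\<ge>\<^sub>0" for \<xi>
  proof -
    have "cinner (ap x \<xi>) \<xi> = cnj (cinner (ap x \<xi>) \<xi>)"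
      using cinner_ap[of x \<xi> \<xi>] adj_nonneg[of x] x by (metis cinner_commute)
    then have "Im (cinner (ap x \<xi>) \<xi>) = 0" by (simp add: complex_eq_iff)
    moreover have "Re (cinner (ap x \<xi>) \<xi>) \<ge> 0"
      using x by (simp add: bop_nonneg_iff inner_commute flip: inner_eq_Re_cinner)
    ultimately show ?thesis by (simp add: complex_nonneg_Reals_iff)
  qed
  then show "op_pos UNIV (ap x)" using x by (simp add: op_pos_def ap_bounded_ops)
qed

lemma clin_diff: "clin x \<Longrightarrow> clin y \<Longrightarrow> clin (x - y)"
  by (simp add: clin_def algebra_simps)

lemma clin_mult: "clin x \<Longrightarrow> clin y \<Longrightarrow> clin (x * y)"
  unfolding clin_def by (metis mult.assoc)

lemma op_le_UNIV: "clin x \<Longrightarrow> clin y \<Longrightarrow> op_le UNIV (ap x) (ap y) \<longleftrightarrow> x \<le> y"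
  by (simp add: op_le_def op_UNIV_simps op_pos_UNIV clin_diff)

lemma op_norm_UNIV: "op_norm UNIV (ap x) = norm x"
  unfolding op_norm_def
proof (rule antisym)
  let ?S = "{\<xi> \<in> UNIV. norm \<xi> \<le> 1}"
  have le: "norm (ap x \<xi>) \<le> norm x" if "norm \<xi> \<le> 1" for \<xi>
    using norm_ap[of x \<xi>] mult_left_mono[OF that norm_ge_zero[of x]] by simp
  have bd: "bdd_above ((\<lambda>\<xi>. norm (ap x \<xi>)) ` ?S)" by (rule bdd_aboveI2[of _ _ "norm x"]) (use le in auto)
  have 0: "0 \<in> ?S" by simp
  show "(SUP \<xi>\<in>?S. norm (ap x \<xi>)) \<le> norm x" using 0 le by (intro cSUP_least) blast+
  let ?s = "SUP \<xi>\<in>?S. norm (ap x \<xi>)"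
  have s0: "0 \<le> ?s" using cSUP_upper[OF 0 bd] by (simp add: ap_arg_simps)
  show "norm x \<le> ?s"
  proof (rule norm_bop_bound[OF s0])
    fix \<xi>
    show "norm (ap x \<xi>) \<le> ?s * norm \<xi>"
    proof (cases "\<xi> = 0")
      case False
      have "(1 / norm \<xi>) *\<^sub>R \<xi> \<in> ?S" using False by simp
      from cSUP_upper[OF this bd] have "norm (ap x \<xi>) / norm \<xi> \<le> ?s" by (simp add: ap_arg_simps)
      then show ?thesis using False by (simp add: field_simps)
    qed (simp add: ap_arg_simps)
  qed
qed

lemma clin_fc: "0 \<le> a \<Longrightarrow> cont0 f \<Longrightarrow> clin a \<Longrightarrow> clin (fc f a)"
  by (simp add: clin_def fc_commute)

lemma clin_opabs: "clin x \<Longrightarrow> clin (opabs x)"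
  unfolding opabs_def opsqrt_def by (intro clin_fc clin_mult clin_adj cont0_sqrt) auto

lemma op_abs_UNIV:
  assumes x: "clin x" shows "op_abs UNIV (ap x) = ap (opabs x)"
  unfolding op_abs_def
proof (rule the_equality)
  show "op_pos UNIV (ap (opabs x)) \<and> compose UNIV (ap (opabs x)) (ap (opabs x)) = compose UNIV (op_adj UNIV (ap x)) (ap x)"
    by (simp add: op_pos_UNIV clin_opabs x op_adj_UNIV op_UNIV_simps opabs_square)
  fix a assume a: "op_pos UNIV a \<and> compose UNIV a a = compose UNIV (op_adj UNIV (ap x)) (ap x)"
  then obtain b where b: "a = ap b" by (auto simp: op_pos_def bounded_ops_UNIV)
  have "0 \<le> b" "b * b = adj x * x" using a by (auto simp: b op_pos_UNIV op_adj_UNIV x op_UNIV_simps)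
  then show "a = ap (opabs x)" unfolding b opabs_def by (simp add: opsqrt_unique)
qed

lemma op_poly_UNIV: "op_poly UNIV q (ap a) = ap (pe q a)"
proof -
  have "(ap a ^^ i) \<xi> = ap (a ^ i) \<xi>" for i \<xi> by (induction i) auto
  then show ?thesis by (simp add: op_poly_def pe_def ap_sum fun_eq_iff)
qed

lemma op_fun_UNIV:
  assumes a: "0 \<le> a" "clin a" and f: "cont0 f"
  shows "op_fun UNIV f (ap a) = ap (fc f a)"
  unfolding op_fun_def op_norm_UNIV
proof (rule the_equality)
  have conv: "((\<lambda>n. op_norm UNIV (op_diff UNIV (op_poly UNIV (q n) (ap a)) (ap b))) \<longlonglongrightarrow> 0) \<longleftrightarrow>
      (\<lambda>n. pe (q n) a) \<longlonglongrightarrow> b" for q b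
    by (simp add: op_poly_UNIV op_UNIV_simps op_norm_UNIV tendsto_norm_zero_iff LIM_zero_iff)
  show "ap (fc f a) \<in> bounded_ops UNIV \<and>
    (\<forall>q. uniform_limit {0..norm a} (\<lambda>n. poly (q n)) f sequentially \<longrightarrow>
      (\<lambda>n. op_norm UNIV (op_diff UNIV (op_poly UNIV (q n) (ap a)) (ap (fc f a)))) \<longlonglongrightarrow> 0)"
    unfolding conv ap_bounded_ops using clin_fc[OF a(1) f a(2)] fc_tendsto[OF a(1) f order_refl] by blast
  fix b assume b: "b \<in> bounded_ops UNIV \<and>
    (\<forall>q. uniform_limit {0..norm a} (\<lambda>n. poly (q n)) f sequentially \<longrightarrow>
      (\<lambda>n. op_norm UNIV (op_diff UNIV (op_poly UNIV (q n) (ap a)) b)) \<longlonglongrightarrow> 0)"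
  then obtain c where c: "b = ap c" by (auto simp: bounded_ops_UNIV)
  obtain q where q: "uniform_limit {0..norm a} (\<lambda>n. poly (q n)) f sequentially"
    using ex_poly_uniform_limit[OF cont0_on[OF f]] .
  then have "(\<lambda>n. pe (q n) a) \<longlonglongrightarrow> c" using b unfolding c conv by blast
  then show "b = ap (fc f a)" unfolding c using fc_eqI[OF a(1) f q] by simp
qed

section \<open>Von Neumann algebras as sets of functions\<close>

definition bops :: "('h::complex_hilbert \<Rightarrow> 'h) set \<Rightarrow> 'h bop set"
  where "bops M = {x. ap x \<in> M}"

lemma bops_iff: "x \<in> bops M \<longleftrightarrow> ap x \<in> M"
  by (simp add: bops_def)

context
  fixes M :: "('h::complex_hilbert \<Rightarrow> 'h) set"
  assumes M: "von_neumann_algebra UNIV M"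
begin

lemma clin_bops: "x \<in> bops M \<Longrightarrow> clin x"
  using M by (auto simp: von_neumann_algebra_def bops_iff ap_bounded_ops subset_iff)

lemma M_ex_bop: "f \<in> M \<Longrightarrow> \<exists>x\<in>bops M. f = ap x"
  using M by (auto simp: von_neumann_algebra_def bops_iff bounded_ops_UNIV subset_iff)

lemma commutant_bops: "ap y \<in> commutant UNIV M \<longleftrightarrow> clin y \<and> (\<forall>x\<in>bops M. y * x = x * y)"
proof
  assume "ap y \<in> commutant UNIV M"
  then have y: "clin y" "\<And>f. f \<in> M \<Longrightarrow> compose UNIV (ap y) f = compose UNIV f (ap y)"
    by (auto simp: commutant_def ap_bounded_ops)
  have "y * x = x * y" if "x \<in> bops M" for x
    using y(2)[of "ap x"] that by (simp add: bops_iff op_UNIV_simps)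
  then show "clin y \<and> (\<forall>x\<in>bops M. y * x = x * y)" using y(1) by blast
next
  assume y: "clin y \<and> (\<forall>x\<in>bops M. y * x = x * y)"
  then have "compose UNIV (ap y) f = compose UNIV f (ap y)" if "f \<in> M" for f
    using M_ex_bop[OF that] by (auto simp: op_UNIV_simps)
  then show "ap y \<in> commutant UNIV M" using y by (auto simp: commutant_def ap_bounded_ops)
qed

lemma bops_iff_commute: "x \<in> bops M \<longleftrightarrow> clin x \<and> (\<forall>y. clin y \<and> (\<forall>z\<in>bops M. y * z = z * y) \<longrightarrow> x * y = y * x)"
proof -
  have "ap x \<in> M \<longleftrightarrow> ap x \<in> commutant UNIV (commutant UNIV M)" using M by (simp add: von_neumann_algebra_def)
  also have "\<dots> \<longleftrightarrow> clin x \<and> (\<forall>f\<in>commutant UNIV M. compose UNIV (ap x) f = compose UNIV f (ap x))"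
    by (simp add: commutant_def[of UNIV "commutant UNIV M"] ap_bounded_ops)
  also have "\<dots> \<longleftrightarrow> clin x \<and> (\<forall>y. ap y \<in> commutant UNIV M \<longrightarrow> x * y = y * x)"
  proof -
    have "\<exists>y. f = ap y" if "f \<in> commutant UNIV M" for f
      using that by (auto simp: commutant_def bounded_ops_UNIV)
    then have "(\<forall>f\<in>commutant UNIV M. compose UNIV (ap x) f = compose UNIV f (ap x)) \<longleftrightarrow>
        (\<forall>y. ap y \<in> commutant UNIV M \<longrightarrow> compose UNIV (ap x) (ap y) = compose UNIV (ap y) (ap x))" by blast
    then show ?thesis by (simp add: op_UNIV_simps)
  qed
  finally show ?thesis by (simp add: bops_iff commutant_bops)
qed

text \<open>Multiplication by \<i> commutes with all complex linear maps, hence lies in the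
  bicommutant. This makes the real commutant equal to the complex one.\<close>

lemma II_bops: "II \<in> bops M"
  by (subst bops_iff_commute) (auto simp: clin_def)

lemma cent_bops: "cent (bops M) = {y. clin y \<and> (\<forall>z\<in>bops M. y * z = z * y)}"
  using II_bops by (auto simp: cent_def clin_def)

lemma vna_bops: "vna (bops M)"
proof
  show "cent (cent (bops M)) = bops M"
  proof -
    have "II \<in> cent (bops M)" using clin_bops by (auto simp: cent_bops clin_def)
    then have "x \<in> cent (cent (bops M)) \<longleftrightarrow> clin x \<and> (\<forall>y\<in>cent (bops M). x * y = y * x)" for x
      unfolding cent_def[of "cent (bops M)"] clin_def by blast
    moreover have "clin x \<and> (\<forall>y\<in>cent (bops M). x * y = y * x) \<longleftrightarrow> x \<in> bops M" for x
      unfolding bops_iff_commute[of x] cent_bops by simp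
    ultimately show ?thesis by blast
  qed
  show "adj x \<in> bops M" if "x \<in> bops M" for x
    using M that op_adj_UNIV[OF clin_bops[OF that]] unfolding von_neumann_algebra_def bops_iff by metis
qed

lemma pos_cone_bops: "ap x \<in> pos_cone UNIV M \<longleftrightarrow> x \<in> bops M \<and> 0 \<le> x"
  using clin_bops by (auto simp: pos_cone_def op_pos_UNIV bops_iff)

lemma pos_cone_ex: "f \<in> pos_cone UNIV M \<Longrightarrow> \<exists>x. f = ap x \<and> x \<in> bops M \<and> 0 \<le> x"
  using M_ex_bop pos_cone_bops by (metis (no_types, lifting) mem_Collect_eq pos_cone_def)

lemma traced_bops:
  assumes "fns_trace UNIV M \<tau>"
  shows "traced (bops M) (\<lambda>x. \<tau> (ap x))"
proof -
  interpret vna "bops M" by (rule vna_bops)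
  have add: "\<And>f g. f \<in> pos_cone UNIV M \<Longrightarrow> g \<in> pos_cone UNIV M \<Longrightarrow> \<tau> (op_add UNIV f g) = \<tau> f + \<tau> g"
    and scale: "\<And>f c. f \<in> pos_cone UNIV M \<Longrightarrow> 0 \<le> c \<Longrightarrow> \<tau> (op_scale UNIV (complex_of_real c) f) = ennreal c * \<tau> f"
    and trac: "\<And>f. f \<in> M \<Longrightarrow> \<tau> (compose UNIV (op_adj UNIV f) f) = \<tau> (compose UNIV f (op_adj UNIV f))"
    and faith: "\<And>f. f \<in> pos_cone UNIV M \<Longrightarrow> \<tau> f = 0 \<Longrightarrow> f = op_zero UNIV"
    and norm: "\<And>D f. D \<subseteq> pos_cone UNIV M \<Longrightarrow> D \<noteq> {} \<Longrightarrow>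
      (\<forall>y\<in>D. \<forall>z\<in>D. \<exists>w\<in>D. op_le UNIV y w \<and> op_le UNIV z w) \<Longrightarrow> is_lub UNIV M D f \<Longrightarrow> \<tau> f = (SUP y\<in>D. \<tau> y)"
    using assms unfolding fns_trace_def by simp_all
  show ?thesis
  proof
    fix x y assume "x \<in> bops M" "0 \<le> x" "y \<in> bops M" "0 \<le> y"
    then show "\<tau> (ap (x + y)) = \<tau> (ap x) + \<tau> (ap y)"
      using add[of "ap x" "ap y"] by (simp add: pos_cone_bops op_UNIV_simps)
  next
    fix x and c :: real assume "x \<in> bops M" "0 \<le> x" "0 \<le> c"
    then show "\<tau> (ap (c *\<^sub>R x)) = ennreal c * \<tau> (ap x)"
      using scale[of "ap x" c] by (simp add: pos_cone_bops op_UNIV_simps)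
  next
    fix x assume x: "x \<in> bops M"
    then show "\<tau> (ap (adj x * x)) = \<tau> (ap (x * adj x))"
      using trac[of "ap x"] by (simp add: bops_iff op_adj_UNIV clin_bops op_UNIV_simps)
  next
    fix x assume "x \<in> bops M" "0 \<le> x" "\<tau> (ap x) = 0"
    then show "x = 0" using faith[of "ap x"] by (simp add: pos_cone_bops op_UNIV_simps)
  next
    fix D and s
    assume D: "D \<subseteq> bops M" "\<And>x. x \<in> D \<Longrightarrow> 0 \<le> x" "D \<noteq> {}"
      and dir: "\<And>x y. x \<in> D \<Longrightarrow> y \<in> D \<Longrightarrow> \<exists>z\<in>D. x \<le> z \<and> y \<le> z"
      and s: "s \<in> bops M" "\<And>x. x \<in> D \<Longrightarrow> x \<le> s"
      and least: "\<And>z. z \<in> bops M \<Longrightarrow> 0 \<le> z \<Longrightarrow> (\<And>x. x \<in> D \<Longrightarrow> x \<le> z) \<Longrightarrow> s \<le> z"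
    have le: "op_le UNIV (ap x) (ap y) \<longleftrightarrow> x \<le> y" if "x \<in> bops M" "y \<in> bops M" for x y
      using that by (simp add: op_le_UNIV clin_bops)
    have s0: "0 \<le> s" using D s(2) by (meson all_not_in_conv order_trans)
    have "\<tau> (ap s) = (SUP y\<in>ap ` D. \<tau> y)"
    proof (rule norm)
      show "ap ` D \<subseteq> pos_cone UNIV M" using D by (auto simp: pos_cone_bops)
      show "ap ` D \<noteq> {}" using D by simp
      show "\<forall>y\<in>ap ` D. \<forall>z\<in>ap ` D. \<exists>w\<in>ap ` D. op_le UNIV y w \<and> op_le UNIV z w"
        using dir D(1) le by (auto simp: subset_iff)
      show "is_lub UNIV M (ap ` D) (ap s)"
        unfolding is_lub_def
      proof (intro conjI ballI impI)
        show "ap s \<in> pos_cone UNIV M" by (simp add: pos_cone_bops s s0)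
        show "op_le UNIV y (ap s)" if "y \<in> ap ` D" for y using that D(1) s le by auto
        fix z assume z: "z \<in> pos_cone UNIV M" "\<forall>y\<in>ap ` D. op_le UNIV y z"
        obtain z' where z': "z = ap z'" "z' \<in> bops M" "0 \<le> z'" using pos_cone_ex[OF z(1)] by blast
        have "s \<le> z'" by (rule least) (use z z' D(1) le in auto)
        then show "op_le UNIV (ap s) z" by (simp add: z' le s)
      qed
    qed
    then show "\<tau> (ap s) = (SUP x\<in>D. \<tau> (ap x))" by (simp add: image_comp comp_def)
  qed
qed

end

section \<open>The group of p-unitaries\<close>

locale p_unitaries =
  fixes M :: "('h::complex_hilbert \<Rightarrow> 'h) set" and \<tau> :: "('h \<Rightarrow> 'h) \<Rightarrow> ennreal" and p :: real
  assumes vN: "von_neumann_algebra UNIV M" and trace: "fns_trace UNIV M \<tau>"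
    and p1: "1 \<le> p" and p2: "p \<le> 2"
begin

sublocale traced "bops M" "\<lambda>x. \<tau> (ap x)"
  by (rule traced_bops[OF vN trace])

abbreviation "A \<equiv> bops M"
abbreviation "P \<equiv> p_unitary_group UNIV M \<tau> p"
abbreviation "Pdist \<equiv> p_unitary_dist UNIV M \<tau> p"
abbreviation "Ptop \<equiv> p_unitary_topology UNIV M \<tau> p"

definition Up :: "'h bop set"
  where "Up = {u \<in> A. adj u * u = 1 \<and> u * adj u = 1 \<and> pnorm_pow p (u - 1) < \<infinity>}"

lemma p0: "0 < p"
  using p1 by simp

lemma trace_abs_powr_eq: "x \<in> A \<Longrightarrow> trace_abs_powr UNIV \<tau> p (ap x) = pnorm_pow p x"
  unfolding trace_abs_powr_def pnorm_pow_def
  by (simp add: op_abs_UNIV op_fun_UNIV clin_opabs clin_bops[OF vN] cont0_powr p0)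

lemma Lp_norm_eq: "x \<in> A \<Longrightarrow> Lp_norm UNIV \<tau> p (ap x) = pnorm p x"
  by (simp add: Lp_norm_def pnorm_def trace_abs_powr_eq)

lemma carrier_P: "carrier P = ap ` Up"
proof -
  have "f \<in> carrier P \<longleftrightarrow> (\<exists>u\<in>Up. f = ap u)" for f
  proof
    assume f: "f \<in> carrier P"
    then obtain u where u: "u \<in> A" "f = ap u" using M_ex_bop[OF vN] by (auto simp: p_unitary_group_def unitary_group_def)
    then show "\<exists>u\<in>Up. f = ap u" using f
      by (intro bexI[of _ u]) (auto simp: p_unitary_group_def unitary_group_def Up_def op_UNIV_simps
          op_adj_UNIV clin_bops[OF vN] Lp_bounded_def trace_abs_powr_eq)
  next
    assume "\<exists>u\<in>Up. f = ap u"
    then show "f \<in> carrier P"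
      by (auto simp: p_unitary_group_def unitary_group_def Up_def op_UNIV_simps bops_iff[symmetric]
          op_adj_UNIV clin_bops[OF vN] Lp_bounded_def trace_abs_powr_eq)
  qed
  then show ?thesis by blast
qed

lemma P_simps: "\<one>\<^bsub>P\<^esub> = ap 1" "ap u \<otimes>\<^bsub>P\<^esub> ap v = ap (u * v)"
  by (simp_all add: p_unitary_group_def unitary_group_def op_UNIV_simps)

lemma UpD: "u \<in> Up \<Longrightarrow> u \<in> A" "u \<in> Up \<Longrightarrow> adj u * u = 1" "u \<in> Up \<Longrightarrow> u * adj u = 1"
  "u \<in> Up \<Longrightarrow> pnorm_pow p (u - 1) < \<infinity>"
  by (auto simp: Up_def)

lemma pnorm_pow_minus_commute: "pnorm_pow p (x - y) = pnorm_pow p (y - x)"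
  by (rule pnorm_pow_cong) (simp add: algebra_simps)

lemma pnorm_minus_commute: "pnorm p (x - y) = pnorm p (y - x)"
  by (simp add: pnorm_def pnorm_pow_minus_commute)

lemma pnorm_pow_diff_finite: "u \<in> Up \<Longrightarrow> v \<in> Up \<Longrightarrow> pnorm_pow p (u - v) < \<infinity>"
proof -
  assume u: "u \<in> Up" and v: "v \<in> Up"
  have "pnorm_pow p ((u - 1) + (1 - v)) < \<infinity>"
    by (rule minkowski(1)[OF _ _ p1 p2]) (use u v in \<open>auto simp: Up_def pnorm_pow_minus_commute[of 1 v]\<close>)
  then show ?thesis by simp
qed

lemma pnorm_triangle:
  "u \<in> Up \<Longrightarrow> v \<in> Up \<Longrightarrow> w \<in> Up \<Longrightarrow> pnorm p (u - w) \<le> pnorm p (u - v) + pnorm p (v - w)"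
  using minkowski(2)[OF _ _ p1 p2 pnorm_pow_diff_finite[of u v] pnorm_pow_diff_finite[of v w]]
  by (simp add: UpD)

lemma Pdist_eq: "u \<in> Up \<Longrightarrow> v \<in> Up \<Longrightarrow> Pdist (ap u) (ap v) = pnorm p (u - v)"
  by (simp add: p_unitary_dist_def carrier_P op_UNIV_simps Lp_norm_eq UpD)

sublocale U: Metric_space "carrier P" Pdist
proof
  show "0 \<le> Pdist x y" for x y by (simp add: p_unitary_dist_def Lp_norm_def)
  show "Pdist x y = Pdist y x" for x y
  proof (cases "x \<in> carrier P \<and> y \<in> carrier P")
    case True
    then show ?thesis by (auto simp: carrier_P Pdist_eq pnorm_minus_commute)
  qed (auto simp: p_unitary_dist_def)
  show "Pdist x y = 0 \<longleftrightarrow> x = y" if "x \<in> carrier P" "y \<in> carrier P" for x y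
  proof -
    obtain u v where uv: "u \<in> Up" "v \<in> Up" "x = ap u" "y = ap v" using \<open>x \<in> carrier P\<close> \<open>y \<in> carrier P\<close> by (auto simp: carrier_P)
    have "u - v = 0" if "pnorm p (u - v) = 0"
      using pnorm_eq_0[OF _ p1 p2 pnorm_pow_diff_finite[OF uv(1,2)] that] uv by (simp add: UpD)
    moreover have "pnorm p 0 = 0" using pnorm_pow_0[OF p0] by (simp add: pnorm_def)
    ultimately show ?thesis using uv by (auto simp: Pdist_eq)
  qed
  show "Pdist x z \<le> Pdist x y + Pdist y z" if "x \<in> carrier P" "y \<in> carrier P" "z \<in> carrier P" for x y z
    using that pnorm_triangle by (auto simp: carrier_P Pdist_eq)
qed

lemma Ptop_eq: "Ptop = U.mtopology"
  by (simp add: p_unitary_topology_def)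

text \<open>The differences from 1 factor as \<open>u * v - 1 = u * (v - adj u)\<close> and
  \<open>adj u - 1 = adj u * (1 - u)\<close>, so unitary invariance and Minkowski give
  finiteness.\<close>

lemma Up_closed: "1 \<in> Up" "u \<in> Up \<Longrightarrow> v \<in> Up \<Longrightarrow> u * v \<in> Up" "u \<in> Up \<Longrightarrow> adj u \<in> Up"
proof -
  show "1 \<in> Up" by (simp add: Up_def pnorm_pow_0 p0)
  show adj: "adj u \<in> Up" if u: "u \<in> Up" for u
  proof -
    have "adj u - 1 = adj u * (1 - u)" using u by (simp add: algebra_simps UpD)
    then have "pnorm_pow p (adj u - 1) = pnorm_pow p (1 - u)"
      using pnorm_pow_unitary(1)[of "1 - u" "adj u" p] u p0 by (simp add: UpD)
    then show ?thesis using u by (simp add: Up_def pnorm_pow_minus_commute)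
  qed
  show "u * v \<in> Up" if u: "u \<in> Up" and v: "v \<in> Up" for u v
  proof -
    have "u * v - 1 = u * (v - adj u)" using u by (simp add: algebra_simps UpD)
    then have "pnorm_pow p (u * v - 1) = pnorm_pow p (v - adj u)"
      using pnorm_pow_unitary(1)[of "v - adj u" u p] u v p0 by (simp add: UpD)
    moreover have "adj (u * v) * (u * v) = adj v * (adj u * u) * v" "(u * v) * adj (u * v) = u * (v * adj v) * adj u"
      by (simp_all add: mult.assoc)
    ultimately show ?thesis using u v pnorm_pow_diff_finite[OF v adj[OF u]] by (simp add: Up_def)
  qed
qed

lemma group_P: "group P"
proof (rule groupI)
  show "x \<otimes>\<^bsub>P\<^esub> y \<in> carrier P" if "x \<in> carrier P" "y \<in> carrier P" for x y
    using that Up_closed by (auto simp: carrier_P P_simps)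
  show "\<one>\<^bsub>P\<^esub> \<in> carrier P" using Up_closed by (auto simp: carrier_P P_simps)
  show "x \<otimes>\<^bsub>P\<^esub> y \<otimes>\<^bsub>P\<^esub> z = x \<otimes>\<^bsub>P\<^esub> (y \<otimes>\<^bsub>P\<^esub> z)" if "x \<in> carrier P" "y \<in> carrier P" "z \<in> carrier P" for x y z
    using that by (auto simp: carrier_P P_simps mult.assoc)
  show "\<one>\<^bsub>P\<^esub> \<otimes>\<^bsub>P\<^esub> x = x" if "x \<in> carrier P" for x
    using that by (auto simp: carrier_P P_simps)
  show "\<exists>y\<in>carrier P. y \<otimes>\<^bsub>P\<^esub> x = \<one>\<^bsub>P\<^esub>" if "x \<in> carrier P" for x
  proof -
    obtain u where u: "u \<in> Up" "x = ap u" using \<open>x \<in> carrier P\<close> by (auto simp: carrier_P)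
    then show ?thesis
      by (intro bexI[of _ "ap (adj u)"]) (auto simp: carrier_P P_simps UpD Up_closed)
  qed
qed

lemma inv_P: "u \<in> Up \<Longrightarrow> inv\<^bsub>P\<^esub> (ap u) = ap (adj u)"
  by (rule group.inv_equality[OF group_P]) (auto simp: carrier_P P_simps UpD Up_closed)

lemma unitary_norm: "u \<in> Up \<Longrightarrow> norm u \<le> 1"
  using norm_adj_mult_self[of u] norm_bop_one[where 'a = 'h]
  by (simp add: UpD power_le_one_iff[of "norm u" 2, simplified])

end

locale FH_subgroup = p_unitaries M \<tau> p
  for M :: "('h::complex_hilbert \<Rightarrow> 'h) set" and \<tau> :: "('h \<Rightarrow> 'h) \<Rightarrow> ennreal" and p :: real +
  fixes G :: "('h \<Rightarrow> 'h) set"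
  assumes closed_subgroup: "closed_subgroup G P Ptop"
    and FH: "property_FH (P\<lparr>carrier := G\<rparr>) (subtopology Ptop G)"
begin

abbreviation "Ggrp \<equiv> P\<lparr>carrier := G\<rparr>"
abbreviation "Gtop \<equiv> subtopology Ptop G"

definition GU :: "'h bop set"
  where "GU = bops G"

lemma subgroup_G: "subgroup G P" and closedin_G: "closedin Ptop G"
  using closed_subgroup by (simp_all add: closed_subgroup_def)

lemma G_eq: "G = ap ` GU" and GU_Up: "GU \<subseteq> Up"
proof -
  have "G \<subseteq> ap ` Up" using subgroup.subset[OF subgroup_G] by (simp add: carrier_P)
  then show "G = ap ` GU" "GU \<subseteq> Up" by (auto simp: GU_def bops_iff subset_iff image_iff)
qed

lemma mem_GU: "u \<in> GU \<longleftrightarrow> ap u \<in> G"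
  by (simp add: GU_def bops_iff)

lemma GU_closed: "1 \<in> GU" "u \<in> GU \<Longrightarrow> v \<in> GU \<Longrightarrow> u * v \<in> GU" "u \<in> GU \<Longrightarrow> adj u \<in> GU"
  using subgroup.one_closed[OF subgroup_G] subgroup.m_closed[OF subgroup_G, of "ap u" "ap v"]
    subgroup.m_inv_closed[OF subgroup_G, of "ap u"] GU_Up
  by (auto simp: mem_GU P_simps inv_P subset_iff)

lemma GU_D: "u \<in> GU \<Longrightarrow> u \<in> Up" "u \<in> GU \<Longrightarrow> u \<in> A" "u \<in> GU \<Longrightarrow> adj u * u = 1" "u \<in> GU \<Longrightarrow> u * adj u = 1"
  using GU_Up UpD by auto

lemma minus_1_N2: "u \<in> GU \<Longrightarrow> u - 1 \<in> N2"
  using pnorm_pow_N2[OF _ p0 p2 UpD(4)[OF GU_D(1)]] by (simp add: GU_D)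

lemma topspace_Gtop: "topspace Gtop = G"
  using closedin_subset[OF closedin_G] unfolding topspace_subtopology by blast

lemma openin_ball: "u \<in> GU \<Longrightarrow> \<exists>U. openin Gtop U \<and> ap u \<in> U \<and> (\<forall>f\<in>U. \<exists>v\<in>GU. f = ap v \<and> pnorm p (v - u) < \<delta>)"
  if "0 < \<delta>"
proof (intro exI conjI ballI)
  assume u: "u \<in> GU"
  show "openin Gtop (U.mball (ap u) \<delta> \<inter> G)"
    unfolding Ptop_eq openin_subtopology by blast
  show "ap u \<in> U.mball (ap u) \<delta> \<inter> G"
  proof
    have "ap u \<in> carrier P" using u GU_Up carrier_P by blast
    then show "ap u \<in> U.mball (ap u) \<delta>" using that U.centre_in_mball_iff by blast
    show "ap u \<in> G" using u by (simp add: mem_GU)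
  qed
  fix f assume f: "f \<in> U.mball (ap u) \<delta> \<inter> G"
  then obtain v where v: "v \<in> GU" "f = ap v" using G_eq by auto
  then show "\<exists>v\<in>GU. f = ap v \<and> pnorm p (v - u) < \<delta>"
    using f u by (intro bexI[of _ v]) (auto simp: Pdist_eq GU_D pnorm_minus_commute[of v])
qed

text \<open>Each operator x has the index \<open>ap x\<close>, so the index type of the completion
  is the type of the group elements, as \<open>property_FH\<close> requires.\<close>

definition J :: "('h \<Rightarrow> 'h) \<Rightarrow> 'h bop"
  where "J = inv_into UNIV ap"

lemma J_ap [simp]: "J (ap x) = x"
  by (simp add: J_def inj_ap)

lemma mem_G: "f \<in> G \<longleftrightarrow> (\<exists>u\<in>GU. f = ap u)"
  using G_eq by blast

lemma cocycle:
  obtains F R where "0 \<le> R" "\<And>x y. x \<in> N2 \<Longrightarrow> y \<in> N2 \<Longrightarrow> F (x + y) = F x + F y"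
    "\<And>x. x \<in> N2 \<Longrightarrow> \<bar>F x\<bar> \<le> R * sqrt (ip x x)"
    "\<And>u x. u \<in> GU \<Longrightarrow> x \<in> N2 \<Longrightarrow> F x = F (adj u * x) + ip (u - 1) x"
proof -
  interpret H: prehilbert_action N2 ip J Ggrp Gtop "\<lambda>u x. J u * x" "\<lambda>u x. adj (J u) * x" "\<lambda>u. J u - 1"
  proof unfold_locales
    show "subspace N2" by (simp add: subspace_def N2_0 N2_add N2_scale)
    show "N2 \<subseteq> range J" by (metis J_ap rangeI subsetI)
    show "topspace Gtop = carrier Ggrp" unfolding topspace_Gtop by simp
    fix u x and e :: real assume u: "u \<in> carrier Ggrp" and x: "x \<in> N2" and e: "0 < e"
    then obtain v where v: "v \<in> GU" "u = ap v" using G_eq by auto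
    define c where "c = norm (x + 1) + 1"
    have c: "c > 0" by (simp add: c_def add_nonneg_pos)
    then have "e / c\<^sup>2 > 0" using e by simp
    then obtain \<delta> where d: "\<delta> > 0" "\<And>y. y \<in> A \<Longrightarrow> norm y \<le> 2 \<Longrightarrow> pnorm_pow p y < \<infinity> \<Longrightarrow> pnorm p y < \<delta> \<Longrightarrow> ip y y < e / c\<^sup>2"
      using pnorm_small_imp_ip_small[OF p1 p2, of _ 2] by meson
    obtain U where U: "openin Gtop U" "ap v \<in> U" "\<And>f. f \<in> U \<Longrightarrow> \<exists>w\<in>GU. f = ap w \<and> pnorm p (w - v) < \<delta>"
      using openin_ball[OF d(1) v(1)] by blast
    have "let d = J f * x + (J f - 1) - (J u * x + (J u - 1)) in ip d d < e" if f: "f \<in> U" for f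
    proof -
      obtain w where w: "w \<in> GU" "f = ap w" "pnorm p (w - v) < \<delta>" using U(3)[OF f] by blast
      have wv: "w - v \<in> A" "w - v \<in> N2"
        using w v N2_diff[OF minus_1_N2 minus_1_N2, of w v] by (auto simp: GU_D)
      have "norm (w - v) \<le> 2"
        using norm_triangle_ineq4[of w v] unitary_norm w v GU_D by (smt (verit))
      then have lt: "ip (w - v) (w - v) < e / c\<^sup>2"
        using d(2)[OF wv(1)] w(3) pnorm_pow_diff_finite[OF GU_D(1)[OF w(1)] GU_D(1)[OF v(1)]] by blast
      \<comment> \<open>The affine map moves x as left multiplication moves x + 1, so its variation
        is bounded by the 2-norm of w - v, which is p-norm small on operators of norm at most
        2.\<close>
      have eq: "w * x + (w - 1) - (v * x + (v - 1)) = (w - v) * (x + 1)" by (simp add: algebra_simps)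
      have "ip ((w - v) * (x + 1)) ((w - v) * (x + 1)) \<le> (norm (x + 1))\<^sup>2 * ip (w - v) (w - v)"
        using wv x by (intro ip_mult_le) (auto simp: N2_A)
      also have "\<dots> \<le> c\<^sup>2 * ip (w - v) (w - v)"
        using wv by (intro mult_right_mono ip_nonneg power_mono) (auto simp: c_def)
      also have "\<dots> < c\<^sup>2 * (e / c\<^sup>2)" using lt c by (intro mult_strict_left_mono) auto
      also have "\<dots> = e" using c by simp
      finally show ?thesis using w v eq by (simp add: Let_def)
    qed
    then show "\<exists>U. openin Gtop U \<and> u \<in> U \<and>
        (\<forall>f\<in>U. let d = J f * x + (J f - 1) - (J u * x + (J u - 1)) in ip d d < e)"
      using U v by blast
  next
    show "ip x y = ip y x" for x y by (rule ip_commute)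
    show "ip (J u * x) (J u * x) = ip x x" if uG: "u \<in> carrier Ggrp" "x \<in> N2" for u x
    proof -
      obtain v where v: "v \<in> GU" "u = ap v" using uG G_eq by auto
      have "ip (v * x) (v * x) = ip x (adj v * v * x)" by (simp only: ip_mult_left mult.assoc)
      then show ?thesis using v by (simp add: GU_D)
    qed
    show "J (u \<otimes>\<^bsub>Ggrp\<^esub> v) * x = J u * (J v * x)" if "u \<in> carrier Ggrp" "v \<in> carrier Ggrp" "x \<in> N2" for u v x
      using that by (auto simp: mem_G P_simps mult.assoc)
    show "u \<otimes>\<^bsub>Ggrp\<^esub> v \<in> carrier Ggrp" if "u \<in> carrier Ggrp" "v \<in> carrier Ggrp" for u v
      using that GU_closed by (auto simp: mem_G P_simps)
    show "J (u \<otimes>\<^bsub>Ggrp\<^esub> v) - 1 = J u * (J v - 1) + (J u - 1)" if "u \<in> carrier Ggrp" "v \<in> carrier Ggrp" for u v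
      using that by (auto simp: mem_G P_simps algebra_simps)
    show "\<one>\<^bsub>Ggrp\<^esub> \<in> carrier Ggrp" "\<And>x. J \<one>\<^bsub>Ggrp\<^esub> * x = x" "J \<one>\<^bsub>Ggrp\<^esub> - 1 = 0"
      using GU_closed by (auto simp: mem_G P_simps)
    show "J u * (x + y) = J u * x + J u * y" for u x y by (rule distrib_left)
    show "ip (J u * x) y = ip x (adj (J u) * y)" for u x y by (rule ip_mult_left)
    show "J u - 1 \<in> N2" if "u \<in> carrier Ggrp" for u
      using that by (auto simp: mem_G minus_1_N2)
    show "J u * x \<in> N2" "adj (J u) * x \<in> N2" if "u \<in> carrier Ggrp" "x \<in> N2" for u x
      using that by (auto simp: mem_G GU_D N2_mult_left)
  qed (simp_all add: ip_add_left ip_scale_left ip_nonneg)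
  show thesis
  proof (rule H.cocycle_functional[OF FH], rule that)
    fix F :: "'h bop \<Rightarrow> real" and R u x
    assume *: "\<And>u x. u \<in> carrier Ggrp \<Longrightarrow> x \<in> N2 \<Longrightarrow> F x = F (adj (J u) * x) + ip (J u - 1) x"
      and u: "u \<in> GU" "x \<in> N2"
    show "F x = F (adj u * x) + ip (u - 1) x"
      using *[of "ap u" x] u by (simp add: mem_GU)
  qed
qed

section \<open>The projection onto the complement of the fixed vectors\<close>

definition e :: "'h bop"
  where "e = kernel_compl ((\<lambda>u. u - 1) ` GU)"

lemma minus_1_A: "(\<lambda>u. u - 1) ` GU \<subseteq> A"
  using GU_D by auto

lemma e_props: "adj e = e" "e * e = e" "e \<in> A"
  using kernel_compl[OF minus_1_A] by (simp_all add: e_def)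

lemma GU_e: assumes u: "u \<in> GU" shows "(u - 1) * e = u - 1" "e * (u - 1) = u - 1"
proof -
  have *: "(u - 1) * e = u - 1" if u: "u \<in> GU" for u
  proof (rule bop_eqI)
    fix \<xi>
    have "ap e (\<xi> - ap e \<xi>) = 0"
      using e_props(2) by (simp add: ap_arg_simps flip: ap_simps(7))
    then have "ap v (\<xi> - ap e \<xi>) = 0" if "v \<in> (\<lambda>u. u - 1) ` GU" for v
      using kernel_compl(4)[OF minus_1_A] that by (auto simp: e_def)
    then have "ap v \<xi> = ap v (ap e \<xi>)" if "v \<in> (\<lambda>u. u - 1) ` GU" for v
      using that by (simp add: ap_arg_simps)
    then show "ap ((u - 1) * e) \<xi> = ap (u - 1) \<xi>"
      using u by (metis ap_simps(7) imageI)
  qed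
  show "(u - 1) * e = u - 1" by (rule *[OF u])
  \<comment> \<open>G is closed under inverses, so the left identity is the adjoint of the right
    identity for \<open>adj u\<close>.\<close>
  have "adj ((adj u - 1) * e) = adj (adj u - 1)" by (simp only: *[OF GU_closed(3)[OF u]])
  then show "e * (u - 1) = u - 1" by (simp add: e_props)
qed

lemma e_finite: "\<tau> (ap e) < \<infinity>"
proof -
  obtain R F where F: "0 \<le> R" "\<And>x y. x \<in> N2 \<Longrightarrow> y \<in> N2 \<Longrightarrow> F (x + y) = F x + F y"
    "\<And>x. x \<in> N2 \<Longrightarrow> \<bar>F x\<bar> \<le> R * sqrt (ip x x)"
    "\<And>u x. u \<in> GU \<Longrightarrow> x \<in> N2 \<Longrightarrow> F x = F (adj u * x) + ip (u - 1) x"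
    by (rule cocycle) (rule that)
  have "\<tau> (ap e) \<le> ennreal (R\<^sup>2)"
    unfolding e_def
  proof (rule kernel_compl_finite_trace)
    show "(\<lambda>u. u - 1) ` GU \<subseteq> N2" using minus_1_N2 by auto
    fix v x assume "v \<in> (\<lambda>u. u - 1) ` GU" and x: "x \<in> N2"
    then obtain u where u: "u \<in> GU" "v = u - 1" by auto
    have "adj u * x \<in> N2" using u x by (simp add: GU_D N2_mult_left)
    \<comment> \<open>With v = u - 1, additivity makes F at \<open>adj v * x\<close> the difference
      of the values at \<open>adj u * x\<close> and x, which the cocycle identity evaluates.\<close>
    then have "F ((adj u * x - x) + x) = F (adj u * x - x) + F x"
      using x by (intro F(2) N2_diff) auto
    then show "F (adj v * x) = - ip v x" using F(4)[OF u(1) x] unfolding u(2) by (simp add: left_diff_distrib)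
  qed (use F in auto)
  then show ?thesis by (simp add: le_less_trans)
qed

sublocale finite_corner "bops M" "\<lambda>x. \<tau> (ap x)" e
  by unfold_locales (use e_props e_finite in auto)

end

section \<open>The corner of a finite projection\<close>

locale p_corner = p_unitaries M \<tau> p + finite_corner "bops M" "\<lambda>x. \<tau> (ap x)" e
  for M :: "('h::complex_hilbert \<Rightarrow> 'h) set" and \<tau> :: "('h \<Rightarrow> 'h) \<Rightarrow> ennreal" and p :: real and e :: "'h bop"
begin

definition K :: "'h set"
  where "K = range (ap e)"

definition R :: "'h bop \<Rightarrow> 'h \<Rightarrow> 'h"
  where "R x = restrict (ap x) K"

abbreviation "Ncor \<equiv> corner UNIV M (ap e)"
abbreviation "W \<equiv> unitary_group K Ncor"
abbreviation "Wtop \<equiv> strong_topology K (carrier W)"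

lemma ap_e_e [simp]: "ap e (ap e \<xi>) = ap e \<xi>"
  using e_idem by (metis ap_simps(7))

lemma mem_K: "\<xi> \<in> K \<longleftrightarrow> ap e \<xi> = \<xi>"
  unfolding K_def by (metis ap_e_e rangeE rangeI)

lemma e_K [simp]: "ap e \<xi> \<in> K"
  by (simp add: mem_K)

lemma commute_K: "e * x = x * e \<Longrightarrow> \<xi> \<in> K \<Longrightarrow> ap x \<xi> \<in> K"
  unfolding mem_K by (metis ap_simps(7))

lemma clin_A: "x \<in> A \<Longrightarrow> clin x"
  by (rule clin_bops[OF vN])

lemma clinD: "clin x \<Longrightarrow> ap x (c *\<^sub>C \<xi>) = c *\<^sub>C ap x \<xi>"
  by (simp add: clin_iff)

lemma closed_csubspace_K: "closed_csubspace K"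
proof -
  have "K = {\<xi>. ap e \<xi> = \<xi>}" by (auto simp: mem_K)
  moreover have "closed {\<xi>. ap e \<xi> = \<xi>}"
    by (intro closed_Collect_eq continuous_intros)
  ultimately have "closed K" by simp
  then show ?thesis
    using clinD[OF clin_A[OF e_A]] by (simp add: closed_csubspace_def mem_K ap_arg_simps)
qed

lemma R_eq_iff: "R x = R y \<longleftrightarrow> x * e = y * e"
proof
  assume eq: "R x = R y"
  show "x * e = y * e"
  proof (rule bop_eqI)
    fix \<xi>
    show "ap (x * e) \<xi> = ap (y * e) \<xi>" using fun_cong[OF eq, of "ap e \<xi>"] by (simp add: R_def)
  qed
next
  assume eq: "x * e = y * e"
  have "ap x \<xi> = ap y \<xi>" if "\<xi> \<in> K" for \<xi>
    using arg_cong[OF eq, of "\<lambda>z. ap z \<xi>"] that by (simp add: mem_K)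
  then show "R x = R y" by (auto simp: R_def fun_eq_iff)
qed

lemma R_bounded: assumes "clin x" "e * x = x * e" shows "R x \<in> bounded_ops K"
proof -
  have K: "\<xi> + \<eta> \<in> K" "c *\<^sub>C \<xi> \<in> K" if "\<xi> \<in> K" "\<eta> \<in> K" for \<xi> \<eta> c
    using closed_csubspace_K that by (auto simp: closed_csubspace_def)
  show ?thesis
    unfolding bounded_ops_def using assms commute_K K
    by (auto simp: R_def ap_arg_simps clinD intro!: exI[of _ "norm x"] norm_ap)
qed

lemma R_compose: "e * y = y * e \<Longrightarrow> compose K (R x) (R y) = R (x * y)"
  by (auto simp: R_def compose_def fun_eq_iff commute_K)

lemma R_one: "op_one K = R 1" "R e = R 1"
  by (simp add: op_one_def R_def fun_eq_iff) (simp add: R_eq_iff e_idem)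

lemma R_adj:
  assumes x: "clin x" "e * x = x * e" shows "op_adj K (R x) = R (adj x)"
  unfolding op_adj_def
proof (rule the_equality)
  have c: "clin (adj x)" "e * adj x = adj x * e"
    using clin_adj[OF x(1)] arg_cong[OF x(2), of adj] by (simp_all add: e_adj)
  show *: "R (adj x) \<in> bounded_ops K \<and> (\<forall>\<xi>\<in>K. \<forall>\<eta>\<in>K. cinner (R x \<xi>) \<eta> = cinner \<xi> (R (adj x) \<eta>))"
    using R_bounded[OF c] cinner_ap[OF x(1)] by (simp add: R_def)
  fix y assume y: "y \<in> bounded_ops K \<and> (\<forall>\<xi>\<in>K. \<forall>\<eta>\<in>K. cinner (R x \<xi>) \<eta> = cinner \<xi> (y \<eta>))"
  show "y = R (adj x)"
  proof
    fix \<eta> show "y \<eta> = R (adj x) \<eta>"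
    proof (cases "\<eta> \<in> K")
      case True
      let ?d = "y \<eta> - R (adj x) \<eta>"
      have "y \<eta> \<in> K" "R (adj x) \<eta> \<in> K" using y * True by (auto simp: bounded_ops_def)
      then have d: "?d \<in> K" by (simp add: mem_K ap_arg_simps)
      have "cinner ?d (y \<eta>) = cinner ?d (R (adj x) \<eta>)" using y * True d by metis
      then have "inner ?d (y \<eta>) = inner ?d (R (adj x) \<eta>)" by (simp add: inner_eq_Re_cinner)
      then have "inner ?d ?d = 0" by (simp add: inner_diff_right)
      then show ?thesis by simp
    next
      case False
      then show ?thesis using y * by (auto simp: bounded_ops_def PiE_def extensional_def)
    qed
  qed
qed

definition eAe :: "'h bop set"
  where "eAe = {x \<in> A. e * x = x \<and> x * e = x}"

lemma eAeD: "x \<in> eAe \<Longrightarrow> x \<in> A" "x \<in> eAe \<Longrightarrow> e * x = x" "x \<in> eAe \<Longrightarrow> x * e = x" "x \<in> eAe \<Longrightarrow> clin x"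
  "x \<in> eAe \<Longrightarrow> e * x = x * e"
  by (auto simp: eAe_def clin_A)

lemma eAe_closed: "x \<in> eAe \<Longrightarrow> adj x \<in> eAe" "x \<in> eAe \<Longrightarrow> y \<in> eAe \<Longrightarrow> x * y \<in> eAe" "e \<in> eAe"
proof -
  assume x: "x \<in> eAe"
  have "adj x * adj e = adj x" "adj e * adj x = adj x"
    unfolding adj_simps(7)[symmetric] by (simp_all only: eAeD(2,3)[OF x])
  then show "adj x \<in> eAe" using eAeD(1)[OF x] by (simp add: eAe_def e_adj)
  show "x * y \<in> eAe" if "y \<in> eAe" using x that
    by (simp add: eAe_def mult.assoc) (simp flip: mult.assoc)
qed (simp add: eAe_def e_A e_idem)

text \<open>An operator x of A and \<open>e * x * e\<close> have the same compression to the range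
  of e.\<close>

lemma corner_eq: "Ncor = R ` eAe"
proof -
  have "Ncor = (\<lambda>x. R (e * x)) ` A"
  proof -
    have "M = ap ` A" using M_ex_bop[OF vN] by (auto simp: bops_iff image_iff)
    then have "Ncor = (\<lambda>x. restrict (compose UNIV (ap e) x) (range (ap e))) ` (ap ` A)"
      unfolding corner_def by (rule arg_cong)
    then show ?thesis by (simp only: image_image op_UNIV_simps R_def K_def)
  qed
  also have "\<dots> = R ` eAe"
  proof (intro subset_antisym image_subsetI)
    fix x assume "x \<in> A"
    then have "e * x * e \<in> eAe" using e_A
      by (simp add: eAe_def mult.assoc e_idem) (simp add: e_idem flip: mult.assoc)
    moreover have "R (e * x) = R (e * x * e)" by (simp add: R_eq_iff mult.assoc e_idem)
    ultimately show "R (e * x) \<in> R ` eAe" by simp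
  next
    fix x assume "x \<in> eAe"
    then show "R x \<in> (\<lambda>x. R (e * x)) ` A" using eAeD by (intro image_eqI[of _ _ x]) simp_all
  qed
  finally show ?thesis .
qed

text \<open>The unitaries of A that are 1 on the complement of the range of e. Restriction
  identifies them with the unitary group of the corner, so both groups are studied inside A.\<close>

definition Ue :: "'h bop set"
  where "Ue = {u \<in> A. adj u * u = 1 \<and> u * adj u = 1 \<and> (u - 1) * e = u - 1 \<and> e * (u - 1) = u - 1}"

lemma UeD: assumes "u \<in> Ue"
  shows "u \<in> A" "adj u * u = 1" "u * adj u = 1" "(u - 1) * e = u - 1" "e * (u - 1) = u - 1"
    "e * u = u * e" "clin u"
proof -
  show *: "u \<in> A" "adj u * u = 1" "u * adj u = 1" "(u - 1) * e = u - 1" "e * (u - 1) = u - 1"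
    using assms by (auto simp: Ue_def)
  then show "clin u" by (simp add: clin_A)
  have "u * e - e = e * u - e" using *(4,5) by (simp add: left_diff_distrib right_diff_distrib)
  then show "e * u = u * e" by simp
qed

lemma Ue_Up: "u \<in> Ue \<Longrightarrow> u \<in> Up"
  using pnorm_pow_corner_finite[OF _ UeD(4) p1 p2, of u] by (simp add: Up_def UeD)

lemma Ue_closed: "1 \<in> Ue" "u \<in> Ue \<Longrightarrow> v \<in> Ue \<Longrightarrow> u * v \<in> Ue" "u \<in> Ue \<Longrightarrow> adj u \<in> Ue"
proof -
  show "1 \<in> Ue" by (simp add: Ue_def)
  show adj: "adj u \<in> Ue" if u: "u \<in> Ue" for u
  proof -
    have "adj ((u - 1) * e) = adj (u - 1)" "adj (e * (u - 1)) = adj (u - 1)"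
      by (simp_all only: UeD(4,5)[OF u])
    then have "(adj u - 1) * e = adj u - 1" "e * (adj u - 1) = adj u - 1" by (simp_all add: e_adj)
    then show ?thesis using UeD(1-3)[OF u] by (simp add: Ue_def)
  qed
  show "u * v \<in> Ue" if u: "u \<in> Ue" and v: "v \<in> Ue" for u v
  proof -
    have "(u * v - 1) * e = u * ((v - 1) * e) + (u - 1) * e" "e * (u * v - 1) = e * (u - 1) * v + e * (v - 1)"
      by (simp_all add: algebra_simps)
    then have "(u * v - 1) * e = u * v - 1" "e * (u * v - 1) = u * v - 1"
      by (simp_all only: UeD(4,5)[OF u] UeD(4,5)[OF v]) (simp_all add: algebra_simps)
    moreover have "adj (u * v) * (u * v) = adj v * (adj u * u) * v" "(u * v) * adj (u * v) = u * (v * adj v) * adj u"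
      by (simp_all add: mult.assoc)
    ultimately show ?thesis using u v by (simp add: Ue_def)
  qed
qed

text \<open>A unitary x of the corner extends to the unitary \<open>x + (1 - e)\<close> of
  A.\<close>

lemma carrier_W: "carrier W = R ` Ue"
proof (intro subset_antisym subsetI)
  fix w assume w: "w \<in> carrier W"
  then obtain x where x: "x \<in> eAe" "w = R x" by (auto simp: unitary_group_def corner_eq)
  have xx: "adj x * x = e" "x * adj x = e"
  proof -
    have "R (adj x * x) = R e" "R (x * adj x) = R e"
      using w x(2) eAeD[OF x(1)] eAeD[OF eAe_closed(1)[OF x(1)]]
      by (simp_all add: unitary_group_def R_adj R_compose R_one)
    moreover have "adj x * x * e = adj x * x" "x * adj x * e = x * adj x"
      using eAeD[OF eAe_closed(2)] eAe_closed(1) x(1) by blast+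
    ultimately show "adj x * x = e" "x * adj x = e" by (simp_all add: R_eq_iff e_idem)
  qed
  have ae: "adj x * e = adj x" "e * adj x = adj x" using eAeD[OF eAe_closed(1)[OF x(1)]] by simp_all
  have "x + (1 - e) \<in> Ue"
    using eAeD[OF x(1)] xx ae by (simp add: Ue_def e_A e_adj e_idem algebra_simps)
  moreover have "w = R (x + (1 - e))"
    using eAeD[OF x(1)] by (simp add: x(2) R_eq_iff e_idem algebra_simps)
  ultimately show "w \<in> R ` Ue" by blast
next
  fix w assume "w \<in> R ` Ue"
  then obtain u where u: "u \<in> Ue" "w = R u" by auto
  have "R u = R (u * e)" by (simp add: R_eq_iff mult.assoc e_idem)
  moreover have "u * e \<in> eAe"
  proof -
    have "u * e * e = u * e" by (simp add: mult.assoc e_idem)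
    moreover have "e * (u * e) = u * e * e" using UeD(6)[OF u(1)] by (simp flip: mult.assoc)
    ultimately show ?thesis using UeD(1)[OF u(1)] e_A by (simp add: eAe_def)
  qed
  ultimately have "R u \<in> Ncor" by (auto simp: corner_eq)
  then show "w \<in> carrier W"
    using UeD[OF u(1)] UeD[OF Ue_closed(3)[OF u(1)]]
    by (simp add: unitary_group_def u(2) R_adj R_compose R_one)
qed

lemma W_simps: "\<one>\<^bsub>W\<^esub> = R 1" "u \<in> Ue \<Longrightarrow> v \<in> Ue \<Longrightarrow> R u \<otimes>\<^bsub>W\<^esub> R v = R (u * v)"
  by (simp_all add: unitary_group_def R_one R_compose UeD)

lemma group_W: "group W"
proof (rule groupI)
  show "x \<otimes>\<^bsub>W\<^esub> y \<in> carrier W" if "x \<in> carrier W" "y \<in> carrier W" for x y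
    using that Ue_closed by (auto simp: carrier_W W_simps)
  show "\<one>\<^bsub>W\<^esub> \<in> carrier W" using Ue_closed by (auto simp: carrier_W W_simps)
  show "x \<otimes>\<^bsub>W\<^esub> y \<otimes>\<^bsub>W\<^esub> z = x \<otimes>\<^bsub>W\<^esub> (y \<otimes>\<^bsub>W\<^esub> z)" if "x \<in> carrier W" "y \<in> carrier W" "z \<in> carrier W" for x y z
    using that Ue_closed by (auto simp: carrier_W W_simps mult.assoc)
  show "\<one>\<^bsub>W\<^esub> \<otimes>\<^bsub>W\<^esub> x = x" if "x \<in> carrier W" for x
    using that Ue_closed W_simps(2)[of 1] by (auto simp: carrier_W W_simps(1))
  show "\<exists>y\<in>carrier W. y \<otimes>\<^bsub>W\<^esub> x = \<one>\<^bsub>W\<^esub>" if "x \<in> carrier W" for x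
  proof -
    obtain u where u: "u \<in> Ue" "x = R u" using \<open>x \<in> carrier W\<close> by (auto simp: carrier_W)
    then show ?thesis
      by (intro bexI[of _ "R (adj u)"]) (auto simp: carrier_W W_simps UeD Ue_closed)
  qed
qed

lemma inv_W: "u \<in> Ue \<Longrightarrow> inv\<^bsub>W\<^esub> (R u) = R (adj u)"
  by (rule group.inv_equality[OF group_W]) (auto simp: carrier_W W_simps UeD Ue_closed)

text \<open>Let Y be y extended by 0. Every z in the commutant of A restricts to an element of the
  commutant of the corner, so y commutes with the restriction and Y with z. Hence Y lies in A; the
  full commutant of the corner need not be computed.\<close>

lemma von_neumann_algebra_corner: "von_neumann_algebra K Ncor"
  unfolding von_neumann_algebra_def
proof (intro conjI ballI)
  show "closed_csubspace K" by (rule closed_csubspace_K)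
  show N: "Ncor \<subseteq> bounded_ops K" using R_bounded eAeD by (auto simp: corner_eq)
  show "op_adj K x \<in> Ncor" if "x \<in> Ncor" for x
    using that eAe_closed(1) R_adj[OF eAeD(4,5)] by (auto simp: corner_eq)
  show "commutant K (commutant K Ncor) = Ncor"
  proof (intro subset_antisym subsetI)
    fix x assume "x \<in> Ncor"
    then show "x \<in> commutant K (commutant K Ncor)" using N by (auto simp: commutant_def)
  next
    fix y assume y: "y \<in> commutant K (commutant K Ncor)"
    then have yb: "y \<in> bounded_ops K" by (simp add: commutant_def)
    obtain B where B: "\<And>\<xi>. \<xi> \<in> K \<Longrightarrow> norm (y \<xi>) \<le> B * norm \<xi>" using yb unfolding bounded_ops_def by blast
    have yK: "y \<xi> \<in> K" if "\<xi> \<in> K" for \<xi> using yb that by (auto simp: bounded_ops_def)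
    have "bounded_linear (\<lambda>\<xi>. y (ap e \<xi>))"
    proof (rule bounded_linear_intro)
      show "y (ap e (\<xi> + \<eta>)) = y (ap e \<xi>) + y (ap e \<eta>)" for \<xi> \<eta>
        using yb by (simp add: bounded_ops_def ap_arg_simps)
      have "y (r *\<^sub>R \<xi>) = r *\<^sub>R y \<xi>" if "\<xi> \<in> K" for r \<xi>
        using yb that by (simp add: bounded_ops_def flip: scaleC_of_real)
      then show "y (ap e (r *\<^sub>R \<xi>)) = r *\<^sub>R y (ap e \<xi>)" for r \<xi> by (simp add: ap_arg_simps)
      show "norm (y (ap e \<xi>)) \<le> norm \<xi> * (\<bar>B\<bar> * norm e)" for \<xi>
      proof -
        have "norm (y (ap e \<xi>)) \<le> \<bar>B\<bar> * norm (ap e \<xi>)"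
          using B[of "ap e \<xi>"] by (meson abs_ge_self e_K mult_right_mono norm_ge_zero order_trans)
        also have "\<dots> \<le> \<bar>B\<bar> * (norm e * norm \<xi>)" by (intro mult_left_mono norm_ap) simp
        finally show ?thesis by (simp add: mult_ac)
      qed
    qed
    then obtain Y where Y: "ap Y = (\<lambda>\<xi>. y (ap e \<xi>))" using ex_bop by metis
    have eY: "e * Y = Y" "Y * e = Y" by (auto intro!: bop_eqI simp: Y yK[unfolded mem_K])
    have "Y \<in> A"
    proof (rule memI)
      fix z assume z: "z \<in> cent A"
      then have zc: "clin z" "\<And>x. x \<in> A \<Longrightarrow> z * x = x * z" by (auto simp: cent_bops[OF vN])
      have ez: "e * z = z * e" using zc(2)[OF e_A] by simp
      have "R z \<in> commutant K Ncor"
        using R_bounded[OF zc(1) ez] zc(2) ez eAeD by (auto simp: commutant_def corner_eq R_compose)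
      then have c: "compose K y (R z) = compose K (R z) y" using y by (auto simp: commutant_def)
      show "Y * z = z * Y"
      proof (rule bop_eqI)
        fix \<xi>
        have "y (ap z (ap e \<xi>)) = ap z (y (ap e \<xi>))"
          using fun_cong[OF c, of "ap e \<xi>"] yK[OF e_K] by (simp add: compose_def R_def)
        moreover have "ap e (ap z \<xi>) = ap z (ap e \<xi>)" using ez by (metis ap_simps(7))
        ultimately show "ap (Y * z) \<xi> = ap (z * Y) \<xi>" by (simp add: Y)
      qed
    qed
    then have "Y \<in> eAe" using eY by (simp add: eAe_def)
    moreover have "y = R Y" using yb by (auto simp: R_def Y mem_K fun_eq_iff bounded_ops_def PiE_def extensional_def)
    ultimately show "y \<in> Ncor" by (auto simp: corner_eq)
  qed
qed

text \<open>If \<open>adj x * x = e\<close>, then q = \<open>x * adj x\<close> is a subprojection of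
  e with the same trace. As that trace is finite, e - q has trace 0 and vanishes by
  faithfulness.\<close>

lemma finite_vna_corner: "finite_vna K Ncor"
  unfolding finite_vna_def finite_projection_def is_projection_def
proof (intro conjI ballI impI)
  show "von_neumann_algebra K Ncor" by (rule von_neumann_algebra_corner)
  show "op_one K \<in> bounded_ops K" "compose K (op_one K) (op_one K) = op_one K" "op_adj K (op_one K) = op_one K"
    using R_bounded[of 1] R_compose[of 1 1] R_adj[of 1] by (simp_all add: R_one(1) clin_A)
  show "op_one K \<in> Ncor" unfolding corner_eq by (metis eAe_closed(3) R_one image_eqI)
  fix v assume "v \<in> Ncor"
    and v: "compose K (op_adj K v) v = op_one K \<and> op_le K (compose K v (op_adj K v)) (op_one K)"
  then obtain x where x: "x \<in> eAe" "v = R x" by (auto simp: corner_eq)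
  note xa = eAe_closed(1)[OF x(1)]
  have "R (adj x * x) = R e" using v x(2) eAeD[OF x(1)] by (simp add: R_adj R_compose R_one)
  moreover have "adj x * x * e = adj x * x" using eAeD[OF eAe_closed(2)[OF xa x(1)]] by blast
  ultimately have xx: "adj x * x = e" by (simp add: R_eq_iff e_idem)
  define q where "q = x * adj x"
  have q: "q \<in> A" "0 \<le> q" "q * q = q" "adj q = q" "e * q = q" "q * e = q"
  proof -
    have "q * q = x * (adj x * x) * adj x" by (simp add: q_def mult.assoc)
    then show "q * q = q" using eAeD[OF x(1)] by (simp add: xx q_def)
    show "e * q = q" "q * e = q" using eAeD[OF eAe_closed(2)[OF x(1) xa]] by (simp_all add: q_def)
  qed (use eAeD(1)[OF x(1)] adj_mult_self_nonneg[of "adj x"] in \<open>auto simp: q_def\<close>)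
  have eq: "adj (e - q) * (e - q) = e - q" using q by (simp add: e_adj algebra_simps e_idem)
  then have nn: "0 \<le> e - q" by (metis adj_mult_self_nonneg)
  have "\<tau> (ap e) = \<tau> (ap (adj x * x))" by (simp add: xx)
  also have "\<dots> = \<tau> (ap q)" unfolding q_def using tracial[OF eAeD(1)[OF x(1)]] by simp
  finally have t: "\<tau> (ap q) = \<tau> (ap e)" by simp
  have "\<tau> (ap ((e - q) + q)) = \<tau> (ap (e - q)) + \<tau> (ap q)"
    using q nn e_A by (intro tr_add) auto
  then have "\<tau> (ap (e - q)) = 0" using t e_fin by (auto simp: ennreal_add_left_cancel)
  then have "e - q = 0" using q nn e_A by (intro faithful) auto
  then have "q = e" by simp
  then have "R (x * adj x) = op_one K" unfolding q_def[symmetric] by (simp only: R_one)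
  moreover have "compose K v (op_adj K v) = R (x * adj x)"
    using eAeD(4,5)[OF x(1)] eAeD(5)[OF xa] by (simp only: x(2) R_adj R_compose)
  ultimately show "compose K v (op_adj K v) = op_one K" by simp
qed

end

section \<open>Topologies\<close>

text \<open>The hypothesis says that finitely many coordinates control the metric near each point.
  So one point of X for each basic open set of the second countable sequence space that meets the
  image gives a dense set.\<close>

lemma separable_space_mtopology:
  fixes f :: "nat \<Rightarrow> 'a \<Rightarrow> complex"
  assumes X: "Metric_space X d"
    and f: "\<And>x \<epsilon>. x \<in> X \<Longrightarrow> 0 < \<epsilon> \<Longrightarrow> \<exists>n \<delta>. 0 < \<delta> \<and> (\<forall>y\<in>X. (\<forall>k<n. dist (f k x) (f k y) < \<delta>) \<longrightarrow> d x y < \<epsilon>)"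
  shows "separable_space (Metric_space.mtopology X d)"
proof -
  interpret Metric_space X d by (rule X)
  define F where "F x k = f k x" for x and k :: nat
  obtain B :: "(nat \<Rightarrow> complex) set set" where B: "countable B" "topological_basis B"
    using ex_countable_basis by blast
  define C where "C = (\<lambda>U. SOME x. x \<in> X \<and> F x \<in> U) ` {U \<in> B. \<exists>x\<in>X. F x \<in> U}"
  have C: "countable C" "C \<subseteq> X"
    unfolding C_def using B(1) by (auto intro!: countable_image countable_subset[OF _ B(1)]) (metis (mono_tags, lifting) someI)
  have "x \<in> mtopology closure_of C" if x: "x \<in> X" for x
    unfolding metric_closure_of
  proof (intro CollectI conjI allI impI)
    fix r :: real assume "0 < r"
    from f[OF x this] obtain n \<delta> where n: "0 < \<delta>" "\<And>y. y \<in> X \<Longrightarrow> (\<And>k. k < n \<Longrightarrow> dist (f k x) (f k y) < \<delta>) \<Longrightarrow> d x y < r"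
      by blast
    define S where "S = (\<Inter>k<n. {g :: nat \<Rightarrow> complex. dist (f k x) (g k) < \<delta>})"
    have "open S" unfolding S_def
      by (intro open_INT ballI open_Collect_less continuous_intros continuous_on_product_coordinates) simp
    moreover have "F x \<in> S" using n(1) by (auto simp: S_def F_def)
    ultimately obtain U where U: "U \<in> B" "F x \<in> U" "U \<subseteq> S" by (rule topological_basisE[OF B(2)])
    define y where "y = (SOME y. y \<in> X \<and> F y \<in> U)"
    have "y \<in> X \<and> F y \<in> U" unfolding y_def by (rule someI[of _ x]) (use x U in simp)
    then have y: "y \<in> C" "F y \<in> S" using U x by (auto simp: C_def y_def)
    then have "d x y < r" using C(2) by (intro n(2)) (auto simp: S_def F_def)
    then show "\<exists>y\<in>C. y \<in> mball x r" using y x C(2) by auto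
  qed (rule x)
  then show ?thesis
    unfolding separable_space_def using C closure_of_subset_topspace[of mtopology C]
    by (intro exI[of _ C]) auto
qed

text \<open>The factor 2 comes from bounding real and imaginary parts separately; it suffices for
  the summability below.\<close>

lemma norm_cinner_le: "norm (cinner \<xi> \<eta>) \<le> 2 * (norm \<xi> * norm (\<eta> :: 'h::complex_hilbert))"
proof -
  have "norm (cinner \<xi> \<eta>) \<le> \<bar>inner \<xi> \<eta>\<bar> + \<bar>inner (\<i> *\<^sub>C \<xi>) \<eta>\<bar>"
    using cmod_le[of "cinner \<xi> \<eta>"] by (simp add: cinner_eq)
  also have "\<dots> \<le> norm \<xi> * norm \<eta> + norm (\<i> *\<^sub>C \<xi>) * norm \<eta>" by (intro add_mono Cauchy_Schwarz_ineq2)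
  finally show ?thesis by (simp add: norm_scaleC_ii mult_ac)
qed

context p_unitaries
begin

text \<open>Boundedness on the unit ball makes the suprema in \<open>separable_predual\<close>
  genuine upper bounds.\<close>

lemma predual_bounded:
  assumes "\<phi> \<in> predual UNIV M"
  shows "\<exists>C. \<forall>x\<in>A. norm x \<le> 1 \<longrightarrow> norm (\<phi> (ap x)) \<le> C"
proof -
  obtain \<xi> \<eta> where h: "\<phi> = (\<lambda>x\<in>M. \<Sum>n. cinner (x (\<xi> n)) (\<eta> n))"
    "summable (\<lambda>n. (norm (\<xi> n))\<^sup>2)" "summable (\<lambda>n. (norm (\<eta> n))\<^sup>2)"
    using assms unfolding predual_def by auto
  define g where "g n = (norm (\<xi> n))\<^sup>2 + (norm (\<eta> n))\<^sup>2" for n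
  have g: "summable g" unfolding g_def using h by (intro summable_add)
  have "norm (\<phi> (ap x)) \<le> suminf g" if x: "x \<in> A" "norm x \<le> 1" for x
  proof -
    have "norm (\<Sum>n. cinner (ap x (\<xi> n)) (\<eta> n)) \<le> suminf g"
    proof (rule norm_suminf_le[OF _ g])
      fix n
      have "norm (ap x (\<xi> n)) \<le> norm x * norm (\<xi> n)" by (rule norm_ap)
      also have "\<dots> \<le> 1 * norm (\<xi> n)" using x by (intro mult_right_mono) auto
      finally have "norm (cinner (ap x (\<xi> n)) (\<eta> n)) \<le> 2 * (norm (\<xi> n) * norm (\<eta> n))"
        using norm_cinner_le[of "ap x (\<xi> n)" "\<eta> n"] mult_right_mono[of "norm (ap x (\<xi> n))" "norm (\<xi> n)" "norm (\<eta> n)"] by simp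
      also have "\<dots> \<le> g n"
        unfolding g_def using sum_squares_bound[of "norm (\<xi> n)" "norm (\<eta> n)"] by simp
      finally show "norm (cinner (ap x (\<xi> n)) (\<eta> n)) \<le> g n" .
    qed
    then show ?thesis using x by (simp add: h(1) bops_iff)
  qed
  then show ?thesis by blast
qed

lemma vector_functional_predual: "(\<lambda>x\<in>M. cinner (x \<xi>) \<eta>) \<in> predual UNIV M"
proof -
  let ?\<xi> = "\<lambda>n::nat. if n = 0 then \<xi> else 0" and ?\<eta> = "\<lambda>n::nat. if n = 0 then \<eta> else 0"
  have "(\<lambda>n. cinner (x (?\<xi> n)) (?\<eta> n)) sums cinner (x \<xi>) \<eta>" for x :: "'h \<Rightarrow> 'h"
    using sums_single[of 0 "\<lambda>_. cinner (x \<xi>) \<eta>"]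
    by (rule sums_cong[THEN iffD1, rotated]) (use norm_cinner_le[of "x 0" 0] in auto)
  then have "(\<Sum>n. cinner (x (?\<xi> n)) (?\<eta> n)) = cinner (x \<xi>) \<eta>" for x :: "'h \<Rightarrow> 'h"
    by (rule sums_unique[symmetric])
  moreover have "summable (\<lambda>n. (norm (?\<xi> n))\<^sup>2)" "summable (\<lambda>n. (norm (?\<eta> n))\<^sup>2)"
    by (auto intro!: summable_finite[of "{0}"] split: if_splits)
  ultimately show ?thesis unfolding predual_def
    by (intro CollectI exI[of _ ?\<xi>] exI[of _ ?\<eta>]) auto
qed

lemma ex_dense_functionals:
  assumes "separable_predual UNIV M"
  obtains \<psi> :: "nat \<Rightarrow> ('h \<Rightarrow> 'h) \<Rightarrow> complex" where "range \<psi> \<subseteq> predual UNIV M"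
    "\<And>\<xi> \<eta> \<epsilon>. 0 < \<epsilon> \<Longrightarrow> \<exists>k. \<forall>x\<in>A. norm x \<le> 1 \<longrightarrow> norm (cinner (ap x \<xi>) \<eta> - \<psi> k (ap x)) < \<epsilon>"
proof -
  obtain D where D: "countable D" "D \<subseteq> predual UNIV M"
    "\<And>\<phi> \<epsilon>. \<phi> \<in> predual UNIV M \<Longrightarrow> 0 < \<epsilon> \<Longrightarrow>
      \<exists>\<psi>\<in>D. (SUP x\<in>{x\<in>M. op_norm UNIV x \<le> 1}. norm (\<phi> x - \<psi> x)) < \<epsilon>"
    using assms unfolding separable_predual_def by blast
  have "D \<noteq> {}" using D(3)[OF vector_functional_predual, of 1] by auto
  then have r: "range (from_nat_into D) = D" using D(1) by (rule range_from_nat_into)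
  show thesis
  proof (rule that)
    show "range (from_nat_into D) \<subseteq> predual UNIV M" using r D(2) by simp
    fix \<xi> \<eta> :: 'h and \<epsilon> :: real assume "0 < \<epsilon>"
    define \<phi> where "\<phi> = (\<lambda>x\<in>M. cinner (x \<xi>) \<eta>)"
    have \<phi>: "\<phi> \<in> predual UNIV M" unfolding \<phi>_def by (rule vector_functional_predual)
    from D(3)[OF this \<open>0 < \<epsilon>\<close>] obtain \<psi> where \<psi>: "\<psi> \<in> D"
      "(SUP x\<in>{x\<in>M. op_norm UNIV x \<le> 1}. norm (\<phi> x - \<psi> x)) < \<epsilon>" by blast
    obtain C C' where C: "\<And>x. x \<in> A \<Longrightarrow> norm x \<le> 1 \<Longrightarrow> norm (\<phi> (ap x)) \<le> C"
      "\<And>x. x \<in> A \<Longrightarrow> norm x \<le> 1 \<Longrightarrow> norm (\<psi> (ap x)) \<le> C'"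
      using predual_bounded[OF \<phi>] predual_bounded[of \<psi>] \<psi>(1) D(2) by blast
    have bdd: "bdd_above ((\<lambda>x. norm (\<phi> x - \<psi> x)) ` {x\<in>M. op_norm UNIV x \<le> 1})"
    proof (rule bdd_aboveI2)
      fix f assume f: "f \<in> {x\<in>M. op_norm UNIV x \<le> 1}"
      then obtain x where "x \<in> A" "f = ap x" using M_ex_bop[OF vN] by auto
      then show "norm (\<phi> f - \<psi> f) \<le> C + C'"
        using f C[of x] norm_triangle_ineq4[of "\<phi> f" "\<psi> f"] by (auto simp: op_norm_UNIV)
    qed
    have "norm (cinner (ap x \<xi>) \<eta> - \<psi> (ap x)) < \<epsilon>" if x: "x \<in> A" "norm x \<le> 1" for x
    proof -
      have "norm (\<phi> (ap x) - \<psi> (ap x)) \<le> (SUP x\<in>{x\<in>M. op_norm UNIV x \<le> 1}. norm (\<phi> x - \<psi> x))"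
        using x by (intro cSUP_upper[OF _ bdd]) (auto simp: op_norm_UNIV bops_iff)
      then show ?thesis using \<psi>(2) x by (simp add: \<phi>_def bops_iff)
    qed
    moreover obtain k where "\<psi> = from_nat_into D k" using r \<psi>(1) by blast
    ultimately show "\<exists>k. \<forall>x\<in>A. norm x \<le> 1 \<longrightarrow> norm (cinner (ap x \<xi>) \<eta> - from_nat_into D k (ap x)) < \<epsilon>"
      by blast
  qed
qed

lemma pnorm_mult_left: "u \<in> Up \<Longrightarrow> x \<in> A \<Longrightarrow> pnorm p (u * x) = pnorm p x"
  and pnorm_mult_right: "u \<in> Up \<Longrightarrow> x \<in> A \<Longrightarrow> pnorm p (x * u) = pnorm p x"
  by (simp_all add: pnorm_def pnorm_pow_unitary UpD p0)

lemma pnorm_adj_diff: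
  assumes u: "u \<in> Up" and v: "v \<in> Up" shows "pnorm p (adj u - adj v) = pnorm p (u - v)"
proof -
  have "adj u * (v - u) * adj v = adj u * (v * adj v) - (adj u * u) * adj v" by (simp add: algebra_simps)
  also have "\<dots> = adj u - adj v" using u v by (simp add: UpD)
  finally have "pnorm p (adj u - adj v) = pnorm p (adj u * (v - u) * adj v)" by simp
  also have "\<dots> = pnorm p (v - u)"
    using u v by (simp add: pnorm_mult_left pnorm_mult_right Up_closed UpD)
  finally show ?thesis by (simp add: pnorm_minus_commute)
qed

lemma mem_mball: "u \<in> Up \<Longrightarrow> v \<in> Up \<Longrightarrow> ap v \<in> U.mball (ap u) r \<longleftrightarrow> pnorm p (u - v) < r"
  unfolding U.in_mball by (simp add: carrier_P Pdist_eq)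

text \<open>Continuity follows from bi-invariance: a product moves by at most the sum of the moves
  of its factors, and inversion is isometric by \<open>pnorm_adj_diff\<close>.\<close>

lemma topological_group_subgroup:
  assumes H: "subgroup H P" shows "topological_group (P\<lparr>carrier := H\<rparr>) (subtopology Ptop H)"
proof -
  let ?H = "P\<lparr>carrier := H\<rparr>" and ?T = "subtopology Ptop H"
  have grp: "group ?H" by (rule subgroup.subgroup_is_group[OF H group_P])
  have HU: "f \<in> H \<Longrightarrow> \<exists>u\<in>Up. f = ap u" for f using subgroup.subset[OF H] carrier_P by blast
  have top: "topspace ?T = H"
    using subgroup.subset[OF H] unfolding Ptop_eq topspace_subtopology U.topspace_mtopology by blast
  have cm: "continuous_map X ?T f \<longleftrightarrow> f \<in> topspace X \<rightarrow> H \<and> (\<forall>x\<in>topspace X. \<forall>\<epsilon>>0. \<exists>U. openin X U \<and> x \<in> U \<and> (\<forall>y\<in>U. f y \<in> U.mball (f x) \<epsilon>))"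
    for X :: "'c topology" and f
    unfolding continuous_map_in_subtopology Ptop_eq U.continuous_map_to_metric by blast
  have ball: "openin ?T (U.mball f \<delta> \<inter> H)" for f \<delta>
    unfolding Ptop_eq openin_subtopology by blast
  have mult: "continuous_map (prod_topology ?T ?T) ?T (\<lambda>(g, h). g \<otimes>\<^bsub>?H\<^esub> h)"
    unfolding cm
  proof (intro conjI ballI allI impI)
    show "(\<lambda>(g, h). g \<otimes>\<^bsub>?H\<^esub> h) \<in> topspace (prod_topology ?T ?T) \<rightarrow> H"
      unfolding topspace_prod_topology top using subgroup.m_closed[OF H] by auto
    fix z \<epsilon> assume z: "z \<in> topspace (prod_topology ?T ?T)" and \<epsilon>: "(0::real) < \<epsilon>"
    then obtain f g where fg: "f \<in> H" "g \<in> H" "z = (f, g)" unfolding topspace_prod_topology top by auto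
    then obtain u v where uv: "u \<in> Up" "v \<in> Up" "f = ap u" "g = ap v" using HU by meson
    let ?U = "(U.mball f (\<epsilon>/2) \<inter> H) \<times> (U.mball g (\<epsilon>/2) \<inter> H)"
    show "\<exists>U. openin (prod_topology ?T ?T) U \<and> z \<in> U \<and>
        (\<forall>y\<in>U. (case y of (g, h) \<Rightarrow> g \<otimes>\<^bsub>?H\<^esub> h) \<in> U.mball (case z of (g, h) \<Rightarrow> g \<otimes>\<^bsub>?H\<^esub> h) \<epsilon>)"
    proof (intro exI conjI ballI)
      show "openin (prod_topology ?T ?T) ?U" using ball by (simp add: openin_prod_Times_iff)
      show "z \<in> ?U" using fg \<epsilon> subgroup.subset[OF H] by auto
      fix y assume "y \<in> ?U"
      then obtain f' g' where y: "y = (f', g')" "f' \<in> H" "g' \<in> H" "f' \<in> U.mball f (\<epsilon>/2)" "g' \<in> U.mball g (\<epsilon>/2)" by auto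
      then obtain u' v' where uv': "u' \<in> Up" "v' \<in> Up" "f' = ap u'" "g' = ap v'" using HU by meson
      have "pnorm p (u - u') < \<epsilon>/2" "pnorm p (v - v') < \<epsilon>/2"
        using y(4,5) mem_mball[OF uv(1) uv'(1), of "\<epsilon>/2"] mem_mball[OF uv(2) uv'(2), of "\<epsilon>/2"]
        unfolding uv(3,4) uv'(3,4) by blast+
      moreover have "pnorm p (u * v - u' * v') \<le> pnorm p (u * v - u * v') + pnorm p (u * v' - u' * v')"
        using uv uv' by (intro pnorm_triangle Up_closed)
      moreover have "pnorm p (u * v - u * v') = pnorm p (v - v')" "pnorm p (u * v' - u' * v') = pnorm p (u - u')"
        using uv uv' by (simp_all add: pnorm_mult_left pnorm_mult_right UpD flip: right_diff_distrib left_diff_distrib)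
      ultimately have "pnorm p (u * v - u' * v') < \<epsilon>" by simp
      then have "ap (u' * v') \<in> U.mball (ap (u * v)) \<epsilon>"
        using mem_mball[OF Up_closed(2)[OF uv(1,2)] Up_closed(2)[OF uv'(1,2)]] by simp
      then show "(case y of (g, h) \<Rightarrow> g \<otimes>\<^bsub>?H\<^esub> h) \<in> U.mball (case z of (g, h) \<Rightarrow> g \<otimes>\<^bsub>?H\<^esub> h) \<epsilon>"
        using fg y uv uv' by (simp add: P_simps)
    qed
  qed
  have inv: "continuous_map ?T ?T (\<lambda>g. inv\<^bsub>?H\<^esub> g)"
    unfolding cm
  proof (intro conjI ballI allI impI)
    have inv_H: "inv\<^bsub>?H\<^esub> f = inv\<^bsub>P\<^esub> f" if "f \<in> H" for f
      by (rule group.m_inv_consistent[OF group_P H that])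
    show "(\<lambda>g. inv\<^bsub>?H\<^esub> g) \<in> topspace ?T \<rightarrow> H"
      unfolding top using group.inv_closed[OF grp] by auto
    fix f \<epsilon> assume "f \<in> topspace ?T" and \<epsilon>: "(0::real) < \<epsilon>"
    then have f: "f \<in> H" unfolding top by simp
    then obtain u where u: "u \<in> Up" "f = ap u" using HU by meson
    show "\<exists>U. openin ?T U \<and> f \<in> U \<and> (\<forall>y\<in>U. inv\<^bsub>?H\<^esub> y \<in> U.mball (inv\<^bsub>?H\<^esub> f) \<epsilon>)"
    proof (intro exI conjI ballI)
      show "openin ?T (U.mball f \<epsilon> \<inter> H)" by (rule ball)
      show "f \<in> U.mball f \<epsilon> \<inter> H" using f \<epsilon> subgroup.subset[OF H] by auto
      fix g assume g: "g \<in> U.mball f \<epsilon> \<inter> H"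
      then obtain v where v: "v \<in> Up" "g = ap v" using HU by blast
      have "pnorm p (u - v) < \<epsilon>" using g mem_mball[OF u(1) v(1)] by (simp add: u(2) v(2))
      then have "ap (adj v) \<in> U.mball (ap (adj u)) \<epsilon>"
        using mem_mball[OF Up_closed(3)[OF u(1)] Up_closed(3)[OF v(1)]] u(1) v(1) by (simp add: pnorm_adj_diff)
      then show "inv\<^bsub>?H\<^esub> g \<in> U.mball (inv\<^bsub>?H\<^esub> f) \<epsilon>"
        using inv_H f g u v by (simp add: inv_P)
    qed
  qed
  show ?thesis unfolding topological_group_def using grp top mult inv by simp
qed

end

section \<open>The restriction map\<close>

locale separable_corner = p_corner M \<tau> p e
  for M :: "('h::complex_hilbert \<Rightarrow> 'h) set" and \<tau> :: "('h \<Rightarrow> 'h) \<Rightarrow> ennreal" and p :: real and e :: "'h bop" +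
  assumes sep: "separable_predual UNIV M"
begin

text \<open>The Hilbert space need not be separable. A dense sequence in the predual involves only
  countably many vectors; an x that kills them all annihilates the dense functionals, hence every
  vector functional.\<close>

lemma ex_separating_sequence:
  obtains \<Xi> :: "nat \<Rightarrow> 'h" where "range \<Xi> \<subseteq> K" "\<forall>x\<in>E. (\<forall>k. ap x (\<Xi> k) = 0) \<longrightarrow> x = 0"
proof -
  obtain \<psi> :: "nat \<Rightarrow> ('h \<Rightarrow> 'h) \<Rightarrow> complex" where \<psi>: "range \<psi> \<subseteq> predual UNIV M"
    "\<And>\<xi> \<eta> \<epsilon>. 0 < \<epsilon> \<Longrightarrow> \<exists>k. \<forall>x\<in>A. norm x \<le> 1 \<longrightarrow> norm (cinner (ap x \<xi>) \<eta> - \<psi> k (ap x)) < \<epsilon>"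
    by (rule ex_dense_functionals[OF sep]) (rule that)
  have "\<exists>\<xi> \<eta>. \<psi> k = (\<lambda>x\<in>M. \<Sum>n. cinner (x (\<xi> n)) (\<eta> n))" for k :: nat
    using \<psi>(1) unfolding predual_def by blast
  then obtain \<xi> \<eta> where \<psi>_eq: "\<And>k. \<psi> k = (\<lambda>x\<in>M. \<Sum>n. cinner (x (\<xi> k n)) (\<eta> k n))" by metis
  \<comment> \<open>Applying e puts the vectors into K and is invisible to x, since
    \<open>x * e = x\<close>.\<close>
  define \<Xi> where "\<Xi> i = ap e (\<xi> (fst (prod_decode i)) (snd (prod_decode i)))" for i
  have \<Xi>: "\<Xi> (prod_encode (k, n)) = ap e (\<xi> k n)" for k n by (simp add: \<Xi>_def)
  show thesis
  proof (rule that, safe)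
    show "\<Xi> k \<in> K" for k by (simp add: \<Xi>_def)
    fix x assume x: "x \<in> E" and 0: "\<forall>k. ap x (\<Xi> k) = 0"
    have xe: "x * e = x" using nonneg_le_projection(1)[OF _ _ e_adj e_idem] x by (auto simp: E_def)
    \<comment> \<open>The dense functionals approximate only on the unit ball, so x is
      rescaled.\<close>
    define y where "y = (1 / (norm x + 1)) *\<^sub>R x"
    have "0 < norm x + 1" by (simp add: add_nonneg_pos)
    then have y: "y \<in> A" "norm y \<le> 1" using E_D(1)[OF x] by (auto simp: y_def divide_simps)
    have "ap x (\<xi> k n) = 0" for k n
      using 0[rule_format, of "prod_encode (k, n)"] xe by (metis \<Xi> ap_simps(7))
    then have "\<psi> k (ap y) = 0" for k
      using y norm_cinner_le[of "0 :: 'h"] by (simp add: \<psi>_eq y_def bops_iff)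
    then have "norm (cinner (ap y \<xi>) \<eta>) < \<epsilon>" if "0 < \<epsilon>" for \<xi> \<eta> \<epsilon>
      using \<psi>(2)[OF that, of \<xi> \<eta>] y by auto
    then have "cinner (ap y \<xi>) \<eta> = 0" for \<xi> \<eta> by (metis less_irrefl zero_less_norm_iff)
    then have "inner (ap y \<xi>) (ap y \<xi>) = 0" for \<xi> by (simp add: inner_eq_Re_cinner)
    then have "y = 0" by (intro bop_eqI) simp
    then show "x = 0" using \<open>0 < norm x + 1\<close> by (auto simp: y_def)
  qed
qed

lemma Ue_diff:
  assumes "u \<in> Ue" "v \<in> Ue"
  shows "u - v \<in> A" "(u - v) * e = u - v" "norm (u - v) \<le> 2" "pnorm_pow p (u - v) < \<infinity>"
proof -
  show *: "u - v \<in> A" using UeD(1) assms by blast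
  have "(u - v) * e = (u - 1) * e - (v - 1) * e" by (simp add: algebra_simps)
  then show "(u - v) * e = u - v" by (simp only: UeD(4)[OF assms(1)] UeD(4)[OF assms(2)]) simp
  show "norm (u - v) \<le> 2"
    using norm_triangle_ineq4[of u v] unitary_norm[OF Ue_Up[OF assms(1)]] unitary_norm[OF Ue_Up[OF assms(2)]] by simp
  show "pnorm_pow p (u - v) < \<infinity>" by (intro pnorm_pow_diff_finite Ue_Up assms)
qed

lemma pnorm_small_imp_strong_small:
  assumes "0 < \<epsilon>"
  shows "\<exists>\<delta>>0. \<forall>u\<in>Ue. \<forall>v\<in>Ue. pnorm p (u - v) < \<delta> \<longrightarrow> norm (ap u \<xi> - ap v \<xi>) < \<epsilon>"
proof -
  obtain \<delta>' where d': "0 < \<delta>'" "\<And>x. x \<in> A \<Longrightarrow> x * e = x \<Longrightarrow> norm x \<le> 2 \<Longrightarrow> ip x x < \<delta>' \<Longrightarrow> norm (ap x \<xi>) < \<epsilon>"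
    using ip_small_imp_strong_small[OF assms, of 2 \<xi>] by blast
  obtain \<delta> where d: "0 < \<delta>" "\<And>x. x \<in> A \<Longrightarrow> norm x \<le> 2 \<Longrightarrow> pnorm_pow p x < \<infinity> \<Longrightarrow> pnorm p x < \<delta> \<Longrightarrow> ip x x < \<delta>'"
    using pnorm_small_imp_ip_small[OF p1 p2 d'(1), of 2] by blast
  have "norm (ap u \<xi> - ap v \<xi>) < \<epsilon>" if "u \<in> Ue" "v \<in> Ue" "pnorm p (u - v) < \<delta>" for u v
    using d'(2)[OF Ue_diff(1-3)[OF that(1,2)] d(2)[OF Ue_diff(1,3,4)[OF that(1,2)] that(3)]] by simp
  with d(1) show ?thesis by blast
qed

lemma strong_small_imp_pnorm_small:
  obtains \<Xi> :: "nat \<Rightarrow> 'h" where "range \<Xi> \<subseteq> K"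
    "\<And>\<epsilon>. 0 < \<epsilon> \<Longrightarrow> \<exists>n. \<exists>\<delta>>0. \<forall>u\<in>Ue. \<forall>v\<in>Ue. (\<forall>k<n. norm (ap u (\<Xi> k) - ap v (\<Xi> k)) < \<delta>) \<longrightarrow> pnorm p (u - v) < \<epsilon>"
proof -
  obtain \<Xi> :: "nat \<Rightarrow> 'h" where \<Xi>: "range \<Xi> \<subseteq> K" "\<forall>x\<in>E. (\<forall>k. ap x (\<Xi> k) = 0) \<longrightarrow> x = 0"
    by (rule ex_separating_sequence) (rule that)
  show thesis
  proof (rule that[OF \<Xi>(1)])
    fix \<epsilon> :: real assume "0 < \<epsilon>"
    then obtain \<delta>' where d': "0 < \<delta>'" "\<And>x. x \<in> A \<Longrightarrow> x * e = x \<Longrightarrow> ip x x < \<delta>' \<Longrightarrow> pnorm p x < \<epsilon>"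
      using ip_small_imp_pnorm_small[OF p1 p2] by meson
    have "\<exists>n::nat. \<exists>\<delta>>0. \<forall>x\<in>A. x * e = x \<and> norm x \<le> 2 \<and> (\<forall>k<n. norm (ap x (\<Xi> k)) < \<delta>) \<longrightarrow> ip x x < \<delta>'"
      by (rule strong_small_imp_ip_small[OF d'(1)]) (use \<Xi>(2) in blast)
    then obtain n :: nat and \<delta> where d: "0 < \<delta>"
      "\<And>x. x \<in> A \<Longrightarrow> x * e = x \<Longrightarrow> norm x \<le> 2 \<Longrightarrow> (\<forall>k<n. norm (ap x (\<Xi> k)) < \<delta>) \<Longrightarrow> ip x x < \<delta>'" by blast
    have "pnorm p (u - v) < \<epsilon>" if "u \<in> Ue" "v \<in> Ue" "\<forall>k<n. norm (ap u (\<Xi> k) - ap v (\<Xi> k)) < \<delta>" for u v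
      using d'(2)[OF Ue_diff(1,2)[OF that(1,2)] d(2)[OF Ue_diff(1-3)[OF that(1,2)]]] that(3) by simp
    with d(1) show "\<exists>n. \<exists>\<delta>>0. \<forall>u\<in>Ue. \<forall>v\<in>Ue. (\<forall>k<n. norm (ap u (\<Xi> k) - ap v (\<Xi> k)) < \<delta>) \<longrightarrow> pnorm p (u - v) < \<epsilon>"
      by blast
  qed
qed

text \<open>Extension by the identity on the complement of K, the inverse of restriction on
  \<open>Ue\<close>.\<close>

definition ext :: "('h \<Rightarrow> 'h) \<Rightarrow> 'h \<Rightarrow> 'h"
  where "ext f = (\<lambda>\<xi>. f (ap e \<xi>) + (\<xi> - ap e \<xi>))"

lemma ext_R: assumes "u \<in> Ue" shows "ext (R u) = ap u"
proof
  fix \<xi>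
  have "ap ((u - 1) * e) \<xi> = ap (u - 1) \<xi>" by (simp only: UeD(4)[OF assms])
  then show "ext (R u) \<xi> = ap u \<xi>" by (simp add: ext_def R_def algebra_simps)
qed

lemma topspace_Wtop: "topspace Wtop = carrier W"
  by (auto simp: strong_topology_def carrier_W R_def)

lemma continuous_map_ext: "continuous_map Wtop Ptop ext"
  unfolding Ptop_eq U.continuous_map_to_metric
proof (intro ballI allI impI)
  fix w \<epsilon> assume w: "w \<in> topspace Wtop" and "(0::real) < \<epsilon>"
  obtain \<Xi> :: "nat \<Rightarrow> 'h" where \<Xi>: "range \<Xi> \<subseteq> K" and
    *: "\<And>\<epsilon>. 0 < \<epsilon> \<Longrightarrow> \<exists>n. \<exists>\<delta>>0. \<forall>u\<in>Ue. \<forall>v\<in>Ue. (\<forall>k<n. norm (ap u (\<Xi> k) - ap v (\<Xi> k)) < \<delta>) \<longrightarrow> pnorm p (u - v) < \<epsilon>"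
    by (rule strong_small_imp_pnorm_small) (rule that)
  obtain n \<delta> where d: "0 < \<delta>"
    "\<And>u v. u \<in> Ue \<Longrightarrow> v \<in> Ue \<Longrightarrow> (\<And>k. k < n \<Longrightarrow> norm (ap u (\<Xi> k) - ap v (\<Xi> k)) < \<delta>) \<Longrightarrow> pnorm p (u - v) < \<epsilon>"
    using *[OF \<open>0 < \<epsilon>\<close>] by meson
  obtain u where u: "u \<in> Ue" "w = R u" using w unfolding topspace_Wtop unfolding carrier_W by auto
  define h where "h v = (\<Sum>k<n. norm (w (\<Xi> k) - v (\<Xi> k)))" for v :: "'h \<Rightarrow> 'h"
  define U where "U = {v \<in> topspace Wtop. h v \<in> {..<\<delta>}}"
  have "continuous_map Wtop euclidean (\<lambda>v. v (\<Xi> k))" for k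
    unfolding strong_topology_def using \<Xi>
    by (intro continuous_map_from_subtopology continuous_map_product_projection) auto
  then have "continuous_map Wtop euclidean h"
    unfolding h_def
    by (intro continuous_map_sum continuous_map_norm continuous_map_diff continuous_map_canonical_const) auto
  then have "openin Wtop U" unfolding U_def by (rule openin_continuous_map_preimage) auto
  moreover have "w \<in> U" using w d(1) by (simp add: U_def h_def)
  moreover have "ext y \<in> U.mball (ext w) \<epsilon>" if y: "y \<in> U" for y
  proof -
    obtain v where v: "v \<in> Ue" "y = R v" using y unfolding U_def unfolding topspace_Wtop unfolding carrier_W by auto
    have "norm (ap u (\<Xi> k) - ap v (\<Xi> k)) < \<delta>" if "k < n" for k
    proof -
      have "\<Xi> k \<in> K" using \<Xi> by auto
      then have "norm (ap u (\<Xi> k) - ap v (\<Xi> k)) = norm (w (\<Xi> k) - y (\<Xi> k))" by (simp add: u(2) v(2) R_def)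
      also have "\<dots> \<le> h y" unfolding h_def using that by (intro member_le_sum) auto
      also have "\<dots> < \<delta>" using y by (simp add: U_def)
      finally show ?thesis .
    qed
    then have "pnorm p (u - v) < \<epsilon>" using u v by (intro d(2)) auto
    then show ?thesis using mem_mball[OF Ue_Up[OF u(1)] Ue_Up[OF v(1)]] by (simp only: u(2) v(2) ext_R[OF u(1)] ext_R[OF v(1)])
  qed
  ultimately show "\<exists>U. openin Wtop U \<and> w \<in> U \<and> (\<forall>y\<in>U. ext y \<in> U.mball (ext w) \<epsilon>)" by blast
qed

abbreviation "\<rho> \<equiv> (\<lambda>f. restrict f K)"

lemma \<rho>_ap: "\<rho> (ap u) = R u"
  by (simp add: R_def)

lemma continuous_map_restrict: "continuous_map (subtopology Ptop (ap ` Ue)) Wtop \<rho>"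
proof -
  have top: "topspace (subtopology Ptop (ap ` Ue)) = ap ` Ue"
    using Ue_Up carrier_P unfolding Ptop_eq topspace_subtopology U.topspace_mtopology by blast
  have "continuous_map (subtopology Ptop (ap ` Ue)) euclidean (\<lambda>f. \<rho> f \<xi>)" if \<xi>: "\<xi> \<in> K" for \<xi>
    unfolding Met_TC.continuous_map_to_metric[unfolded mtopology_is_euclidean]
  proof (intro ballI allI impI)
    fix f \<epsilon> assume "f \<in> topspace (subtopology Ptop (ap ` Ue))" and \<epsilon>: "(0::real) < \<epsilon>"
    then obtain u where u: "u \<in> Ue" "f = ap u" unfolding top by auto
    obtain \<delta> where d: "0 < \<delta>" "\<And>u v. u \<in> Ue \<Longrightarrow> v \<in> Ue \<Longrightarrow> pnorm p (u - v) < \<delta> \<Longrightarrow> norm (ap u \<xi> - ap v \<xi>) < \<epsilon>"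
      using pnorm_small_imp_strong_small[OF \<epsilon>, of \<xi>] by blast
    show "\<exists>U. openin (subtopology Ptop (ap ` Ue)) U \<and> f \<in> U \<and> (\<forall>y\<in>U. \<rho> y \<xi> \<in> Met_TC.mball (\<rho> f \<xi>) \<epsilon>)"
    proof (intro exI conjI ballI)
      show "openin (subtopology Ptop (ap ` Ue)) (U.mball f \<delta> \<inter> ap ` Ue)"
        unfolding Ptop_eq openin_subtopology by blast
      have "ap u \<in> carrier P" using u Ue_Up carrier_P by blast
      then show "f \<in> U.mball f \<delta> \<inter> ap ` Ue" using u d(1) U.centre_in_mball_iff by blast
      fix y assume y: "y \<in> U.mball f \<delta> \<inter> ap ` Ue"
      then obtain v where v: "v \<in> Ue" "y = ap v" by auto
      have "pnorm p (u - v) < \<delta>" using y mem_mball[OF Ue_Up[OF u(1)] Ue_Up[OF v(1)], of \<delta>] unfolding u(2) v(2) by blast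
      from d(2)[OF u(1) v(1) this] show "\<rho> y \<xi> \<in> Met_TC.mball (\<rho> f \<xi>) \<epsilon>"
        using \<xi> by (simp add: u(2) v(2) dist_norm)
    qed
  qed
  then show ?thesis
    unfolding strong_topology_def continuous_map_in_subtopology continuous_map_componentwise top
    by (auto simp: carrier_W \<rho>_ap)
qed

context
  fixes G assumes G: "closed_subgroup G P Ptop" and GU: "G \<subseteq> ap ` Ue"
begin

lemma subgroup: "subgroup G P" and closed: "closedin Ptop G"
  using G by (simp_all add: closed_subgroup_def)

lemma topspace_G: "topspace (subtopology Ptop G) = G"
  using closedin_subset[OF closed] unfolding topspace_subtopology by blast

text \<open>Writing the image as a preimage under the continuous map \<open>ext\<close> makes it
  closed because G is closed.\<close>

lemma image_eq: "\<rho> ` G = {w \<in> topspace Wtop. ext w \<in> G}"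
proof (intro subset_antisym subsetI)
  fix w assume "w \<in> \<rho> ` G"
  then obtain u where u: "u \<in> Ue" "ap u \<in> G" "w = R u" using GU by (auto simp: \<rho>_ap)
  then show "w \<in> {w \<in> topspace Wtop. ext w \<in> G}" unfolding topspace_Wtop unfolding carrier_W by (auto simp: ext_R)
next
  fix w assume "w \<in> {w \<in> topspace Wtop. ext w \<in> G}"
  then obtain u where u: "u \<in> Ue" "w = R u" "ap u \<in> G"
    unfolding topspace_Wtop unfolding carrier_W by (auto simp: ext_R)
  then show "w \<in> \<rho> ` G" by (metis \<rho>_ap imageI)
qed

lemma iso_onto_closed_subgroup_restrict:
  "iso_onto_closed_subgroup \<rho> (P\<lparr>carrier := G\<rparr>) (subtopology Ptop G) W Wtop"
proof -
  have mem: "\<exists>u\<in>Ue. f = ap u" if "f \<in> G" for f using GU that by blast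
  have inW: "\<rho> ` G \<subseteq> carrier W" using image_eq topspace_Wtop by blast
  have sub: "subgroup (\<rho> ` G) W"
  proof (rule subgroup.intro)
    show "\<rho> ` G \<subseteq> carrier W" by (rule inW)
    fix x assume "x \<in> \<rho> ` G"
    then obtain u where u: "u \<in> Ue" "ap u \<in> G" "x = R u" using GU by (auto simp: \<rho>_ap)
    have "ap (adj u) \<in> G" using subgroup.m_inv_closed[OF subgroup u(2)] u by (simp add: inv_P Ue_Up)
    then show "inv\<^bsub>W\<^esub> x \<in> \<rho> ` G" unfolding u(3) inv_W[OF u(1)] by (metis \<rho>_ap imageI)
    fix y assume "y \<in> \<rho> ` G"
    then obtain v where v: "v \<in> Ue" "ap v \<in> G" "y = R v" using GU by (auto simp: \<rho>_ap)
    have "ap (u * v) \<in> G" using subgroup.m_closed[OF subgroup u(2) v(2)] by (simp add: P_simps)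
    then show "x \<otimes>\<^bsub>W\<^esub> y \<in> \<rho> ` G" unfolding u(3) v(3) W_simps(2)[OF u(1) v(1)] by (metis \<rho>_ap imageI)
  next
    show "\<one>\<^bsub>W\<^esub> \<in> \<rho> ` G" unfolding W_simps(1) using subgroup.one_closed[OF subgroup] by (metis P_simps(1) \<rho>_ap imageI)
  qed
  have closed': "closedin Wtop (\<rho> ` G)"
    unfolding image_eq by (rule closedin_continuous_map_preimage[OF continuous_map_ext closed])
  have ext_\<rho>: "ext (\<rho> f) = f" if "f \<in> G" for f using mem[OF that] by (auto simp: \<rho>_ap ext_R)
  have iso: "\<rho> \<in> iso (P\<lparr>carrier := G\<rparr>) (W\<lparr>carrier := \<rho> ` G\<rparr>)"
    unfolding iso_def hom_def
  proof (intro CollectI conjI ballI)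
    show "\<rho> (x \<otimes>\<^bsub>P\<lparr>carrier := G\<rparr>\<^esub> y) = \<rho> x \<otimes>\<^bsub>W\<lparr>carrier := \<rho> ` G\<rparr>\<^esub> \<rho> y"
      if xy: "x \<in> carrier (P\<lparr>carrier := G\<rparr>)" "y \<in> carrier (P\<lparr>carrier := G\<rparr>)" for x y
    proof -
      have "x \<in> G" "y \<in> G" using xy by simp_all
      then obtain u v where "u \<in> Ue" "v \<in> Ue" "x = ap u" "y = ap v" using mem by meson
      then show ?thesis by (simp add: P_simps W_simps \<rho>_ap)
    qed
    have "inj_on \<rho> G" by (rule inj_on_inverseI[of _ ext]) (rule ext_\<rho>)
    then show "bij_betw \<rho> (carrier (P\<lparr>carrier := G\<rparr>)) (carrier (W\<lparr>carrier := \<rho> ` G\<rparr>))"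
      by (simp add: bij_betw_def)
  qed auto
  have "homeomorphic_maps (subtopology Ptop G) (subtopology Wtop (\<rho> ` G)) \<rho> ext"
    unfolding homeomorphic_maps_def
  proof (intro conjI ballI)
    have "continuous_map (subtopology (subtopology Ptop (ap ` Ue)) G) Wtop \<rho>"
      by (intro continuous_map_from_subtopology continuous_map_restrict)
    then have "continuous_map (subtopology Ptop G) Wtop \<rho>"
      using GU by (simp only: subtopology_subtopology inf.absorb2)
    then show "continuous_map (subtopology Ptop G) (subtopology Wtop (\<rho> ` G)) \<rho>"
      unfolding continuous_map_in_subtopology topspace_G by blast
    show "continuous_map (subtopology Wtop (\<rho> ` G)) (subtopology Ptop G) ext"
      unfolding continuous_map_in_subtopology
      by (intro conjI continuous_map_from_subtopology continuous_map_ext) (auto simp: ext_\<rho>)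
    show "ext (\<rho> f) = f" if "f \<in> topspace (subtopology Ptop G)" for f
      using that unfolding topspace_G by (rule ext_\<rho>)
    show "\<rho> (ext w) = w" if "w \<in> topspace (subtopology Wtop (\<rho> ` G))" for w
      using that by (auto simp: ext_\<rho>)
  qed
  then have "homeomorphic_map (subtopology Ptop G) (subtopology Wtop (\<rho> ` G)) \<rho>"
    by (rule homeomorphic_maps_imp_map)
  with sub closed' iso show ?thesis
    by (simp add: iso_onto_closed_subgroup_def closed_subgroup_def topological_group_iso_def)
qed

end

end

section \<open>Polish groups\<close>

context separable_corner
begin

lemma Cauchy_imp_strong_limit:
  assumes u: "\<And>n. u n \<in> Ue"
    and C: "\<And>\<epsilon>. 0 < \<epsilon> \<Longrightarrow> \<exists>N. \<forall>m\<ge>N. \<forall>n\<ge>N. pnorm p (u m - u n) < \<epsilon>"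
  shows "\<exists>x. \<forall>\<xi>. (\<lambda>n. ap (u n) \<xi>) \<longlonglongrightarrow> ap x \<xi>"
proof -
  have "Cauchy (\<lambda>n. ap (u n) \<xi>)" for \<xi>
  proof (rule metric_CauchyI)
    fix \<epsilon> :: real assume "0 < \<epsilon>"
    then obtain \<delta> where d: "0 < \<delta>" "\<And>v w. v \<in> Ue \<Longrightarrow> w \<in> Ue \<Longrightarrow> pnorm p (v - w) < \<delta> \<Longrightarrow> norm (ap v \<xi> - ap w \<xi>) < \<epsilon>"
      using pnorm_small_imp_strong_small[of \<epsilon> \<xi>] by blast
    obtain N where "\<And>m n. N \<le> m \<Longrightarrow> N \<le> n \<Longrightarrow> pnorm p (u m - u n) < \<delta>" using C[OF d(1)] by blast
    then show "\<exists>N. \<forall>m\<ge>N. \<forall>n\<ge>N. dist (ap (u m) \<xi>) (ap (u n) \<xi>) < \<epsilon>"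
      unfolding dist_norm using d(2)[OF u u] by blast
  qed
  then have "\<exists>\<eta>. (\<lambda>n. ap (u n) \<xi>) \<longlonglongrightarrow> \<eta>" for \<xi> by (simp add: Cauchy_convergent flip: convergent_def)
  then obtain L where L: "\<And>\<xi>. (\<lambda>n. ap (u n) \<xi>) \<longlonglongrightarrow> L \<xi>" by metis
  have "bounded_linear L"
  proof (rule bounded_linear_intro)
    show "L (\<xi> + \<eta>) = L \<xi> + L \<eta>" for \<xi> \<eta>
      using LIMSEQ_unique[OF L[of "\<xi> + \<eta>"]] tendsto_add[OF L[of \<xi>] L[of \<eta>]] by (simp add: ap_arg_simps)
    show "L (r *\<^sub>R \<xi>) = r *\<^sub>R L \<xi>" for r \<xi>
      using LIMSEQ_unique[OF L[of "r *\<^sub>R \<xi>"]] tendsto_scaleR[OF tendsto_const L[of \<xi>], of r] by (simp add: ap_arg_simps)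
    show "norm (L \<xi>) \<le> norm \<xi> * 1" for \<xi>
    proof (rule LIMSEQ_le_const2[OF tendsto_norm[OF L]], intro exI allI impI)
      fix n
      have "norm (ap (u n) \<xi>) \<le> norm (u n) * norm \<xi>" by (rule norm_ap)
      also have "\<dots> \<le> 1 * norm \<xi>" by (intro mult_right_mono unitary_norm Ue_Up u) simp
      finally show "norm (ap (u n) \<xi>) \<le> norm \<xi> * 1" by simp
    qed
  qed
  from ex_bop[OF this] L show ?thesis by auto
qed

text \<open>A strong limit of unitaries is in general only an isometry. Inversion preserves the
  p-distance, so the adjoints converge strongly as well, and both products with the adjoint pass to
  the limit.\<close>

lemma Cauchy_imp_strong_limit_Ue:
  assumes u: "\<And>n. u n \<in> Ue"
    and C: "\<And>\<epsilon>. 0 < \<epsilon> \<Longrightarrow> \<exists>N. \<forall>m\<ge>N. \<forall>n\<ge>N. pnorm p (u m - u n) < \<epsilon>"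
  shows "\<exists>x\<in>Ue. \<forall>\<xi>. (\<lambda>n. ap (u n) \<xi>) \<longlonglongrightarrow> ap x \<xi>"
proof -
  obtain x where x: "\<And>\<xi>. (\<lambda>n. ap (u n) \<xi>) \<longlonglongrightarrow> ap x \<xi>" using Cauchy_imp_strong_limit[OF u C] by auto
  obtain y where y: "\<And>\<xi>. (\<lambda>n. ap (adj (u n)) \<xi>) \<longlonglongrightarrow> ap y \<xi>"
    using Cauchy_imp_strong_limit[of "\<lambda>n. adj (u n)"] C u by (auto simp: Ue_closed pnorm_adj_diff Ue_Up)
  have ay: "adj x = y"
  proof (rule adj_unique)
    fix \<xi> \<eta>
    have "(\<lambda>n. inner (ap (u n) \<xi>) \<eta>) \<longlonglongrightarrow> inner (ap x \<xi>) \<eta>" by (intro tendsto_intros x)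
    moreover have "(\<lambda>n. inner (ap (u n) \<xi>) \<eta>) \<longlonglongrightarrow> inner \<xi> (ap y \<eta>)"
      unfolding inner_ap_left by (intro tendsto_intros y)
    ultimately show "inner (ap x \<xi>) \<eta> = inner \<xi> (ap y \<eta>)" by (rule LIMSEQ_unique)
  qed
  have isometry: "adj z * z = 1" if z: "\<And>\<xi>. (\<lambda>n. ap (v n) \<xi>) \<longlonglongrightarrow> ap z \<xi>" and v: "\<And>n. adj (v n) * v n = 1"
    for v z
  proof (rule bop_eqI)
    fix \<xi>
    have "inner (ap (adj z * z) \<xi>) \<eta> = inner \<xi> \<eta>" for \<eta>
    proof -
      have "(\<lambda>n. inner (ap (v n) \<xi>) (ap (v n) \<eta>)) \<longlonglongrightarrow> inner (ap z \<xi>) (ap z \<eta>)" by (intro tendsto_intros z)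
      moreover have "inner (ap (v n) \<xi>) (ap (v n) \<eta>) = inner \<xi> \<eta>" for n
        using arg_cong[OF v[of n], of "\<lambda>w. inner \<xi> (ap w \<eta>)"] by (simp add: inner_ap_left)
      ultimately have "inner (ap z \<xi>) (ap z \<eta>) = inner \<xi> \<eta>" by (simp add: LIMSEQ_const_iff)
      then show ?thesis by (simp add: inner_ap_left)
    qed
    then have "inner (ap (adj z * z) \<xi> - \<xi>) (ap (adj z * z) \<xi> - \<xi>) = 0" by (simp only: inner_diff_left)
    then show "ap (adj z * z) \<xi> = ap 1 \<xi>" by simp
  qed
  have "x \<in> Ue" unfolding Ue_def
  proof (intro CollectI conjI)
    show "x \<in> A" by (rule strong_limit_closed[OF _ x]) (rule UeD(1)[OF u])
    show "adj x * x = 1" by (rule isometry[OF x UeD(2)[OF u]])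
    show "x * adj x = 1" using isometry[OF y] UeD(3)[OF u] by (simp flip: ay)
    show "(x - 1) * e = x - 1"
    proof (rule bop_eqI)
      fix \<xi>
      have "(\<lambda>n. ap ((u n - 1) * e) \<xi>) \<longlonglongrightarrow> ap ((x - 1) * e) \<xi>" by (auto intro!: tendsto_intros x)
      moreover have "(\<lambda>n. ap ((u n - 1) * e) \<xi>) \<longlonglongrightarrow> ap (x - 1) \<xi>"
        unfolding UeD(4)[OF u] by (auto intro!: tendsto_intros x)
      ultimately show "ap ((x - 1) * e) \<xi> = ap (x - 1) \<xi>" by (rule LIMSEQ_unique)
    qed
    show "e * (x - 1) = x - 1"
    proof (rule bop_eqI)
      fix \<xi>
      have "(\<lambda>n. ap (e * (u n - 1)) \<xi>) \<longlonglongrightarrow> ap (e * (x - 1)) \<xi>"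
        by (auto intro!: tendsto_intros x bounded_linear.tendsto[OF bounded_linear_ap])
      moreover have "(\<lambda>n. ap (e * (u n - 1)) \<xi>) \<longlonglongrightarrow> ap (x - 1) \<xi>"
        unfolding UeD(5)[OF u] by (auto intro!: tendsto_intros x)
      ultimately show "ap (e * (x - 1)) \<xi> = ap (x - 1) \<xi>" by (rule LIMSEQ_unique)
    qed
  qed
  with x show ?thesis by blast
qed

text \<open>A p-Cauchy sequence has a strong limit in \<open>Ue\<close>, and
  \<open>strong_small_imp_pnorm_small\<close> turns strong convergence back into
  p-convergence.\<close>

lemma completely_metrizable_space_Ue: "completely_metrizable_space (subtopology Ptop (ap ` Ue))"
proof -
  have sub: "ap ` Ue \<subseteq> carrier P" using Ue_Up carrier_P by blast
  interpret S: Submetric "carrier P" Pdist "ap ` Ue" by unfold_locales (rule sub)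
  have "S.sub.mcomplete" unfolding S.sub.mcomplete_def
  proof (intro allI impI)
    fix \<sigma> assume \<sigma>: "S.sub.MCauchy \<sigma>"
    have "\<exists>u\<in>Ue. \<sigma> n = ap u" for n using \<sigma> unfolding S.sub.MCauchy_def by blast
    then obtain u where u: "\<And>n. u n \<in> Ue" "\<And>n. \<sigma> n = ap (u n)" by metis
    have D: "Pdist (ap v) (ap w) = pnorm p (v - w)" if "v \<in> Ue" "w \<in> Ue" for v w
      using that by (intro Pdist_eq Ue_Up)
    have "\<forall>\<epsilon>>0. \<exists>N. \<forall>m n. N \<le> m \<longrightarrow> N \<le> n \<longrightarrow> Pdist (\<sigma> m) (\<sigma> n) < \<epsilon>"
      using \<sigma> unfolding S.sub.MCauchy_def by (rule conjunct2)
    then have "\<forall>\<epsilon>>0. \<exists>N. \<forall>m n. N \<le> m \<longrightarrow> N \<le> n \<longrightarrow> pnorm p (u m - u n) < \<epsilon>"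
      unfolding u(2) D[OF u(1) u(1)] .
    then have C: "\<exists>N. \<forall>m\<ge>N. \<forall>n\<ge>N. pnorm p (u m - u n) < \<epsilon>" if "0 < \<epsilon>" for \<epsilon>
      using that by meson
    obtain x where x: "x \<in> Ue" "\<And>\<xi>. (\<lambda>n. ap (u n) \<xi>) \<longlonglongrightarrow> ap x \<xi>"
      using Cauchy_imp_strong_limit_Ue[OF u(1) C] by blast
    obtain \<Xi> :: "nat \<Rightarrow> 'h" where \<Xi>: "range \<Xi> \<subseteq> K" and
      *: "\<And>\<epsilon>. 0 < \<epsilon> \<Longrightarrow> \<exists>n. \<exists>\<delta>>0. \<forall>u\<in>Ue. \<forall>v\<in>Ue. (\<forall>k<n. norm (ap u (\<Xi> k) - ap v (\<Xi> k)) < \<delta>) \<longrightarrow> pnorm p (u - v) < \<epsilon>"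
      by (rule strong_small_imp_pnorm_small) (rule that)
    have "\<forall>\<^sub>F n in sequentially. \<sigma> n \<in> ap ` Ue \<and> Pdist (\<sigma> n) (ap x) < \<epsilon>" if "0 < \<epsilon>" for \<epsilon>
    proof -
      obtain N \<delta> where d: "0 < \<delta>"
        "\<And>u v. u \<in> Ue \<Longrightarrow> v \<in> Ue \<Longrightarrow> (\<forall>k<N. norm (ap u (\<Xi> k) - ap v (\<Xi> k)) < \<delta>) \<Longrightarrow> pnorm p (u - v) < \<epsilon>"
        using *[OF \<open>0 < \<epsilon>\<close>] by meson
      have "\<forall>\<^sub>F n in sequentially. \<forall>k\<in>{..<N}. norm (ap (u n) (\<Xi> k) - ap x (\<Xi> k)) < \<delta>"
        using tendstoD[OF x(2) d(1)] by (intro eventually_ball_finite) (auto simp: dist_norm)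
      then show ?thesis
      proof eventually_elim
        case (elim n)
        then have "pnorm p (u n - x) < \<epsilon>" by (intro d(2) u x) auto
        then show ?case unfolding u(2) D[OF u(1) x(1)] using u(1) by simp
      qed
    qed
    then have "limitin S.sub.mtopology \<sigma> (ap x) sequentially"
      unfolding S.sub.limitin_metric using x(1) by blast
    then show "\<exists>x. limitin S.sub.mtopology \<sigma> x sequentially" by (intro exI)
  qed
  then show ?thesis
    unfolding completely_metrizable_space_def Ptop_eq S.mtopology_submetric[symmetric]
    using S.sub.Metric_space_axioms by blast
qed

text \<open>On unitaries weak closeness gives strong closeness: the squared norm of
  \<open>u \<xi> - v \<xi>\<close> is twice the real part of
  \<open><u \<xi> - v \<xi>, u \<xi>>\<close>. Hence the dense sequence in the predual supplies the
  coordinates for \<open>separable_space_mtopology\<close>.\<close>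

lemma separable_space_subset_Ue:
  assumes G: "G \<subseteq> ap ` Ue" shows "separable_space (subtopology Ptop G)"
proof -
  have sub: "G \<subseteq> carrier P" using G Ue_Up carrier_P by blast
  interpret S: Submetric "carrier P" Pdist G by unfold_locales (rule sub)
  obtain \<psi> :: "nat \<Rightarrow> ('h \<Rightarrow> 'h) \<Rightarrow> complex" where \<psi>: "range \<psi> \<subseteq> predual UNIV M"
    "\<And>\<xi> \<eta> \<epsilon>. 0 < \<epsilon> \<Longrightarrow> \<exists>k. \<forall>x\<in>A. norm x \<le> 1 \<longrightarrow> norm (cinner (ap x \<xi>) \<eta> - \<psi> k (ap x)) < \<epsilon>"
    by (rule ex_dense_functionals[OF sep]) (rule that)
  obtain \<Xi> :: "nat \<Rightarrow> 'h" where \<Xi>: "range \<Xi> \<subseteq> K" and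
    *: "\<And>\<epsilon>. 0 < \<epsilon> \<Longrightarrow> \<exists>n. \<exists>\<delta>>0. \<forall>u\<in>Ue. \<forall>v\<in>Ue. (\<forall>k<n. norm (ap u (\<Xi> k) - ap v (\<Xi> k)) < \<delta>) \<longrightarrow> pnorm p (u - v) < \<epsilon>"
    by (rule strong_small_imp_pnorm_small) (rule that)
  have "separable_space S.sub.mtopology"
  proof (rule separable_space_mtopology[OF S.sub.Metric_space_axioms, of \<psi>])
    fix f and \<epsilon> :: real assume f: "f \<in> G" and "0 < \<epsilon>"
    obtain u where u: "u \<in> Ue" "f = ap u" using f G by blast
    obtain N \<delta> where d: "0 < \<delta>"
      "\<And>u v. u \<in> Ue \<Longrightarrow> v \<in> Ue \<Longrightarrow> (\<forall>k<N. norm (ap u (\<Xi> k) - ap v (\<Xi> k)) < \<delta>) \<Longrightarrow> pnorm p (u - v) < \<epsilon>"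
      using *[OF \<open>0 < \<epsilon>\<close>] by meson
    \<comment> \<open>Three approximation errors of size \<eta> are doubled by the identity for the
      squared norm, which gives \<delta>^2.\<close>
    define \<eta> where "\<eta> = \<delta>\<^sup>2 / 6"
    have \<eta>: "0 < \<eta>" using d(1) by (simp add: \<eta>_def)
    have "\<exists>j. \<forall>x\<in>A. norm x \<le> 1 \<longrightarrow> norm (cinner (ap x (\<Xi> k)) (ap u (\<Xi> k)) - \<psi> j (ap x)) < \<eta>" for k
      by (rule \<psi>(2)[OF \<eta>])
    then obtain j where j: "\<And>k x. x \<in> A \<Longrightarrow> norm x \<le> 1 \<Longrightarrow>
        norm (cinner (ap x (\<Xi> k)) (ap u (\<Xi> k)) - \<psi> (j k) (ap x)) < \<eta>" by metis
    \<comment> \<open>The successor of the sum of the indices \<open>j k\<close> exceeds each of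
      them, so all required functionals are among those compared.\<close>
    have "Pdist f g < \<epsilon>" if g: "g \<in> G" "\<forall>i<Suc (\<Sum>k<N. j k). dist (\<psi> i f) (\<psi> i g) < \<eta>" for g
    proof -
      obtain v where v: "v \<in> Ue" "g = ap v" using g G by blast
      have "norm (ap u (\<Xi> k) - ap v (\<Xi> k)) < \<delta>" if k: "k < N" for k
      proof -
        let ?\<xi> = "\<Xi> k"
        have iso: "inner (ap w ?\<xi>) (ap w ?\<xi>) = inner ?\<xi> ?\<xi>" if "w \<in> Ue" for w
          using arg_cong[OF UeD(2)[OF that], of "\<lambda>w. inner ?\<xi> (ap w ?\<xi>)"] by (simp add: inner_ap_left)
        have "j k \<le> (\<Sum>k<N. j k)" using k by (intro member_le_sum) auto
        then have "dist (\<psi> (j k) f) (\<psi> (j k) g) < \<eta>" using g(2) by simp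
        moreover have "norm (cinner (ap u ?\<xi>) (ap u ?\<xi>) - \<psi> (j k) f) < \<eta>" "norm (cinner (ap v ?\<xi>) (ap u ?\<xi>) - \<psi> (j k) g) < \<eta>"
          unfolding u(2) v(2) using u v by (intro j UeD(1) unitary_norm Ue_Up; simp)+
        ultimately have "norm (cinner (ap u ?\<xi>) (ap u ?\<xi>) - cinner (ap v ?\<xi>) (ap u ?\<xi>)) < 3 * \<eta>"
          unfolding dist_norm by norm
        then have "Re (cinner (ap u ?\<xi>) (ap u ?\<xi>) - cinner (ap v ?\<xi>) (ap u ?\<xi>)) < 3 * \<eta>"
          using complex_Re_le_cmod le_less_trans by blast
        then have "inner (ap u ?\<xi>) (ap u ?\<xi>) - inner (ap v ?\<xi>) (ap u ?\<xi>) < 3 * \<eta>"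
          by (simp add: inner_eq_Re_cinner)
        moreover have "(norm (ap u ?\<xi> - ap v ?\<xi>))\<^sup>2 = 2 * (inner (ap u ?\<xi>) (ap u ?\<xi>) - inner (ap v ?\<xi>) (ap u ?\<xi>))"
          using iso[OF u(1)] iso[OF v(1)]
          by (simp add: power2_norm_eq_inner inner_diff_left inner_diff_right inner_commute)
        ultimately have "(norm (ap u ?\<xi> - ap v ?\<xi>))\<^sup>2 < \<delta>\<^sup>2" by (simp add: \<eta>_def)
        then show ?thesis using d(1) by (rule power2_less_imp_less[OF _ less_imp_le])
      qed
      then have "pnorm p (u - v) < \<epsilon>" by (intro d(2) u v) auto
      then show ?thesis unfolding u(2) v(2) Pdist_eq[OF Ue_Up[OF u(1)] Ue_Up[OF v(1)]] .
    qed
    with \<eta> show "\<exists>n \<delta>. 0 < \<delta> \<and> (\<forall>g\<in>G. (\<forall>k<n. dist (\<psi> k f) (\<psi> k g) < \<delta>) \<longrightarrow> Pdist f g < \<epsilon>)" by blast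
  qed
  then show ?thesis unfolding S.mtopology_submetric Ptop_eq .
qed

lemma polish_group_closed_subgroup:
  assumes G: "closed_subgroup G P Ptop" "G \<subseteq> ap ` Ue"
  shows "polish_group (P\<lparr>carrier := G\<rparr>) (subtopology Ptop G)"
  unfolding polish_group_def
proof (intro conjI)
  show "topological_group (P\<lparr>carrier := G\<rparr>) (subtopology Ptop G)"
    using topological_group_subgroup G(1) by (simp add: closed_subgroup_def)
  have "closedin (subtopology Ptop (ap ` Ue)) G"
    using G by (auto simp: closed_subgroup_def closedin_subtopology)
  from completely_metrizable_space_closedin[OF completely_metrizable_space_Ue this]
  show "completely_metrizable_space (subtopology Ptop G)"
    using G(2) by (simp only: subtopology_subtopology inf.absorb2)
qed (rule separable_space_subset_Ue[OF G(2)])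

lemma finite_type_group_closed_subgroup:
  assumes G: "closed_subgroup G P Ptop" "G \<subseteq> ap ` Ue"
  shows "finite_type_group TYPE('h) (P\<lparr>carrier := G\<rparr>) (subtopology Ptop G)"
  unfolding finite_type_group_def
proof (intro conjI exI)
  show "topological_group (P\<lparr>carrier := G\<rparr>) (subtopology Ptop G)"
    using topological_group_subgroup G(1) by (simp add: closed_subgroup_def)
  show "Hausdorff_space (subtopology Ptop G)"
    unfolding Ptop_eq by (intro Hausdorff_space_subtopology U.Hausdorff_space_mtopology)
qed (rule finite_vna_corner iso_onto_closed_subgroup_restrict[OF G])+

end

lemma reduces_UNIV:
  fixes e u :: "'h::complex_hilbert bop"
  assumes "adj e = e" "clin e" "e * u = u * e"
  shows "reduces UNIV (ap e) (ap u)"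
proof -
  have c: "ap e (ap u \<xi>) = ap u (ap e \<xi>)" for \<xi> using assms(3) by (metis ap_simps(7))
  have "cinner (ap e \<xi>) \<eta> = cinner \<xi> (ap e \<eta>)" for \<xi> \<eta> using cinner_ap[OF assms(2)] assms(1) by simp
  then have "\<xi> \<in> ortho_compl UNIV (range (ap e)) \<longleftrightarrow> (\<forall>\<eta>. cinner (ap e \<xi>) \<eta> = 0)" for \<xi>
    by (auto simp: ortho_compl_def)
  moreover have "(\<forall>\<eta>. cinner \<zeta> \<eta> = 0) \<longleftrightarrow> \<zeta> = 0" for \<zeta> :: 'h
    by (metis inner_eq_Re_cinner inner_eq_zero_iff norm_cinner_le mult_zero_left mult_zero_right norm_le_zero_iff norm_zero zero_complex.sel(1))
  ultimately have o: "\<xi> \<in> ortho_compl UNIV (range (ap e)) \<longleftrightarrow> ap e \<xi> = 0" for \<xi> by simp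
  show ?thesis
    unfolding reduces_def
  proof (intro conjI subsetI)
    fix \<xi> assume "\<xi> \<in> ap u ` range (ap e)"
    then obtain \<eta> where "\<xi> = ap u (ap e \<eta>)" by blast
    then show "\<xi> \<in> range (ap e)" by (metis c rangeI)
  next
    fix \<xi> assume "\<xi> \<in> ap u ` ortho_compl UNIV (range (ap e))"
    then obtain \<eta> where "\<xi> = ap u \<eta>" "ap e \<eta> = 0" using o by blast
    then show "\<xi> \<in> ortho_compl UNIV (range (ap e))" by (simp add: o c ap_arg_simps)
  qed
qed

theorem theorem4p17:
  fixes M :: "('h::complex_hilbert \<Rightarrow> 'h) set"
    and \<tau> :: "('h \<Rightarrow> 'h) \<Rightarrow> ennreal"
    and p :: real
    and G :: "('h \<Rightarrow> 'h) set"
  defines "Ggrp \<equiv> (p_unitary_group UNIV M \<tau> p)\<lparr>carrier := G\<rparr>"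
    and "Gtop \<equiv> subtopology (p_unitary_topology UNIV M \<tau> p) G"
  assumes "semifinite_vna UNIV M"
    and "separable_predual UNIV M"
    and "fns_trace UNIV M \<tau>"
    and "1 \<le> p" and "p \<le> 2"
    and "closed_subgroup G (p_unitary_group UNIV M \<tau> p) (p_unitary_topology UNIV M \<tau> p)"
    and "property_FH Ggrp Gtop"
  shows "(\<exists>e\<in>M. is_projection UNIV e \<and> \<tau> e < \<infinity> \<and>
      (\<forall>u\<in>G. reduces UNIV e u) \<and>
      (\<forall>u\<in>G. \<forall>\<xi>\<in>ortho_compl UNIV (range e). u \<xi> = \<xi>) \<and>
      iso_onto_closed_subgroup (\<lambda>u. restrict u (range e)) Ggrp Gtop
        (unitary_group (range e) (corner UNIV M e))
        (strong_topology (range e) (carrier (unitary_group (range e) (corner UNIV M e)))))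
    \<and> polish_group Ggrp Gtop \<and> finite_type_group TYPE('h) Ggrp Gtop"
proof -
  interpret FH: FH_subgroup M \<tau> p G
    by unfold_locales (use assms in \<open>auto simp: semifinite_vna_def\<close>)
  interpret separable_corner M \<tau> p FH.e
    by unfold_locales (rule assms)
  have Ue: "u \<in> Ue" if "u \<in> FH.GU" for u
    using FH.GU_D[OF that] FH.GU_e[OF that] by (simp add: Ue_def)
  then have G: "G \<subseteq> ap ` Ue" using FH.G_eq by blast
  have cl: "clin FH.e" by (rule clin_A[OF FH.e_A])
  show ?thesis
    unfolding Ggrp_def Gtop_def
  proof (intro conjI bexI[of _ "ap FH.e"] ballI)
    show "is_projection UNIV (ap FH.e)"
      by (simp add: is_projection_def ap_bounded_ops cl op_UNIV_simps op_adj_UNIV FH.e_adj FH.e_idem)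
    show "\<tau> (ap FH.e) < \<infinity>" by (rule FH.e_finite)
    show "ap FH.e \<in> M" using FH.e_A by (simp add: bops_iff)
    show "reduces UNIV (ap FH.e) u" if "u \<in> G" for u
      using that G reduces_UNIV[OF FH.e_adj cl UeD(6)] by blast
    show "u \<xi> = \<xi>" if u: "u \<in> G" and \<xi>: "\<xi> \<in> ortho_compl UNIV (range (ap FH.e))" for u \<xi>
    proof -
      obtain v where v: "v \<in> Ue" "u = ap v" using u G by blast
      have "cinner \<xi> (ap FH.e \<xi>) = 0" using \<xi> by (simp add: ortho_compl_def)
      then have "inner \<xi> (ap FH.e \<xi>) = 0" by (simp add: inner_eq_Re_cinner)
      then have "inner (ap FH.e \<xi>) (ap FH.e \<xi>) = 0" by (simp add: inner_ap_left FH.e_adj)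
      then have "ap FH.e \<xi> = 0" by simp
      moreover have "ap ((v - 1) * FH.e) \<xi> = ap (v - 1) \<xi>" by (simp only: UeD(4)[OF v(1)])
      ultimately show ?thesis by (simp add: v(2) ap_arg_simps)
    qed
  qed (use iso_onto_closed_subgroup_restrict[OF FH.closed_subgroup G] polish_group_closed_subgroup[OF FH.closed_subgroup G]
      finite_type_group_closed_subgroup[OF FH.closed_subgroup G] in \<open>simp_all add: K_def\<close>)
qed

end
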